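(* Let $\alpha\in(0,1)$, $\beta>0$, $a_2>a_1>0$, $b_2>b_1>0$ satisfy $a_2b_1-a_1b_2=0$ and, for $i=1,2$, $$a_i> 2b_i\cosh\tfrac{\beta\pi}{2}\sqrt{1+\big(\cot\tfrac{\alpha\pi}{2}\tanh\tfrac{\beta\pi}{2}\big)^2},\qquad a_i> 2b_i\cosh\tfrac{\beta\pi}{2}\sqrt{1+\big(\tan\tfrac{\alpha\pi}{2}\tanh\tfrac{\beta\pi}{2}\big)^2}.$$ Put $\tilde P(s)=1+a_2s^\alpha+b_2(s^{\alpha+i\beta}+s^{\alpha-i\beta})$, $\tilde Q(s)=1+a_1s^\alpha+b_1(s^{\alpha+i\beta}+s^{\alpha-i\beta})$, $M(s)=\sqrt{\tilde Q(s)/\tilde P(s)}$ for $\operatorname{Re}s>0$, and $L=\mathcal L^{-1}[\tilde P/\tilde Q]$. Let $0<l\le\infty$ and let $U$ be a tempered distribution supported in $[0,\infty)$. Consider the problem $$\frac{\partial^2}{\partial t^2}u(x,t)=\Big(L*_t\frac{\partial^2}{\partial x^2}u\Big)(x,t),\qquad x\in[0,l],\ t>0,$$ $$u(x,0)=0,\quad \frac{\partial}{\partial t}u(x,0)=0\quad (x\in[0,l]),$$ $$u(0,t)=U(t),\qquad u(l,t)=0\ \text{ if } l<\infty,\qquad \lim_{x\to\infty}u(x,t)=0\ \text{ if } l=\infty\qquad(t>0).$$ This problem has a solution, given by $$u(x,t)=(U*_tK)(x,t)=\int_0^tU(t-\tau)K(x,\tau)\,d\tau,\qquad x\in(0,l],\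 t>0,$$ where, with $s_0>0$, for $l<\infty$ $$K(x,t)=\frac1{2\pi i}\int_{s_0-i\infty}^{s_0+i\infty}e^{ts}\Big[\frac{e^{sM(s)x}}{1-e^{2sM(s)l}}+\frac{e^{-sM(s)x}}{1-e^{-2sM(s)l}}\Big]\,ds,$$ and for $l=\infty$ $$K(x,t)=\frac1{2\pi i}\int_{s_0-i\infty}^{s_0+i\infty}e^{ts}e^{-sM(s)x}\,ds.$$ In particular, for every $t>0$, $K(x,t)$ is continuous with respect to $x$, and so is $u(x,t)$. For $x=0$ one has $K(0,t)=\delta(t)$, the Dirac distribution.
   Context: Complex powers $s^\alpha$, $s^{\alpha\pm i\beta}$ are taken with the principal branch, and $M$ is the square root of $M^2=\tilde Q/\tilde P$ with positive real part. $\mathcal L$ is the (distributional) Laplace transform in $t$, $\mathcal L[f](s)=\int_0^\infty e^{-ts}f(t)\,dt$ for $\operatorname{Re}s>0$, defined for tempered distributions supported in $[0,\infty)$; $*_t$ is convolution in $t$ of distributions supported in $[0,\infty)$ (for locally integrable functions, $(f*_tg)(t)=\int_0^tf(t-\tau)g(\tau)\,d\tau$), with the integral formula for $u$ read as such a convolution when $U$ is not a function. The variable $x$ is a parameter: for each $x$, $u(x,\cdot)$ is a tempered distribution supported in $[0,\infty)$, the $t$-derivative is the distributional derivative on $\mathbb R$ of this distribution (so that the zero initial conditions are encoded by $\mathcal L[\partial_t^2u](x,s)=s^2\mathcal L[u](x,s)$), and the equation is understood in the sense of distributions in $t$. When $l=\infty$, $[0,l]$ and $(0,l]$ mean $[0,\infty)$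 and $(0,\infty)$. *)

theory Defs
  imports "HOL-Analysis.Analysis"
begin

definition vderiv :: "(real \<Rightarrow> complex) \<Rightarrow> real \<Rightarrow> complex" where
  "vderiv \<phi> = (\<lambda>t. vector_derivative \<phi> (at t))"

definition schwartz :: "(real \<Rightarrow> complex) set" where
  "schwartz = {\<phi>. (\<forall>n t. (vderiv ^^ n) \<phi> differentiable (at t)) \<and>
     (\<forall>k n. bounded (range (\<lambda>t. \<bar>t\<bar> ^ k * norm ((vderiv ^^ n) \<phi> t))))}"

(* A distribution is extensional (undefined outside the Schwartz space), so that equality of
   distributions is equality of HOL functions. *)
type_synonym distr = "(real \<Rightarrow> complex) \<Rightarrow> complex"

definition tempered :: "distr set" where
  "tempered = {T \<in> extensional schwartz.
     (\<forall>\<phi>\<in>schwartz. \<forall>\<psi>\<in>schwartz. T (\<lambda>t. \<phi> t + \<psi> t) = T \<phi> + T \<psi>) \<and>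
     (\<forall>c. \<forall>\<phi>\<in>schwartz. T (\<lambda>t. c * \<phi> t) = c * T \<phi>) \<and>
     (\<exists>C N. \<forall>\<phi>\<in>schwartz. norm (T \<phi>) \<le>
        C * (\<Sum>k\<le>N. \<Sum>n\<le>N. SUP t. \<bar>t\<bar> ^ k * norm ((vderiv ^^ n) \<phi> t)))}"

definition tempered_pos :: "distr set" where
  "tempered_pos = {T \<in> tempered. \<forall>\<phi>\<in>schwartz. closure {t. \<phi> t \<noteq> 0} \<subseteq> {..<0} \<longrightarrow> T \<phi> = 0}"

definition dirac :: distr where
  "dirac = (\<lambda>\<phi>\<in>schwartz. \<phi> 0)"

definition zero_distr :: distr where
  "zero_distr = (\<lambda>\<phi>\<in>schwartz. 0)"

definition ddt :: "distr \<Rightarrow> distr" where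
  "ddt T = (\<lambda>\<phi>\<in>schwartz. - T (vderiv \<phi>))"

(* T is the function f on (0,\<infinity>), extended by 0 to the negative half-line; tested, as usual,
   against compactly supported functions only, since a tempered distribution that is a function
   need not have f * \<phi> absolutely integrable for every Schwartz function \<phi>. *)
definition represented_by :: "distr \<Rightarrow> (real \<Rightarrow> complex) \<Rightarrow> bool" where
  "represented_by T f \<longleftrightarrow> (\<forall>\<phi>\<in>schwartz. bounded {t. \<phi> t \<noteq> 0} \<longrightarrow>
     set_integrable lborel {0<..} (\<lambda>t. f t * \<phi> t) \<and>
     T \<phi> = (LINT t:{0<..}|lborel. f t * \<phi> t))"

(* The functions t \<mapsto> exp (-s t), and t \<mapsto> T (\<phi> (t + \<cdot>)) below, are in general not
   Schwartz functions because of their behaviour as t \<rightarrow> -\<infinity>.  A distribution supported in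
   [0,\<infinity>) is applied to them by changing them away from a neighbourhood of [0,\<infinity>) into a
   Schwartz function; the value does not depend on the choice. *)
definition pos_apply :: "distr \<Rightarrow> (real \<Rightarrow> complex) \<Rightarrow> complex" where
  "pos_apply T g = T (SOME \<psi>. \<psi> \<in> schwartz \<and> (\<exists>\<epsilon>>0. \<forall>t>-\<epsilon>. \<psi> t = g t))"

definition laplace :: "distr \<Rightarrow> complex \<Rightarrow> complex" where
  "laplace T s = pos_apply T (\<lambda>t. exp (- s * of_real t))"

definition conv :: "distr \<Rightarrow> distr \<Rightarrow> distr" (infixl "*\<^sub>t" 70) where
  "S *\<^sub>t T = (\<lambda>\<phi>\<in>schwartz. pos_apply S (\<lambda>t. T (\<lambda>\<tau>. \<phi> (t + \<tau>))))"

definition has_laplace :: "distr \<Rightarrow> (complex \<Rightarrow> complex) \<Rightarrow> bool" where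
  "has_laplace T F \<longleftrightarrow> T \<in> tempered_pos \<and> (\<forall>s. Re s > 0 \<longrightarrow> laplace T s = F s)"

definition inverse_laplace :: "(complex \<Rightarrow> complex) \<Rightarrow> distr" where
  "inverse_laplace F = (THE T. has_laplace T F)"

definition bromwich_integrand :: "real \<Rightarrow> (complex \<Rightarrow> complex) \<Rightarrow> real \<Rightarrow> real \<Rightarrow> complex" where
  "bromwich_integrand s0 F t y = exp (of_real t * Complex s0 y) * F (Complex s0 y) * \<i>"

(* The integral over the line Re s = s0, with s = s0 + i y and ds = i dy. *)
definition bromwich :: "real \<Rightarrow> (complex \<Rightarrow> complex) \<Rightarrow> real \<Rightarrow> complex" where
  "bromwich s0 F t = 1 / (2 * of_real pi * \<i>) * (\<integral>y. bromwich_integrand s0 F t y \<partial>lborel)"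

definition frac_poly :: "real \<Rightarrow> real \<Rightarrow> real \<Rightarrow> real \<Rightarrow> complex \<Rightarrow> complex" where
  "frac_poly \<alpha> \<beta> a b s = 1 + of_real a * s powr of_real \<alpha>
     + of_real b * (s powr Complex \<alpha> \<beta> + s powr Complex \<alpha> (- \<beta>))"

definition kernel_hat :: "(complex \<Rightarrow> complex) \<Rightarrow> ereal \<Rightarrow> real \<Rightarrow> complex \<Rightarrow> complex" where
  "kernel_hat M l x s =
     (if l = \<infinity> then exp (- (s * M s * of_real x))
      else exp (s * M s * of_real x) / (1 - exp (2 * s * M s * of_real (real_of_ereal l)))
         + exp (- (s * M s * of_real x)) / (1 - exp (- (2 * s * M s * of_real (real_of_ereal l)))))"

definition space_dom :: "ereal \<Rightarrow> real set" where
  "space_dom l = {x. 0 \<le> x \<and> ereal x \<le> l}"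

(* Derivative of a distribution-valued function of the parameter x, in the weak sense;
   one-sided at the end points of X. *)
definition has_x_deriv :: "(real \<Rightarrow> distr) \<Rightarrow> (real \<Rightarrow> distr) \<Rightarrow> real set \<Rightarrow> bool" where
  "has_x_deriv u u' X \<longleftrightarrow> (\<forall>x\<in>X. \<forall>\<phi>\<in>schwartz.
     ((\<lambda>y. u y \<phi>) has_vector_derivative u' x \<phi>) (at x within X))"

(* The zero initial conditions are encoded in the equation: ddt is the derivative on the whole
   line of a distribution supported in [0,\<infinity>), so nonzero initial data would contribute
   multiples of the Dirac distribution and its derivative at t = 0 to the left-hand side. *)
definition wave_solution :: "distr \<Rightarrow> ereal \<Rightarrow> distr \<Rightarrow> (real \<Rightarrow> distr) \<Rightarrow> bool" where
  "wave_solution L l U u \<longleftrightarrow>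
     (\<forall>x\<in>space_dom l. u x \<in> tempered_pos) \<and>
     (\<exists>u1 u2. (\<forall>x\<in>space_dom l. u1 x \<in> tempered_pos \<and> u2 x \<in> tempered_pos) \<and>
        has_x_deriv u u1 (space_dom l) \<and> has_x_deriv u1 u2 (space_dom l) \<and>
        (\<forall>x\<in>space_dom l. ddt (ddt (u x)) = L *\<^sub>t u2 x)) \<and>
     u 0 = U \<and>
     (if l = \<infinity> then \<forall>\<phi>\<in>schwartz. ((\<lambda>x. u x \<phi>) \<longlongrightarrow> 0) at_top
      else u (real_of_ereal l) = zero_distr)"

end

theory Submission
  imports Defs "HOL-Complex_Analysis.Complex_Analysis" "HOL-Probability.Sinc_Integral"
begin

text \<open>With \<open>Q = 1 + Z\<close> and \<open>P = 1 + \<rho> Z\<close>, where \<open>\<rho> = a2 / a1 > 1\<close>, the two inequalities imply that on the closed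
  right half-plane \<open>Re Z \<ge> 0\<close> and that \<open>Im Z\<close> has the sign of \<open>Im s\<close> and size at least a multiple of
  \<open>\<bar>s\<bar>^(\<alpha> - 1) \<bar>Im s\<bar>\<close>.  Hence \<open>P\<close> and \<open>Q\<close> do not vanish, \<open>M\<close> is bounded and continuous up to the imaginary axis, and
  \<open>Re (s M(s))\<close> grows at least like \<open>\<bar>s\<bar>^(1 - \<alpha>)\<close> at infinity.  So for \<open>x > 0\<close> the transformed kernel decreases faster
  than any power of \<open>s\<close>, the contour of the inversion integral can be moved to the imaginary axis, and
  the kernel is a smooth function of \<open>t\<close> vanishing for \<open>t < 0\<close>; its convolution with any tempered \<open>U\<close> is a
  continuous function, continuous in \<open>x\<close>.  At \<open>x = 0\<close> only polynomial bounds hold; there one inverts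
  \<open>F(s) / (1 + s)^(m + 2)\<close>, which is integrable on the imaginary axis, and applies \<open>(1 + d/dt)^(m + 2)\<close>.  Everything
  else (the equation, the boundary values) follows from the injectivity of the Laplace transform on
  tempered distributions supported in the half-line: in \<open>y = exp (- t)\<close>, linear combinations of
  \<open>exp (- k t)\<close> are polynomials, dense by Weierstrass.\<close>

text \<open>The two inequalities divide the work: the one with tan keeps Re Z nonnegative, the one
  with cot gives Im Z its sign. The phase \<beta> ln |s| takes every value, so only the amplitude of
  the oscillating terms can be compared with \<open>a1\<close>; the inequalities say that this
  comparison succeeds at the extreme angles arg s = +-\<pi>/2, and convexity of sinh and concavity
  of sin carry it to the angles between. Since U is an arbitrary distribution, no integral
  represents the pairing with it. Differentiations and limits are therefore reduced to scalar
  estimates: a remainder of quadratic order is bounded in finitely many seminorms, or in weighted L1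
  norms of the symbol on the imaginary axis, and such a bound passes through any continuous
  functional. For finite l a further obstacle is the zero of 1 - exp(-2 l s M) at s = 0, a point of
  the contour. The singularity of the kernel there is removable, and numerator and denominator are
  both compared with min(1, |2 l s M|).\<close>

section \<open>Smooth functions carried together with all their derivatives\<close>

definition derivs :: "(nat \<Rightarrow> real \<Rightarrow> complex) \<Rightarrow> bool" where
  "derivs F \<longleftrightarrow> (\<forall>n t. (F n has_vector_derivative F (Suc n) t) (at t))"

lemma derivsD: "derivs F \<Longrightarrow> (F n has_vector_derivative F (Suc n) t) (at t)"
  by (simp add: derivs_def)

text \<open>A sequence satisfying \<open>derivs\<close> is forced to be the sequence of iterated
  derivatives. Closed forms (Leibniz sums, powers times exponentials, integrals) can thus be
  supplied directly, and \<open>vderiv\<close> is computed only here.\<close>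

lemma derivs_vderiv:
  assumes "derivs F" shows "(vderiv ^^ n) (F 0) = F n"
proof (induction n)
  case (Suc n)
  then show ?case
    using vector_derivative_at[OF derivsD[OF assms]] by (auto simp: vderiv_def)
qed auto

lemma derivs_Suc: "derivs F \<Longrightarrow> derivs (\<lambda>n. F (Suc n))"
  by (simp add: derivs_def)

lemma derivs_shift: "derivs F \<Longrightarrow> derivs (\<lambda>n. F (n + m))"
  by (simp add: derivs_def)

lemma derivs_isCont: "derivs F \<Longrightarrow> isCont (F n) t"
  using derivsD has_vector_derivative_continuous by blast

lemma derivs_continuous_on: "derivs F \<Longrightarrow> continuous_on A (F n)"
  by (simp add: continuous_at_imp_continuous_on derivs_isCont)

lemma derivs_add: "derivs F \<Longrightarrow> derivs G \<Longrightarrow> derivs (\<lambda>n t. F n t + G n t)"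
  by (auto simp: derivs_def intro!: derivative_eq_intros)

lemma derivs_diff: "derivs F \<Longrightarrow> derivs G \<Longrightarrow> derivs (\<lambda>n t. F n t - G n t)"
  by (auto simp: derivs_def intro!: derivative_eq_intros)

lemma derivs_cmult: "derivs F \<Longrightarrow> derivs (\<lambda>n t. c * F n t)"
  by (auto simp: derivs_def intro!: derivative_eq_intros)

lemma derivs_0: "derivs (\<lambda>n t. 0)"
  by (simp add: derivs_def)

lemma derivs_exp: "derivs (\<lambda>n t. (- s) ^ n * exp (- s * of_real t))"
proof -
  have "((\<lambda>t::real. exp (- s * of_real t)) has_vector_derivative - s * exp (- s * of_real t)) (at t)" for t
    by (rule has_vector_derivative_real_field) (auto intro!: derivative_eq_intros)
  then show ?thesis
    unfolding derivs_def
    by (intro allI, rule has_vector_derivative_eq_rhs[OF has_vector_derivative_mult_right]) auto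
qed

lemma derivs_sum: "(\<And>i. i \<in> I \<Longrightarrow> derivs (F i)) \<Longrightarrow> derivs (\<lambda>n t. \<Sum>i\<in>I. F i n t)"
  by (auto simp: derivs_def intro!: has_vector_derivative_sum)

lemma derivs_affine:
  assumes "derivs F" shows "derivs (\<lambda>n t. of_real (c ^ n) * F n (a + c * t))"
  unfolding derivs_def
proof (intro allI)
  fix n t
  have "((F n \<circ> (\<lambda>t. a + c * t)) has_vector_derivative (c *\<^sub>R F (Suc n) (a + c * t))) (at t)"
    by (rule vector_diff_chain_at) (auto intro!: derivative_eq_intros derivsD[OF assms])
  then show "((\<lambda>t. of_real (c ^ n) * F n (a + c * t)) has_vector_derivative of_real (c ^ Suc n) * F (Suc n) (a + c * t)) (at t)"
    unfolding o_def
    by (rule has_vector_derivative_eq_rhs[OF has_vector_derivative_mult_right]) (simp add: scaleR_conv_of_real)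
qed

lemma derivs_translate: "derivs F \<Longrightarrow> derivs (\<lambda>n t. F n (a + t))"
  using derivs_affine[of F 1 a] by simp

text \<open>The Leibniz expression for the n-th derivative of the product of \<open>F 0\<close> and
  \<open>G 0\<close>.\<close>

definition dmult :: "(nat \<Rightarrow> real \<Rightarrow> complex) \<Rightarrow> (nat \<Rightarrow> real \<Rightarrow> complex) \<Rightarrow> nat \<Rightarrow> real \<Rightarrow> complex" where
  "dmult F G n t = (\<Sum>i\<le>n. of_nat (n choose i) * F i t * G (n - i) t)"

lemma dmult_0 [simp]: "dmult F G 0 t = F 0 t * G 0 t"
  by (simp add: dmult_def)

text \<open>Pascal's rule in the form that differentiates a Leibniz sum; \<open>f i j\<close> stands
  for the product of an i-th and a j-th derivative.\<close>

lemma sum_pascal: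
  fixes f :: "nat \<Rightarrow> nat \<Rightarrow> complex"
  shows "(\<Sum>i\<le>n. of_nat (n choose i) * (f (Suc i) (n - i) + f i (Suc (n - i))))
    = (\<Sum>i\<le>Suc n. of_nat (Suc n choose i) * f i (Suc n - i))"
proof -
  have "(\<Sum>i\<le>Suc n. of_nat (Suc n choose i) * f i (Suc n - i))
     = f 0 (Suc n) + (\<Sum>i\<le>n. of_nat ((n choose i) + (n choose Suc i)) * f (Suc i) (n - i))"
    by (subst sum.atMost_Suc_shift) simp
  also have "\<dots> = (\<Sum>i\<le>n. of_nat (n choose i) * f (Suc i) (n - i)) +
       (f 0 (Suc n) + (\<Sum>i\<le>n. of_nat (n choose Suc i) * f (Suc i) (n - i)))"
    by (simp only: of_nat_add distrib_right sum.distrib add.left_commute)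
  also have "f 0 (Suc n) + (\<Sum>i\<le>n. of_nat (n choose Suc i) * f (Suc i) (n - i))
      = (\<Sum>i\<le>Suc n. of_nat (n choose i) * f i (Suc n - i))"
    by (subst sum.atMost_Suc_shift) simp
  also have "\<dots> = (\<Sum>i\<le>n. of_nat (n choose i) * f i (Suc (n - i)))"
    by (simp add: Suc_diff_le)
  finally show ?thesis
    by (simp only: distrib_left sum.distrib)
qed

lemma derivs_dmult:
  assumes "derivs F" "derivs G" shows "derivs (dmult F G)"
  unfolding derivs_def
proof (intro allI)
  fix n t
  have "(dmult F G n has_vector_derivative
     (\<Sum>i\<le>n. of_nat (n choose i) * (F (Suc i) t * G (n - i) t + F i t * G (Suc (n - i)) t))) (at t)"
    unfolding dmult_def
    by (rule has_vector_derivative_sum)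
      (auto intro!: derivative_eq_intros derivsD[OF assms(1)] derivsD[OF assms(2)] simp: algebra_simps)
  then show "(dmult F G n has_vector_derivative dmult F G (Suc n) t) (at t)"
    using sum_pascal[of n "\<lambda>i j. F i t * G j t"] by (simp add: dmult_def mult.assoc)
qed

text \<open>The binomial coefficients sum to 2^n. The weight c, in applications a power of |t|, goes
  with the second factor, because the first one is built from a cutoff and is bounded without
  weight.\<close>

lemma norm_dmult_le:
  assumes "\<And>i. i \<le> n \<Longrightarrow> norm (F i t) \<le> A" "\<And>i. i \<le> n \<Longrightarrow> c * norm (G i t) \<le> B" "0 \<le> c" "0 \<le> B"
  shows "c * norm (dmult F G n t) \<le> 2 ^ n * (A * B)"
proof -
  have A: "0 \<le> A"
    using order_trans[OF norm_ge_zero assms(1)[of 0]] by simp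
  have "c * norm (dmult F G n t) \<le> c * (\<Sum>i\<le>n. of_nat (n choose i) * norm (F i t) * norm (G (n - i) t))"
    unfolding dmult_def
    by (intro mult_left_mono assms sum_norm_le) (simp add: norm_mult)
  also have "\<dots> = (\<Sum>i\<le>n. of_nat (n choose i) * (norm (F i t) * (c * norm (G (n - i) t))))"
    by (simp add: sum_distrib_left algebra_simps)
  also have "\<dots> \<le> (\<Sum>i\<le>n. of_nat (n choose i) * (A * B))"
    using A assms by (intro sum_mono mult_left_mono mult_mono) auto
  also have "\<dots> = 2 ^ n * (A * B)"
    by (simp flip: sum_distrib_right of_nat_sum add: choose_row_sum)
  finally show ?thesis .
qed

lemma has_vector_derivative_0_openI:
  assumes "open S" "t \<in> S" "(f has_vector_derivative d) (at t)" "\<And>u. u \<in> S \<Longrightarrow> f u = (0::complex)"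
  shows "d = 0"
proof -
  have "((\<lambda>u. 0) has_vector_derivative d) (at t)"
    by (rule has_vector_derivative_transform_within_open[OF assms(3,1,2)]) (use assms in auto)
  then show ?thesis
    using vector_derivative_unique_at[of "\<lambda>u. 0" d t 0] by auto
qed

text \<open>Differentiation is local: on an open set, vanishing passes from each derivative to the
  next. This spares all computation of derivatives in regions where a cutoff is constant.\<close>

lemma derivs_zero_open:
  assumes "derivs F" "open S" "\<And>u. u \<in> S \<Longrightarrow> F 0 u = 0" "t \<in> S"
  shows "F n t = 0"
  using assms(4)
proof (induction n arbitrary: t)
  case 0 then show ?case using assms by auto
next
  case (Suc n)
  then show ?case
    using has_vector_derivative_0_openI[OF assms(2) _ derivsD[OF assms(1)]] by blast
qed

lemma derivs_eq_open:
  assumes "derivs F" "derivs G" "open S" "\<And>u. u \<in> S \<Longrightarrow> F 0 u = G 0 u" "t \<in> S"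
  shows "F n t = G n t"
  using derivs_zero_open[OF derivs_diff[OF assms(1,2)] assms(3)] assms by auto

subsection \<open>A smooth cutoff function\<close>

text \<open>The class of functions p(1/t) exp(-1/t), extended by zero, is closed under
  differentiation; a single derivative rule then shows that the standard flat function is
  smooth.\<close>

definition flat :: "real poly \<Rightarrow> real \<Rightarrow> real" where
  "flat p t = (if 0 < t then poly p (1 / t) * exp (- (1 / t)) else 0)"

lemma poly_times_exp_tendsto_0: "((\<lambda>y. poly p y * exp (- y)) \<longlongrightarrow> 0) (at_top :: real filter)"
proof -
  have eq: "poly p y * exp (- y) = (\<Sum>i\<le>degree p. coeff p i * (y ^ i / exp y))" for y
    unfolding poly_altdef sum_distrib_right exp_minus divide_inverse by (rule sum.cong) auto
  show ?thesis
    unfolding eq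
    by (rule tendsto_null_sum, rule tendsto_mult_right_zero, rule tendsto_power_div_exp_0)
qed

lemma flat_tendsto_0: "((\<lambda>t. flat p t) \<longlongrightarrow> 0) (at_right 0)"
proof -
  have "((\<lambda>t. poly p (inverse t) * exp (- (inverse t))) \<longlongrightarrow> 0) (at_right 0)"
    by (rule filterlim_compose[OF poly_times_exp_tendsto_0 filterlim_inverse_at_top_right])
  then show ?thesis
    by (rule Lim_transform_eventually) (auto simp: eventually_at_filter flat_def inverse_eq_divide)
qed

text \<open>For t > 0 the chain rule gives (1/t)^2 (p - p')(1/t) exp(-1/t). At t = 0 the difference
  quotient is again of this class, with polynomial X p, and tends to 0 from the right.\<close>

lemma flat_deriv: "(flat p has_real_derivative flat (monom 1 2 * (p - pderiv p)) t) (at t)"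
proof (cases t "0::real" rule: linorder_cases)
  case less
  have "((\<lambda>t. 0) has_real_derivative 0) (at t)"
    by simp
  then have "(flat p has_real_derivative 0) (at t)"
    by (rule DERIV_cong_ev[THEN iffD1, rotated -1])
      (use less in \<open>auto simp: flat_def eventually_nhds intro!: exI[of _ "{..<0}"]\<close>)
  then show ?thesis
    using less by (simp add: flat_def)
next
  case greater
  have "((\<lambda>t. poly p (1 / t) * exp (- (1 / t))) has_real_derivative
     (1 / t)^2 * (poly p (1/t) - poly (pderiv p) (1/t)) * exp (- (1/t))) (at t)"
    using greater by (auto intro!: derivative_eq_intros DERIV_chain2[OF poly_DERIV] simp: field_simps power2_eq_square)
  then have "(flat p has_real_derivative (1 / t)^2 * (poly p (1/t) - poly (pderiv p) (1/t)) * exp (- (1/t))) (at t)"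
    by (rule DERIV_cong_ev[THEN iffD1, rotated -1])
      (use greater in \<open>auto simp: flat_def eventually_nhds intro!: exI[of _ "{0<..}"]\<close>)
  then show ?thesis
    using greater by (simp add: flat_def poly_monom)
next
  case equal
  have "((\<lambda>t. flat p t / t) \<longlongrightarrow> 0) (at_right 0)"
    using flat_tendsto_0[of "monom 1 1 * p"]
    by (rule Lim_transform_eventually) (auto simp: eventually_at_filter flat_def poly_monom)
  moreover have "((\<lambda>t. flat p t / t) \<longlongrightarrow> 0) (at_left 0)"
    by (rule Lim_transform_eventually[OF tendsto_const]) (auto simp: eventually_at_filter flat_def)
  ultimately have "((\<lambda>t. flat p t / t) \<longlongrightarrow> 0) (at 0)"
    by (simp add: filterlim_at_split)
  then show ?thesis
    using equal by (simp add: DERIV_def flat_def)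
qed

lemma derivs_flat: "\<exists>F. derivs F \<and> F 0 = (\<lambda>t. of_real (flat 1 t))"
proof -
  define P where "P n = ((\<lambda>p. monom 1 2 * (p - pderiv p)) ^^ n) (1 :: real poly)" for n
  have "derivs (\<lambda>n t. of_real (flat (P n) t))"
    unfolding derivs_def
  proof (intro allI)
    fix n t
    show "((\<lambda>t. of_real (flat (P n) t)) has_vector_derivative complex_of_real (flat (P (Suc n)) t)) (at t)"
      using flat_deriv[of "P n" t]
      by (intro has_vector_derivative_of_real) (simp_all add: has_real_derivative_iff_has_vector_derivative P_def)
  qed
  moreover have "P 0 = 1" by (simp add: P_def)
  ultimately show ?thesis
    by (intro exI[of _ "\<lambda>n t. of_real (flat (P n) t)"]) auto
qed

text \<open>The cutoff is the normalized primitive of a bump supported in [-1, -1/2], the product of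
  two flat functions facing each other. The transition lies strictly left of 0, so that the cutoff
  is 1 on a neighbourhood of the half-line.\<close>

lemma smooth_cutoff:
  "\<exists>F. derivs F \<and> (\<forall>t\<le>-1. F 0 t = 0) \<and> (\<forall>t\<ge>-1/2. F 0 t = 1) \<and> (\<forall>n. \<exists>B. \<forall>t. norm (F n t) \<le> B)"
proof -
  obtain E where E: "derivs E" and E0: "E 0 = (\<lambda>t. of_real (flat 1 t))"
    using derivs_flat by blast
  define G where "G = dmult (\<lambda>n t. E n (1 + t)) (\<lambda>n t. of_real ((-1) ^ n) * E n (- 1 / 2 + (- 1) * t))"
  have G: "derivs G"
    unfolding G_def by (rule derivs_dmult[OF derivs_translate[OF E, of 1] derivs_affine[OF E, of "-1" "-1/2"]])
  define g where "g t = flat 1 (1 + t) * flat 1 (- 1 / 2 - t)" for t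
  have G0: "G 0 t = of_real (g t)" for t
    by (simp add: G_def E0 g_def)
  have contg: "continuous_on A g" for A
    using continuous_on_Re[OF derivs_continuous_on[OF G, of A 0]] by (simp add: G0)
  have gpos: "g t > 0" if "-1 < t" "t < -1/2" for t
    using that by (simp add: g_def flat_def)
  have gz: "g t = 0" if "t \<le> -1 \<or> t \<ge> -1/2" for t
    using that by (auto simp: g_def flat_def)
  \<comment> \<open>Starting the integral at -2, left of the support of \<open>g\<close>, makes the
    primitive differentiable at -1 as well.\<close>
  define c where "c t = integral {-2..t} g" for t
  have cderiv: "(c has_real_derivative g t) (at t)" if "t > -2" for t
  proof -
    have "(c has_real_derivative g t) (at t within {-2..t+1})"
      unfolding c_def using that by (intro integral_has_real_derivative contg) auto
    moreover have "at t within {-2..t+1} = at t"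
      using that by (intro at_within_interior) auto
    ultimately show ?thesis by simp
  qed
  have c0: "c t = 0" if "t \<le> -1" for t
  proof -
    have "c t = integral {-2..t} (\<lambda>_. 0)"
      unfolding c_def using that by (intro integral_cong) (auto simp: gz)
    then show ?thesis by simp
  qed
  define a where "a = c (-1/2)"
  have c_eq: "c t = a" if "t \<ge> -1/2" for t
  proof -
    have "\<exists>k. \<forall>x\<in>{-1/2..}. c x = k"
    proof (rule has_field_derivative_zero_constant)
      show "(c has_real_derivative 0) (at x within {-1/2..})" if "x \<in> {-1/2..}" for x
        using has_field_derivative_at_within[OF cderiv[of x]] gz[of x] that by simp
    qed simp
    then show ?thesis using that unfolding a_def by auto
  qed
  have cpos: "a > 0"
  proof -
    have "\<exists>z::real. z > -1 \<and> z < -1/2 \<and> c (-1/2) - c (-1) = (-1/2 - (-1)) * g z"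
      by (rule MVT2[of "-1" "-1/2" c g]) (auto intro!: cderiv)
    then obtain z where "z > -1" "z < -1/2" "c (-1/2) - c (-1) = (-1/2 - (-1)) * g z"
      by blast
    then show ?thesis using gpos[of z] c0[of "-1"] by (simp add: a_def)
  qed
  define F where "F n = (case n of 0 \<Rightarrow> (\<lambda>t. of_real (c t / a)) | Suc m \<Rightarrow> (\<lambda>t. of_real (1 / a) * G m t))" for n
  have dF: "derivs F"
    unfolding derivs_def
  proof (intro allI)
    fix n t
    show "(F n has_vector_derivative F (Suc n) t) (at t)"
    proof (cases n)
      case 0
      have "(c has_real_derivative g t) (at t)"
      proof (cases "t > -2")
        case False
        have "((\<lambda>t. 0) has_real_derivative 0) (at t)"
          by simp
        then have "(c has_real_derivative 0) (at t)"
          by (rule DERIV_cong_ev[THEN iffD1, rotated -1])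
            (use False in \<open>auto simp: c0 eventually_nhds intro!: exI[of _ "{..<-1}"]\<close>)
        then show ?thesis using False gz by auto
      qed (rule cderiv)
      then have "((\<lambda>t. c t / a) has_real_derivative g t / a) (at t)"
        by (intro DERIV_cdivide)
      then have "((\<lambda>t. complex_of_real (c t / a)) has_vector_derivative of_real (g t / a)) (at t)"
        by (intro has_vector_derivative_of_real) (simp_all add: has_real_derivative_iff_has_vector_derivative)
      then show ?thesis by (simp add: 0 F_def G0)
    next
      case (Suc m)
      then show ?thesis
        unfolding F_def by (simp only: nat.case) (intro has_vector_derivative_mult_right derivsD[OF G])
    qed
  qed
  have bdd: "\<exists>B. \<forall>t. norm (F n t) \<le> B" for n
  proof -
    \<comment> \<open>The constant function 1 with its derivatives, to be compared with
      \<open>F\<close> right of -1/2; on the compact interval in between continuity gives the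
      bound.\<close>
    have D: "derivs (\<lambda>n t. if n = 0 then 1 else 0)"
      by (auto simp: derivs_def)
    obtain B where B: "\<forall>t\<in>{-1..-1/2}. norm (F n t) \<le> B"
      using compact_imp_bounded[OF compact_continuous_image[OF derivs_continuous_on[OF dF, of "{-1..-1/2}" n]]]
      unfolding bounded_iff by (simp add: image_iff) blast
    have "\<forall>t. norm (F n t) \<le> max B 1"
    proof
      fix t :: real
      consider "t < -1" | "t \<in> {-1..-1/2}" | "t > -1/2" by fastforce
      then show "norm (F n t) \<le> max B 1"
      proof cases
        case 1
        have "F n t = 0"
          by (rule derivs_zero_open[OF dF, of "{..<-1}"]) (use 1 in \<open>auto simp: F_def c0\<close>)
        then show ?thesis by simp
      next
        case 3
        have "F n t = (if n = 0 then 1 else 0)"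
          by (rule derivs_eq_open[OF dF D, of "{-1/2<..}"]) (use 3 cpos in \<open>auto simp: F_def c_eq\<close>)
        then show ?thesis by (simp add: le_max_iff_disj)
      next
        case 2
        then show ?thesis using B by (simp add: le_max_iff_disj)
      qed
    qed
    then show ?thesis ..
  qed
  have zero: "\<forall>t\<le>-1. F 0 t = 0"
    by (simp add: F_def c0)
  have one: "\<forall>t\<ge>-1/2. F 0 t = 1"
    using cpos by (simp add: F_def c_eq)
  show ?thesis
    using dF zero one bdd by blast
qed

subsection \<open>Tempered distributions supported in the half-line\<close>

lemma derivs_iff_differentiable:
  "derivs (\<lambda>n. (vderiv ^^ n) f) \<longleftrightarrow> (\<forall>n t. (vderiv ^^ n) f differentiable (at t))"
  unfolding derivs_def vector_derivative_works by (simp add: vderiv_def)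

lemma schwartz_iff:
  "\<phi> \<in> schwartz \<longleftrightarrow> derivs (\<lambda>n. (vderiv ^^ n) \<phi>) \<and>
     (\<forall>k n. \<exists>B. \<forall>t. \<bar>t\<bar> ^ k * norm ((vderiv ^^ n) \<phi> t) \<le> B)"
  unfolding derivs_iff_differentiable schwartz_def bounded_iff by auto

lemma schwartz_derivs: "\<phi> \<in> schwartz \<Longrightarrow> derivs (\<lambda>n. (vderiv ^^ n) \<phi>)"
  by (simp add: schwartz_iff)

text \<open>Functions that are Schwartz to the right of \<open>- 1\<close>, such as \<open>exp (- s t)\<close>; these are the ones to which
  a distribution supported in the half-line can be applied.\<close>

definition pos_schwartz :: "(real \<Rightarrow> complex) set" where
  "pos_schwartz = {f. derivs (\<lambda>n. (vderiv ^^ n) f) \<and>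
     (\<forall>k n. \<exists>B. \<forall>t\<ge>-1. \<bar>t\<bar> ^ k * norm ((vderiv ^^ n) f t) \<le> B)}"

lemma schwartzI:
  assumes "derivs F" "\<And>k n. \<exists>B. \<forall>t. \<bar>t\<bar> ^ k * norm (F n t) \<le> B"
  shows "F 0 \<in> schwartz"
  using assms by (simp add: schwartz_iff derivs_vderiv)

lemma pos_schwartzI:
  assumes "derivs F" "\<And>k n. \<exists>B. \<forall>t\<ge>-1. \<bar>t\<bar> ^ k * norm (F n t) \<le> B"
  shows "F 0 \<in> pos_schwartz"
  using assms by (simp add: pos_schwartz_def derivs_vderiv)

lemma schwartz_imp_pos: "\<phi> \<in> schwartz \<Longrightarrow> \<phi> \<in> pos_schwartz"
  unfolding schwartz_iff pos_schwartz_def by blast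

lemma pos_schwartz_derivs: "f \<in> pos_schwartz \<Longrightarrow> derivs (\<lambda>n. (vderiv ^^ n) f)"
  by (simp add: pos_schwartz_def)

lemma pos_schwartz_bound: "f \<in> pos_schwartz \<Longrightarrow> \<exists>B. \<forall>t\<ge>-1. \<bar>t\<bar> ^ k * norm ((vderiv ^^ n) f t) \<le> B"
  by (simp add: pos_schwartz_def)

lemma continuous_on_Icc_bounded:
  fixes f :: "real \<Rightarrow> real"
  assumes "continuous_on {a..b} f"
  shows "\<exists>B. \<forall>t\<in>{a..b}. f t \<le> B"
proof -
  have "bdd_above (f ` {a..b})"
    by (intro bounded_imp_bdd_above compact_imp_bounded compact_continuous_image assms) auto
  then show ?thesis by (auto simp: bdd_above_def)
qed

lemma
  assumes "f \<in> pos_schwartz"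
  shows pos_schwartz_cmult: "(\<lambda>t. c * f t) \<in> pos_schwartz"
    and vderiv_cmult: "(vderiv ^^ n) (\<lambda>t. c * f t) = (\<lambda>t. c * (vderiv ^^ n) f t)"
proof -
  note d = derivs_cmult[OF pos_schwartz_derivs[OF assms], of c]
  have "\<exists>B. \<forall>t\<ge>-1. \<bar>t\<bar> ^ k * norm (c * (vderiv ^^ n) f t) \<le> B" for k n
  proof -
    obtain B where B: "\<forall>t\<ge>-1. \<bar>t\<bar> ^ k * norm ((vderiv ^^ n) f t) \<le> B"
      using pos_schwartz_bound[OF assms] by blast
    have "\<bar>t\<bar> ^ k * norm (c * (vderiv ^^ n) f t) \<le> norm c * B" if "t \<ge> -1" for t
      using mult_left_mono[of "\<bar>t\<bar> ^ k * norm ((vderiv ^^ n) f t)" B "norm c"] B that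
      by (simp add: norm_mult algebra_simps)
    then show ?thesis by blast
  qed
  from pos_schwartzI[OF d this] show "(\<lambda>t. c * f t) \<in> pos_schwartz"
    by simp
  show "(vderiv ^^ n) (\<lambda>t. c * f t) = (\<lambda>t. c * (vderiv ^^ n) f t)"
    using derivs_vderiv[OF d] by simp
qed

lemma
  assumes "f \<in> pos_schwartz" "g \<in> pos_schwartz"
  shows pos_schwartz_add: "(\<lambda>t. f t + g t) \<in> pos_schwartz"
    and vderiv_add: "(vderiv ^^ n) (\<lambda>t. f t + g t) = (\<lambda>t. (vderiv ^^ n) f t + (vderiv ^^ n) g t)"
proof -
  note d = derivs_add[OF assms[THEN pos_schwartz_derivs]]
  have "\<exists>B. \<forall>t\<ge>-1. \<bar>t\<bar> ^ k * norm ((vderiv ^^ n) f t + (vderiv ^^ n) g t) \<le> B" for k n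
  proof -
    obtain B B' where B: "\<forall>t\<ge>-1. \<bar>t\<bar> ^ k * norm ((vderiv ^^ n) f t) \<le> B"
      "\<forall>t\<ge>-1. \<bar>t\<bar> ^ k * norm ((vderiv ^^ n) g t) \<le> B'"
      using pos_schwartz_bound assms by meson
    have "\<bar>t\<bar> ^ k * norm ((vderiv ^^ n) f t + (vderiv ^^ n) g t) \<le> B + B'" if "t \<ge> -1" for t
    proof -
      have "\<bar>t\<bar> ^ k * norm ((vderiv ^^ n) f t + (vderiv ^^ n) g t)
         \<le> \<bar>t\<bar> ^ k * (norm ((vderiv ^^ n) f t) + norm ((vderiv ^^ n) g t))"
        by (intro mult_left_mono norm_triangle_ineq) auto
      also have "\<dots> \<le> B + B'"
        using B that by (simp add: distrib_left add_mono)
      finally show ?thesis .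
    qed
    then show ?thesis by blast
  qed
  from pos_schwartzI[OF d this] show "(\<lambda>t. f t + g t) \<in> pos_schwartz"
    by simp
  show "(vderiv ^^ n) (\<lambda>t. f t + g t) = (\<lambda>t. (vderiv ^^ n) f t + (vderiv ^^ n) g t)"
    using derivs_vderiv[OF d] by simp
qed

lemma pos_schwartz_diff:
  assumes "f \<in> pos_schwartz" "g \<in> pos_schwartz"
  shows "(\<lambda>t. f t - g t) \<in> pos_schwartz"
  using pos_schwartz_add[OF assms(1) pos_schwartz_cmult[OF assms(2), of "-1"]] by simp

lemma vderiv_diff:
  assumes "f \<in> pos_schwartz" "g \<in> pos_schwartz"
  shows "(vderiv ^^ n) (\<lambda>t. f t - g t) = (\<lambda>t. (vderiv ^^ n) f t - (vderiv ^^ n) g t)"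
  using derivs_vderiv[OF derivs_diff[OF assms[THEN pos_schwartz_derivs]]] by simp

lemma pos_schwartz_0: "(\<lambda>t. 0) \<in> pos_schwartz"
  using pos_schwartzI[OF derivs_0] by auto

lemma pos_schwartz_exp:
  assumes "Re s > 0"
  shows "(\<lambda>t. exp (- s * of_real t)) \<in> pos_schwartz"
proof -
  have "\<exists>B. \<forall>t\<ge>-1. \<bar>t\<bar> ^ k * norm ((- s) ^ n * exp (- s * of_real t)) \<le> B" for k n
  proof -
    \<comment> \<open>Scaling by Re s reduces the limit to that of t^k / exp t.\<close>
    have lim: "((\<lambda>t. t ^ k / exp (Re s * t)) \<longlongrightarrow> 0) at_top"
    proof -
      have "((\<lambda>t. (1 / Re s) ^ k * ((Re s * t) ^ k / exp (Re s * t))) \<longlongrightarrow> 0) at_top"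
        by (intro tendsto_mult_right_zero filterlim_compose[OF tendsto_power_div_exp_0]
            filterlim_tendsto_pos_mult_at_top[OF tendsto_const _ filterlim_ident] assms)
      then show ?thesis
        using assms by (simp add: power_mult_distrib field_simps)
    qed
    then have "\<forall>\<^sub>F t in at_top. t ^ k / exp (Re s * t) < 1"
      by (rule order_tendstoD) auto
    then obtain a where a: "\<And>t. t \<ge> a \<Longrightarrow> t ^ k / exp (Re s * t) < 1"
      by (auto simp: eventually_at_top_linorder)
    have "continuous_on {-1..max a 0} (\<lambda>t. \<bar>t\<bar> ^ k / exp (Re s * t))"
      by (intro continuous_intros) auto
    from continuous_on_Icc_bounded[OF this]
    obtain B where B: "\<forall>t\<in>{-1..max a 0}. \<bar>t\<bar> ^ k / exp (Re s * t) \<le> B"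
      by blast
    have le: "\<bar>t\<bar> ^ k / exp (Re s * t) \<le> max B 1" if "t \<ge> -1" for t
    proof (cases "t \<le> max a 0")
      case True then show ?thesis using B that by (simp add: le_max_iff_disj)
    next
      case False then show ?thesis using a[of t] by (simp add: le_max_iff_disj)
    qed
    have "\<bar>t\<bar> ^ k * norm ((- s) ^ n * exp (- s * of_real t)) \<le> norm s ^ n * max B 1" if "t \<ge> -1" for t
    proof -
      have "\<bar>t\<bar> ^ k * norm ((- s) ^ n * exp (- s * of_real t)) = norm s ^ n * (\<bar>t\<bar> ^ k / exp (Re s * t))"
        by (simp add: norm_mult norm_power exp_minus norm_inverse divide_inverse)
      also have "\<dots> \<le> norm s ^ n * max B 1"
        using le[OF that] by (intro mult_left_mono) auto
      finally show ?thesis .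
    qed
    then show ?thesis by blast
  qed
  from pos_schwartzI[OF derivs_exp this] show ?thesis by simp
qed

section \<open>Extension of functions on the half-line to Schwartz functions\<close>

definition cutoff :: "nat \<Rightarrow> real \<Rightarrow> complex" where
  "cutoff = (SOME F. derivs F \<and> (\<forall>t\<le>-1. F 0 t = 0) \<and> (\<forall>t\<ge>-1/2. F 0 t = 1) \<and> (\<forall>n. \<exists>B. \<forall>t. norm (F n t) \<le> B))"

lemma
  shows derivs_cutoff: "derivs cutoff"
    and cutoff_eq_0: "t \<le> -1 \<Longrightarrow> cutoff 0 t = 0"
    and cutoff_eq_1: "t \<ge> -1/2 \<Longrightarrow> cutoff 0 t = 1"
    and cutoff_bounded: "\<exists>B. \<forall>t. norm (cutoff n t) \<le> B"
  using someI_ex[OF smooth_cutoff, folded cutoff_def] by auto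

lemma cutoff_bounded_upto: "\<exists>A. \<forall>n\<le>N. \<forall>t. norm (cutoff n t) \<le> A"
proof -
  obtain B where B: "\<And>n t. norm (cutoff n t) \<le> B n"
    using cutoff_bounded by metis
  have "norm (cutoff n t) \<le> (\<Sum>i\<le>N. B i)" if "n \<le> N" for n t
  proof -
    have "0 \<le> B i" for i
      using B[of i 0] norm_ge_zero order_trans by blast
    then have "B n \<le> (\<Sum>i\<le>N. B i)"
      using that by (intro member_le_sum) auto
    then show ?thesis using B order_trans by blast
  qed
  then show ?thesis by blast
qed

text \<open>One constant for all seminorms up to order N, with t \<ge> -1. It replaces the sum of
  suprema in \<open>tempered\<close>, so that estimates can be composed without computing
  suprema.\<close>

definition pos_bounded :: "nat \<Rightarrow> (real \<Rightarrow> complex) \<Rightarrow> real \<Rightarrow> bool" where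
  "pos_bounded N f B \<longleftrightarrow> (\<forall>k\<le>N. \<forall>n\<le>N. \<forall>t\<ge>-1. \<bar>t\<bar> ^ k * norm ((vderiv ^^ n) f t) \<le> B)"

lemma pos_bounded_nonneg: "pos_bounded N f B \<Longrightarrow> 0 \<le> B"
  unfolding pos_bounded_def
  by (drule spec[of _ 0], drule mp, simp, drule spec[of _ 0], drule mp, simp, drule spec[of _ 0])
    (auto intro: order_trans[OF norm_ge_zero])

lemma pos_bounded_exists:
  assumes "f \<in> pos_schwartz" shows "\<exists>B. pos_bounded N f B"
proof -
  obtain b where b: "\<And>k n t. t \<ge> -1 \<Longrightarrow> \<bar>t\<bar> ^ k * norm ((vderiv ^^ n) f t) \<le> b k n"
    using pos_schwartz_bound[OF assms] by metis
  have nn: "0 \<le> b k n" for k n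
    using order_trans[OF _ b[of 0 k n], of 0] by simp
  have "b k n \<le> (\<Sum>k\<le>N. \<Sum>n\<le>N. b k n)" if "k \<le> N" "n \<le> N" for k n
  proof -
    have "b k n \<le> (\<Sum>n\<le>N. b k n)"
      using that nn by (intro member_le_sum) auto
    also have "\<dots> \<le> (\<Sum>k\<le>N. \<Sum>n\<le>N. b k n)"
      using that nn by (intro member_le_sum[of k "{..N}" "\<lambda>k. \<Sum>n\<le>N. b k n"]) (auto intro: sum_nonneg)
    finally show ?thesis .
  qed
  then have "pos_bounded N f (\<Sum>k\<le>N. \<Sum>n\<le>N. b k n)"
    unfolding pos_bounded_def by (intro allI impI order_trans[OF b]) auto
  then show ?thesis ..
qed

lemma derivs_extend:
  "f \<in> pos_schwartz \<Longrightarrow> derivs (dmult cutoff (\<lambda>n. (vderiv ^^ n) f))"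
  by (intro derivs_dmult derivs_cutoff pos_schwartz_derivs)

lemma extend_zero:
  assumes "f \<in> pos_schwartz" "t < -1"
  shows "dmult cutoff (\<lambda>n. (vderiv ^^ n) f) n t = 0"
  by (rule derivs_zero_open[OF derivs_extend[OF assms(1)], of "{..<-1}"])
    (use assms(2) in \<open>auto simp: cutoff_eq_0\<close>)

lemma extend_schwartz:
  assumes "f \<in> pos_schwartz"
  shows "(\<lambda>t. cutoff 0 t * f t) \<in> schwartz"
proof -
  have "\<exists>B. \<forall>t. \<bar>t\<bar> ^ k * norm (dmult cutoff (\<lambda>n. (vderiv ^^ n) f) n t) \<le> B" for k n
  proof -
    obtain A where A: "\<And>i t. i \<le> n \<Longrightarrow> norm (cutoff i t) \<le> A"
      using cutoff_bounded_upto by blast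
    obtain B where B: "pos_bounded (max k n) f B"
      using pos_bounded_exists[OF assms] by blast
    have A0: "0 \<le> A"
      using order_trans[OF norm_ge_zero A[of 0]] by simp
    have "\<bar>t\<bar> ^ k * norm (dmult cutoff (\<lambda>n. (vderiv ^^ n) f) n t) \<le> 2 ^ n * (A * B)" for t
    proof (cases "t < -1")
      case True
      then show ?thesis
        using extend_zero[OF assms] A0 pos_bounded_nonneg[OF B] by simp
    next
      case False
      then show ?thesis
        using B A pos_bounded_nonneg[OF B] by (intro norm_dmult_le) (auto simp: pos_bounded_def)
    qed
    then show ?thesis by blast
  qed
  from schwartzI[OF derivs_extend[OF assms] this] show ?thesis
    by (simp add: dmult_def[abs_def])
qed

definition full_bounded :: "nat \<Rightarrow> (real \<Rightarrow> complex) \<Rightarrow> real \<Rightarrow> bool" where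
  "full_bounded N f B \<longleftrightarrow> (\<forall>k\<le>N. \<forall>n\<le>N. \<forall>t. \<bar>t\<bar> ^ k * norm ((vderiv ^^ n) f t) \<le> B)"

lemma full_bounded_imp_pos: "full_bounded N f B \<Longrightarrow> pos_bounded N f B"
  by (simp add: full_bounded_def pos_bounded_def)

text \<open>The factor A depends on N and on the cutoff but not on f; continuity of a functional on
  the extended functions requires this uniformity.\<close>

lemma full_bounded_extend:
  "\<exists>A\<ge>0. \<forall>f B. f \<in> pos_schwartz \<and> pos_bounded N f B \<longrightarrow> full_bounded N (\<lambda>t. cutoff 0 t * f t) (A * B)"
proof -
  obtain A where A: "\<And>i t. i \<le> N \<Longrightarrow> norm (cutoff i t) \<le> A"
    using cutoff_bounded_upto by blast
  have A0: "0 \<le> A"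
    using order_trans[OF norm_ge_zero A[of 0]] by simp
  show ?thesis
  proof (intro exI[of _ "2 ^ N * A"] conjI allI impI)
    fix f B assume *: "f \<in> pos_schwartz \<and> pos_bounded N f B"
    then have f: "f \<in> pos_schwartz" and B: "pos_bounded N f B" by auto
    note B0 = pos_bounded_nonneg[OF B]
    have D: "(vderiv ^^ n) (\<lambda>t. cutoff 0 t * f t) = dmult cutoff (\<lambda>n. (vderiv ^^ n) f) n" for n
      using derivs_vderiv[OF derivs_extend[OF f], of n] by (simp add: dmult_def[abs_def])
    have "\<bar>t\<bar> ^ k * norm (dmult cutoff (\<lambda>n. (vderiv ^^ n) f) n t) \<le> 2 ^ N * A * B"
      if "k \<le> N" "n \<le> N" for k n t
    proof (cases "t < -1")
      case True
      then show ?thesis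
        using extend_zero[OF f] A0 B0 by simp
    next
      case False
      then have "\<bar>t\<bar> ^ k * norm (dmult cutoff (\<lambda>n. (vderiv ^^ n) f) n t) \<le> 2 ^ n * (A * B)"
        using B A B0 that by (intro norm_dmult_le) (auto simp: pos_bounded_def)
      also have "\<dots> \<le> 2 ^ N * (A * B)"
        using A0 B0 that by (intro mult_right_mono power_increasing) auto
      finally show ?thesis by (simp add: mult.assoc)
    qed
    then show "full_bounded N (\<lambda>t. cutoff 0 t * f t) (2 ^ N * A * B)"
      unfolding full_bounded_def D by blast
  qed (use A0 in auto)
qed

section \<open>Continuity bounds for tempered distributions\<close>

lemma schwartz_bounded: "\<phi> \<in> schwartz \<Longrightarrow> bounded (range (\<lambda>t. \<bar>t\<bar> ^ k * norm ((vderiv ^^ n) \<phi> t)))"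
  by (simp add: schwartz_def)

text \<open>Each of the (N + 1)^2 suprema in the definition of \<open>tempered\<close> is at most
  B.\<close>

lemma tempered_bound:
  assumes "T \<in> tempered"
  shows "\<exists>C\<ge>0. \<exists>N. \<forall>\<phi>\<in>schwartz. \<forall>B. full_bounded N \<phi> B \<longrightarrow> norm (T \<phi>) \<le> C * B"
proof -
  obtain C N where C: "\<And>\<phi>. \<phi> \<in> schwartz \<Longrightarrow> norm (T \<phi>) \<le>
        C * (\<Sum>k\<le>N. \<Sum>n\<le>N. SUP t. \<bar>t\<bar> ^ k * norm ((vderiv ^^ n) \<phi> t))"
    using assms unfolding tempered_def by blast
  have "norm (T \<phi>) \<le> (\<bar>C\<bar> * (real (Suc N) * real (Suc N))) * B" if "\<phi> \<in> schwartz" "full_bounded N \<phi> B" for \<phi> B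
  proof -
    let ?s = "\<lambda>k n. SUP t. \<bar>t\<bar> ^ k * norm ((vderiv ^^ n) \<phi> t)"
    have le: "?s k n \<le> B" if "k \<le> N" "n \<le> N" for k n
      using that \<open>full_bounded N \<phi> B\<close> unfolding full_bounded_def by (intro cSUP_least) auto
    have ge: "0 \<le> ?s k n" for k n
    proof -
      have "0 \<le> \<bar>0::real\<bar> ^ k * norm ((vderiv ^^ n) \<phi> 0)" by simp
      also have "\<dots> \<le> ?s k n"
        by (rule cSUP_upper[OF UNIV_I bounded_imp_bdd_above[OF schwartz_bounded[OF that(1)]]])
      finally show ?thesis .
    qed
    have "norm (T \<phi>) \<le> C * (\<Sum>k\<le>N. \<Sum>n\<le>N. ?s k n)"
      by (rule C[OF that(1)])
    also have "\<dots> \<le> \<bar>C\<bar> * (\<Sum>k\<le>N. \<Sum>n\<le>N. ?s k n)"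
      by (intro mult_right_mono sum_nonneg ge) auto
    also have "\<dots> \<le> \<bar>C\<bar> * (\<Sum>k\<le>N. \<Sum>n\<le>N. B)"
      by (intro mult_left_mono sum_mono le) auto
    finally show ?thesis by (simp add: algebra_simps)
  qed
  then show ?thesis
    by (intro exI[of _ "\<bar>C\<bar> * (real (Suc N) * real (Suc N))"] conjI exI[of _ N]) auto
qed

text \<open>The sum of all suprema is itself an admissible B, since each seminorm is one of its
  nonnegative terms.\<close>

lemma temperedI:
  assumes "T \<in> extensional schwartz"
    "\<And>\<phi> \<psi>. \<phi> \<in> schwartz \<Longrightarrow> \<psi> \<in> schwartz \<Longrightarrow> T (\<lambda>t. \<phi> t + \<psi> t) = T \<phi> + T \<psi>"
    "\<And>c \<phi>. \<phi> \<in> schwartz \<Longrightarrow> T (\<lambda>t. c * \<phi> t) = c * T \<phi>"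
    "C \<ge> 0" "\<And>\<phi> B. \<phi> \<in> schwartz \<Longrightarrow> full_bounded N \<phi> B \<Longrightarrow> norm (T \<phi>) \<le> C * B"
  shows "T \<in> tempered"
proof -
  have "norm (T \<phi>) \<le> C * (\<Sum>k\<le>N. \<Sum>n\<le>N. SUP t. \<bar>t\<bar> ^ k * norm ((vderiv ^^ n) \<phi> t))"
    if "\<phi> \<in> schwartz" for \<phi>
  proof (rule assms(5)[OF that])
    let ?s = "\<lambda>k n. SUP t. \<bar>t\<bar> ^ k * norm ((vderiv ^^ n) \<phi> t)"
    have up: "\<bar>t\<bar> ^ k * norm ((vderiv ^^ n) \<phi> t) \<le> ?s k n" for k n t
      by (rule cSUP_upper[OF UNIV_I bounded_imp_bdd_above[OF schwartz_bounded[OF that]]])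
    have ge: "0 \<le> ?s k n" for k n
      using order_trans[OF _ up[of 0 k n], of 0] by simp
    have "?s k n \<le> (\<Sum>k\<le>N. \<Sum>n\<le>N. ?s k n)" if "k \<le> N" "n \<le> N" for k n
    proof -
      have "?s k n \<le> (\<Sum>n\<le>N. ?s k n)"
        using that ge by (intro member_le_sum) auto
      also have "\<dots> \<le> (\<Sum>k\<le>N. \<Sum>n\<le>N. ?s k n)"
        using that ge by (intro member_le_sum[of k "{..N}" "\<lambda>k. \<Sum>n\<le>N. ?s k n"]) (auto intro: sum_nonneg)
      finally show ?thesis .
    qed
    then show "full_bounded N \<phi> (\<Sum>k\<le>N. \<Sum>n\<le>N. ?s k n)"
      unfolding full_bounded_def by (intro allI impI order_trans[OF up]) auto
  qed
  then show ?thesis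
    unfolding tempered_def using assms(1-3) by blast
qed

lemma tempered_pos_imp: "T \<in> tempered_pos \<Longrightarrow> T \<in> tempered"
  by (simp add: tempered_pos_def)

lemma tempered_extensional: "T \<in> tempered \<Longrightarrow> T \<in> extensional schwartz"
  by (simp add: tempered_def)

lemma tempered_add: "T \<in> tempered \<Longrightarrow> \<phi> \<in> schwartz \<Longrightarrow> \<psi> \<in> schwartz \<Longrightarrow> T (\<lambda>t. \<phi> t + \<psi> t) = T \<phi> + T \<psi>"
  unfolding tempered_def by blast

lemma tempered_cmult: "T \<in> tempered \<Longrightarrow> \<phi> \<in> schwartz \<Longrightarrow> T (\<lambda>t. c * \<phi> t) = c * T \<phi>"
  unfolding tempered_def by blast

lemma schwartz_add:
  assumes "\<phi> \<in> schwartz" "\<psi> \<in> schwartz" shows "(\<lambda>t. \<phi> t + \<psi> t) \<in> schwartz"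
proof -
  have "\<exists>B. \<forall>t. \<bar>t\<bar> ^ k * norm ((vderiv ^^ n) \<phi> t + (vderiv ^^ n) \<psi> t) \<le> B" for k n
  proof -
    obtain B B' where B: "\<forall>t. \<bar>t\<bar> ^ k * norm ((vderiv ^^ n) \<phi> t) \<le> B"
      "\<forall>t. \<bar>t\<bar> ^ k * norm ((vderiv ^^ n) \<psi> t) \<le> B'"
      using assms unfolding schwartz_iff by meson
    have "\<bar>t\<bar> ^ k * norm ((vderiv ^^ n) \<phi> t + (vderiv ^^ n) \<psi> t) \<le> B + B'" for t
    proof -
      have "\<bar>t\<bar> ^ k * norm ((vderiv ^^ n) \<phi> t + (vderiv ^^ n) \<psi> t)
         \<le> \<bar>t\<bar> ^ k * (norm ((vderiv ^^ n) \<phi> t) + norm ((vderiv ^^ n) \<psi> t))"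
        by (intro mult_left_mono norm_triangle_ineq) auto
      also have "\<dots> \<le> B + B'"
        using B by (simp add: distrib_left add_mono)
      finally show ?thesis .
    qed
    then show ?thesis by blast
  qed
  from schwartzI[OF derivs_add[OF assms[THEN schwartz_derivs]] this] show ?thesis
    by simp
qed

lemma schwartz_cmult:
  assumes "\<phi> \<in> schwartz" shows "(\<lambda>t. c * \<phi> t) \<in> schwartz"
proof -
  have "\<exists>B. \<forall>t. \<bar>t\<bar> ^ k * norm (c * (vderiv ^^ n) \<phi> t) \<le> B" for k n
  proof -
    obtain B where B: "\<forall>t. \<bar>t\<bar> ^ k * norm ((vderiv ^^ n) \<phi> t) \<le> B"
      using assms unfolding schwartz_iff by meson
    have "\<bar>t\<bar> ^ k * norm (c * (vderiv ^^ n) \<phi> t) \<le> norm c * B" for t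
      using mult_left_mono[of "\<bar>t\<bar> ^ k * norm ((vderiv ^^ n) \<phi> t)" B "norm c"] B
      by (simp add: norm_mult algebra_simps)
    then show ?thesis by blast
  qed
  from schwartzI[OF derivs_cmult[OF schwartz_derivs[OF assms]] this] show ?thesis
    by simp
qed

lemma schwartz_diff:
  assumes "\<phi> \<in> schwartz" "\<psi> \<in> schwartz" shows "(\<lambda>t. \<phi> t - \<psi> t) \<in> schwartz"
  using schwartz_add[OF assms(1) schwartz_cmult[OF assms(2), of "-1"]] by simp

lemma tempered_diff:
  assumes "T \<in> tempered" "\<phi> \<in> schwartz" "\<psi> \<in> schwartz"
  shows "T (\<lambda>t. \<phi> t - \<psi> t) = T \<phi> - T \<psi>"
  using tempered_add[OF assms(1,2) schwartz_cmult[OF assms(3), of "-1"]]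
    tempered_cmult[OF assms(1,3), of "-1"] by simp

lemma closure_support_subset:
  assumes "0 < \<epsilon>" "\<And>t. t > - \<epsilon> \<Longrightarrow> f t = (0::complex)"
  shows "closure {t. f t \<noteq> 0} \<subseteq> {..<0::real}"
proof -
  have "{t. f t \<noteq> 0} \<subseteq> {.. - \<epsilon>}"
    using assms(2) by (auto simp: not_le[symmetric])
  then have "closure {t. f t \<noteq> 0} \<subseteq> {.. - \<epsilon>}"
    by (intro closure_minimal) auto
  then show ?thesis using assms(1) by (meson atMost_iff lessThan_iff neg_less_0_iff_less order_le_less_trans subset_iff)
qed

text \<open>A closed set inside the open negative half-line misses a ball about 0. The support
  condition of \<open>tempered_pos\<close> thereby turns into vanishing for all t > -\<epsilon>,
  which is easier to propagate.\<close>

lemma support_gap: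
  assumes "closure {t. f t \<noteq> (0::complex)} \<subseteq> {..<0::real}"
  shows "\<exists>\<epsilon>>0. \<forall>t>-\<epsilon>. f t = 0"
proof -
  have o: "open (- closure {t. f t \<noteq> 0})" and z: "0 \<in> - closure {t. f t \<noteq> 0}"
    using assms by auto
  obtain e where e: "e > 0" "ball 0 e \<subseteq> - closure {t. f t \<noteq> 0}"
    by (rule openE[OF o z])
  have "f t = 0" if "t > -e" for t
  proof (rule ccontr)
    assume n: "f t \<noteq> 0"
    then have c: "t \<in> closure {t. f t \<noteq> 0}"
      by (intro subsetD[OF closure_subset]) simp
    then have "t < 0" using assms by auto
    then have "t \<in> ball 0 e" using that by (simp add: dist_real_def)
    then show False using e c by auto
  qed
  then show ?thesis using e(1) by blast
qed

section \<open>Locality and application to functions on the half-line\<close>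

lemma tempered_pos_local:
  assumes "T \<in> tempered_pos" "\<phi> \<in> schwartz" "\<psi> \<in> schwartz" "0 < \<epsilon>" "\<And>t. t > -\<epsilon> \<Longrightarrow> \<phi> t = \<psi> t"
  shows "T \<phi> = T \<psi>"
proof -
  have "T (\<lambda>t. \<phi> t - \<psi> t) = 0"
    using assms(1) schwartz_diff[OF assms(2,3)] closure_support_subset[OF assms(4), of "\<lambda>t. \<phi> t - \<psi> t"] assms(5)
    unfolding tempered_pos_def by auto
  then show ?thesis
    using tempered_diff[OF tempered_pos_imp[OF assms(1)] assms(2,3)] by simp
qed

text \<open>Two admissible choices agree on a common neighbourhood of the half-line, and the
  functional is local there; hence the choice made by \<open>SOME\<close> does not affect the
  value.\<close>

lemma pos_apply_eq:
  assumes "T \<in> tempered_pos" "\<psi> \<in> schwartz" "0 < \<epsilon>" "\<And>t. t > -\<epsilon> \<Longrightarrow> \<psi> t = g t"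
  shows "pos_apply T g = T \<psi>"
proof -
  define \<eta> where "\<eta> = (SOME \<psi>. \<psi> \<in> schwartz \<and> (\<exists>\<epsilon>>0. \<forall>t>-\<epsilon>. \<psi> t = g t))"
  have "\<eta> \<in> schwartz \<and> (\<exists>\<epsilon>>0. \<forall>t>-\<epsilon>. \<eta> t = g t)"
    unfolding \<eta>_def by (rule someI[of _ \<psi>]) (use assms in blast)
  then obtain \<delta> where \<eta>: "\<eta> \<in> schwartz" "\<delta> > 0" "\<And>t. t > -\<delta> \<Longrightarrow> \<eta> t = g t"
    by blast
  have "T \<eta> = T \<psi>"
    by (rule tempered_pos_local[OF assms(1) \<eta>(1) assms(2), of "min \<epsilon> \<delta>"]) (use assms \<eta> in auto)
  then show ?thesis by (simp add: pos_apply_def \<eta>_def)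
qed

lemma pos_apply_schwartz: "T \<in> tempered_pos \<Longrightarrow> \<phi> \<in> schwartz \<Longrightarrow> pos_apply T \<phi> = T \<phi>"
  by (rule pos_apply_eq[of _ _ 1]) auto

lemma pos_apply_extend:
  assumes "T \<in> tempered_pos" "f \<in> pos_schwartz"
  shows "pos_apply T f = T (\<lambda>t. cutoff 0 t * f t)"
  by (rule pos_apply_eq[OF assms(1) extend_schwartz[OF assms(2)], of "1/2"]) (auto simp: cutoff_eq_1)

lemma pos_apply_cong:
  assumes "T \<in> tempered_pos" "f \<in> pos_schwartz" "0 < \<epsilon>" "\<And>t. t > -\<epsilon> \<Longrightarrow> f t = g t"
  shows "pos_apply T f = pos_apply T g"
proof -
  have "pos_apply T g = T (\<lambda>t. cutoff 0 t * f t)"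
    by (rule pos_apply_eq[OF assms(1) extend_schwartz[OF assms(2)], of "min (1/2) \<epsilon>"])
      (use assms in \<open>auto simp: cutoff_eq_1\<close>)
  then show ?thesis using pos_apply_extend[OF assms(1,2)] by simp
qed

lemma pos_apply_add:
  assumes "T \<in> tempered_pos" "f \<in> pos_schwartz" "g \<in> pos_schwartz"
  shows "pos_apply T (\<lambda>t. f t + g t) = pos_apply T f + pos_apply T g"
  using tempered_add[OF tempered_pos_imp[OF assms(1)] extend_schwartz[OF assms(2)] extend_schwartz[OF assms(3)]]
  by (simp add: pos_apply_extend assms pos_schwartz_add distrib_left)

lemma pos_apply_cmult:
  assumes "T \<in> tempered_pos" "f \<in> pos_schwartz"
  shows "pos_apply T (\<lambda>t. c * f t) = c * pos_apply T f"
  using tempered_cmult[OF tempered_pos_imp[OF assms(1)] extend_schwartz[OF assms(2)], of c]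
  by (simp add: pos_apply_extend assms pos_schwartz_cmult mult.left_commute)

lemma pos_apply_diff:
  assumes "T \<in> tempered_pos" "f \<in> pos_schwartz" "g \<in> pos_schwartz"
  shows "pos_apply T (\<lambda>t. f t - g t) = pos_apply T f - pos_apply T g"
  using pos_apply_add[OF assms(1,2) pos_schwartz_cmult[OF assms(3), of "-1"]]
    pos_apply_cmult[OF assms(1,3), of "-1"] by simp

lemma pos_apply_0: "T \<in> tempered_pos \<Longrightarrow> pos_apply T (\<lambda>t. 0) = 0"
  using pos_apply_cmult[OF _ pos_schwartz_0, of T 0] by simp

lemma pos_schwartz_sum:
  "finite I \<Longrightarrow> (\<And>i. i \<in> I \<Longrightarrow> f i \<in> pos_schwartz) \<Longrightarrow> (\<lambda>t. \<Sum>i\<in>I. f i t) \<in> pos_schwartz"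
  by (induction I rule: finite_induct) (auto simp: pos_schwartz_0 pos_schwartz_add)

lemma pos_apply_sum:
  assumes T: "T \<in> tempered_pos" and "finite I" and f: "\<And>i. i \<in> I \<Longrightarrow> f i \<in> pos_schwartz"
  shows "pos_apply T (\<lambda>t. \<Sum>i\<in>I. f i t) = (\<Sum>i\<in>I. pos_apply T (f i))"
  using assms(2,3)
proof (induction I rule: finite_induct)
  case (insert i I)
  then show ?case
    using pos_apply_add[OF T, of "f i" "\<lambda>t. \<Sum>i\<in>I. f i t"] pos_schwartz_sum[of I f] by simp
qed (simp add: pos_apply_0 T)

text \<open>Continuity with respect to seminorms over t \<ge> -1 only. The estimates of pairings
  with exponentials, translates and reflected kernels all rest on this bound.\<close>

lemma pos_apply_bound:
  assumes "T \<in> tempered_pos"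
  shows "\<exists>C\<ge>0. \<exists>N. \<forall>f\<in>pos_schwartz. \<forall>B. pos_bounded N f B \<longrightarrow> norm (pos_apply T f) \<le> C * B"
proof -
  obtain C N where C: "C \<ge> 0" "\<And>\<phi> B. \<phi> \<in> schwartz \<Longrightarrow> full_bounded N \<phi> B \<Longrightarrow> norm (T \<phi>) \<le> C * B"
    using tempered_bound[OF tempered_pos_imp[OF assms]] by blast
  obtain A where A: "A \<ge> 0"
    "\<And>f B. f \<in> pos_schwartz \<Longrightarrow> pos_bounded N f B \<Longrightarrow> full_bounded N (\<lambda>t. cutoff 0 t * f t) (A * B)"
    using full_bounded_extend by blast
  have "norm (pos_apply T f) \<le> (C * A) * B" if "f \<in> pos_schwartz" "pos_bounded N f B" for f B
    using C(2)[OF extend_schwartz A(2)] that by (simp add: pos_apply_extend[OF assms] mult.assoc)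
  then show ?thesis
    using C(1) A(1) by (intro exI[of _ "C * A"] conjI exI[of _ N]) auto
qed

lemma tempered_posI:
  assumes "T \<in> extensional schwartz"
    "\<And>\<phi> \<psi>. \<phi> \<in> schwartz \<Longrightarrow> \<psi> \<in> schwartz \<Longrightarrow> T (\<lambda>t. \<phi> t + \<psi> t) = T \<phi> + T \<psi>"
    "\<And>c \<phi>. \<phi> \<in> schwartz \<Longrightarrow> T (\<lambda>t. c * \<phi> t) = c * T \<phi>"
    "C \<ge> 0" "\<And>\<phi> B. \<phi> \<in> schwartz \<Longrightarrow> full_bounded N \<phi> B \<Longrightarrow> norm (T \<phi>) \<le> C * B"
    "\<And>\<phi> \<epsilon>. \<phi> \<in> schwartz \<Longrightarrow> 0 < \<epsilon> \<Longrightarrow> (\<And>t. t > -\<epsilon> \<Longrightarrow> \<phi> t = 0) \<Longrightarrow> T \<phi> = 0"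
  shows "T \<in> tempered_pos"
proof -
  have "T \<in> tempered"
    by (rule temperedI[of T C N, OF assms(1-4)]) (auto intro: assms(5))
  moreover have "T \<phi> = 0" if \<phi>: "\<phi> \<in> schwartz" "closure {t. \<phi> t \<noteq> 0} \<subseteq> {..<0}" for \<phi>
  proof -
    obtain \<epsilon> where "\<epsilon> > 0" "\<And>t. t > -\<epsilon> \<Longrightarrow> \<phi> t = 0"
      using support_gap[OF \<phi>(2)] by blast
    then show ?thesis by (rule assms(6)[OF \<phi>(1)])
  qed
  ultimately show ?thesis
    unfolding tempered_pos_def by blast
qed

lemma laplace_eq: "T \<in> tempered_pos \<Longrightarrow> Re s > 0 \<Longrightarrow> laplace T s = pos_apply T (\<lambda>t. exp (- s * of_real t))"
  by (simp add: laplace_def)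

subsection \<open>Uniqueness of the Laplace transform\<close>

lemma pos_bounded_antimono: "pos_bounded N f B \<Longrightarrow> M \<le> N \<Longrightarrow> pos_bounded M f B"
  by (auto simp: pos_bounded_def)

lemma full_bounded_antimono: "full_bounded N f B \<Longrightarrow> M \<le> N \<Longrightarrow> full_bounded M f B"
  by (auto simp: full_bounded_def)

text \<open>Truncation at a large R: beyond R one additional power of |t| is available in the
  seminorms and contributes a factor 1 / R.\<close>

lemma pos_schwartz_right_cut:
  assumes f: "f \<in> pos_schwartz" and e: "e > 0"
  shows "\<exists>g R. g \<in> pos_schwartz \<and> (\<forall>t\<ge>R. g t = 0) \<and> pos_bounded N (\<lambda>t. f t - g t) e"
proof -
  obtain A where A: "\<And>i t. i \<le> N \<Longrightarrow> norm (cutoff i t) \<le> A"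
    using cutoff_bounded_upto by blast
  have A0: "0 \<le> A"
    using order_trans[OF norm_ge_zero A[of 0]] by simp
  obtain B where B: "pos_bounded (Suc N) f B"
    using pos_bounded_exists[OF f] by blast
  note B0 = pos_bounded_nonneg[OF B]
  \<comment> \<open>Order \<open>Suc N\<close> in the bound B supplies the additional power of |t|;
    R is so large that the Leibniz bound divided by R is at most e.\<close>
  define R where "R = max 1 (2 ^ N * ((1 + A) * B) / e)"
  have R: "R \<ge> 1" "2 ^ N * ((1 + A) * B) \<le> e * R"
    using e by (auto simp: R_def max_def field_simps)
  \<comment> \<open>Derivatives of the reflected cutoff: \<open>X 0\<close> is 1 for t \<le> R + 1/2
    and 0 for t \<ge> R + 1.\<close>
  define X where "X n t = of_real ((-1) ^ n) * cutoff n (R + (-1) * t)" for n t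
  have dX: "derivs X"
    unfolding X_def by (rule derivs_affine[OF derivs_cutoff])
  define G where "G n t = (if n = 0 then 1 else 0) - X n t" for n t
  have "derivs (\<lambda>n t. if n = 0 then 1 else 0)"
    by (auto simp: derivs_def)
  then have dG: "derivs G"
    unfolding G_def using dX by (rule derivs_diff)
  define h where "h = dmult G (\<lambda>n. (vderiv ^^ n) f)"
  have dh: "derivs h"
    unfolding h_def by (rule derivs_dmult[OF dG pos_schwartz_derivs[OF f]])
  have hps: "h 0 \<in> pos_schwartz"
  proof (rule pos_schwartzI[OF dh])
    fix k n
    obtain A where A: "\<And>i t. i \<le> n \<Longrightarrow> norm (cutoff i t) \<le> A"
      using cutoff_bounded_upto by blast
    obtain B where B: "pos_bounded (max k n) f B"
      using pos_bounded_exists[OF f] by blast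
    have GA: "norm (G i t) \<le> 1 + A" if "i \<le> n" for i t
    proof -
      have "norm (G i t) \<le> norm (if i = 0 then 1 else 0 :: complex) + norm (X i t)"
        unfolding G_def by (rule norm_triangle_ineq4)
      also have "\<dots> \<le> 1 + A"
        using A[OF that, of "R + (-1) * t"] by (intro add_mono) (auto simp: X_def norm_mult norm_power)
      finally show ?thesis .
    qed
    have "\<bar>t\<bar> ^ k * norm (h n t) \<le> 2 ^ n * ((1 + A) * B)" if "t \<ge> -1" for t
      unfolding h_def using that B GA pos_bounded_nonneg[OF B]
      by (intro norm_dmult_le) (auto simp: pos_bounded_def)
    then show "\<exists>B. \<forall>t\<ge>-1. \<bar>t\<bar> ^ k * norm (h n t) \<le> B" by blast
  qed
  have GA: "norm (G i t) \<le> 1 + A" if "i \<le> N" for i t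
  proof -
    have "norm (G i t) \<le> norm (if i = 0 then 1 else 0 :: complex) + norm (X i t)"
      unfolding G_def by (rule norm_triangle_ineq4)
    also have "\<dots> \<le> 1 + A"
      using A[OF that, of "R + (-1) * t"] by (intro add_mono) (auto simp: X_def norm_mult norm_power)
    finally show ?thesis .
  qed
  have hb: "\<bar>t\<bar> ^ k * norm (h n t) \<le> e" if "t \<ge> -1" "k \<le> N" "n \<le> N" for k n t
  proof (cases "t < R")
    case True
    have "h n t = 0"
      by (rule derivs_zero_open[OF dh, of "{..<R}"])
        (use True in \<open>auto simp: h_def G_def X_def cutoff_eq_1\<close>)
    then show ?thesis using e by simp
  next
    case False
    have "\<bar>t\<bar> ^ k * norm ((vderiv ^^ i) f t) \<le> B / R" if "i \<le> N" for i
    proof -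
      have "R * (\<bar>t\<bar> ^ k * norm ((vderiv ^^ i) f t)) \<le> \<bar>t\<bar> * (\<bar>t\<bar> ^ k * norm ((vderiv ^^ i) f t))"
        using False by (intro mult_right_mono) auto
      also have "\<dots> \<le> B"
        using B \<open>t \<ge> -1\<close> \<open>k \<le> N\<close> that unfolding pos_bounded_def
        by (metis Suc_le_mono le_SucI mult.assoc power_Suc)
      finally show ?thesis using R(1) by (simp add: field_simps)
    qed
    then have "\<bar>t\<bar> ^ k * norm (h n t) \<le> 2 ^ n * ((1 + A) * (B / R))"
      unfolding h_def using that GA B0 R(1) by (intro norm_dmult_le) auto
    also have "\<dots> \<le> 2 ^ N * ((1 + A) * (B / R))"
      using A0 B0 R(1) that by (intro mult_right_mono power_increasing) auto
    also have "\<dots> \<le> e"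
      using R by (simp add: field_simps)
    finally show ?thesis .
  qed
  define g where "g t = f t - h 0 t" for t
  have "g \<in> pos_schwartz"
    unfolding g_def by (rule pos_schwartz_diff[OF f hps])
  moreover have "\<forall>t\<ge>R+1. g t = 0"
    by (auto simp: g_def h_def G_def X_def cutoff_eq_0)
  moreover have eq: "(\<lambda>t. f t - g t) = h 0"
    by (auto simp: g_def)
  have "pos_bounded N (\<lambda>t. f t - g t) e"
    unfolding eq pos_bounded_def derivs_vderiv[OF dh] using hb by blast
  ultimately show ?thesis by blast
qed

lemma pos_schwartz_tendsto_0:
  assumes "f \<in> pos_schwartz"
  shows "((vderiv ^^ n) f \<longlongrightarrow> 0) at_top"
proof -
  obtain B where B: "\<And>t. t \<ge> -1 \<Longrightarrow> \<bar>t\<bar> ^ 1 * norm ((vderiv ^^ n) f t) \<le> B"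
    using pos_schwartz_bound[OF assms] by blast
  have "\<forall>\<^sub>F t in at_top. norm ((vderiv ^^ n) f t) \<le> B / t"
    using eventually_gt_at_top[of 0]
  proof eventually_elim
    case (elim t)
    then show ?case using B[of t] by (simp add: field_simps)
  qed
  moreover have "((\<lambda>t. B / t) \<longlongrightarrow> 0) at_top"
    by (rule tendsto_divide_0[OF tendsto_const filterlim_at_top_imp_at_infinity[OF filterlim_ident]])
  ultimately show ?thesis
    by (rule Lim_null_comparison)
qed

text \<open>Integration from infinity reproduces the bound e exp(-t) with the same constant, so it
  can be iterated without loss.\<close>

lemma exp_decay_integrate:
  fixes f :: "real \<Rightarrow> complex"
  assumes d: "\<And>t. (f has_vector_derivative f' t) (at t)" and "\<And>t. t \<ge> -1 \<Longrightarrow> norm (f' t) \<le> e * exp (- t)"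
    and lim: "(f \<longlongrightarrow> 0) at_top" and t: "t \<ge> -1" and e: "e \<ge> 0"
  shows "norm (f t) \<le> e * exp (- t)"
proof -
  have "norm (f u - f t) \<le> e * exp (- t)" if "u > t" for u
  proof -
    have "norm (f u - f t) \<le> (- e * exp (- u)) - (- e * exp (- t))"
    proof (rule differentiable_bound_general[OF that, of f "\<lambda>x. - e * exp (- x)" f' "\<lambda>x. e * exp (- x)"])
      show "continuous_on {t..u} f"
        by (meson continuous_at_imp_continuous_on d has_vector_derivative_continuous)
      show "((\<lambda>x. - e * exp (- x)) has_vector_derivative e * exp (- x)) (at x)" for x
        unfolding has_real_derivative_iff_has_vector_derivative[symmetric]
        by (auto intro!: derivative_eq_intros)
    qed (use d assms(2) t in \<open>auto intro!: continuous_intros\<close>)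
    also have "\<dots> \<le> e * exp (- t)"
      using e by simp
    finally show ?thesis .
  qed
  then have "\<forall>\<^sub>F u in at_top. norm (f u - f t) \<le> e * exp (- t)"
    by (rule eventually_mono[OF eventually_gt_at_top[of t]])
  moreover have "((\<lambda>u. norm (f u - f t)) \<longlongrightarrow> norm (0 - f t)) at_top"
    by (intro tendsto_intros lim)
  ultimately have "norm (0 - f t) \<le> e * exp (- t)"
    by (intro tendsto_upperbound[where F = at_top]) auto
  then show ?thesis by simp
qed

text \<open>Stone-Weierstrass for vector-valued functions gives polynomials for both real and
  imaginary part; they are padded with zero coefficients to the common degree k + l.\<close>

lemma complex_Weierstrass:
  fixes h :: "real \<Rightarrow> complex"
  assumes "continuous_on {a..b} h" "e > 0"
  shows "\<exists>c m. \<forall>y\<in>{a..b}. norm (h y - (\<Sum>i\<le>m. c i * of_real y ^ i)) < e"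
proof -
  obtain p where p: "polynomial_function p" "\<And>y. y \<in> {a..b} \<Longrightarrow> norm (h y - p y) < e"
    using Stone_Weierstrass_polynomial_function[OF compact_Icc assms] by blast
  have "real_polynomial_function (Re \<circ> p)" "real_polynomial_function (Im \<circ> p)"
    using p(1) bounded_linear_Re bounded_linear_Im unfolding polynomial_function_def by blast+
  then obtain c d k l where c: "Re \<circ> p = (\<lambda>y. \<Sum>i\<le>k. c i * y ^ i)" and d: "Im \<circ> p = (\<lambda>y. \<Sum>i\<le>l. d i * y ^ i)"
    unfolding real_polynomial_function_iff_sum by blast
  define c' where "c' i = (if i \<le> k then c i else 0)" for i
  define d' where "d' i = (if i \<le> l then d i else 0)" for i
  have cc: "(\<Sum>i\<le>k. c i * y ^ i) = (\<Sum>i\<le>k+l. c' i * y ^ i)" for y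
    by (rule sum.mono_neutral_cong_left) (auto simp: c'_def)
  have dd: "(\<Sum>i\<le>l. d i * y ^ i) = (\<Sum>i\<le>k+l. d' i * y ^ i)" for y
    by (rule sum.mono_neutral_cong_left) (auto simp: d'_def)
  have "p y = (\<Sum>i\<le>k+l. Complex (c' i) (d' i) * of_real y ^ i)" for y
  proof -
    have "Re (p y) = (\<Sum>i\<le>k+l. c' i * y ^ i)" "Im (p y) = (\<Sum>i\<le>k+l. d' i * y ^ i)"
      using fun_cong[OF c, of y] fun_cong[OF d, of y] by (simp_all add: cc dd)
    then show ?thesis
      by (simp add: complex_eq_iff flip: of_real_power)
  qed
  with p(2) show ?thesis
    by (intro exI[of _ "\<lambda>i. Complex (c' i) (d' i)"] exI[of _ "k+l"]) simp
qed

text \<open>In the variable \<open>y = exp (- t)\<close> the \<open>N\<close>-th derivative is approximated by a polynomial;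
  the approximation is then integrated \<open>N\<close> times from infinity.\<close>

lemma pos_schwartz_exp_dense:
  assumes g: "g \<in> pos_schwartz" and gR: "\<And>t. t \<ge> R \<Longrightarrow> g t = 0" and e: "e > 0"
  shows "\<exists>c m. pos_bounded N (\<lambda>t. g t - (\<Sum>i\<le>m. c i * exp (- of_nat (Suc i) * of_real t))) e"
proof -
  have ex: "(\<lambda>t. exp (- of_nat (Suc i) * of_real t)) \<in> pos_schwartz" for i
    by (rule pos_schwartz_exp) simp
  obtain M where M: "pos_bounded N (\<lambda>t. exp (- of_nat (Suc 0) * of_real t)) M"
    using pos_bounded_exists[OF ex] by blast
  have M': "\<bar>t\<bar> ^ k * exp (- t) \<le> M" if "t \<ge> -1" "k \<le> N" for k t
  proof -
    have "\<bar>t\<bar> ^ k * norm ((vderiv ^^ 0) (\<lambda>t. exp (- of_nat (Suc 0) * of_real t)) t) \<le> M"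
      using M that unfolding pos_bounded_def by blast
    then show ?thesis by simp
  qed
  note M0 = pos_bounded_nonneg[OF M]
  \<comment> \<open>M bounds |t|^k exp(-t) for k \<le> N, so an error \<epsilon> exp(-t) in every
    derivative costs at most \<epsilon> M in the weighted seminorms; the summand 1 keeps the
    denominator positive.\<close>
  define \<epsilon> where "\<epsilon> = e / (M + 1)"
  have \<epsilon>: "\<epsilon> > 0" "\<epsilon> * M \<le> e"
    using e M0 by (auto simp: \<epsilon>_def field_simps)
  \<comment> \<open>exp(-t) < \<delta> means t > R + 1, where g and its derivatives vanish; cutting
    the variable at \<delta> avoids the singularities of ln y and 1 / y at 0.\<close>
  define \<delta> where "\<delta> = exp (- R - 1)"
  \<comment> \<open>Dividing by y leaves a factor exp(-t) in front of the approximating polynomial: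
    the exponents start at 1, and the error decays like exp(-t).\<close>
  define h where "h y = (vderiv ^^ N) g (- ln (max y \<delta>)) / of_real (max y \<delta>)" for y
  have \<delta>: "\<delta> > 0" by (simp add: \<delta>_def)
  have max0: "max y \<delta> \<noteq> 0" for y
    using \<delta> by linarith
  have "continuous_on {0..exp 1} h"
  proof -
    have "continuous_on {0..exp 1} (\<lambda>y. (vderiv ^^ N) g (- ln (max y \<delta>)))"
      by (rule continuous_on_compose2[OF derivs_continuous_on[OF pos_schwartz_derivs[OF g], of UNIV]])
        (auto intro!: continuous_intros simp: max0)
    then show ?thesis
      unfolding h_def by (intro continuous_intros) (auto simp only: max0 of_real_eq_0_iff)
  qed
  from complex_Weierstrass[OF this \<epsilon>(1)]
  obtain c m where c: "\<And>y. y \<in> {0..exp 1} \<Longrightarrow> norm (h y - (\<Sum>i\<le>m. c i * of_real y ^ i)) < \<epsilon>"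
    by blast
  have gz: "(vderiv ^^ n) g t = 0" if "t > R" for n t
    by (rule derivs_zero_open[OF pos_schwartz_derivs[OF g], of "{R<..}"]) (use gR that in auto)
  have h: "(vderiv ^^ N) g t = of_real (exp (- t)) * h (exp (- t))" for t
  proof (cases "exp (- t) < \<delta>")
    case True
    then have "t > R" by (simp add: \<delta>_def)
    then show ?thesis using True by (simp add: h_def \<delta>_def gz)
  qed (simp add: h_def max_def)
  define s where "s i = complex_of_nat (Suc i)" for i
  have s: "s i \<noteq> 0" for i by (auto simp: s_def simp del: of_nat_Suc)
  \<comment> \<open>The N-fold primitive that vanishes at infinity: each exponential is divided by
    (-s)^N.\<close>
  define b where "b i = c i / (- s i) ^ N" for i
  define \<psi> where "\<psi> t = (\<Sum>i\<le>m. b i * exp (- s i * of_real t))" for t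
  have d\<psi>: "derivs (\<lambda>n t. \<Sum>i\<le>m. b i * ((- s i) ^ n * exp (- s i * of_real t)))"
    by (rule derivs_sum, rule derivs_cmult, rule derivs_exp)
  have \<psi>: "\<psi> \<in> pos_schwartz"
    unfolding \<psi>_def s_def by (intro pos_schwartz_sum finite_atMost pos_schwartz_cmult ex)
  have D\<psi>: "(vderiv ^^ N) \<psi> t = (\<Sum>i\<le>m. c i * exp (- s i * of_real t))" for t
    using fun_cong[OF derivs_vderiv[OF d\<psi>, of N], of t] s by (simp add: \<psi>_def[abs_def] b_def)
  have D: "(vderiv ^^ n) (\<lambda>t. g t - \<psi> t) = (\<lambda>t. (vderiv ^^ n) g t - (vderiv ^^ n) \<psi> t)" for n
    by (rule vderiv_diff[OF g \<psi>])
  have diff: "(\<lambda>t. g t - \<psi> t) \<in> pos_schwartz"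
    by (rule pos_schwartz_diff[OF g \<psi>])
  have top: "norm ((vderiv ^^ N) (\<lambda>t. g t - \<psi> t) t) \<le> \<epsilon> * exp (- t)" if "t \<ge> -1" for t
  proof -
    have "exp (- s i * of_real t) = of_real (exp (- t)) * of_real (exp (- t)) ^ i" for i
      by (simp add: s_def exp_of_real exp_of_nat_mult[symmetric] exp_add[symmetric] ring_distribs flip: exp_of_real)
    then have "(vderiv ^^ N) (\<lambda>t. g t - \<psi> t) t = of_real (exp (- t)) * (h (exp (- t)) - (\<Sum>i\<le>m. c i * of_real (exp (- t)) ^ i))"
      unfolding D D\<psi> h by (simp add: ring_distribs sum_distrib_left mult.left_commute)
    then have "norm ((vderiv ^^ N) (\<lambda>t. g t - \<psi> t) t) = exp (- t) * norm (h (exp (- t)) - (\<Sum>i\<le>m. c i * of_real (exp (- t)) ^ i))"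
      by (simp add: norm_mult)
    also have "\<dots> \<le> exp (- t) * \<epsilon>"
      using c[of "exp (- t)"] that by (intro mult_left_mono less_imp_le) auto
    finally show ?thesis by (simp add: mult.commute)
  qed
  \<comment> \<open>Downward induction on the order of differentiation, from N to 0, integrating
    from infinity each time.\<close>
  have all: "norm ((vderiv ^^ (N - j)) (\<lambda>t. g t - \<psi> t) t) \<le> \<epsilon> * exp (- t)" if "t \<ge> -1" "j \<le> N" for t j
    using that
  proof (induction j arbitrary: t)
    case 0 then show ?case using top by simp
  next
    case (Suc j)
    have *: "Suc (N - Suc j) = N - j" using Suc.prems by simp
    show ?case
    proof (rule exp_decay_integrate[where f' = "(vderiv ^^ (N - j)) (\<lambda>t. g t - \<psi> t)"])
      show "((vderiv ^^ (N - Suc j)) (\<lambda>t. g t - \<psi> t) has_vector_derivative (vderiv ^^ (N - j)) (\<lambda>t. g t - \<psi> t) t) (at t)" for t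
        using derivsD[OF pos_schwartz_derivs[OF diff], of "N - Suc j" t] unfolding * .
      show "norm ((vderiv ^^ (N - j)) (\<lambda>t. g t - \<psi> t) t) \<le> \<epsilon> * exp (- t)" if "t \<ge> -1" for t
        using Suc that by simp
    qed (use pos_schwartz_tendsto_0[OF diff] Suc.prems \<epsilon>(1) in auto)
  qed
  have "pos_bounded N (\<lambda>t. g t - \<psi> t) e"
    unfolding pos_bounded_def
  proof (intro allI impI)
    fix k n t assume *: "k \<le> N" "n \<le> N" "(-1::real) \<le> t"
    have "norm ((vderiv ^^ n) (\<lambda>t. g t - \<psi> t) t) \<le> \<epsilon> * exp (- t)"
      using all[of t "N - n"] * by simp
    then have "\<bar>t\<bar> ^ k * norm ((vderiv ^^ n) (\<lambda>t. g t - \<psi> t) t) \<le> \<epsilon> * (\<bar>t\<bar> ^ k * exp (- t))"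
      using mult_left_mono[of _ "\<epsilon> * exp (- t)" "\<bar>t\<bar> ^ k"] by (simp add: mult.left_commute)
    also have "\<dots> \<le> \<epsilon> * M"
      using M' * \<epsilon>(1) by (intro mult_left_mono) auto
    finally show "\<bar>t\<bar> ^ k * norm ((vderiv ^^ n) (\<lambda>t. g t - \<psi> t) t) \<le> e"
      using \<epsilon>(2) by linarith
  qed
  then show ?thesis
    unfolding \<psi>_def s_def by blast
qed

text \<open>The difference of the two functionals is continuous and vanishes on exp(-k t) for k
  \<ge> 1. Truncation followed by exponential approximation makes it arbitrarily small on a given
  Schwartz function.\<close>

lemma laplace_unique:
  assumes S: "S \<in> tempered_pos" and T: "T \<in> tempered_pos"
    and eq: "\<And>s. Re s > 0 \<Longrightarrow> laplace S s = laplace T s"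
  shows "S = T"
proof (rule extensionalityI[of _ schwartz])
  show "S \<in> extensional schwartz" "T \<in> extensional schwartz"
    using S T by (auto intro: tempered_extensional tempered_pos_imp)
  fix \<phi> assume \<phi>: "\<phi> \<in> schwartz"
  note f = schwartz_imp_pos[OF \<phi>]
  obtain C1 N1 where C1: "C1 \<ge> 0" "\<And>f B. f \<in> pos_schwartz \<Longrightarrow> pos_bounded N1 f B \<Longrightarrow> norm (pos_apply S f) \<le> C1 * B"
    using pos_apply_bound[OF S] by blast
  obtain C2 N2 where C2: "C2 \<ge> 0" "\<And>f B. f \<in> pos_schwartz \<Longrightarrow> pos_bounded N2 f B \<Longrightarrow> norm (pos_apply T f) \<le> C2 * B"
    using pos_apply_bound[OF T] by blast
  define N where "N = max N1 N2"
  define \<Delta> where "\<Delta> f = pos_apply S f - pos_apply T f" for f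
  have bd: "norm (\<Delta> f) \<le> (C1 + C2) * B" if "f \<in> pos_schwartz" "pos_bounded N f B" for f B
  proof -
    have "norm (\<Delta> f) \<le> norm (pos_apply S f) + norm (pos_apply T f)"
      unfolding \<Delta>_def by (rule norm_triangle_ineq4)
    also have "\<dots> \<le> C1 * B + C2 * B"
      using that by (intro add_mono C1(2) C2(2)) (auto simp: N_def intro: pos_bounded_antimono)
    finally show ?thesis by (simp add: distrib_right)
  qed
  have le: "norm (\<Delta> \<phi>) \<le> 2 * (C1 + C2) * e" if e: "e > 0" for e
  proof -
    obtain g R where g: "g \<in> pos_schwartz" "\<And>t. t \<ge> R \<Longrightarrow> g t = 0" "pos_bounded N (\<lambda>t. \<phi> t - g t) e"
      using pos_schwartz_right_cut[OF f e] by blast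
    obtain c m where c: "pos_bounded N (\<lambda>t. g t - (\<Sum>i\<le>m. c i * exp (- of_nat (Suc i) * of_real t))) e"
      using pos_schwartz_exp_dense[OF g(1,2) e] by blast
    define \<psi> where "\<psi> t = (\<Sum>i\<le>m. c i * exp (- of_nat (Suc i) * of_real t))" for t
    have ex: "(\<lambda>t. exp (- of_nat (Suc i) * of_real t)) \<in> pos_schwartz" for i
      by (rule pos_schwartz_exp) simp
    have \<psi>: "\<psi> \<in> pos_schwartz"
      unfolding \<psi>_def by (intro pos_schwartz_sum finite_atMost pos_schwartz_cmult ex)
    have lap: "pos_apply X \<psi> = (\<Sum>i\<le>m. c i * laplace X (of_nat (Suc i)))" if X: "X \<in> tempered_pos" for X
    proof -
      have "pos_apply X \<psi> = (\<Sum>i\<le>m. pos_apply X (\<lambda>t. c i * exp (- of_nat (Suc i) * of_real t)))"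
        unfolding \<psi>_def by (intro pos_apply_sum X finite_atMost pos_schwartz_cmult ex)
      also have "\<dots> = (\<Sum>i\<le>m. c i * pos_apply X (\<lambda>t. exp (- of_nat (Suc i) * of_real t)))"
        by (intro sum.cong refl pos_apply_cmult X ex)
      finally show ?thesis
        by (simp only: laplace_def)
    qed
    have "pos_apply S \<psi> = pos_apply T \<psi>"
      unfolding lap[OF S] lap[OF T] by (intro sum.cong refl arg_cong2[where f = "(*)"] eq) simp
    then have z: "\<Delta> \<psi> = 0" by (simp add: \<Delta>_def)
    have "\<Delta> \<phi> = \<Delta> (\<lambda>t. \<phi> t - g t) + \<Delta> (\<lambda>t. g t - \<psi> t) + \<Delta> \<psi>"
      by (simp add: \<Delta>_def pos_apply_diff S T f g \<psi>)
    then have "norm (\<Delta> \<phi>) \<le> norm (\<Delta> (\<lambda>t. \<phi> t - g t)) + norm (\<Delta> (\<lambda>t. g t - \<psi> t))"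
      using z norm_triangle_ineq by simp
    also have "\<dots> \<le> (C1 + C2) * e + (C1 + C2) * e"
      using g c by (intro add_mono bd pos_schwartz_diff f \<psi>) (auto simp: \<psi>_def)
    finally show ?thesis by (simp add: algebra_simps)
  qed
  have "norm (\<Delta> \<phi>) \<le> 0"
  proof (rule ccontr)
    assume "\<not> norm (\<Delta> \<phi>) \<le> 0"
    then have p: "norm (\<Delta> \<phi>) > 0" by simp
    \<comment> \<open>With this e the bound 2 (C1 + C2) e is strictly below the norm that it ought
      to dominate; the 1 covers C1 = C2 = 0.\<close>
    define e where "e = norm (\<Delta> \<phi>) / (4 * (C1 + C2 + 1))"
    have "e > 0" using p C1(1) C2(1) by (simp add: e_def)
    from le[OF this] have "norm (\<Delta> \<phi>) \<le> 2 * (C1 + C2) * e" .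
    also have "\<dots> < 4 * (C1 + C2 + 1) * e"
      using \<open>e > 0\<close> C1(1) C2(1) by (intro mult_strict_right_mono) auto
    also have "\<dots> = norm (\<Delta> \<phi>)"
      using C1(1) C2(1) by (simp add: e_def)
    finally show False by simp
  qed
  then show "S \<phi> = T \<phi>"
    by (simp add: \<Delta>_def pos_apply_schwartz S T \<phi>)
qed

lemma has_laplaceD: "has_laplace T F \<Longrightarrow> T \<in> tempered_pos" "has_laplace T F \<Longrightarrow> Re s > 0 \<Longrightarrow> laplace T s = F s"
  by (auto simp: has_laplace_def)

lemma has_laplace_unique:
  assumes "has_laplace S F" "has_laplace T G" "\<And>s. Re s > 0 \<Longrightarrow> F s = G s"
  shows "S = T"
  using assms by (intro laplace_unique) (auto simp: has_laplace_def)

lemma has_laplace_cong: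
  "has_laplace T F \<Longrightarrow> (\<And>s. Re s > 0 \<Longrightarrow> F s = G s) \<Longrightarrow> has_laplace T G"
  by (auto simp: has_laplace_def)

lemma inverse_laplace_eq: "has_laplace T F \<Longrightarrow> inverse_laplace F = T"
  unfolding inverse_laplace_def by (rule the_equality) (auto intro: has_laplace_unique)

subsection \<open>Convolution\<close>

text \<open>A quadratic remainder estimate is the form of differentiability that survives the
  application of a functional bounded by finitely many seminorms.\<close>

lemma has_vector_derivative_quadraticI:
  fixes f :: "real \<Rightarrow> 'a::real_normed_vector"
  assumes "\<And>y. y \<in> S \<Longrightarrow> \<bar>y - x\<bar> \<le> 1 \<Longrightarrow> norm (f y - f x - (y - x) *\<^sub>R d) \<le> K * (y - x)^2"
  shows "(f has_vector_derivative d) (at x within S)"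
  unfolding has_vector_derivative_def has_derivative_within_alt
proof (intro conjI allI impI)
  show "bounded_linear (\<lambda>h. h *\<^sub>R d)"
    by (rule bounded_linear_scaleR_left)
  fix e :: real assume e: "e > 0"
  define \<delta> where "\<delta> = min 1 (e / (\<bar>K\<bar> + 1))"
  have \<delta>: "\<delta> > 0" "\<delta> \<le> 1" "\<bar>K\<bar> * \<delta> \<le> e"
  proof -
    show "\<delta> > 0" "\<delta> \<le> 1" using e by (auto simp: \<delta>_def)
    have "\<bar>K\<bar> * \<delta> \<le> \<bar>K\<bar> * (e / (\<bar>K\<bar> + 1))"
      by (intro mult_left_mono) (auto simp: \<delta>_def)
    also have "\<dots> \<le> e" using e by (simp add: field_simps)
    finally show "\<bar>K\<bar> * \<delta> \<le> e" .
  qed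
  have "norm (f y - f x - (y - x) *\<^sub>R d) \<le> e * norm (y - x)" if "y \<in> S" "norm (y - x) < \<delta>" for y
  proof -
    have "norm (f y - f x - (y - x) *\<^sub>R d) \<le> K * (y - x)^2"
      using that \<delta> by (intro assms) auto
    also have "\<dots> \<le> \<bar>K\<bar> * (y - x)^2"
      by (intro mult_right_mono) auto
    also have "\<dots> = (\<bar>K\<bar> * \<bar>y - x\<bar>) * \<bar>y - x\<bar>"
      by (metis mult.assoc power2_abs power2_eq_square)
    also have "\<dots> \<le> (\<bar>K\<bar> * \<delta>) * \<bar>y - x\<bar>"
      using that by (intro mult_right_mono mult_left_mono) auto
    also have "\<dots> \<le> e * \<bar>y - x\<bar>"
      using \<delta> by (intro mult_right_mono) auto
    finally show ?thesis by simp
  qed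
  then show "\<exists>\<delta>>0. \<forall>y\<in>S. norm (y - x) < \<delta> \<longrightarrow> norm (f y - f x - (y - x) *\<^sub>R d) \<le> e * norm (y - x)"
    using \<delta>(1) by blast
qed

text \<open>The mean value inequality is applied to f' and then to f minus its linear part, at the
  price of M instead of M / 2. Derivatives are taken within a convex set, so that intervals with end
  points are covered.\<close>

lemma quadratic_remainder:
  fixes f :: "real \<Rightarrow> 'a::real_normed_vector"
  assumes S: "convex S" "x \<in> S" "y \<in> S"
    and f: "\<And>z. z \<in> S \<Longrightarrow> (f has_vector_derivative f' z) (at z within S)"
    and f': "\<And>z. z \<in> S \<Longrightarrow> (f' has_vector_derivative f'' z) (at z within S)"
    and M: "\<And>z. z \<in> closed_segment x y \<Longrightarrow> norm (f'' z) \<le> M"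
  shows "norm (f y - f x - (y - x) *\<^sub>R f' x) \<le> M * (y - x)^2"
proof -
  have sub: "closed_segment x y \<subseteq> S"
    using S by (simp add: closed_segment_subset)
  have lin: "norm (f' z - f' x) \<le> M * \<bar>y - x\<bar>" if z: "z \<in> closed_segment x y" for z
  proof -
    have M0: "0 \<le> M" using order_trans[OF norm_ge_zero M[of x]] by simp
    have "norm (f' z - f' x) \<le> M * norm (z - x)"
    proof (rule differentiable_bound[of "closed_segment x y" f' "\<lambda>z h. h *\<^sub>R f'' z"])
      show "(f' has_derivative (\<lambda>h. h *\<^sub>R f'' z)) (at z within closed_segment x y)" if "z \<in> closed_segment x y" for z
        using f'[of z] that sub unfolding has_vector_derivative_def
        by (meson has_derivative_subset subsetD)
      show "onorm (\<lambda>h. h *\<^sub>R f'' z) \<le> M" if "z \<in> closed_segment x y" for z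
        using M[OF that] by (intro onorm_le) (simp add: mult.commute[of M] mult_left_mono)
    qed (use z in auto)
    also have "\<dots> \<le> M * \<bar>y - x\<bar>"
      using z M0 by (intro mult_left_mono) (auto simp: closed_segment_eq_real_ivl split: if_splits)
    finally show ?thesis .
  qed
  have "norm (f y - f x - (y - x) *\<^sub>R f' x) \<le> norm (y - x) * (M * \<bar>y - x\<bar>)"
  proof (rule vector_differentiable_bound_linearization[of "closed_segment x y"])
    show "(f has_vector_derivative f' z) (at z within closed_segment x y)" if "z \<in> closed_segment x y" for z
      using f[of z] that sub has_vector_derivative_within_subset by blast
  qed (use lin in auto)
  also have "\<dots> = M * (y - x)^2"
    by (simp add: power2_eq_square abs_mult_self_eq mult.left_commute)
  finally show ?thesis .
qed

lemma power_sum_le: "0 \<le> a \<Longrightarrow> 0 \<le> b \<Longrightarrow> (a + b) ^ k \<le> 2 ^ k * (a ^ k + b ^ k)" for a b :: real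
proof -
  assume ab: "0 \<le> a" "0 \<le> b"
  then have "(a + b) ^ k \<le> (2 * max a b) ^ k"
    by (intro power_mono) auto
  also have "\<dots> = 2 ^ k * max a b ^ k"
    by (simp add: power_mult_distrib)
  also have "\<dots> \<le> 2 ^ k * (a ^ k + b ^ k)"
    using ab by (intro mult_left_mono) (auto simp: max_def)
  finally show ?thesis .
qed

lemma schwartz_bounds:
  assumes "\<phi> \<in> schwartz" shows "\<exists>B. full_bounded N \<phi> B"
proof -
  obtain b where b: "\<And>k n t. \<bar>t\<bar> ^ k * norm ((vderiv ^^ n) \<phi> t) \<le> b k n"
    using assms unfolding schwartz_iff by metis
  have nn: "0 \<le> b k n" for k n
    using order_trans[OF _ b[of 0 k n], of 0] by simp
  have "b k n \<le> (\<Sum>k\<le>N. \<Sum>n\<le>N. b k n)" if "k \<le> N" "n \<le> N" for k n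
  proof -
    have "b k n \<le> (\<Sum>n\<le>N. b k n)"
      using that nn by (intro member_le_sum) auto
    also have "\<dots> \<le> (\<Sum>k\<le>N. \<Sum>n\<le>N. b k n)"
      using that nn by (intro member_le_sum[of k "{..N}" "\<lambda>k. \<Sum>n\<le>N. b k n"]) (auto intro: sum_nonneg)
    finally show ?thesis .
  qed
  then have "full_bounded N \<phi> (\<Sum>k\<le>N. \<Sum>n\<le>N. b k n)"
    unfolding full_bounded_def by (intro allI impI order_trans[OF b]) auto
  then show ?thesis ..
qed

lemma full_bounded_nonneg: "full_bounded N f B \<Longrightarrow> 0 \<le> B"
  by (rule pos_bounded_nonneg[OF full_bounded_imp_pos])

lemma vderiv_translate:
  assumes "derivs (\<lambda>n. (vderiv ^^ n) \<phi>)"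
  shows "(vderiv ^^ n) (\<lambda>\<tau>. \<phi> (t + \<tau>)) = (\<lambda>\<tau>. (vderiv ^^ n) \<phi> (t + \<tau>))"
  using derivs_vderiv[OF derivs_translate[OF assms, of t], of n] by simp

lemma schwartz_translate:
  assumes "\<phi> \<in> schwartz" shows "(\<lambda>\<tau>. \<phi> (t + \<tau>)) \<in> schwartz"
proof -
  have "\<exists>B. \<forall>\<tau>. \<bar>\<tau>\<bar> ^ k * norm ((vderiv ^^ n) \<phi> (t + \<tau>)) \<le> B" for k n
  proof -
    obtain B where B: "full_bounded (max k n) \<phi> B"
      using schwartz_bounds[OF assms] by blast
    have "\<bar>\<tau>\<bar> ^ k * norm ((vderiv ^^ n) \<phi> (t + \<tau>)) \<le> 2 ^ k * (B + \<bar>t\<bar> ^ k * B)" for \<tau>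
    proof -
      have "\<bar>\<tau>\<bar> ^ k * norm ((vderiv ^^ n) \<phi> (t + \<tau>)) \<le> (\<bar>t + \<tau>\<bar> + \<bar>t\<bar>) ^ k * norm ((vderiv ^^ n) \<phi> (t + \<tau>))"
        by (intro mult_right_mono power_mono) auto
      also have "\<dots> \<le> (2 ^ k * (\<bar>t + \<tau>\<bar> ^ k + \<bar>t\<bar> ^ k)) * norm ((vderiv ^^ n) \<phi> (t + \<tau>))"
        by (intro mult_right_mono power_sum_le) auto
      also have "\<dots> = 2 ^ k * (\<bar>t + \<tau>\<bar> ^ k * norm ((vderiv ^^ n) \<phi> (t + \<tau>)) + \<bar>t\<bar> ^ k * (\<bar>t + \<tau>\<bar> ^ 0 * norm ((vderiv ^^ n) \<phi> (t + \<tau>))))"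
        by (simp add: algebra_simps)
      also have "\<dots> \<le> 2 ^ k * (B + \<bar>t\<bar> ^ k * B)"
        using B unfolding full_bounded_def by (intro mult_left_mono add_mono) (auto simp del: power_0)
      finally show ?thesis .
    qed
    then show ?thesis by blast
  qed
  from schwartzI[OF derivs_translate[OF schwartz_derivs[OF assms]] this] show ?thesis by simp
qed

lemma schwartz_vderiv: "\<phi> \<in> schwartz \<Longrightarrow> (vderiv ^^ n) \<phi> \<in> schwartz"
  using schwartzI[of "\<lambda>m. (vderiv ^^ (m + n)) \<phi>"] derivs_shift[OF schwartz_derivs, of \<phi> n]
  by (simp add: schwartz_iff)

lemma vderiv_vderiv: "(vderiv ^^ n) ((vderiv ^^ m) \<phi>) = (vderiv ^^ (n + m)) \<phi>"
  by (simp add: funpow_add)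

text \<open>The first-order remainder of \<phi>(y + \<tau>) in y is O((y - t)^2) in every seminorm
  in \<tau> up to order N, at the expense of two more derivatives of \<phi>; then T is
  applied.\<close>

lemma tempered_translate_derivative:
  assumes T: "T \<in> tempered" and \<phi>: "\<phi> \<in> schwartz"
  shows "((\<lambda>t. T (\<lambda>\<tau>. \<phi> (t + \<tau>))) has_vector_derivative T (\<lambda>\<tau>. (vderiv ^^ 1) \<phi> (t + \<tau>))) (at t)"
proof -
  obtain C N where C: "C \<ge> 0" "\<And>\<phi> B. \<phi> \<in> schwartz \<Longrightarrow> full_bounded N \<phi> B \<Longrightarrow> norm (T \<phi>) \<le> C * B"
    using tempered_bound[OF T] by blast
  obtain B where B: "full_bounded (N + 2) \<phi> B"
    using schwartz_bounds[OF \<phi>] by blast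
  note B0 = full_bounded_nonneg[OF B]
  \<comment> \<open>For |y - t| \<le> 1 each z between t + \<tau> and y + \<tau> satisfies |\<tau>|
    \<le> |z| + a, which turns a weight in \<tau> into one in z.\<close>
  define a where "a = \<bar>t\<bar> + 1"
  have a: "a \<ge> 1" by (simp add: a_def)
  define K where "K = 2 ^ N * (B + a ^ N * B)"
  note dphi = schwartz_derivs[OF \<phi>]
  have sch: "(\<lambda>\<tau>. \<phi> (y + \<tau>)) \<in> schwartz" "(\<lambda>\<tau>. (vderiv ^^ 1) \<phi> (y + \<tau>)) \<in> schwartz" for y
    by (rule schwartz_translate[OF \<phi>], rule schwartz_translate[OF schwartz_vderiv[OF \<phi>]])
  have main: "norm (T (\<lambda>\<tau>. \<phi> (y + \<tau>)) - T (\<lambda>\<tau>. \<phi> (t + \<tau>)) - (y - t) *\<^sub>R T (\<lambda>\<tau>. (vderiv ^^ 1) \<phi> (t + \<tau>))) \<le> (C * K) * (y - t)^2"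
    if y: "\<bar>y - t\<bar> \<le> 1" for y
  proof -
    define \<psi> where "\<psi> n \<tau> = ((vderiv ^^ n) \<phi> (y + \<tau>) - (vderiv ^^ n) \<phi> (t + \<tau>)) - of_real (y - t) * (vderiv ^^ Suc n) \<phi> (t + \<tau>)" for n \<tau>
    have d\<psi>: "derivs \<psi>"
      unfolding \<psi>_def
      by (rule derivs_diff[OF derivs_diff[OF derivs_translate[OF dphi] derivs_translate[OF dphi]] derivs_cmult[OF derivs_translate[OF derivs_Suc[OF dphi]]]])
    have T\<psi>: "T (\<psi> 0) = T (\<lambda>\<tau>. \<phi> (y + \<tau>)) - T (\<lambda>\<tau>. \<phi> (t + \<tau>)) - (y - t) *\<^sub>R T (\<lambda>\<tau>. (vderiv ^^ 1) \<phi> (t + \<tau>))"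
      using tempered_diff[OF T schwartz_diff[OF sch(1) sch(1)] schwartz_cmult[OF sch(2)], of y t "of_real (y - t)" t]
      by (simp add: \<psi>_def[abs_def] tempered_diff[OF T sch(1) sch(1)] tempered_cmult[OF T sch(2)[unfolded One_nat_def funpow.simps o_id]] tempered_cmult[OF T sch(2)] scaleR_conv_of_real)
    have \<psi>s: "\<psi> 0 \<in> schwartz"
      using schwartz_diff[OF schwartz_diff[OF sch(1) sch(1)] schwartz_cmult[OF sch(2)], of y t "of_real (y - t)" t]
      by (simp add: \<psi>_def[abs_def])
    have "\<bar>\<tau>\<bar> ^ k * norm (\<psi> n \<tau>) \<le> K * (y - t)^2" if "k \<le> N" "n \<le> N" for k n \<tau>
    proof (cases "\<tau> = 0 \<and> k > 0")
      \<comment> \<open>Here the weight is 0; in all other cases it is positive and can be divided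
        out.\<close>
      case True
      then show ?thesis using B0 a by (simp add: K_def zero_power)
    next
      case False
      then have p: "\<bar>\<tau>\<bar> ^ k > 0" by auto
      have "norm ((vderiv ^^ n) \<phi> (y + \<tau>) - (vderiv ^^ n) \<phi> (t + \<tau>) - ((y + \<tau>) - (t + \<tau>)) *\<^sub>R (vderiv ^^ Suc n) \<phi> (t + \<tau>))
         \<le> (K / \<bar>\<tau>\<bar> ^ k) * ((y + \<tau>) - (t + \<tau>))^2"
      proof (rule quadratic_remainder[of UNIV _ _ _ _ "(vderiv ^^ Suc (Suc n)) \<phi>"])
        fix z assume z: "z \<in> closed_segment (t + \<tau>) (y + \<tau>)"
        have "\<bar>\<tau>\<bar> \<le> \<bar>z\<bar> + a"
          using z y unfolding a_def by (auto simp: closed_segment_eq_real_ivl split: if_splits)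
        then have "\<bar>\<tau>\<bar> ^ k * norm ((vderiv ^^ Suc (Suc n)) \<phi> z) \<le> (\<bar>z\<bar> + a) ^ k * norm ((vderiv ^^ Suc (Suc n)) \<phi> z)"
          by (intro mult_right_mono power_mono) auto
        also have "\<dots> \<le> (2 ^ k * (\<bar>z\<bar> ^ k + a ^ k)) * norm ((vderiv ^^ Suc (Suc n)) \<phi> z)"
          using a by (intro mult_right_mono power_sum_le) auto
        also have "\<dots> = 2 ^ k * (\<bar>z\<bar> ^ k * norm ((vderiv ^^ Suc (Suc n)) \<phi> z) + a ^ k * (\<bar>z\<bar> ^ 0 * norm ((vderiv ^^ Suc (Suc n)) \<phi> z)))"
          by (simp add: algebra_simps)
        also have "\<dots> \<le> 2 ^ k * (B + a ^ k * B)"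
          using B that a unfolding full_bounded_def by (intro mult_left_mono add_mono) (auto simp del: power_0 funpow.simps)
        also have "\<dots> \<le> K"
          unfolding K_def using that a B0
          by (intro mult_mono power_increasing add_mono mult_right_mono) auto
        finally show "norm ((vderiv ^^ Suc (Suc n)) \<phi> z) \<le> K / \<bar>\<tau>\<bar> ^ k"
          using p by (simp add: field_simps)
      qed (use derivsD[OF dphi] in \<open>auto simp del: funpow.simps\<close>)
      then show ?thesis
        using p by (simp add: \<psi>_def scaleR_conv_of_real field_simps del: funpow.simps)
    qed
    then have "full_bounded N (\<psi> 0) (K * (y - t)^2)"
      unfolding full_bounded_def derivs_vderiv[OF d\<psi>] by blast
    from C(2)[OF \<psi>s this] show ?thesis
      unfolding T\<psi> by (simp add: mult.assoc)
  qed
  show ?thesis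
    by (rule has_vector_derivative_quadraticI[where K = "C * K"]) (rule main)
qed

lemma derivs_tempered_translate:
  assumes T: "T \<in> tempered" and \<phi>: "\<phi> \<in> schwartz"
  shows "derivs (\<lambda>n t. T (\<lambda>\<tau>. (vderiv ^^ n) \<phi> (t + \<tau>)))"
  unfolding derivs_def
  using tempered_translate_derivative[OF T schwartz_vderiv[OF \<phi>]] by (simp add: funpow_swap1)

lemma vderiv_tempered_translate:
  assumes "T \<in> tempered" and "\<phi> \<in> schwartz"
  shows "(vderiv ^^ n) (\<lambda>t. T (\<lambda>\<tau>. \<phi> (t + \<tau>))) = (\<lambda>t. T (\<lambda>\<tau>. (vderiv ^^ n) \<phi> (t + \<tau>)))"
  using derivs_vderiv[OF derivs_tempered_translate[OF assms], of n] by simp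

text \<open>For t and \<tau> both at least -1, each of |t| and |\<tau>| is at most |t + \<tau>| + 1,
  so the decay of \<phi> in t + \<tau> controls both weights. This makes the convolution of two
  half-line distributions well defined.\<close>

lemma pos_bounded_translate:
  assumes T: "T \<in> tempered_pos"
  shows "\<exists>K\<ge>0. \<exists>N. \<forall>\<phi>\<in>schwartz. \<forall>B. full_bounded N \<phi> B \<longrightarrow> pos_bounded M (\<lambda>t. T (\<lambda>\<tau>. \<phi> (t + \<tau>))) (K * B)"
proof -
  obtain C N where C: "C \<ge> 0" "\<And>f B. f \<in> pos_schwartz \<Longrightarrow> pos_bounded N f B \<Longrightarrow> norm (pos_apply T f) \<le> C * B"
    using pos_apply_bound[OF T] by blast
  have "pos_bounded M (\<lambda>t. T (\<lambda>\<tau>. \<phi> (t + \<tau>))) ((C * (2 ^ (M + N) * 2)) * B)"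
    if \<phi>: "\<phi> \<in> schwartz" and B: "full_bounded (M + N) \<phi> B" for \<phi> B
    unfolding pos_bounded_def vderiv_tempered_translate[OF tempered_pos_imp[OF T] \<phi>]
  proof (intro allI impI)
    fix m n t assume mn: "m \<le> M" "n \<le> M" and t: "(-1::real) \<le> t"
    note B0 = full_bounded_nonneg[OF B]
    define f where "f \<tau> = (vderiv ^^ n) \<phi> (t + \<tau>)" for \<tau>
    have f: "f \<in> schwartz"
      unfolding f_def by (rule schwartz_translate[OF schwartz_vderiv[OF \<phi>]])
    have Df: "(vderiv ^^ j) f = (\<lambda>\<tau>. (vderiv ^^ (j + n)) \<phi> (t + \<tau>))" for j
      unfolding f_def vderiv_translate[OF schwartz_derivs[OF schwartz_vderiv[OF \<phi>]]] vderiv_vderiv ..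
    \<comment> \<open>The weight |t|^m is carried inside T as a scalar factor of the test function,
      so that one seminorm estimate covers both variables.\<close>
    have "pos_bounded N (\<lambda>\<tau>. of_real (\<bar>t\<bar> ^ m) * f \<tau>) (2 ^ (M + N) * 2 * B)"
      unfolding pos_bounded_def vderiv_cmult[OF schwartz_imp_pos[OF f]] Df
    proof (intro allI impI)
      fix k j \<tau> assume kj: "k \<le> N" "j \<le> N" and \<tau>: "(-1::real) \<le> \<tau>"
      let ?v = "\<bar>t + \<tau>\<bar>" and ?d = "norm ((vderiv ^^ (j + n)) \<phi> (t + \<tau>))"
      have v: "\<bar>t\<bar> \<le> ?v + 1" "\<bar>\<tau>\<bar> \<le> ?v + 1" using t \<tau> by auto
      have "\<bar>\<tau>\<bar> ^ k * norm (of_real (\<bar>t\<bar> ^ m) * (vderiv ^^ (j + n)) \<phi> (t + \<tau>)) = (\<bar>t\<bar> ^ m * \<bar>\<tau>\<bar> ^ k) * ?d"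
        by (simp add: norm_mult norm_power)
      also have "\<dots> \<le> ((?v + 1) ^ m * (?v + 1) ^ k) * ?d"
        using v by (intro mult_right_mono mult_mono power_mono) auto
      also have "\<dots> \<le> (2 ^ (m + k) * (?v ^ (m + k) + 1 ^ (m + k))) * ?d"
        unfolding power_add[symmetric] by (intro mult_right_mono power_sum_le) auto
      also have "\<dots> = 2 ^ (m + k) * (?v ^ (m + k) * ?d + ?v ^ 0 * ?d)"
        by (simp add: algebra_simps)
      also have "\<dots> \<le> 2 ^ (m + k) * (B + B)"
        using B kj mn unfolding full_bounded_def by (intro mult_left_mono add_mono) (auto simp del: power_0)
      also have "\<dots> \<le> 2 ^ (M + N) * (B + B)"
        using B0 kj mn by (intro mult_right_mono power_increasing) auto
      finally show "\<bar>\<tau>\<bar> ^ k * norm (of_real (\<bar>t\<bar> ^ m) * (vderiv ^^ (j + n)) \<phi> (t + \<tau>)) \<le> 2 ^ (M + N) * 2 * B"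
        by simp
    qed
    from C(2)[OF pos_schwartz_cmult[OF schwartz_imp_pos[OF f]] this]
    have "norm (of_real (\<bar>t\<bar> ^ m) * T f) \<le> C * (2 ^ (M + N) * 2 * B)"
      by (simp only: pos_apply_cmult[OF T schwartz_imp_pos[OF f]] pos_apply_schwartz[OF T f])
    then show "\<bar>t\<bar> ^ m * norm (T (\<lambda>\<tau>. (vderiv ^^ n) \<phi> (t + \<tau>))) \<le> C * (2 ^ (M + N) * 2) * B"
      by (simp add: f_def[abs_def] norm_mult norm_power mult.assoc)
  qed
  then show ?thesis
    using C(1) by (intro exI[of _ "C * (2 ^ (M + N) * 2)"] conjI exI[of _ "M + N"]) auto
qed

lemma pos_schwartz_translate:
  assumes T: "T \<in> tempered_pos" and \<phi>: "\<phi> \<in> schwartz"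
  shows "(\<lambda>t. T (\<lambda>\<tau>. \<phi> (t + \<tau>))) \<in> pos_schwartz"
proof -
  have "\<exists>B. \<forall>t\<ge>-1. \<bar>t\<bar> ^ k * norm (T (\<lambda>\<tau>. (vderiv ^^ n) \<phi> (t + \<tau>))) \<le> B" for k n
  proof -
    obtain K N where K: "\<And>B. full_bounded N \<phi> B \<Longrightarrow> pos_bounded (max k n) (\<lambda>t. T (\<lambda>\<tau>. \<phi> (t + \<tau>))) (K * B)"
      using pos_bounded_translate[OF T, of "max k n"] \<phi> by blast
    obtain B where B: "full_bounded N \<phi> B" using schwartz_bounds[OF \<phi>] by blast
    show ?thesis
      using K[OF B] unfolding pos_bounded_def vderiv_tempered_translate[OF tempered_pos_imp[OF T] \<phi>]
      by (intro exI[of _ "K * B"]) auto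
  qed
  from pos_schwartzI[OF derivs_tempered_translate[OF tempered_pos_imp[OF T] \<phi>] this] show ?thesis by simp
qed

lemma conv_apply: "\<phi> \<in> schwartz \<Longrightarrow> (S *\<^sub>t T) \<phi> = pos_apply S (\<lambda>t. T (\<lambda>\<tau>. \<phi> (t + \<tau>)))"
  by (simp add: conv_def)

text \<open>Boundedness is the composition of the estimate for S with that for translates under T.
  For the support, the gap \<epsilon> is shared between the two variables, \<epsilon> / 2 for
  each.\<close>

lemma conv_tempered_pos:
  assumes S: "S \<in> tempered_pos" and T: "T \<in> tempered_pos"
  shows "S *\<^sub>t T \<in> tempered_pos"
proof -
  obtain C M where C: "C \<ge> 0" "\<And>f B. f \<in> pos_schwartz \<Longrightarrow> pos_bounded M f B \<Longrightarrow> norm (pos_apply S f) \<le> C * B"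
    using pos_apply_bound[OF S] by blast
  obtain K N where K: "K \<ge> 0" "\<And>\<phi> B. \<phi> \<in> schwartz \<Longrightarrow> full_bounded N \<phi> B \<Longrightarrow> pos_bounded M (\<lambda>t. T (\<lambda>\<tau>. \<phi> (t + \<tau>))) (K * B)"
    using pos_bounded_translate[OF T, of M] by blast
  note Tt = tempered_pos_imp[OF T] and ps = pos_schwartz_translate[OF T]
  show ?thesis
  proof (rule tempered_posI[where C = "C * K" and N = N])
    show "S *\<^sub>t T \<in> extensional schwartz" by (simp add: conv_def)
    fix \<phi> assume \<phi>: "\<phi> \<in> schwartz"
    show "(S *\<^sub>t T) (\<lambda>t. \<phi> t + \<psi> t) = (S *\<^sub>t T) \<phi> + (S *\<^sub>t T) \<psi>" if \<psi>: "\<psi> \<in> schwartz" for \<psi>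
      by (simp add: conv_apply \<phi> \<psi> schwartz_add tempered_add[OF Tt] schwartz_translate pos_apply_add[OF S] ps)
    show "(S *\<^sub>t T) (\<lambda>t. c * \<phi> t) = c * (S *\<^sub>t T) \<phi>" for c
      by (simp add: conv_apply \<phi> schwartz_cmult tempered_cmult[OF Tt] schwartz_translate pos_apply_cmult[OF S] ps)
    show "norm ((S *\<^sub>t T) \<phi>) \<le> C * K * B" if "full_bounded N \<phi> B" for B
      using C(2)[OF ps[OF \<phi>] K(2)[OF \<phi> that]] by (simp add: conv_apply \<phi> mult.assoc)
    show "(S *\<^sub>t T) \<phi> = 0" if e: "0 < \<epsilon>" and z: "\<And>t. t > -\<epsilon> \<Longrightarrow> \<phi> t = 0" for \<epsilon>
    proof -
      have zs: "(\<lambda>\<tau>. 0) \<in> schwartz" using schwartz_cmult[OF \<phi>, of 0] by simp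
      have "T (\<lambda>\<tau>. \<phi> (t + \<tau>)) = 0" if "t > - (\<epsilon> / 2)" for t
      proof -
        have "T (\<lambda>\<tau>. \<phi> (t + \<tau>)) = T (\<lambda>\<tau>. 0)"
          by (rule tempered_pos_local[OF T schwartz_translate[OF \<phi>] zs, of "\<epsilon> / 2"]) (use e that in \<open>auto intro!: z\<close>)
        also have "\<dots> = 0"
          using tempered_cmult[OF Tt \<phi>, of 0] by simp
        finally show ?thesis .
      qed
      then have "pos_apply S (\<lambda>t. T (\<lambda>\<tau>. \<phi> (t + \<tau>))) = pos_apply S (\<lambda>t. 0)"
        using e by (intro pos_apply_cong[OF S ps[OF \<phi>], of "\<epsilon> / 2"]) auto
      then show ?thesis by (simp add: conv_apply \<phi> pos_apply_0 S)
    qed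
  qed (use C(1) K(1) in auto)
qed

text \<open>exp(-s (t + \<tau>)) factorizes, and the cutoff that makes it a test function is
  invisible: t, \<tau> > -1/4 gives t + \<tau> > -1/2, where the cutoff is 1.\<close>

lemma laplace_conv:
  assumes S: "S \<in> tempered_pos" and T: "T \<in> tempered_pos" and s: "Re s > 0"
  shows "laplace (S *\<^sub>t T) s = laplace S s * laplace T s"
proof -
  let ?e = "\<lambda>t::real. exp (- s * of_real t)"
  note ex = pos_schwartz_exp[OF s]
  define \<psi> where "\<psi> t = cutoff 0 t * ?e t" for t
  have \<psi>: "\<psi> \<in> schwartz" unfolding \<psi>_def by (rule extend_schwartz[OF ex])
  have \<psi>e: "\<psi> t = ?e t" if "t > -1/2" for t using that by (simp add: \<psi>_def cutoff_eq_1)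
  have T\<psi>: "T (\<lambda>\<tau>. \<psi> (t + \<tau>)) = laplace T s * ?e t" if t: "t > -1/4" for t
  proof -
    have "pos_apply T (\<lambda>\<tau>. ?e t * ?e \<tau>) = T (\<lambda>\<tau>. \<psi> (t + \<tau>))"
      by (rule pos_apply_eq[OF T schwartz_translate[OF \<psi>], of "1/4"])
        (use t in \<open>auto simp: \<psi>e exp_add[symmetric] algebra_simps\<close>)
    then show ?thesis
      using pos_apply_cmult[OF T ex, of "?e t"] by (simp add: laplace_eq[OF T s])
  qed
  have "laplace (S *\<^sub>t T) s = (S *\<^sub>t T) \<psi>"
    unfolding laplace_eq[OF conv_tempered_pos[OF S T] s] \<psi>_def
    by (rule pos_apply_extend[OF conv_tempered_pos[OF S T] ex])
  also have "\<dots> = pos_apply S (\<lambda>t. T (\<lambda>\<tau>. \<psi> (t + \<tau>)))"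
    by (rule conv_apply[OF \<psi>])
  also have "\<dots> = pos_apply S (\<lambda>t. laplace T s * ?e t)"
    by (rule pos_apply_cong[OF S pos_schwartz_translate[OF T \<psi>], of "1/4"]) (simp_all add: T\<psi>)
  also have "\<dots> = laplace T s * laplace S s"
    by (simp only: pos_apply_cmult[OF S ex] laplace_eq[OF S s])
  finally show ?thesis by simp
qed

text \<open>Both sides have the same transform; uniqueness takes the place of a Fubini theorem for
  distributions.\<close>

lemma conv_commute:
  assumes "S \<in> tempered_pos" "T \<in> tempered_pos"
  shows "S *\<^sub>t T = T *\<^sub>t S"
  by (rule laplace_unique) (auto simp: conv_tempered_pos laplace_conv assms)

section \<open>The derivative, the Dirac and the zero distribution under the transform\<close>

lemma ddt_apply: "\<phi> \<in> schwartz \<Longrightarrow> ddt T \<phi> = - T (vderiv \<phi>)"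
  by (simp add: ddt_def)

lemma schwartz_vderiv1: "\<phi> \<in> schwartz \<Longrightarrow> vderiv \<phi> \<in> schwartz"
  using schwartz_vderiv[of \<phi> 1] by simp

lemma full_bounded_vderiv: "full_bounded (Suc N) \<phi> B \<Longrightarrow> full_bounded N (vderiv \<phi>) B"
  unfolding full_bounded_def
proof (intro allI impI)
  fix k n t assume *: "\<forall>k\<le>Suc N. \<forall>n\<le>Suc N. \<forall>t. \<bar>t\<bar> ^ k * norm ((vderiv ^^ n) \<phi> t) \<le> B" "k \<le> N" "n \<le> N"
  have "\<bar>t\<bar> ^ k * norm ((vderiv ^^ Suc n) \<phi> t) \<le> B"
    using *(1)[rule_format, of k "Suc n" t] *(2,3) by simp
  then show "\<bar>t\<bar> ^ k * norm ((vderiv ^^ n) (vderiv \<phi>) t) \<le> B"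
    by (simp add: funpow_swap1)
qed

lemma ddt_tempered_pos:
  assumes T: "T \<in> tempered_pos" shows "ddt T \<in> tempered_pos"
proof -
  obtain C N where C: "C \<ge> 0" "\<And>\<phi> B. \<phi> \<in> schwartz \<Longrightarrow> full_bounded N \<phi> B \<Longrightarrow> norm (T \<phi>) \<le> C * B"
    using tempered_bound[OF tempered_pos_imp[OF T]] by blast
  show ?thesis
  proof (rule tempered_posI[OF _ _ _ C(1), where N = "Suc N"])
    show "ddt T \<in> extensional schwartz" by (simp add: ddt_def)
    fix \<phi> assume \<phi>: "\<phi> \<in> schwartz"
    note f = schwartz_imp_pos[OF \<phi>]
    show "ddt T (\<lambda>t. \<phi> t + \<psi> t) = ddt T \<phi> + ddt T \<psi>" if \<psi>: "\<psi> \<in> schwartz" for \<psi>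
      using vderiv_add[OF f schwartz_imp_pos[OF \<psi>], of 1]
      by (simp add: ddt_apply \<phi> \<psi> schwartz_add tempered_add[OF tempered_pos_imp[OF T]] schwartz_vderiv1)
    show "ddt T (\<lambda>t. c * \<phi> t) = c * ddt T \<phi>" for c
      using vderiv_cmult[OF f, of 1]
      by (simp add: ddt_apply \<phi> schwartz_cmult tempered_cmult[OF tempered_pos_imp[OF T]] schwartz_vderiv1)
    show "norm (ddt T \<phi>) \<le> C * B" if "full_bounded (Suc N) \<phi> B" for B
      using C(2)[OF schwartz_vderiv1[OF \<phi>] full_bounded_vderiv[OF that]] by (simp add: ddt_apply \<phi>)
    show "ddt T \<phi> = 0" if e: "0 < \<epsilon>" and z: "\<And>t. t > -\<epsilon> \<Longrightarrow> \<phi> t = 0" for \<epsilon>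
    proof -
      have zs: "(\<lambda>\<tau>. 0) \<in> schwartz" using schwartz_cmult[OF \<phi>, of 0] by simp
      have d: "(vderiv ^^ 1) \<phi> t = 0" if "t > -\<epsilon>" for t
        by (rule derivs_zero_open[OF schwartz_derivs[OF \<phi>], of "{-\<epsilon><..}"]) (use z that in auto)
      have "T (vderiv \<phi>) = T (\<lambda>\<tau>. 0)"
        by (rule tempered_pos_local[OF T schwartz_vderiv1[OF \<phi>] zs e]) (use d in auto)
      also have "\<dots> = 0"
        using tempered_cmult[OF tempered_pos_imp[OF T] \<phi>, of 0] by simp
      finally show ?thesis by (simp add: ddt_apply \<phi>)
    qed
  qed
qed

text \<open>The factor -s from differentiating the exponential cancels the sign of the transpose. No
  term at t = 0 appears, because the derivative is taken on the whole line.\<close>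

lemma laplace_ddt:
  assumes T: "T \<in> tempered_pos" and s: "Re s > 0"
  shows "laplace (ddt T) s = s * laplace T s"
proof -
  let ?e = "\<lambda>t::real. exp (- s * of_real t)"
  note ex = pos_schwartz_exp[OF s]
  define \<psi> where "\<psi> t = cutoff 0 t * ?e t" for t
  have \<psi>: "\<psi> \<in> schwartz" unfolding \<psi>_def by (rule extend_schwartz[OF ex])
  have d: "vderiv \<psi> t = - s * ?e t" if "t > -1/2" for t
  proof -
    have "(vderiv ^^ 1) \<psi> t = (- s) ^ 1 * ?e t"
      by (rule derivs_eq_open[OF schwartz_derivs[OF \<psi>] derivs_exp, of "{-1/2<..}"])
        (use that in \<open>auto simp: \<psi>_def cutoff_eq_1\<close>)
    then show ?thesis by simp
  qed
  have "laplace (ddt T) s = ddt T \<psi>"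
    unfolding laplace_eq[OF ddt_tempered_pos[OF T] s] \<psi>_def
    by (rule pos_apply_extend[OF ddt_tempered_pos[OF T] ex])
  also have "\<dots> = - T (vderiv \<psi>)" by (rule ddt_apply[OF \<psi>])
  also have "T (vderiv \<psi>) = pos_apply T (\<lambda>t. - s * ?e t)"
    by (rule pos_apply_eq[OF T schwartz_vderiv1[OF \<psi>], of "1/2", symmetric]) (use d in auto)
  also have "\<dots> = - s * laplace T s"
    by (simp only: pos_apply_cmult[OF T ex] laplace_eq[OF T s])
  finally show ?thesis by simp
qed

lemma laplace_extend:
  assumes "T \<in> tempered_pos" "Re s > 0"
  shows "laplace T s = T (\<lambda>t. cutoff 0 t * exp (- s * of_real t))"
  unfolding laplace_eq[OF assms] by (rule pos_apply_extend[OF assms(1) pos_schwartz_exp[OF assms(2)]])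

lemma has_laplace_dirac: "has_laplace dirac (\<lambda>s. 1)"
proof -
  have T: "dirac \<in> tempered_pos"
  proof (rule tempered_posI[where C = 1 and N = 0])
    show "dirac \<in> extensional schwartz" by (simp add: dirac_def)
    fix \<phi> assume \<phi>: "\<phi> \<in> schwartz"
    show "dirac (\<lambda>t. \<phi> t + \<psi> t) = dirac \<phi> + dirac \<psi>" if "\<psi> \<in> schwartz" for \<psi>
      using that \<phi> by (simp add: dirac_def schwartz_add)
    show "dirac (\<lambda>t. c * \<phi> t) = c * dirac \<phi>" for c
      using \<phi> by (simp add: dirac_def schwartz_cmult)
    show "norm (dirac \<phi>) \<le> 1 * B" if "full_bounded 0 \<phi> B" for B
      using \<phi> that by (simp add: dirac_def full_bounded_def)
    show "dirac \<phi> = 0" if "0 < \<epsilon>" "\<And>t. t > -\<epsilon> \<Longrightarrow> \<phi> t = 0" for \<epsilon>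
      using \<phi> that by (simp add: dirac_def)
  qed simp
  moreover have "laplace dirac s = 1" if "Re s > 0" for s
    unfolding laplace_extend[OF T that] using extend_schwartz[OF pos_schwartz_exp[OF that]]
    by (simp add: dirac_def cutoff_eq_1)
  ultimately show ?thesis by (simp add: has_laplace_def)
qed

lemma has_laplace_zero: "has_laplace zero_distr (\<lambda>s. 0)"
proof -
  have T: "zero_distr \<in> tempered_pos"
    by (rule tempered_posI[where C = 0 and N = 0]) (auto simp: zero_distr_def schwartz_add schwartz_cmult)
  moreover have "laplace zero_distr s = 0" if "Re s > 0" for s
    unfolding laplace_extend[OF T that] using extend_schwartz[OF pos_schwartz_exp[OF that]]
    by (simp add: zero_distr_def)
  ultimately show ?thesis by (simp add: has_laplace_def)
qed

subsection \<open>Laplace inversion in the half-plane\<close>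

text \<open>Continuity up to the imaginary axis is included because the contour will lie on it,
  while fractional powers are not holomorphic at 0.\<close>

definition hp_holo :: "(complex \<Rightarrow> complex) \<Rightarrow> bool" where
  "hp_holo f \<longleftrightarrow> continuous_on {z. 0 \<le> Re z} f \<and> f holomorphic_on {z. 0 < Re z}"

lemma hp_holo_mult: "hp_holo f \<Longrightarrow> hp_holo g \<Longrightarrow> hp_holo (\<lambda>z. f z * g z)"
  by (auto simp: hp_holo_def intro!: continuous_intros holomorphic_intros)

lemma hp_holoI_entire: "f holomorphic_on UNIV \<Longrightarrow> hp_holo f"
  unfolding hp_holo_def by (meson holomorphic_on_imp_continuous_on holomorphic_on_subset subset_UNIV)

lemma hp_holo_line_continuous: "hp_holo f \<Longrightarrow> 0 \<le> x \<Longrightarrow> continuous_on A (\<lambda>y. f (Complex x y))"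
  unfolding hp_holo_def
  by (rule continuous_on_compose2[of "{z. 0 \<le> Re z}" f]) (auto intro!: continuous_intros simp: Complex_eq)

lemma integrable_inverse_1_plus_square': "integrable lborel (\<lambda>y::real. inverse (1 + y\<^sup>2))"
  using integrable_inverse_1_plus_square by (simp add: set_integrable_def)

lemma integrable_of_bound:
  fixes f :: "real \<Rightarrow> complex"
  assumes "f \<in> borel_measurable borel" "\<And>y. norm (f y) * (1 + y\<^sup>2) \<le> C"
  shows "integrable lborel f"
proof (rule Bochner_Integration.integrable_bound[OF integrable_mult_right[OF integrable_inverse_1_plus_square', of C]])
  show "f \<in> borel_measurable lborel" using assms(1) by simp
  have "norm (f y) \<le> norm (C * inverse (1 + y\<^sup>2))" for y
  proof -
    have p: "1 + y\<^sup>2 > 0" by (simp add: add_pos_nonneg)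
    have "norm (f y) \<le> C * inverse (1 + y\<^sup>2)"
      using assms(2)[of y] p by (simp add: field_simps)
    then show ?thesis by (simp add: order_trans[OF _ abs_ge_self])
  qed
  then show "AE y in lborel. norm (f y) \<le> norm (C * inverse (1 + y\<^sup>2))" by simp
qed

lemma norm_LINT_le:
  fixes f :: "real \<Rightarrow> complex"
  assumes "integrable lborel f" "integrable lborel g" "\<And>x. norm (f x) \<le> g x"
  shows "norm (\<integral>x. f x \<partial>lborel) \<le> (\<integral>x. g x \<partial>lborel)"
  by (rule order_trans[OF integral_norm_bound integral_mono]) (auto intro: assms integrable_norm)

text \<open>Links the gauge integrals over segments, which arise from contour integrals, with
  Lebesgue integrals over whole lines.\<close>

lemma integral_truncate_tendsto:
  fixes f :: "real \<Rightarrow> complex"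
  assumes f: "integrable lborel f"
  shows "(\<lambda>n. integral {- real n..real n} f) \<longlonglongrightarrow> (\<integral>y. f y \<partial>lborel)"
proof -
  have si: "set_integrable lborel {- real n..real n} f" for n
    unfolding set_integrable_def using f by (intro integrable_mult_indicator) auto
  have eq: "integral {- real n..real n} f = (\<integral>y. indicator {- real n..real n} y *\<^sub>R f y \<partial>lborel)" for n
    using set_borel_integral_eq_integral(2)[OF si] by (simp add: set_lebesgue_integral_def)
  show ?thesis
    unfolding eq
  proof (rule integral_dominated_convergence[where w = "\<lambda>y. norm (f y)"])
    show "AE y in lborel. (\<lambda>n. indicator {- real n..real n} y *\<^sub>R f y) \<longlonglongrightarrow> f y"
    proof (rule AE_I2)
      fix y :: real
      obtain N :: nat where N: "\<bar>y\<bar> \<le> real N" using real_arch_simple by blast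
      have "\<forall>\<^sub>F n in sequentially. indicator {- real n..real n} y *\<^sub>R f y = f y"
        using eventually_ge_at_top[of N]
      proof eventually_elim
        case (elim n)
        then have "\<bar>y\<bar> \<le> real n" using N by linarith
        then show ?case by (simp add: indicator_def abs_le_iff)
      qed
      then show "(\<lambda>n. indicator {- real n..real n} y *\<^sub>R f y) \<longlonglongrightarrow> f y"
        by (rule tendsto_eventually)
    qed
  qed (use f in \<open>auto simp: indicator_def borel_measurable_integrable intro!: integrable_norm\<close>)
qed

lemma interior_half_plane: "interior {z. 0 \<le> Re z} = {z. 0 < Re z}"
  using interior_halfspace_ge[of "1 :: complex" 0] by (simp add: inner_complex_def)

lemma one_plus_norm_sq: "(1 + norm z)\<^sup>2 \<le> 2 * (1 + (norm z)\<^sup>2)" for z :: complex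
  using zero_le_power2[of "norm z - 1"] by (simp add: power2_eq_square algebra_simps)

text \<open>Cauchy's formula on rectangles with vertical sides on Re z = 0 and Re z = \<sigma>,
  whose height tends to infinity. One order of decay of f and one of 1 / (z - s) make the vertical
  integrals absolutely convergent; the horizontal sides are O(1 / R).\<close>

lemma strip_Cauchy_formula:
  assumes f: "hp_holo f" and s: "0 < Re s" "Re s < \<sigma>"
    and C: "\<And>z. 0 \<le> Re z \<Longrightarrow> Re z \<le> \<sigma> \<Longrightarrow> norm (f z) * (1 + norm z) \<le> C"
  defines "h \<equiv> \<lambda>z. f z / (z - s)"
  shows "integrable lborel (\<lambda>y. h (Complex 0 y))" "integrable lborel (\<lambda>y. h (Complex \<sigma> y))"
    "(\<integral>y. h (Complex \<sigma> y) \<partial>lborel) - (\<integral>y. h (Complex 0 y) \<partial>lborel) = 2 * of_real pi * f s"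
proof -
  have C0: "0 \<le> C"
    using C[of s] s order_trans[OF mult_nonneg_nonneg[OF norm_ge_zero[of "f s"]], of "1 + norm s" C] by auto
  have int: "integrable lborel (\<lambda>y. h (Complex x y))" if x: "0 \<le> x" "x \<le> \<sigma>" "x \<noteq> Re s" for x
  proof (rule integrable_of_bound)
    have "Re (Complex x y - s) \<noteq> 0" for y using x by simp
    then have ne: "Complex x y - s \<noteq> 0" for y by (metis zero_complex.sel(1))
    then have ne': "s \<noteq> Complex x y" for y by force
    have "continuous_on UNIV (\<lambda>y. h (Complex x y))"
      unfolding h_def by (intro continuous_intros hp_holo_line_continuous[OF f] x) (use ne' in \<open>auto intro!: continuous_intros simp: Complex_eq\<close>)
    then show "(\<lambda>y. h (Complex x y)) \<in> borel_measurable borel"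
      by (rule borel_measurable_continuous_onI)
    \<comment> \<open>The distance of the vertical line from the pole; thanks to it |z - s|
      dominates 1 + |z| up to a constant.\<close>
    define \<delta> where "\<delta> = \<bar>x - Re s\<bar>"
    have \<delta>: "\<delta> > 0" using x by (simp add: \<delta>_def)
    fix y
    let ?z = "Complex x y"
    have d: "\<delta> \<le> norm (?z - s)"
      using abs_Re_le_cmod[of "?z - s"] by (simp add: \<delta>_def)
    then have n0: "norm (?z - s) > 0" using \<delta> by linarith
    have "1 + norm ?z \<le> (1 + norm s) + norm (?z - s)"
      using norm_triangle_ineq[of "?z - s" s] by simp
    also have "\<dots> \<le> (1 + norm s) * (norm (?z - s) / \<delta>) + norm (?z - s)"
      using mult_left_mono[of 1 "norm (?z - s) / \<delta>" "1 + norm s"] d \<delta> by simp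
    also have "\<dots> = ((1 + norm s) / \<delta> + 1) * norm (?z - s)"
      by (simp add: distrib_right)
    finally have k: "1 + norm ?z \<le> ((1 + norm s) / \<delta> + 1) * norm (?z - s)" .
    have "y\<^sup>2 \<le> (norm ?z)\<^sup>2"
      by (simp add: cmod_power2)
    then have "1 + y\<^sup>2 \<le> (1 + norm ?z) * (1 + norm ?z)"
      using norm_ge_zero[of ?z] by (simp add: power2_eq_square algebra_simps add_increasing)
    then have "norm (h ?z) * (1 + y\<^sup>2) \<le> norm (h ?z) * ((1 + norm ?z) * (1 + norm ?z))"
      by (intro mult_left_mono) auto
    also have "\<dots> = (norm (f ?z) * (1 + norm ?z)) * ((1 + norm ?z) / norm (?z - s))"
      by (simp add: h_def norm_divide)
    also have "\<dots> \<le> C * ((1 + norm s) / \<delta> + 1)"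
    proof (rule mult_mono)
      show "norm (f ?z) * (1 + norm ?z) \<le> C" using x by (intro C) auto
      show "(1 + norm ?z) / norm (?z - s) \<le> (1 + norm s) / \<delta> + 1"
        using k n0 by (simp add: divide_le_eq)
    qed (use C0 in auto)
    finally show "norm (h ?z) * (1 + y\<^sup>2) \<le> C * ((1 + norm s) / \<delta> + 1)" .
  qed
  show i0: "integrable lborel (\<lambda>y. h (Complex 0 y))" and i1: "integrable lborel (\<lambda>y. h (Complex \<sigma> y))"
    using int[of 0] int[of \<sigma>] s by auto
  \<comment> \<open>From this height on, |z - s| \<ge> 1/2 on the horizontal sides.\<close>
  define N0 where "N0 = nat \<lceil>2 * norm s + 1\<rceil>"
  define E where "E n = (integral {- real n..real n} (\<lambda>y. h (Complex \<sigma> y)) - integral {- real n..real n} (\<lambda>y. h (Complex 0 y)))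
      - 2 * of_real pi * f s" for n
  have Eb: "norm (E n) \<le> 4 * C * \<sigma> / real n" if n: "n \<ge> N0" for n
  proof -
    define R where "R = real n"
    have R: "R \<ge> 2 * norm s + 1"
      using n unfolding N0_def R_def by linarith
    then have R1: "R \<ge> 1" "norm s < R" using norm_ge_zero[of s] by linarith+
    define a1 a2 a3 a4 where "a1 = Complex 0 (- R)" and "a2 = Complex \<sigma> (- R)" and "a3 = Complex \<sigma> R" and "a4 = Complex 0 R"
    note a = a1_def a2_def a3_def a4_def
    have rp: "rectpath a1 a3 = linepath a1 a2 +++ linepath a2 a3 +++ linepath a3 a4 +++ linepath a4 a1"
      by (simp add: rectpath_def Let_def a)
    have ims: "\<bar>Im s\<bar> < R" using abs_Im_le_cmod[of s] R1 by linarith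
    have pi_eq: "path_image (rectpath a1 a3) =
           {z. Re z \<in> {0, \<sigma>} \<and> Im z \<in> {-R..R}} \<union> {z. Im z \<in> {-R, R} \<and> Re z \<in> {0..\<sigma>}}"
      using s R1 by (subst path_image_rectpath) (auto simp: a)
    have sub: "path_image (rectpath a1 a3) \<subseteq> {z. 0 \<le> Re z} - {s}"
      using s ims unfolding pi_eq by auto
    \<comment> \<open>The left side of the rectangle lies on the boundary of the half-plane, where f
      is only continuous; hence the weak form of Cauchy's formula.\<close>
    have main: "(h has_contour_integral (2 * pi * \<i> * winding_number (rectpath a1 a3) s * f s)) (rectpath a1 a3)"
      unfolding h_def
    proof (rule Cauchy_integral_formula_weak[where k = "{}" and S = "{z. 0 \<le> Re z}"])
      show "convex {z. 0 \<le> Re z}" by (rule convex_halfspace_Re_ge)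
      show "continuous_on {z. 0 \<le> Re z} f" using f by (simp add: hp_holo_def)
      show "f field_differentiable at x" if "x \<in> interior {z. 0 \<le> Re z} - {}" for x
        using that f unfolding interior_half_plane hp_holo_def
        by (auto simp: holomorphic_on_open[OF open_halfspace_Re_gt] field_differentiable_def)
      show "s \<in> interior {z. 0 \<le> Re z} - {}" using s by (simp add: interior_half_plane)
    qed (use sub in auto)
    have wn: "winding_number (rectpath a1 a3) s = 1"
      using s ims by (intro winding_number_rectpath) (auto simp: in_box_complex_iff a)
    have hc: "continuous_on (path_image (rectpath a1 a3)) h"
      unfolding h_def
    proof (intro continuous_intros)
      show "continuous_on (path_image (rectpath a1 a3)) f"
        using f sub unfolding hp_holo_def by (meson Diff_subset continuous_on_subset order_trans)
    qed (use sub in auto)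
    have segs: "closed_segment a1 a2 \<subseteq> path_image (rectpath a1 a3)" "closed_segment a2 a3 \<subseteq> path_image (rectpath a1 a3)"
       "closed_segment a3 a4 \<subseteq> path_image (rectpath a1 a3)" "closed_segment a4 a1 \<subseteq> path_image (rectpath a1 a3)"
      unfolding rp by (auto simp: path_image_join)
    note ci = contour_integrable_continuous_linepath[OF continuous_on_subset[OF hc]]
    have "contour_integral (rectpath a1 a3) h = contour_integral (linepath a1 a2) h + (contour_integral (linepath a2 a3) h
       + (contour_integral (linepath a3 a4) h + contour_integral (linepath a4 a1) h))"
      unfolding rp using segs by (simp add: contour_integral_join ci contour_integrable_joinI)
    then have tot: "contour_integral (linepath a1 a2) h + (contour_integral (linepath a2 a3) h
       + (contour_integral (linepath a3 a4) h + contour_integral (linepath a4 a1) h)) = 2 * pi * \<i> * f s"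
      using contour_integral_unique[OF main] wn by simp
    have v1: "contour_integral (linepath a2 a3) h = \<i> * integral {-R..R} (\<lambda>y. h (Complex \<sigma> y))"
      using R1 by (intro contour_integral_linepath_same_Re) (auto simp: a)
    have v2: "contour_integral (linepath a4 a1) h = - (\<i> * integral {-R..R} (\<lambda>y. h (Complex 0 y)))"
      using contour_integral_linepath_same_Re[of a1 0 a4 "-R" R h] contour_integral_reverse_linepath[of a1 a4 h]
        continuous_on_subset[OF hc] segs(4) R1 by (simp add: a closed_segment_commute)
    have hb: "norm (h z) \<le> 2 * C / R" if z: "\<bar>Im z\<bar> = R" "0 \<le> Re z" "Re z \<le> \<sigma>" for z
    proof -
      have zR: "norm z \<ge> R" using abs_Im_le_cmod[of z] z by simp
      have "norm (z - s) \<ge> norm z - norm s" by (rule norm_triangle_ineq2)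
      then have zs: "norm (z - s) \<ge> 1/2" using zR R norm_ge_zero[of s] by linarith
      have "norm (f z) * R \<le> norm (f z) * (1 + norm z)"
        using zR by (intro mult_left_mono) auto
      also have "\<dots> \<le> C" using z by (intro C) auto
      finally have "norm (f z) \<le> C / R" using R1 by (simp add: field_simps)
      moreover have "norm (f z) / norm (z - s) \<le> norm (f z) / (1/2)"
        using zs by (intro divide_left_mono) auto
      ultimately show ?thesis by (simp add: h_def norm_divide)
    qed
    have B0: "0 \<le> 2 * C / R" using C0 R1 by simp
    have b1: "norm (contour_integral (linepath a1 a2) h) \<le> 2 * C / R * norm (a2 - a1)"
    proof (rule contour_integral_bound_linepath[OF ci[OF segs(1)] B0])
      fix z assume "z \<in> closed_segment a1 a2"
      then show "norm (h z) \<le> 2 * C / R"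
        using s R1 by (intro hb) (auto simp: a closed_segment_same_Im closed_segment_eq_real_ivl)
    qed
    have b2: "norm (contour_integral (linepath a3 a4) h) \<le> 2 * C / R * norm (a4 - a3)"
    proof (rule contour_integral_bound_linepath[OF ci[OF segs(3)] B0])
      fix z assume "z \<in> closed_segment a3 a4"
      then show "norm (h z) \<le> 2 * C / R"
        using s R1 by (intro hb) (auto simp: a closed_segment_same_Im closed_segment_eq_real_ivl)
    qed
    have len: "norm (a2 - a1) = \<sigma>" "norm (a4 - a3) = \<sigma>"
      using s by (auto simp: a cmod_def)
    \<comment> \<open>The vertical sides and the residue are accounted for by \<open>E n\<close>;
      what is left are the two horizontal sides.\<close>
    have "\<i> * E n = - (contour_integral (linepath a1 a2) h + contour_integral (linepath a3 a4) h)"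
      using tot unfolding v1 v2 E_def R_def[symmetric] by (simp add: algebra_simps eq_neg_iff_add_eq_0)
    then have "norm (E n) = norm (contour_integral (linepath a1 a2) h + contour_integral (linepath a3 a4) h)"
      by (metis norm_minus_cancel norm_mult norm_ii mult_1)
    also have "\<dots> \<le> 2 * C / R * \<sigma> + 2 * C / R * \<sigma>"
      using b1 b2 unfolding len by (rule norm_triangle_mono)
    finally show ?thesis by (simp add: R_def)
  qed
  have "E \<longlonglongrightarrow> 0"
  proof (rule Lim_null_comparison)
    show "\<forall>\<^sub>F n in sequentially. norm (E n) \<le> 4 * C * \<sigma> / real n"
      using eventually_ge_at_top[of N0] by eventually_elim (rule Eb)
    show "(\<lambda>n. 4 * C * \<sigma> / real n) \<longlonglongrightarrow> 0"
      by (rule tendsto_divide_0[OF tendsto_const filterlim_at_top_imp_at_infinity[OF filterlim_real_sequentially]])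
  qed
  moreover have "E \<longlonglongrightarrow> ((\<integral>y. h (Complex \<sigma> y) \<partial>lborel) - (\<integral>y. h (Complex 0 y) \<partial>lborel)) - 2 * of_real pi * f s"
    unfolding E_def by (intro tendsto_intros integral_truncate_tendsto i0 i1)
  ultimately show "(\<integral>y. h (Complex \<sigma> y) \<partial>lborel) - (\<integral>y. h (Complex 0 y) \<partial>lborel) = 2 * of_real pi * f s"
    using LIMSEQ_unique by fastforce
qed

definition hp_decay :: "(complex \<Rightarrow> complex) \<Rightarrow> bool" where
  "hp_decay G \<longleftrightarrow> hp_holo G \<and> (\<exists>C. \<forall>z. 0 \<le> Re z \<longrightarrow> norm (G z) * (1 + (norm z)\<^sup>2) \<le> C)"

lemma hp_decay_bound:
  assumes "hp_decay G"
  obtains C where "C \<ge> 0" "\<And>z. 0 \<le> Re z \<Longrightarrow> norm (G z) * (1 + (norm z)\<^sup>2) \<le> C"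
proof -
  obtain C where C: "\<And>z. 0 \<le> Re z \<Longrightarrow> norm (G z) * (1 + (norm z)\<^sup>2) \<le> C"
    using assms unfolding hp_decay_def by blast
  have "0 \<le> norm (G 0) * (1 + (norm (0::complex))\<^sup>2)" by simp
  also have "\<dots> \<le> C" by (rule C) simp
  finally show thesis using that C by blast
qed

lemma norm_Complex_sq_ge: "1 + y\<^sup>2 \<le> 1 + (norm (Complex x y))\<^sup>2"
  by (simp add: cmod_power2)

lemma hp_decay_line_integrable:
  assumes G: "hp_decay G" and x: "0 \<le> x"
  shows "integrable lborel (\<lambda>y. G (Complex x y))"
proof -
  obtain C where C: "\<And>z. 0 \<le> Re z \<Longrightarrow> norm (G z) * (1 + (norm z)\<^sup>2) \<le> C"
    using hp_decay_bound[OF G] by blast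
  show ?thesis
  proof (rule integrable_of_bound)
    show "(\<lambda>y. G (Complex x y)) \<in> borel_measurable borel"
      using G x unfolding hp_decay_def by (intro borel_measurable_continuous_onI hp_holo_line_continuous) auto
    show "norm (G (Complex x y)) * (1 + y\<^sup>2) \<le> C" for y
      using mult_left_mono[OF norm_Complex_sq_ge[of y x] norm_ge_zero[of "G (Complex x y)"]] C[of "Complex x y"] x by simp
  qed
qed

text \<open>The formula for the strip is applied to f(z) = G(z) (z - s) with an auxiliary point s
  inside the strip: f(s) = 0 removes the residue, and f(z) / (z - s) is G(z) on both lines.\<close>

lemma integral_line_shift:
  assumes G: "hp_holo G" and \<sigma>: "0 < \<sigma>"
    and C: "\<And>z. 0 \<le> Re z \<Longrightarrow> Re z \<le> \<sigma> \<Longrightarrow> norm (G z) * (1 + (norm z)\<^sup>2) \<le> C"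
  shows "integrable lborel (\<lambda>y. G (Complex \<sigma> y))"
    "(\<integral>y. G (Complex \<sigma> y) \<partial>lborel) = (\<integral>y. G (Complex 0 y) \<partial>lborel)"
proof -
  define s where "s = complex_of_real (\<sigma> / 2)"
  have s: "0 < Re s" "Re s < \<sigma>" using \<sigma> by (auto simp: s_def)
  define f where "f z = G z * (z - s)" for z
  have f: "hp_holo f"
    unfolding f_def by (intro hp_holo_mult G hp_holoI_entire holomorphic_intros)
  have fb: "norm (f z) * (1 + norm z) \<le> 2 * (1 + norm s) * C" if z: "0 \<le> Re z" "Re z \<le> \<sigma>" for z
  proof -
    have "norm (z - s) \<le> (1 + norm s) * (1 + norm z)"
    proof -
      have "(1 + norm s) * (1 + norm z) = 1 + norm s + norm z + norm s * norm z"
        by (simp add: algebra_simps)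
      moreover have "0 \<le> norm s * norm z" by simp
      ultimately show ?thesis using norm_triangle_ineq4[of z s] by linarith
    qed
    then have "norm (f z) * (1 + norm z) \<le> norm (G z) * ((1 + norm s) * (1 + norm z)) * (1 + norm z)"
      unfolding f_def norm_mult by (intro mult_right_mono mult_left_mono) auto
    also have "\<dots> = (1 + norm s) * (norm (G z) * (1 + norm z)\<^sup>2)"
      by (simp add: power2_eq_square algebra_simps)
    also have "\<dots> \<le> (1 + norm s) * (norm (G z) * (2 * (1 + (norm z)\<^sup>2)))"
      by (intro mult_left_mono one_plus_norm_sq) auto
    also have "\<dots> = 2 * (1 + norm s) * (norm (G z) * (1 + (norm z)\<^sup>2))" by (simp add: algebra_simps)
    also have "\<dots> \<le> 2 * (1 + norm s) * C"
      using C[OF z] by (intro mult_left_mono) auto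
    finally show ?thesis .
  qed
  have eq: "f (Complex x y) / (Complex x y - s) = G (Complex x y)" if "x \<noteq> Re s" for x y
  proof -
    have "Complex x y - s \<noteq> 0" using that by (auto simp: complex_eq_iff)
    then show ?thesis by (simp add: f_def)
  qed
  have eqs: "f (Complex \<sigma> y) / (Complex \<sigma> y - s) = G (Complex \<sigma> y)" "f (Complex 0 y) / (Complex 0 y - s) = G (Complex 0 y)" for y
    using s by (auto intro!: eq)
  note res = strip_Cauchy_formula[OF f s fb, unfolded eqs]
  show "integrable lborel (\<lambda>y. G (Complex \<sigma> y))" by (rule res(2))
  show "(\<integral>y. G (Complex \<sigma> y) \<partial>lborel) = (\<integral>y. G (Complex 0 y) \<partial>lborel)"
    using res(3) by (simp add: f_def)
qed

text \<open>On Re z = \<sigma> the integral is O(1 / (\<sigma> - Re s)), so the right-hand line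
  drops out as \<sigma> tends to infinity.\<close>

lemma hp_decay_Cauchy_formula:
  assumes G: "hp_decay G" and s: "0 < Re s"
  shows "(\<integral>y. G (Complex 0 y) / (s - Complex 0 y) \<partial>lborel) = 2 * of_real pi * G s"
proof -
  obtain C where C0: "C \<ge> 0" and C: "\<And>z. 0 \<le> Re z \<Longrightarrow> norm (G z) * (1 + (norm z)\<^sup>2) \<le> C"
    using hp_decay_bound[OF G] by blast
  have Gh: "hp_holo G" using G by (simp add: hp_decay_def)
  have b: "norm (G z) * (1 + norm z) \<le> 2 * C" if "0 \<le> Re z" for z
  proof -
    have "1 + norm z \<le> 2 * (1 + (norm z)\<^sup>2)"
    proof -
      have "2 * norm z \<le> 1 + (norm z)\<^sup>2"
        using zero_le_power2[of "norm z - 1"] by (simp add: power2_eq_square algebra_simps)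
      then show ?thesis using zero_le_power2[of "norm z"] by (smt (verit))
    qed
    then have "norm (G z) * (1 + norm z) \<le> norm (G z) * (2 * (1 + (norm z)\<^sup>2))"
      by (intro mult_left_mono) auto
    also have "\<dots> = 2 * (norm (G z) * (1 + (norm z)\<^sup>2))" by simp
    also have "\<dots> \<le> 2 * C" using C[OF that] by simp
    finally show ?thesis .
  qed
  define J where "J = (\<integral>y. G (Complex 0 y) / (Complex 0 y - s) \<partial>lborel)"
  define A where "A = C * (\<integral>y. inverse (1 + y\<^sup>2) \<partial>lborel)"
  have A0: "A \<ge> 0" unfolding A_def using C0 by (intro mult_nonneg_nonneg integral_nonneg_AE) auto
  have le: "norm (J + 2 * of_real pi * G s) \<le> A / (\<sigma> - Re s)" if \<sigma>: "\<sigma> > Re s" for \<sigma>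
  proof -
    note res = strip_Cauchy_formula[OF Gh s \<sigma> b]
    have "J + 2 * of_real pi * G s = (\<integral>y. G (Complex \<sigma> y) / (Complex \<sigma> y - s) \<partial>lborel)"
      using res(3) by (simp add: J_def algebra_simps)
    also have "norm \<dots> \<le> (\<integral>y. (C / (\<sigma> - Re s)) * inverse (1 + y\<^sup>2) \<partial>lborel)"
    proof (rule norm_LINT_le)
      show "integrable lborel (\<lambda>y. G (Complex \<sigma> y) / (Complex \<sigma> y - s))" by (rule res(2))
      show "integrable lborel (\<lambda>y. (C / (\<sigma> - Re s)) * inverse (1 + y\<^sup>2))"
        by (intro integrable_mult_right integrable_inverse_1_plus_square')
      fix y :: real
      have p: "1 + y\<^sup>2 > 0" by (simp add: add_pos_nonneg)
      have "norm (G (Complex \<sigma> y)) * (1 + y\<^sup>2) \<le> C"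
        using mult_left_mono[OF norm_Complex_sq_ge[of y \<sigma>] norm_ge_zero[of "G (Complex \<sigma> y)"]] C[of "Complex \<sigma> y"] s \<sigma> by simp
      then have 1: "norm (G (Complex \<sigma> y)) \<le> C * inverse (1 + y\<^sup>2)"
        using p by (simp add: field_simps)
      have 2: "\<sigma> - Re s \<le> norm (Complex \<sigma> y - s)"
        using complex_Re_le_cmod[of "Complex \<sigma> y - s"] by simp
      have "norm (G (Complex \<sigma> y) / (Complex \<sigma> y - s)) \<le> (C * inverse (1 + y\<^sup>2)) / (\<sigma> - Re s)"
        unfolding norm_divide using 1 2 \<sigma> C0 by (intro frac_le) auto
      then show "norm (G (Complex \<sigma> y) / (Complex \<sigma> y - s)) \<le> (C / (\<sigma> - Re s)) * inverse (1 + y\<^sup>2)"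
        by simp
    qed
    also have "\<dots> = A / (\<sigma> - Re s)"
      by (simp add: A_def)
    finally show ?thesis .
  qed
  have "((\<lambda>\<sigma>::real. J + 2 * of_real pi * G s) \<longlongrightarrow> 0) at_top"
  proof (rule Lim_null_comparison)
    show "\<forall>\<^sub>F \<sigma> in at_top. norm (J + 2 * of_real pi * G s) \<le> A / (\<sigma> - Re s)"
      using eventually_gt_at_top[of "Re s"] by eventually_elim (rule le)
    have "filterlim (\<lambda>\<sigma>. - Re s + \<sigma>) at_top at_top"
      by (rule filterlim_tendsto_add_at_top[OF tendsto_const filterlim_ident])
    then show "((\<lambda>\<sigma>. A / (\<sigma> - Re s)) \<longlongrightarrow> 0) at_top"
      by (intro tendsto_divide_0[OF tendsto_const] filterlim_at_top_imp_at_infinity) simp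
  qed
  then have "J + 2 * of_real pi * G s = 0"
    by (simp add: tendsto_const_iff)
  then have "J = - (2 * of_real pi * G s)"
    by (simp add: eq_neg_iff_add_eq_0)
  moreover have "G (Complex 0 y) / (s - Complex 0 y) = - (G (Complex 0 y) / (Complex 0 y - s))" for y
    by (metis minus_diff_eq minus_divide_right)
  then have "(\<integral>y. G (Complex 0 y) / (s - Complex 0 y) \<partial>lborel) = - J"
    by (simp only: J_def integral_minus)
  ultimately show ?thesis by simp
qed

section \<open>Inversion along the imaginary axis\<close>

text \<open>The Bromwich integral with abscissa 0, where |exp(t z)| = 1 and bounds are uniform in
  t.\<close>

definition line_inverse :: "(complex \<Rightarrow> complex) \<Rightarrow> real \<Rightarrow> complex" where
  "line_inverse G t = 1 / (2 * of_real pi) * (\<integral>y. exp (of_real t * Complex 0 y) * G (Complex 0 y) \<partial>lborel)"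

lemma norm_exp_line [simp]: "norm (exp (of_real t * Complex 0 y)) = 1"
  by (simp add: norm_exp_eq_Re)

lemma exp_line_integrable:
  assumes "integrable lborel (\<lambda>y. G (Complex 0 y) :: complex)"
  shows "integrable lborel (\<lambda>y. exp (of_real t * Complex 0 y) * G (Complex 0 y))"
proof (rule Bochner_Integration.integrable_bound[OF assms])
  have [measurable]: "(\<lambda>y. G (Complex 0 y)) \<in> borel_measurable borel"
    using borel_measurable_integrable[OF assms] by simp
  have [measurable]: "(\<lambda>y. exp (of_real t * Complex 0 y)) \<in> borel_measurable borel"
    by (intro borel_measurable_continuous_onI) (auto intro!: continuous_intros simp: Complex_eq)
  show "(\<lambda>y. exp (of_real t * Complex 0 y) * G (Complex 0 y)) \<in> borel_measurable lborel"
    by measurable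
qed (simp add: norm_mult)

lemma norm_line_inverse_le:
  assumes G: "integrable lborel (\<lambda>y. G (Complex 0 y))"
  shows "norm (line_inverse G t) \<le> (\<integral>y. norm (G (Complex 0 y)) \<partial>lborel)"
proof -
  have "norm (\<integral>y. exp (of_real t * Complex 0 y) * G (Complex 0 y) \<partial>lborel) \<le> (\<integral>y. norm (G (Complex 0 y)) \<partial>lborel)"
    by (rule norm_LINT_le) (auto simp: norm_mult intro!: exp_line_integrable integrable_norm G)
  moreover have "0 \<le> (\<integral>y. norm (G (Complex 0 y)) \<partial>lborel)"
    by (rule integral_nonneg_AE) simp
  moreover have "1 / (2 * pi) \<le> 1" using pi_ge_two by (simp add: field_simps)
  ultimately have "(1 / (2 * pi)) * norm (\<integral>y. exp (of_real t * Complex 0 y) * G (Complex 0 y) \<partial>lborel) \<le> 1 * (\<integral>y. norm (G (Complex 0 y)) \<partial>lborel)"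
    by (intro mult_mono) auto
  then show ?thesis
    by (simp add: line_inverse_def norm_mult norm_divide)
qed

lemma continuous_line_inverse:
  assumes G: "integrable lborel (\<lambda>y. G (Complex 0 y))"
  shows "continuous_on A (line_inverse G)"
  unfolding continuous_on_sequentially o_def
proof (intro allI impI ballI)
  fix x a assume "a \<in> A" and *: "(\<forall>n. x n \<in> A) \<and> x \<longlonglongrightarrow> a"
  have "(\<lambda>n. \<integral>y. exp (of_real (x n) * Complex 0 y) * G (Complex 0 y) \<partial>lborel) \<longlonglongrightarrow> (\<integral>y. exp (of_real a * Complex 0 y) * G (Complex 0 y) \<partial>lborel)"
  proof (rule integral_dominated_convergence[where w = "\<lambda>y. norm (G (Complex 0 y))"])
    show "AE y in lborel. (\<lambda>n. exp (of_real (x n) * Complex 0 y) * G (Complex 0 y)) \<longlonglongrightarrow> exp (of_real a * Complex 0 y) * G (Complex 0 y)"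
      using * by (intro AE_I2 tendsto_intros) auto
  qed (use exp_line_integrable[OF G] in \<open>auto simp: norm_mult intro!: integrable_norm G borel_measurable_integrable\<close>)
  then show "(\<lambda>n. line_inverse G (x n)) \<longlonglongrightarrow> line_inverse G a"
    unfolding line_inverse_def by (intro tendsto_intros)
qed

lemma exp_times_decay:
  assumes "norm (G z) * (1 + (norm z)\<^sup>2) \<le> C" "t * Re z \<le> a"
  shows "norm (exp (of_real t * z) * G z) * (1 + (norm z)\<^sup>2) \<le> exp a * C"
proof -
  have "norm (exp (of_real t * z) * G z) * (1 + (norm z)\<^sup>2) = exp (t * Re z) * (norm (G z) * (1 + (norm z)\<^sup>2))"
    by (simp add: norm_mult norm_exp_eq_Re)
  also have "\<dots> \<le> exp a * C"
    using assms by (intro mult_mono) auto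
  finally show ?thesis .
qed

text \<open>The contour moves from Re z = s0 to the imaginary axis, so all choices of s0 > 0 give
  the same function of t.\<close>

lemma bromwich_eq_line_inverse:
  assumes G: "hp_decay G" and s0: "0 < s0"
  shows "integrable lborel (bromwich_integrand s0 G t)" "bromwich s0 G t = line_inverse G t"
proof -
  obtain C where C: "\<And>z. 0 \<le> Re z \<Longrightarrow> norm (G z) * (1 + (norm z)\<^sup>2) \<le> C"
    using hp_decay_bound[OF G] by blast
  have h: "hp_holo (\<lambda>z. exp (of_real t * z) * G z)"
    by (rule hp_holo_mult[OF hp_holoI_entire]) (use G in \<open>auto intro!: holomorphic_intros simp: hp_decay_def\<close>)
  have b: "norm (exp (of_real t * z) * G z) * (1 + (norm z)\<^sup>2) \<le> exp (\<bar>t\<bar> * s0) * C" if "0 \<le> Re z" "Re z \<le> s0" for z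
    using that by (intro exp_times_decay C mult_mono) auto
  note sh = integral_line_shift[OF h s0 b]
  show "integrable lborel (bromwich_integrand s0 G t)"
    unfolding bromwich_integrand_def[abs_def] by (intro integrable_mult_left sh(1))
  show "bromwich s0 G t = line_inverse G t"
    unfolding bromwich_def bromwich_integrand_def line_inverse_def
    by (simp add: sh(2)[symmetric])
qed

text \<open>For t < 0 the contour is pushed to the right, where exp(t \<sigma>) tends to 0.\<close>

lemma line_inverse_negative:
  assumes G: "hp_decay G" and t: "t < 0"
  shows "line_inverse G t = 0"
proof -
  obtain C where C0: "C \<ge> 0" and C: "\<And>z. 0 \<le> Re z \<Longrightarrow> norm (G z) * (1 + (norm z)\<^sup>2) \<le> C"
    using hp_decay_bound[OF G] by blast
  have h: "hp_holo (\<lambda>z. exp (of_real t * z) * G z)"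
    by (rule hp_holo_mult[OF hp_holoI_entire]) (use G in \<open>auto intro!: holomorphic_intros simp: hp_decay_def\<close>)
  define J where "J = (\<integral>y. exp (of_real t * Complex 0 y) * G (Complex 0 y) \<partial>lborel)"
  define A where "A = C * (\<integral>y. inverse (1 + y\<^sup>2) \<partial>lborel)"
  have le: "norm J \<le> exp (t * \<sigma>) * A" if \<sigma>: "\<sigma> > 0" for \<sigma>
  proof -
    have b: "norm (exp (of_real t * z) * G z) * (1 + (norm z)\<^sup>2) \<le> exp 0 * C" if "0 \<le> Re z" "Re z \<le> \<sigma>" for z
      using that t by (intro exp_times_decay C) (auto simp: mult_nonpos_nonneg)
    note sh = integral_line_shift[OF h \<sigma> b]
    have "norm J = norm (\<integral>y. exp (of_real t * Complex \<sigma> y) * G (Complex \<sigma> y) \<partial>lborel)"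
      by (simp add: J_def sh(2))
    also have "\<dots> \<le> (\<integral>y. (exp (t * \<sigma>) * C) * inverse (1 + y\<^sup>2) \<partial>lborel)"
    proof (rule norm_LINT_le)
      show "integrable lborel (\<lambda>y. exp (of_real t * Complex \<sigma> y) * G (Complex \<sigma> y))" by (rule sh(1))
      show "integrable lborel (\<lambda>y. (exp (t * \<sigma>) * C) * inverse (1 + y\<^sup>2))"
        by (intro integrable_mult_right integrable_inverse_1_plus_square')
      fix y :: real
      have p: "1 + y\<^sup>2 > 0" by (simp add: add_pos_nonneg)
      have "norm (G (Complex \<sigma> y)) * (1 + y\<^sup>2) \<le> C"
        using mult_left_mono[OF norm_Complex_sq_ge[of y \<sigma>] norm_ge_zero[of "G (Complex \<sigma> y)"]] C[of "Complex \<sigma> y"] \<sigma> by simp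
      then have "norm (G (Complex \<sigma> y)) \<le> C * inverse (1 + y\<^sup>2)"
        using p by (simp add: field_simps)
      then show "norm (exp (of_real t * Complex \<sigma> y) * G (Complex \<sigma> y)) \<le> (exp (t * \<sigma>) * C) * inverse (1 + y\<^sup>2)"
        by (simp add: norm_mult norm_exp_eq_Re mult.assoc mult_left_mono)
    qed
    also have "\<dots> = exp (t * \<sigma>) * A"
      by (simp add: A_def mult.assoc)
    finally show ?thesis .
  qed
  have "((\<lambda>\<sigma>::real. J) \<longlongrightarrow> 0) at_top"
  proof (rule Lim_null_comparison)
    show "\<forall>\<^sub>F \<sigma> in at_top. norm J \<le> exp (t * \<sigma>) * A"
      using eventually_gt_at_top[of 0] by eventually_elim (rule le)
    have "((\<lambda>\<sigma>. exp (t * \<sigma>)) \<longlongrightarrow> 0) at_top"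
      using t by (intro filterlim_compose[OF exp_at_bot] filterlim_tendsto_neg_mult_at_bot[OF tendsto_const _ filterlim_ident]) auto
    then show "((\<lambda>\<sigma>. exp (t * \<sigma>) * A) \<longlongrightarrow> 0) at_top"
      by (rule tendsto_mult_left_zero)
  qed
  then have "J = 0" by (simp add: tendsto_const_iff)
  then show ?thesis by (simp add: line_inverse_def J_def)
qed

lemma exp_half_line_integral:
  assumes w: "Re w > 0"
  shows "integrable lborel (\<lambda>t. indicator {0<..} t *\<^sub>R exp (- w * of_real t))"
    "(\<integral>t. indicator {0<..} t *\<^sub>R exp (- w * of_real t) \<partial>lborel) = 1 / w"
proof -
  have w0: "w \<noteq> 0" using w by auto
  have [measurable]: "(\<lambda>t. exp (- w * of_real t)) \<in> borel_measurable borel"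
    by (intro borel_measurable_continuous_onI continuous_intros)
  show i: "integrable lborel (\<lambda>t. indicator {0<..} t *\<^sub>R exp (- w * of_real t))"
  proof (rule Bochner_Integration.integrable_bound[OF integrable_I0i_exp_mscale[OF w, unfolded set_integrable_def]])
    show "AE t in lborel. norm (indicator {0<..} t *\<^sub>R exp (- w * of_real t)) \<le> norm (indicat_real {0<..} t *\<^sub>R exp (- (t * Re w)))"
      by (auto simp: norm_exp_eq_Re indicator_def mult.commute)
  qed measurable
  have "(LBINT t=0..\<infinity>. exp (- w * of_real t)) = 0 - (- 1 / w)"
  proof (rule interval_integral_FTC_integrable[where F = "\<lambda>t. - exp (- w * of_real t) / w"])
    show "((\<lambda>t. - exp (- w * of_real t) / w) has_vector_derivative exp (- w * of_real t)) (at t)" for t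
      by (rule has_vector_derivative_real_field) (use w0 in \<open>auto intro!: derivative_eq_intros\<close>)
    show "set_integrable lborel (einterval 0 \<infinity>) (\<lambda>t. exp (- w * of_real t))"
      using i by (simp add: set_integrable_def einterval_def greaterThan_def zero_ereal_def)
    have "((\<lambda>t. - exp (- w * of_real t) / w) \<longlongrightarrow> - exp (- w * of_real 0) / w) (at_right 0)"
      by (intro tendsto_intros w0)
    then show "(((\<lambda>t. - exp (- w * of_real t) / w) \<circ> real_of_ereal) \<longlongrightarrow> - 1 / w) (at_right 0)"
      unfolding zero_ereal_def ereal_tendsto_simps by simp
    have "((\<lambda>t. exp (- w * of_real t)) \<longlongrightarrow> 0) at_top"
    proof (rule Lim_null_comparison)
      show "\<forall>\<^sub>F t in at_top. norm (exp (- w * of_real t)) \<le> exp (- Re w * t)"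
        by (simp add: norm_exp_eq_Re)
      show "((\<lambda>t. exp (- Re w * t)) \<longlongrightarrow> 0) at_top"
        using w by (intro filterlim_compose[OF exp_at_bot] filterlim_tendsto_neg_mult_at_bot[OF tendsto_const _ filterlim_ident]) auto
    qed
    then have "((\<lambda>t. - exp (- w * of_real t) / w) \<longlongrightarrow> - 0 / w) at_top"
      by (intro tendsto_intros w0)
    then show "(((\<lambda>t. - exp (- w * of_real t) / w) \<circ> real_of_ereal) \<longlongrightarrow> 0) (at_left \<infinity>)"
      unfolding ereal_tendsto_simps by simp
  qed (auto intro!: continuous_intros)
  then show "(\<integral>t. indicator {0<..} t *\<^sub>R exp (- w * of_real t) \<partial>lborel) = 1 / w"
    by (simp add: interval_lebesgue_integral_def set_lebesgue_integral_def einterval_def greaterThan_def zero_ereal_def)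
qed

text \<open>Absolute integrability of f(x) h(x, y) g(y) on the product follows from |h| \<le> 1 and
  the integrability of f and g.\<close>

lemma Fubini_bounded:
  fixes f g :: "real \<Rightarrow> complex" and h :: "real \<Rightarrow> real \<Rightarrow> complex"
  assumes f: "integrable lborel f" and g: "integrable lborel g"
    and h: "case_prod h \<in> borel_measurable (borel \<Otimes>\<^sub>M borel)" and h1: "\<And>x y. norm (h x y) \<le> 1"
  shows "(\<integral>x. f x * (\<integral>y. h x y * g y \<partial>lborel) \<partial>lborel) = (\<integral>y. g y * (\<integral>x. h x y * f x \<partial>lborel) \<partial>lborel)"
proof -
  have [measurable]: "f \<in> borel_measurable borel" "g \<in> borel_measurable borel"
    using f g by (auto dest: borel_measurable_integrable)
  have hm[measurable]: "case_prod h \<in> borel_measurable (lborel \<Otimes>\<^sub>M lborel)"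
    using h by (simp cong: measurable_cong_sets)
  have [measurable]: "(\<lambda>y. h x y) \<in> borel_measurable borel" for x
    using measurable_Pair2[OF h, of x] by simp
  have m: "(\<lambda>(x, y). f x * (h x y * g y)) \<in> borel_measurable (lborel \<Otimes>\<^sub>M lborel)"
    unfolding case_prod_beta' using hm[unfolded case_prod_beta'] by measurable
  have inner: "integrable lborel (\<lambda>y. f x * (h x y * g y))" for x
    by (rule integrable_mult_right, rule Bochner_Integration.integrable_bound[OF g])
      (auto simp: norm_mult intro!: mult_left_le_one_le h1)
  have "integrable (lborel \<Otimes>\<^sub>M lborel) (\<lambda>(x, y). f x * (h x y * g y))"
  proof (rule lborel_pair.Fubini_integrable[OF m])
    show "integrable lborel (\<lambda>x. \<integral>y. norm (case (x, y) of (x, y) \<Rightarrow> f x * (h x y * g y)) \<partial>lborel)"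
    proof (rule Bochner_Integration.integrable_bound[OF integrable_mult_left[OF integrable_norm[OF f], of "\<integral>y. norm (g y) \<partial>lborel"]])
      show "(\<lambda>x. \<integral>y. norm (case (x, y) of (x, y) \<Rightarrow> f x * (h x y * g y)) \<partial>lborel) \<in> borel_measurable lborel"
        by (rule lborel.borel_measurable_lebesgue_integral) (use m in \<open>simp add: case_prod_beta'\<close>)
      have "(\<integral>y. norm (f x * (h x y * g y)) \<partial>lborel) \<le> norm (f x) * (\<integral>y. norm (g y) \<partial>lborel)" for x
      proof -
        have "norm (f x * (h x y * g y)) \<le> norm (f x) * norm (g y)" for y
          unfolding norm_mult by (intro mult_left_mono mult_left_le_one_le h1) auto
        then have "(\<integral>y. norm (f x * (h x y * g y)) \<partial>lborel) \<le> (\<integral>y. norm (f x) * norm (g y) \<partial>lborel)"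
          by (intro integral_mono integrable_norm[OF inner] integrable_mult_right integrable_norm[OF g])
        then show ?thesis by simp
      qed
      then show "AE x in lborel. norm (\<integral>y. norm (case (x, y) of (x, y) \<Rightarrow> f x * (h x y * g y)) \<partial>lborel)
          \<le> norm (norm (f x) * (\<integral>y. norm (g y) \<partial>lborel))"
        by (auto simp: integral_nonneg_AE abs_mult)
    qed
    show "AE x in lborel. integrable lborel (\<lambda>y. case (x, y) of (x, y) \<Rightarrow> f x * (h x y * g y))"
      using inner by simp
  qed
  from lborel_pair.Fubini_integral[OF this]
  have "(\<integral>x. (\<integral>y. f x * (h x y * g y) \<partial>lborel) \<partial>lborel) = (\<integral>y. (\<integral>x. f x * (h x y * g y) \<partial>lborel) \<partial>lborel)"
    by simp
  moreover have "(\<integral>x. f x * (h x y * g y) \<partial>lborel) = g y * (\<integral>x. h x y * f x \<partial>lborel)" for y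
  proof -
    have "(\<integral>x. f x * (h x y * g y) \<partial>lborel) = (\<integral>x. g y * (h x y * f x) \<partial>lborel)"
      by (rule Bochner_Integration.integral_cong) auto
    then show ?thesis by (simp only: integral_mult_right_zero)
  qed
  ultimately show ?thesis by (simp only: integral_mult_right_zero)
qed

lemma borel_measurable_line_inverse:
  assumes "integrable lborel (\<lambda>y. G (Complex 0 y))"
  shows "line_inverse G \<in> borel_measurable borel"
  by (rule borel_measurable_continuous_onI[OF continuous_line_inverse[OF assms]])

text \<open>Exchanging the integrals leaves the elementary transform 1 / (s - i y) of the
  exponential; the remaining integral over y is Cauchy's formula for the half-plane.\<close>

lemma laplace_line_inverse:
  assumes G: "hp_decay G" and s: "0 < Re s"
  shows "(\<integral>t. indicator {0<..} t *\<^sub>R (line_inverse G t * exp (- s * of_real t)) \<partial>lborel) = G s"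
proof -
  note Gi = hp_decay_line_integrable[OF G order_refl]
  define e where "e t = indicator {0<..} t *\<^sub>R exp (- s * of_real t)" for t :: real
  have e: "integrable lborel e" unfolding e_def by (rule exp_half_line_integral(1)[OF s])
  have "(\<integral>t. indicator {0<..} t *\<^sub>R (line_inverse G t * exp (- s * of_real t)) \<partial>lborel)
      = (\<integral>t. 1 / (2 * of_real pi) * (e t * (\<integral>y. exp (of_real t * Complex 0 y) * G (Complex 0 y) \<partial>lborel)) \<partial>lborel)"
    by (simp add: e_def line_inverse_def scaleR_conv_of_real algebra_simps)
  also have "\<dots> = 1 / (2 * of_real pi) * (\<integral>t. e t * (\<integral>y. exp (of_real t * Complex 0 y) * G (Complex 0 y) \<partial>lborel) \<partial>lborel)"
    by (rule integral_mult_right_zero)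
  also have "(\<integral>t. e t * (\<integral>y. exp (of_real t * Complex 0 y) * G (Complex 0 y) \<partial>lborel) \<partial>lborel)
     = (\<integral>y. G (Complex 0 y) * (\<integral>t. exp (of_real t * Complex 0 y) * e t \<partial>lborel) \<partial>lborel)"
  proof (rule Fubini_bounded[OF e Gi])
    have "continuous_on UNIV (\<lambda>(t, y). exp (of_real t * Complex 0 y))"
      unfolding Complex_eq case_prod_beta' by (intro continuous_intros)
    then show "(\<lambda>(t, y). exp (of_real t * Complex 0 y)) \<in> borel_measurable (borel \<Otimes>\<^sub>M borel)"
      unfolding borel_prod by (rule borel_measurable_continuous_onI)
  qed simp
  also have "\<dots> = (\<integral>y. G (Complex 0 y) / (s - Complex 0 y) \<partial>lborel)"
  proof (rule Bochner_Integration.integral_cong[OF refl])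
    fix y
    have "(\<integral>t. exp (of_real t * Complex 0 y) * e t \<partial>lborel) = (\<integral>t. indicator {0<..} t *\<^sub>R exp (- (s - Complex 0 y) * of_real t) \<partial>lborel)"
      by (simp add: e_def exp_add[symmetric] algebra_simps)
    also have "\<dots> = 1 / (s - Complex 0 y)"
      using s by (intro exp_half_line_integral(2)) simp
    finally show "G (Complex 0 y) * (\<integral>t. exp (of_real t * Complex 0 y) * e t \<partial>lborel) = G (Complex 0 y) / (s - Complex 0 y)"
      by simp
  qed
  also have "\<dots> = 2 * of_real pi * G s"
    by (rule hp_decay_Cauchy_formula[OF G s])
  finally show ?thesis by simp
qed

subsection \<open>Distributions with a prescribed Laplace transform\<close>

lemma schwartz_decay:
  assumes "full_bounded 2 \<phi> B"
  shows "norm (\<phi> t) * (1 + t\<^sup>2) \<le> 2 * B"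
proof -
  have "\<bar>t\<bar> ^ 0 * norm ((vderiv ^^ 0) \<phi> t) \<le> B" "\<bar>t\<bar> ^ 2 * norm ((vderiv ^^ 0) \<phi> t) \<le> B"
    using assms unfolding full_bounded_def by (blast intro: order_refl le0)+
  then show ?thesis by (simp add: algebra_simps)
qed

lemma schwartz_measurable: "\<phi> \<in> schwartz \<Longrightarrow> \<phi> \<in> borel_measurable borel"
  using derivs_continuous_on[OF schwartz_derivs, of \<phi> UNIV 0] by (intro borel_measurable_continuous_onI) simp

text \<open>The distribution given by a function on the positive half-line. The functions inserted
  are bounded and measurable, which makes them integrable against every Schwartz function.\<close>

definition reg :: "(real \<Rightarrow> complex) \<Rightarrow> distr" where
  "reg g = (\<lambda>\<phi>\<in>schwartz. \<integral>t. indicator {0<..} t *\<^sub>R (g t * \<phi> t) \<partial>lborel)"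

lemma reg_bound:
  assumes g: "g \<in> borel_measurable borel" "\<And>t. norm (g t) \<le> K"
    and \<phi>: "\<phi> \<in> schwartz" "full_bounded 2 \<phi> B"
  shows "integrable lborel (\<lambda>t. indicator {0<..} t *\<^sub>R (g t * \<phi> t))"
    and "norm (reg g \<phi>) \<le> K * (2 * (\<integral>t. inverse (1 + t\<^sup>2) \<partial>lborel)) * B"
proof -
  note [measurable] = g(1) schwartz_measurable[OF \<phi>(1)]
  have K: "0 \<le> K" using order_trans[OF norm_ge_zero g(2)[of 0]] .
  have b: "norm (indicator {0<..} t *\<^sub>R (g t * \<phi> t)) * (1 + t\<^sup>2) \<le> K * (2 * B)" for t
  proof -
    have "norm (indicator {0<..} t *\<^sub>R (g t * \<phi> t)) * (1 + t\<^sup>2) \<le> norm (g t) * (norm (\<phi> t) * (1 + t\<^sup>2))"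
      by (auto simp: indicator_def norm_mult)
    also have "\<dots> \<le> K * (2 * B)"
      using K by (intro mult_mono g schwartz_decay \<phi>) auto
    finally show ?thesis .
  qed
  show i: "integrable lborel (\<lambda>t. indicator {0<..} t *\<^sub>R (g t * \<phi> t))"
    by (rule integrable_of_bound[OF _ b]) measurable
  have "norm (\<integral>t. indicator {0<..} t *\<^sub>R (g t * \<phi> t) \<partial>lborel) \<le> (\<integral>t. (K * (2 * B)) * inverse (1 + t\<^sup>2) \<partial>lborel)"
  proof (rule norm_LINT_le[OF i])
    show "integrable lborel (\<lambda>t. (K * (2 * B)) * inverse (1 + t\<^sup>2))"
      by (intro integrable_mult_right integrable_inverse_1_plus_square')
    fix t :: real
    have "1 + t\<^sup>2 > 0" by (simp add: add_pos_nonneg)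
    then show "norm (indicator {0<..} t *\<^sub>R (g t * \<phi> t)) \<le> (K * (2 * B)) * inverse (1 + t\<^sup>2)"
      using b[of t] by (simp add: field_simps)
  qed
  then show "norm (reg g \<phi>) \<le> K * (2 * (\<integral>t. inverse (1 + t\<^sup>2) \<partial>lborel)) * B"
    using \<phi> by (simp add: reg_def algebra_simps)
qed

lemma reg_integrable:
  assumes "g \<in> borel_measurable borel" "\<And>t. norm (g t) \<le> K" "\<phi> \<in> schwartz"
  shows "integrable lborel (\<lambda>t. indicator {0<..} t *\<^sub>R (g t * \<phi> t))"
  using reg_bound(1)[OF assms] schwartz_bounds[OF assms(3)] by blast

lemma reg_tempered_pos:
  assumes g: "g \<in> borel_measurable borel" "\<And>t. norm (g t) \<le> K"
  shows "reg g \<in> tempered_pos"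
proof (rule tempered_posI[where C = "K * (2 * (\<integral>t. inverse (1 + t\<^sup>2) \<partial>lborel))" and N = 2])
  show "reg g \<in> extensional schwartz" by (simp add: reg_def)
  have "0 \<le> K" using order_trans[OF norm_ge_zero g(2)[of 0]] .
  then show "0 \<le> K * (2 * (\<integral>t. inverse (1 + t\<^sup>2) \<partial>lborel))"
    by (intro mult_nonneg_nonneg integral_nonneg_AE) auto
  fix \<phi> assume \<phi>: "\<phi> \<in> schwartz"
  show "reg g (\<lambda>t. \<phi> t + \<psi> t) = reg g \<phi> + reg g \<psi>" if "\<psi> \<in> schwartz" for \<psi>
    using \<phi> that by (simp add: reg_def schwartz_add distrib_left scaleR_add_right Bochner_Integration.integral_add reg_integrable[OF g])
  show "reg g (\<lambda>t. c * \<phi> t) = c * reg g \<phi>" for c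
  proof -
    have "(\<lambda>t. indicator {0<..} t *\<^sub>R (g t * (c * \<phi> t))) = (\<lambda>t. c * (indicator {0<..} t *\<^sub>R (g t * \<phi> t)))"
      by (auto simp: indicator_def)
    then have "reg g (\<lambda>t. c * \<phi> t) = (\<integral>t. c * (indicator {0<..} t *\<^sub>R (g t * \<phi> t)) \<partial>lborel)"
      by (simp only: reg_def restrict_apply' schwartz_cmult[OF \<phi>])
    also have "\<dots> = c * (\<integral>t. indicator {0<..} t *\<^sub>R (g t * \<phi> t) \<partial>lborel)"
      by (rule integral_mult_right_zero)
    finally show ?thesis by (simp only: reg_def restrict_apply' \<phi>)
  qed
  show "norm (reg g \<phi>) \<le> K * (2 * (\<integral>t. inverse (1 + t\<^sup>2) \<partial>lborel)) * B" if "full_bounded 2 \<phi> B" for B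
    by (rule reg_bound(2)[OF g \<phi> that])
  show "reg g \<phi> = 0" if "0 < \<epsilon>" "\<And>t. t > -\<epsilon> \<Longrightarrow> \<phi> t = 0" for \<epsilon>
  proof -
    have "(\<lambda>t. indicator {0<..} t *\<^sub>R (g t * \<phi> t)) = (\<lambda>t. 0)"
      using that by (auto simp: indicator_def)
    then show ?thesis using \<phi> by (simp add: reg_def)
  qed
qed

lemma reg_line_inverse_has_laplace:
  assumes G: "hp_decay G"
  shows "has_laplace (reg (line_inverse G)) G"
proof -
  note Gi = hp_decay_line_integrable[OF G order_refl]
  have T: "reg (line_inverse G) \<in> tempered_pos"
    by (rule reg_tempered_pos[OF borel_measurable_line_inverse[OF Gi] norm_line_inverse_le[OF Gi]])
  have "laplace (reg (line_inverse G)) s = G s" if s: "Re s > 0" for s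
  proof -
    have "laplace (reg (line_inverse G)) s = (\<integral>t. indicator {0<..} t *\<^sub>R (line_inverse G t * (cutoff 0 t * exp (- s * of_real t))) \<partial>lborel)"
      unfolding laplace_extend[OF T s] by (simp only: reg_def restrict_apply' extend_schwartz[OF pos_schwartz_exp[OF s]])
    also have "\<dots> = (\<integral>t. indicator {0<..} t *\<^sub>R (line_inverse G t * exp (- s * of_real t)) \<partial>lborel)"
      by (rule Bochner_Integration.integral_cong) (auto simp: indicator_def cutoff_eq_1)
    also have "\<dots> = G s" by (rule laplace_line_inverse[OF G s])
    finally show ?thesis .
  qed
  then show ?thesis using T by (simp add: has_laplace_def)
qed

section \<open>Symbols of polynomial growth and the operator 1 + d/dt\<close>

text \<open>The operator 1 + d/dt, written through its transpose 1 - d/dt on test functions. On the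
  transform side it multiplies by 1 + s, which has no zero in the closed right half-plane.\<close>

definition add_ddt :: "distr \<Rightarrow> distr" where
  "add_ddt T = (\<lambda>\<phi>\<in>schwartz. T (\<lambda>t. \<phi> t - vderiv \<phi> t))"

definition sub_vderiv :: "(real \<Rightarrow> complex) \<Rightarrow> real \<Rightarrow> complex" where
  "sub_vderiv \<phi> = (\<lambda>t. \<phi> t - vderiv \<phi> t)"

lemma sub_vderiv_schwartz: "\<phi> \<in> schwartz \<Longrightarrow> (sub_vderiv ^^ m) \<phi> \<in> schwartz"
  by (induction m) (auto simp: sub_vderiv_def intro: schwartz_diff schwartz_vderiv1)

lemma add_ddt_funpow: "\<phi> \<in> schwartz \<Longrightarrow> (add_ddt ^^ m) T \<phi> = T ((sub_vderiv ^^ m) \<phi>)"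
proof (induction m arbitrary: \<phi>)
  case (Suc m)
  have "(add_ddt ^^ Suc m) T \<phi> = (add_ddt ^^ m) T (sub_vderiv \<phi>)"
    using Suc.prems by (simp add: add_ddt_def sub_vderiv_def)
  also have "\<dots> = T ((sub_vderiv ^^ m) (sub_vderiv \<phi>))"
    using sub_vderiv_schwartz[OF Suc.prems, of 1] by (intro Suc.IH) simp
  finally show ?case by (simp add: funpow_swap1)
qed simp

lemma add_ddt_tempered_pos:
  assumes T: "T \<in> tempered_pos"
  shows "add_ddt T \<in> tempered_pos"
proof -
  obtain C N where C: "C \<ge> 0" "\<And>\<phi> B. \<phi> \<in> schwartz \<Longrightarrow> full_bounded N \<phi> B \<Longrightarrow> norm (T \<phi>) \<le> C * B"
    using tempered_bound[OF tempered_pos_imp[OF T]] by blast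
  have ap: "add_ddt T \<phi> = T \<phi> + ddt T \<phi>" if "\<phi> \<in> schwartz" for \<phi>
    using tempered_diff[OF tempered_pos_imp[OF T] that schwartz_vderiv1[OF that]] that
    by (simp add: add_ddt_def ddt_apply)
  note D = ddt_tempered_pos[OF T]
  obtain C' N' where C': "C' \<ge> 0" "\<And>\<phi> B. \<phi> \<in> schwartz \<Longrightarrow> full_bounded N' \<phi> B \<Longrightarrow> norm (ddt T \<phi>) \<le> C' * B"
    using tempered_bound[OF tempered_pos_imp[OF D]] by blast
  show ?thesis
  proof (rule tempered_posI[where C = "C + C'" and N = "max N N'"])
    show "add_ddt T \<in> extensional schwartz" by (simp add: add_ddt_def)
    fix \<phi> assume \<phi>: "\<phi> \<in> schwartz"
    show "add_ddt T (\<lambda>t. \<phi> t + \<psi> t) = add_ddt T \<phi> + add_ddt T \<psi>" if "\<psi> \<in> schwartz" for \<psi>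
      by (simp add: ap \<phi> that schwartz_add tempered_add[OF tempered_pos_imp[OF T]] tempered_add[OF tempered_pos_imp[OF D]])
    show "add_ddt T (\<lambda>t. c * \<phi> t) = c * add_ddt T \<phi>" for c
      by (simp add: ap \<phi> schwartz_cmult tempered_cmult[OF tempered_pos_imp[OF T]] tempered_cmult[OF tempered_pos_imp[OF D]] distrib_left)
    show "norm (add_ddt T \<phi>) \<le> (C + C') * B" if "full_bounded (max N N') \<phi> B" for B
    proof -
      have "norm (T \<phi> + ddt T \<phi>) \<le> C * B + C' * B"
        by (rule norm_triangle_mono[OF C(2)[OF \<phi>] C'(2)[OF \<phi>]]) (auto intro: full_bounded_antimono[OF that])
      then show ?thesis by (simp add: ap \<phi> distrib_right)
    qed
    show "add_ddt T \<phi> = 0" if e: "0 < \<epsilon>" and z: "\<And>t. t > -\<epsilon> \<Longrightarrow> \<phi> t = 0" for \<epsilon>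
    proof -
      have zs: "(\<lambda>\<tau>. 0) \<in> schwartz" using schwartz_cmult[OF \<phi>, of 0] by simp
      have "X \<phi> = 0" if "X \<in> tempered_pos" for X
        using tempered_pos_local[OF that \<phi> zs e z] tempered_cmult[OF tempered_pos_imp[OF that] \<phi>, of 0] by simp
      from this[OF T] this[OF D] show ?thesis by (simp add: ap \<phi>)
    qed
  qed (use C C' in auto)
qed

lemma laplace_add_ddt:
  assumes T: "T \<in> tempered_pos" and s: "Re s > 0"
  shows "laplace (add_ddt T) s = (1 + s) * laplace T s"
proof -
  note sch = extend_schwartz[OF pos_schwartz_exp[OF s]]
  have "laplace (add_ddt T) s = laplace T s + laplace (ddt T) s"
    unfolding laplace_extend[OF T s] laplace_extend[OF ddt_tempered_pos[OF T] s] laplace_extend[OF add_ddt_tempered_pos[OF T] s]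
    using tempered_diff[OF tempered_pos_imp[OF T] sch schwartz_vderiv1[OF sch]] sch
    by (simp add: add_ddt_def ddt_apply)
  then show ?thesis
    by (simp add: laplace_ddt[OF T s] algebra_simps)
qed

lemma add_ddt_funpow_has_laplace:
  assumes "has_laplace T F"
  shows "has_laplace ((add_ddt ^^ m) T) (\<lambda>s. (1 + s) ^ m * F s)"
proof (induction m)
  case 0 then show ?case using assms by simp
next
  case (Suc m)
  have T: "(add_ddt ^^ m) T \<in> tempered_pos"
    and L: "\<And>s. Re s > 0 \<Longrightarrow> laplace ((add_ddt ^^ m) T) s = (1 + s) ^ m * F s"
    using Suc by (auto dest: has_laplaceD)
  show ?case
    unfolding has_laplace_def funpow.simps o_apply
  proof (intro conjI allI impI)
    show "add_ddt ((add_ddt ^^ m) T) \<in> tempered_pos" by (rule add_ddt_tempered_pos[OF T])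
    fix s :: complex assume s: "0 < Re s"
    show "laplace (add_ddt ((add_ddt ^^ m) T)) s = (1 + s) ^ Suc m * F s"
      unfolding laplace_add_ddt[OF T s] L[OF s] power_Suc mult.assoc ..
  qed
qed

definition hp_poly :: "nat \<Rightarrow> (complex \<Rightarrow> complex) \<Rightarrow> bool" where
  "hp_poly m F \<longleftrightarrow> hp_holo F \<and> (\<exists>C. \<forall>z. 0 \<le> Re z \<longrightarrow> norm (F z) \<le> C * (1 + norm z) ^ m)"

text \<open>Of the m + 2 powers, m undo the growth of F and two give the quadratic decay that
  inversion requires.\<close>

definition damped :: "nat \<Rightarrow> (complex \<Rightarrow> complex) \<Rightarrow> complex \<Rightarrow> complex" where
  "damped m F z = F z / (1 + z) ^ (m + 2)"

text \<open>From |1 + z|^2 = 1 + |z|^2 + 2 Re z; thus 1 + z serves as a holomorphic substitute for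
  the weight 1 + |z|.\<close>

lemma norm_one_plus:
  assumes "0 \<le> Re z"
  shows "1 + (norm z)\<^sup>2 \<le> (norm (1 + z))\<^sup>2" "1 + norm z \<le> 2 * norm (1 + z)" "1 + z \<noteq> 0"
proof -
  have "(norm (1 + z))\<^sup>2 = 1 + (norm z)\<^sup>2 + 2 * Re z"
    unfolding cmod_power2 by (simp add: power2_eq_square algebra_simps)
  then show *: "1 + (norm z)\<^sup>2 \<le> (norm (1 + z))\<^sup>2" using assms by simp
  have "(1 + norm z)\<^sup>2 \<le> 2 * (norm (1 + z))\<^sup>2"
    by (rule order_trans[OF one_plus_norm_sq mult_left_mono[OF *]]) simp
  also have "\<dots> \<le> (2 * norm (1 + z))\<^sup>2"
    by (simp add: power_mult_distrib)
  finally have "(1 + norm z)\<^sup>2 \<le> (2 * norm (1 + z))\<^sup>2" .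
  then show "1 + norm z \<le> 2 * norm (1 + z)"
    by (rule power2_le_imp_le) simp
  then have "norm (1 + z) > 0"
    using norm_ge_zero[of z] by linarith
  then show "1 + z \<noteq> 0" by auto
qed

lemma damped_bound:
  assumes "0 \<le> Re z" "norm (F z) \<le> C * (1 + norm z) ^ m"
  shows "norm (damped m F z) * (1 + (norm z)\<^sup>2) \<le> 2 ^ m * \<bar>C\<bar>"
proof -
  note n = norm_one_plus[OF assms(1)]
  have p: "norm (1 + z) > 0" using n(3) by simp
  have "norm (F z) \<le> \<bar>C\<bar> * (1 + norm z) ^ m"
    using assms(2) mult_right_mono[OF abs_ge_self[of C], of "(1 + norm z) ^ m"] by simp
  also have "\<dots> \<le> \<bar>C\<bar> * (2 * norm (1 + z)) ^ m"
    using n(2) by (intro mult_left_mono power_mono) auto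
  finally have F: "norm (F z) \<le> \<bar>C\<bar> * (2 * norm (1 + z)) ^ m" .
  have "norm (damped m F z) * (1 + (norm z)\<^sup>2) \<le> norm (damped m F z) * (norm (1 + z))\<^sup>2"
    using n(1) by (intro mult_left_mono) auto
  also have "\<dots> = norm (F z) / norm (1 + z) ^ m"
    using p by (simp add: damped_def norm_divide norm_power power_add norm_mult power2_eq_square)
  also have "\<dots> \<le> 2 ^ m * \<bar>C\<bar>"
    using F p by (simp add: divide_le_eq power_mult_distrib algebra_simps)
  finally show ?thesis .
qed

lemma hp_holo_divide:
  "hp_holo f \<Longrightarrow> hp_holo g \<Longrightarrow> (\<And>z. 0 \<le> Re z \<Longrightarrow> g z \<noteq> 0) \<Longrightarrow> hp_holo (\<lambda>z. f z / g z)"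
  by (auto simp: hp_holo_def intro!: continuous_intros holomorphic_intros)

lemma hp_decay_damped:
  assumes "hp_poly m F" shows "hp_decay (damped m F)"
proof -
  obtain C where C: "\<And>z. 0 \<le> Re z \<Longrightarrow> norm (F z) \<le> C * (1 + norm z) ^ m"
    using assms unfolding hp_poly_def by blast
  have "hp_holo (damped m F)"
    unfolding damped_def[abs_def]
    by (rule hp_holo_divide[OF _ hp_holoI_entire])
      (use assms norm_one_plus(3) in \<open>auto simp: hp_poly_def intro!: holomorphic_intros\<close>)
  then show ?thesis
    unfolding hp_decay_def using damped_bound C by blast
qed

text \<open>The order m is an explicit argument, so that a family of symbols with common growth is
  inverted by one linear formula.\<close>

definition inv_dist :: "nat \<Rightarrow> (complex \<Rightarrow> complex) \<Rightarrow> distr" where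
  "inv_dist m F = (add_ddt ^^ (m + 2)) (reg (line_inverse (damped m F)))"

lemma inv_dist_has_laplace:
  assumes "hp_poly m F" shows "has_laplace (inv_dist m F) F"
proof -
  have "has_laplace (inv_dist m F) (\<lambda>s. (1 + s) ^ (m + 2) * damped m F s)"
    unfolding inv_dist_def
    by (rule add_ddt_funpow_has_laplace[OF reg_line_inverse_has_laplace[OF hp_decay_damped[OF assms]]])
  then show ?thesis
  proof (rule has_laplace_cong)
    fix s :: complex assume "Re s > 0"
    then have "(1 + s) ^ (m + 2) \<noteq> 0" using norm_one_plus(3)[of s] by simp
    then show "(1 + s) ^ (m + 2) * damped m F s = F s"
      unfolding damped_def by (simp del: power_Suc power_add)
  qed
qed

lemma inv_dist_apply:
  assumes "\<phi> \<in> schwartz"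
  shows "inv_dist m F \<phi> = (\<integral>t. indicator {0<..} t *\<^sub>R (line_inverse (damped m F) t * (sub_vderiv ^^ (m + 2)) \<phi> t) \<partial>lborel)"
  unfolding inv_dist_def add_ddt_funpow[OF assms] reg_def
  by (rule restrict_apply'[OF sub_vderiv_schwartz[OF assms]])

subsection \<open>Rapidly decreasing symbols\<close>

definition hp_rapid :: "(complex \<Rightarrow> complex) \<Rightarrow> bool" where
  "hp_rapid F \<longleftrightarrow> hp_holo F \<and> (\<forall>n. \<exists>C. \<forall>z. 0 \<le> Re z \<longrightarrow> norm (F z) * (1 + norm z) ^ n \<le> C)"

lemma hp_rapid_decay: assumes "hp_rapid F" shows "hp_decay F"
proof -
  obtain C where C: "\<And>z. 0 \<le> Re z \<Longrightarrow> norm (F z) * (1 + norm z) ^ 2 \<le> C"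
    using assms unfolding hp_rapid_def by blast
  have "norm (F z) * (1 + (norm z)\<^sup>2) \<le> C" if "0 \<le> Re z" for z
  proof -
    have "1 + (norm z)\<^sup>2 \<le> (1 + norm z)\<^sup>2" by (simp add: power2_eq_square algebra_simps)
    then have "norm (F z) * (1 + (norm z)\<^sup>2) \<le> norm (F z) * (1 + norm z)\<^sup>2"
      by (intro mult_left_mono) auto
    then show ?thesis using C[OF that] by linarith
  qed
  then show ?thesis using assms unfolding hp_decay_def hp_rapid_def by blast
qed

lemma hp_rapid_mult_power: assumes "hp_rapid F" shows "hp_rapid (\<lambda>z. z ^ m * F z)"
  unfolding hp_rapid_def
proof (intro conjI allI)
  show "hp_holo (\<lambda>z. z ^ m * F z)"
    by (rule hp_holo_mult[OF hp_holoI_entire]) (use assms in \<open>auto intro!: holomorphic_intros simp: hp_rapid_def\<close>)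
  fix n
  obtain C where C: "\<And>z. 0 \<le> Re z \<Longrightarrow> norm (F z) * (1 + norm z) ^ (m + n) \<le> C"
    using assms unfolding hp_rapid_def by blast
  have "norm (z ^ m * F z) * (1 + norm z) ^ n \<le> C" if "0 \<le> Re z" for z
  proof -
    have "norm (z ^ m * F z) * (1 + norm z) ^ n \<le> (1 + norm z) ^ m * norm (F z) * (1 + norm z) ^ n"
      unfolding norm_mult norm_power by (intro mult_right_mono power_mono) auto
    also have "\<dots> = norm (F z) * (1 + norm z) ^ (m + n)" by (simp add: power_add)
    also have "\<dots> \<le> C" by (rule C[OF that])
    finally show ?thesis .
  qed
  then show "\<exists>C. \<forall>z. 0 \<le> Re z \<longrightarrow> norm (z ^ m * F z) * (1 + norm z) ^ n \<le> C" by blast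
qed

lemma hp_rapid_diff: assumes "hp_rapid F" "hp_rapid G" shows "hp_rapid (\<lambda>z. F z - G z)"
  unfolding hp_rapid_def
proof (intro conjI allI)
  show "hp_holo (\<lambda>z. F z - G z)"
    using assms by (auto simp: hp_rapid_def hp_holo_def intro!: continuous_intros holomorphic_intros)
  fix n
  obtain C D where C: "\<And>z. 0 \<le> Re z \<Longrightarrow> norm (F z) * (1 + norm z) ^ n \<le> C"
    and D: "\<And>z. 0 \<le> Re z \<Longrightarrow> norm (G z) * (1 + norm z) ^ n \<le> D"
    using assms unfolding hp_rapid_def by metis
  have "norm (F z - G z) * (1 + norm z) ^ n \<le> C + D" if "0 \<le> Re z" for z
  proof -
    have "norm (F z - G z) * (1 + norm z) ^ n \<le> (norm (F z) + norm (G z)) * (1 + norm z) ^ n"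
      by (intro mult_right_mono norm_triangle_ineq4) auto
    also have "\<dots> \<le> C + D"
      unfolding distrib_right by (intro add_mono C D that)
    finally show ?thesis .
  qed
  then show "\<exists>C. \<forall>z. 0 \<le> Re z \<longrightarrow> norm (F z - G z) * (1 + norm z) ^ n \<le> C" by blast
qed

lemma hp_rapid_integrable: "hp_rapid F \<Longrightarrow> integrable lborel (\<lambda>y. Complex 0 y ^ n * F (Complex 0 y))"
  using hp_decay_line_integrable[OF hp_rapid_decay[OF hp_rapid_mult_power], of F 0 n] by simp

lemma hp_rapid_integrable0: "hp_rapid F \<Longrightarrow> integrable lborel (\<lambda>y. F (Complex 0 y))"
  using hp_rapid_integrable[of F 0] by simp

text \<open>The L1 norm of z^n F(z) on the imaginary axis; it bounds the n-th derivative of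
  \<open>line_inverse F\<close>.\<close>

definition line_weight :: "nat \<Rightarrow> (complex \<Rightarrow> complex) \<Rightarrow> real" where
  "line_weight n F = (\<integral>y. norm (Complex 0 y ^ n * F (Complex 0 y)) \<partial>lborel)"

lemma line_weight_nonneg: "0 \<le> line_weight n F"
  unfolding line_weight_def by (rule integral_nonneg_AE) simp

lemma norm_line_inverse_weight:
  "hp_rapid F \<Longrightarrow> norm (line_inverse (\<lambda>z. z ^ n * F z) t) \<le> line_weight n F"
  unfolding line_weight_def by (rule norm_line_inverse_le[OF hp_rapid_integrable])

lemma line_inverse_diff:
  assumes "integrable lborel (\<lambda>y. F (Complex 0 y))" "integrable lborel (\<lambda>y. G (Complex 0 y))"
  shows "line_inverse (\<lambda>z. F z - G z) t = line_inverse F t - line_inverse G t"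
  using exp_line_integrable[of F t] exp_line_integrable[of G t] assms
  by (simp add: line_inverse_def right_diff_distrib Bochner_Integration.integral_diff)

text \<open>The exponential is expanded to first order in t; the remainder is at most |y|^2 (u -
  t)^2, and |y|^2 is integrable against F.\<close>

lemma line_inverse_derivative:
  assumes F: "hp_rapid F"
  shows "(line_inverse F has_vector_derivative line_inverse (\<lambda>z. z * F z) t) (at t)"
proof (rule has_vector_derivative_quadraticI)
  fix u :: real
  let ?z = "\<lambda>y. Complex 0 y"
  define H where "H z = exp (of_real u * z) * F z - exp (of_real t * z) * F z - (u - t) *\<^sub>R (exp (of_real t * z) * (z * F z))" for z
  note i0 = hp_rapid_integrable0[OF F]
  have i1: "integrable lborel (\<lambda>y. ?z y * F (?z y))" using hp_rapid_integrable[OF F, of 1] by simp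
  have i: "integrable lborel (\<lambda>y. exp (of_real r * ?z y) * F (?z y))" for r by (rule exp_line_integrable[OF i0])
  have i': "integrable lborel (\<lambda>y. exp (of_real t * ?z y) * (?z y * F (?z y)))"
    using exp_line_integrable[of "\<lambda>z. z * F z" t] i1 by simp
  have Hi: "integrable lborel (\<lambda>y. H (?z y))"
    unfolding H_def by (intro Bochner_Integration.integrable_diff i integrable_scaleR_right i')
  have "line_inverse F u - line_inverse F t - (u - t) *\<^sub>R line_inverse (\<lambda>z. z * F z) t = 1 / (2 * of_real pi) * (\<integral>y. H (?z y) \<partial>lborel)"
  proof -
    have "(\<integral>y. H (?z y) \<partial>lborel) = (\<integral>y. exp (of_real u * ?z y) * F (?z y) \<partial>lborel) - (\<integral>y. exp (of_real t * ?z y) * F (?z y) \<partial>lborel)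
        - (u - t) *\<^sub>R (\<integral>y. exp (of_real t * ?z y) * (?z y * F (?z y)) \<partial>lborel)"
      unfolding H_def Bochner_Integration.integral_diff[OF Bochner_Integration.integrable_diff[OF i i] integrable_scaleR_right[OF i']]
        Bochner_Integration.integral_diff[OF i i] integral_scaleR_right ..
    then show ?thesis
      by (simp add: line_inverse_def scaleR_conv_of_real right_diff_distrib)
  qed
  moreover have "norm (\<integral>y. H (?z y) \<partial>lborel) \<le> (\<integral>y. (u - t)\<^sup>2 * norm (?z y ^ 2 * F (?z y)) \<partial>lborel)"
  proof (rule norm_LINT_le[OF Hi])
    show "integrable lborel (\<lambda>y. (u - t)\<^sup>2 * norm (?z y ^ 2 * F (?z y)))"
      by (intro integrable_mult_right integrable_norm hp_rapid_integrable F)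
    fix y
    have "norm (exp (of_real u * ?z y) - exp (of_real t * ?z y) - (u - t) *\<^sub>R (?z y * exp (of_real t * ?z y))) \<le> norm (?z y ^ 2) * (u - t)\<^sup>2"
    proof (rule quadratic_remainder[of UNIV t u _ _ "\<lambda>r. ?z y * (?z y * exp (of_real r * ?z y))"])
      show "((\<lambda>r. exp (of_real r * ?z y)) has_vector_derivative ?z y * exp (of_real r * ?z y)) (at r within UNIV)" for r
        by (rule has_vector_derivative_real_field) (auto intro!: derivative_eq_intros)
      then show "((\<lambda>r. ?z y * exp (of_real r * ?z y)) has_vector_derivative ?z y * (?z y * exp (of_real r * ?z y))) (at r within UNIV)" for r
        by (rule has_vector_derivative_mult_right)
    qed (auto simp: norm_mult norm_power power2_eq_square)
    then have "norm (exp (of_real u * ?z y) - exp (of_real t * ?z y) - (u - t) *\<^sub>R (?z y * exp (of_real t * ?z y))) * norm (F (?z y))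
       \<le> norm (?z y ^ 2) * (u - t)\<^sup>2 * norm (F (?z y))"
      by (rule mult_right_mono) simp
    moreover have Heq: "H (?z y) = (exp (of_real u * ?z y) - exp (of_real t * ?z y) - (u - t) *\<^sub>R (?z y * exp (of_real t * ?z y))) * F (?z y)"
      by (simp add: H_def scaleR_conv_of_real algebra_simps)
    ultimately show "norm (H (?z y)) \<le> (u - t)\<^sup>2 * norm (?z y ^ 2 * F (?z y))"
      unfolding Heq norm_mult by (simp only: mult_ac)
  qed
  moreover have "(\<integral>y. (u - t)\<^sup>2 * norm (?z y ^ 2 * F (?z y)) \<partial>lborel) = line_weight 2 F * (u - t)\<^sup>2"
    unfolding line_weight_def by simp
  moreover have "norm (1 / (2 * of_real pi) * c) \<le> norm c" for c :: complex
    using pi_ge_two mult_right_mono[of "1 / (2 * pi)" 1 "norm c"] by (simp add: norm_mult norm_divide field_simps)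
  ultimately show "norm (line_inverse F u - line_inverse F t - (u - t) *\<^sub>R line_inverse (\<lambda>z. z * F z) t) \<le> line_weight 2 F * (u - t)\<^sup>2"
    by (metis order_trans)
qed

lemma derivs_line_inverse: "hp_rapid F \<Longrightarrow> derivs (\<lambda>n. line_inverse (\<lambda>z. z ^ n * F z))"
  unfolding derivs_def using line_inverse_derivative[OF hp_rapid_mult_power[of F]] by (simp add: mult.assoc)

lemma line_inverse_rapid_negative: "hp_rapid F \<Longrightarrow> t < 0 \<Longrightarrow> line_inverse (\<lambda>z. z ^ n * F z) t = 0"
  by (rule line_inverse_negative[OF hp_rapid_decay[OF hp_rapid_mult_power]])

text \<open>Only the compact interval [-1, b] matters, and there continuity gives the
  bounds.\<close>

lemma pos_schwartz_right_zero:
  assumes d: "derivs G" and z: "\<And>n t. t > b \<Longrightarrow> G n t = 0"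
  shows "G 0 \<in> pos_schwartz"
proof (rule pos_schwartzI[OF d])
  fix k n
  have "continuous_on {-1..b} (\<lambda>t. \<bar>t\<bar> ^ k * norm (G n t))"
    by (intro continuous_intros derivs_continuous_on[OF d])
  from continuous_on_Icc_bounded[OF this]
  obtain B where B: "\<forall>t\<in>{-1..b}. \<bar>t\<bar> ^ k * norm (G n t) \<le> B" by blast
  have "\<bar>t\<bar> ^ k * norm (G n t) \<le> max B 0" if "t \<ge> -1" for t
    using B z[of t n] that by (cases "t > b") (auto simp: le_max_iff_disj)
  then show "\<exists>B. \<forall>t\<ge>-1. \<bar>t\<bar> ^ k * norm (G n t) \<le> B" by blast
qed

lemma pos_bounded_right_zero:
  assumes d: "derivs G" and b: "0 \<le> b" "0 \<le> B" and z: "\<And>n t. t > b \<Longrightarrow> G n t = 0"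
    and B: "\<And>n t. n \<le> N \<Longrightarrow> norm (G n t) \<le> B"
  shows "pos_bounded N (G 0) ((b + 1) ^ N * B)"
  unfolding pos_bounded_def derivs_vderiv[OF d]
proof (intro allI impI)
  fix k n t assume *: "k \<le> N" "n \<le> N" "(-1::real) \<le> t"
  show "\<bar>t\<bar> ^ k * norm (G n t) \<le> (b + 1) ^ N * B"
  proof (cases "t > b")
    case True then show ?thesis using b by (simp add: z)
  next
    case False
    have "\<bar>t\<bar> ^ k \<le> (b + 1) ^ k" using * b False by (intro power_mono) auto
    also have "\<dots> \<le> (b + 1) ^ N" using * b by (intro power_increasing) auto
    finally show ?thesis using * b B by (intro mult_mono) auto
  qed
qed

lemma derivs_reflected:
  assumes "hp_rapid F"
  shows "derivs (\<lambda>n \<tau>. of_real ((-1) ^ n) * line_inverse (\<lambda>z. z ^ n * F z) (t - \<tau>))"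
  using derivs_affine[OF derivs_line_inverse[OF assms], of "-1" t] by simp

lemma reflected_pos_schwartz:
  assumes "hp_rapid F"
  shows "(\<lambda>\<tau>. line_inverse F (t - \<tau>)) \<in> pos_schwartz"
  using pos_schwartz_right_zero[OF derivs_reflected[OF assms], of t t] line_inverse_rapid_negative[OF assms] by simp

section \<open>Pointwise convolution of a distribution with a smooth kernel\<close>

text \<open>The value at t of the convolution, as a pairing with the reflected kernel. The latter
  vanishes for \<tau> > t, hence lies in \<open>pos_schwartz\<close>.\<close>

definition kernel_conv :: "distr \<Rightarrow> (complex \<Rightarrow> complex) \<Rightarrow> real \<Rightarrow> complex" where
  "kernel_conv U F t = pos_apply U (\<lambda>\<tau>. line_inverse F (t - \<tau>))"

lemma kernel_conv_diff:
  assumes U: "U \<in> tempered_pos" and F: "hp_rapid F" and G: "hp_rapid G"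
  shows "kernel_conv U (\<lambda>z. F z - G z) t = kernel_conv U F t - kernel_conv U G t"
  unfolding kernel_conv_def line_inverse_diff[OF hp_rapid_integrable0[OF F] hp_rapid_integrable0[OF G]]
  by (rule pos_apply_diff[OF U reflected_pos_schwartz[OF F] reflected_pos_schwartz[OF G]])

text \<open>For \<tau> \<ge> -1 the reflected kernel lives on [-1, |t|], whence the power of |t| +
  1, and its derivatives are bounded by the weights. The constants depend on U alone, so convergence
  of symbols in these weights gives convergence of the convolutions.\<close>

lemma kernel_conv_bound:
  assumes U: "U \<in> tempered_pos"
  shows "\<exists>C\<ge>0. \<exists>N. \<forall>F t. hp_rapid F \<longrightarrow> norm (kernel_conv U F t) \<le> C * ((\<bar>t\<bar> + 1) ^ N * (\<Sum>n\<le>N. line_weight n F))"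
proof -
  obtain C N where C: "C \<ge> 0" "\<And>f B. f \<in> pos_schwartz \<Longrightarrow> pos_bounded N f B \<Longrightarrow> norm (pos_apply U f) \<le> C * B"
    using pos_apply_bound[OF U] by blast
  have "norm (kernel_conv U F t) \<le> C * ((\<bar>t\<bar> + 1) ^ N * (\<Sum>n\<le>N. line_weight n F))" if F: "hp_rapid F" for F t
    unfolding kernel_conv_def
  proof (rule C(2)[OF reflected_pos_schwartz[OF F]])
    have "norm (of_real ((-1) ^ n) * line_inverse (\<lambda>z. z ^ n * F z) (t - \<tau>)) \<le> (\<Sum>n\<le>N. line_weight n F)" if "n \<le> N" for n \<tau>
    proof -
      have "norm (of_real ((-1) ^ n) * line_inverse (\<lambda>z. z ^ n * F z) (t - \<tau>)) \<le> line_weight n F"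
        using norm_line_inverse_weight[OF F] by (simp add: norm_mult norm_power)
      also have "\<dots> \<le> (\<Sum>n\<le>N. line_weight n F)"
        using that by (intro member_le_sum line_weight_nonneg) auto
      finally show ?thesis .
    qed
    then show "pos_bounded N (\<lambda>\<tau>. line_inverse F (t - \<tau>)) ((\<bar>t\<bar> + 1) ^ N * (\<Sum>n\<le>N. line_weight n F))"
      using pos_bounded_right_zero[OF derivs_reflected[OF F], of "\<bar>t\<bar>" "\<Sum>n\<le>N. line_weight n F" t N]
        line_inverse_rapid_negative[OF F] by (simp add: sum_nonneg line_weight_nonneg)
  qed
  then show ?thesis using C(1) by blast
qed

text \<open>Locally Lipschitz: in each derivative up to order N two reflected kernels differ by at
  most |u - t| times a weight of one order more, hence \<open>Suc N\<close>.\<close>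

lemma kernel_conv_continuous:
  assumes U: "U \<in> tempered_pos" and F: "hp_rapid F"
  shows "continuous_on A (kernel_conv U F)"
proof (rule continuous_at_imp_continuous_on, rule ballI)
  fix t :: real
  obtain C N where C: "C \<ge> 0" "\<And>f B. f \<in> pos_schwartz \<Longrightarrow> pos_bounded N f B \<Longrightarrow> norm (pos_apply U f) \<le> C * B"
    using pos_apply_bound[OF U] by blast
  define W where "W = (\<Sum>n\<le>Suc N. line_weight n F)"
  have W0: "0 \<le> W" unfolding W_def by (intro sum_nonneg line_weight_nonneg)
  \<comment> \<open>All reflected kernels with |u - t| \<le> 1 vanish to the right of this
    point.\<close>
  define b where "b = \<bar>t\<bar> + 1"
  define K where "K = C * ((b + 1) ^ N * W)"
  have le: "norm (kernel_conv U F u - kernel_conv U F t) \<le> K * \<bar>u - t\<bar>" if u: "\<bar>u - t\<bar> \<le> 1" for u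
  proof -
    define G where "G n \<tau> = of_real ((-1) ^ n) * line_inverse (\<lambda>z. z ^ n * F z) (u - \<tau>) - of_real ((-1) ^ n) * line_inverse (\<lambda>z. z ^ n * F z) (t - \<tau>)" for n \<tau>
    have dG: "derivs G" unfolding G_def by (rule derivs_diff[OF derivs_reflected[OF F] derivs_reflected[OF F]])
    have zG: "G n \<tau> = 0" if "\<tau> > b" for n \<tau>
      using that u by (auto simp: G_def b_def line_inverse_rapid_negative[OF F])
    have G: "norm (G n \<tau>) \<le> W * \<bar>u - t\<bar>" if "n \<le> N" for n \<tau>
    proof -
      have "norm (G n \<tau>) = norm (line_inverse (\<lambda>z. z ^ n * F z) (u - \<tau>) - line_inverse (\<lambda>z. z ^ n * F z) (t - \<tau>))"
        unfolding G_def right_diff_distrib[symmetric] by (simp add: norm_mult norm_power)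
      also have "\<dots> \<le> line_weight (Suc n) F * norm ((u - \<tau>) - (t - \<tau>))"
      proof (rule differentiable_bound[of UNIV _ "\<lambda>x h. h *\<^sub>R line_inverse (\<lambda>z. z ^ Suc n * F z) x"])
        show "(line_inverse (\<lambda>z. z ^ n * F z) has_derivative (\<lambda>h. h *\<^sub>R line_inverse (\<lambda>z. z ^ Suc n * F z) x)) (at x within UNIV)" for x
          using derivsD[OF derivs_line_inverse[OF F], of n x] by (simp add: has_vector_derivative_def)
        show "onorm (\<lambda>h. h *\<^sub>R line_inverse (\<lambda>z. z ^ Suc n * F z) x) \<le> line_weight (Suc n) F" for x
          using norm_line_inverse_weight[OF F, of "Suc n" x]
          by (intro onorm_le) (simp add: mult.commute[of "line_weight _ _"] mult_left_mono del: power_Suc)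
      qed auto
      also have "\<dots> \<le> W * \<bar>u - t\<bar>"
        unfolding W_def using that by (intro mult_mono member_le_sum line_weight_nonneg sum_nonneg) auto
      finally show ?thesis .
    qed
    have "pos_bounded N (G 0) ((b + 1) ^ N * (W * \<bar>u - t\<bar>))"
      by (rule pos_bounded_right_zero[OF dG _ _ zG G]) (use W0 in \<open>auto simp: b_def\<close>)
    from C(2)[OF pos_schwartz_right_zero[OF dG zG] this]
    have "norm (pos_apply U (G 0)) \<le> K * \<bar>u - t\<bar>"
      by (simp add: K_def mult.assoc)
    moreover have "pos_apply U (G 0) = kernel_conv U F u - kernel_conv U F t"
      unfolding kernel_conv_def pos_apply_diff[OF U reflected_pos_schwartz[OF F] reflected_pos_schwartz[OF F], symmetric]
      by (simp add: G_def[abs_def])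
    ultimately show ?thesis by simp
  qed
  have "((\<lambda>u. kernel_conv U F u - kernel_conv U F t) \<longlongrightarrow> 0) (at t)"
  proof (rule Lim_null_comparison)
    show "\<forall>\<^sub>F u in at t. norm (kernel_conv U F u - kernel_conv U F t) \<le> K * \<bar>u - t\<bar>"
      using le by (auto simp: eventually_at dist_real_def intro!: exI[of _ 1])
    have "((\<lambda>u. K * \<bar>u - t\<bar>) \<longlongrightarrow> K * \<bar>t - t\<bar>) (at t)"
      by (intro tendsto_intros)
    then show "((\<lambda>u. K * \<bar>u - t\<bar>) \<longlongrightarrow> 0) (at t)" by simp
  qed
  then show "isCont (kernel_conv U F) t"
    unfolding isCont_def by (rule LIM_zero_cancel)
qed

lemma kernel_conv_negative:
  assumes U: "U \<in> tempered_pos" and F: "hp_rapid F" and t: "t < 0"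
  shows "kernel_conv U F t = 0"
proof -
  have "pos_apply U (\<lambda>\<tau>. line_inverse F (t - \<tau>)) = pos_apply U (\<lambda>\<tau>. 0)"
    using t line_inverse_rapid_negative[OF F, of _ 0]
    by (intro pos_apply_cong[OF U reflected_pos_schwartz[OF F], of "- t"]) auto
  then show ?thesis by (simp add: kernel_conv_def pos_apply_0[OF U])
qed

text \<open>The pairing with \<open>U\<close> is interchanged with the integral over \<open>{a..b}\<close> by differentiating
  both sides with respect to the upper end point.\<close>

lemma pos_apply_integral:
  assumes U: "U \<in> tempered_pos" and F: "hp_rapid F" and \<phi>: "\<phi> \<in> schwartz" and ab: "a \<le> b" "0 \<le> b"
  shows "pos_apply U (\<lambda>\<tau>. integral {a..b} (\<lambda>r. \<phi> r * line_inverse F (r - \<tau>))) = integral {a..b} (\<lambda>r. \<phi> r * kernel_conv U F r)"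
proof -
  define k where "k n = line_inverse (\<lambda>z. z ^ n * F z)" for n
  have k0: "k 0 = line_inverse F" by (simp add: k_def)
  have dk: "derivs k" unfolding k_def by (rule derivs_line_inverse[OF F])
  have kz: "k n t = 0" if "t < 0" for n t unfolding k_def by (rule line_inverse_rapid_negative[OF F that])
  have d\<phi>: "derivs (\<lambda>n. (vderiv ^^ n) \<phi>)" by (rule schwartz_derivs[OF \<phi>])
  have cont\<phi>: "continuous_on A \<phi>" for A using derivs_continuous_on[OF d\<phi>, of A 0] by simp
  have contk: "continuous_on A (\<lambda>r. k n (r - \<tau>))" for A n \<tau>
    by (rule continuous_on_compose2[OF derivs_continuous_on[OF dk, of UNIV]]) (auto intro!: continuous_intros)
  obtain B where B: "full_bounded 1 \<phi> B" using schwartz_bounds[OF \<phi>] by blast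
  have B0: "norm (\<phi> t) \<le> B" "norm ((vderiv ^^ 1) \<phi> t) \<le> B" for t
  proof -
    have "\<bar>t\<bar> ^ 0 * norm ((vderiv ^^ 0) \<phi> t) \<le> B" "\<bar>t\<bar> ^ 0 * norm ((vderiv ^^ 1) \<phi> t) \<le> B"
      using B unfolding full_bounded_def by (blast intro: order_refl le0)+
    then show "norm (\<phi> t) \<le> B" "norm ((vderiv ^^ 1) \<phi> t) \<le> B" by simp_all
  qed
  note Bn = full_bounded_nonneg[OF B]
  \<comment> \<open>The n-th derivative in \<tau> of the integral up to \<rho>; the sign comes from
    the inner function r - \<tau>.\<close>
  define G where "G \<rho> n \<tau> = of_real ((-1) ^ n) * integral {a..\<rho>} (\<lambda>r. \<phi> r * k n (r - \<tau>))" for \<rho> n \<tau>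
  have dG: "derivs (G \<rho>)" for \<rho>
    unfolding derivs_def
  proof (intro allI)
    fix n \<tau>
    have "((\<lambda>\<tau>. integral (cbox a \<rho>) (\<lambda>r. \<phi> r * k n (r - \<tau>))) has_vector_derivative
        integral (cbox a \<rho>) (\<lambda>r. \<phi> r * (- k (Suc n) (r - \<tau>)))) (at \<tau> within UNIV)"
    proof (rule leibniz_rule_vector_derivative)
      fix x r :: real
      have "((k n \<circ> (\<lambda>\<tau>. r - \<tau>)) has_vector_derivative (-1) *\<^sub>R k (Suc n) (r - x)) (at x)"
        by (rule vector_diff_chain_at) (auto intro!: derivative_eq_intros derivsD[OF dk])
      then have "((\<lambda>\<tau>. k n (r - \<tau>)) has_vector_derivative - k (Suc n) (r - x)) (at x)"
        by (simp add: o_def)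
      then show "((\<lambda>\<tau>. \<phi> r * k n (r - \<tau>)) has_vector_derivative \<phi> r * (- k (Suc n) (r - x))) (at x within UNIV)"
        by (rule has_vector_derivative_mult_right)
    next
      show "(\<lambda>r. \<phi> r * k n (r - x)) integrable_on cbox a \<rho>" for x
        by (intro integrable_continuous continuous_intros cont\<phi> contk)
      show "continuous_on (UNIV \<times> cbox a \<rho>) (\<lambda>(x, r). \<phi> r * (- k (Suc n) (r - x)))"
        unfolding case_prod_beta'
        by (intro continuous_intros continuous_on_compose2[OF cont\<phi>[of UNIV]] continuous_on_compose2[OF derivs_continuous_on[OF dk, of UNIV]]) auto
    qed auto
    from has_vector_derivative_mult_right[OF this, of "of_real ((-1) ^ n)"]
    show "(G \<rho> n has_vector_derivative G \<rho> (Suc n) \<tau>) (at \<tau>)"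
      unfolding G_def by (simp add: integral_neg)
  qed
  have zG: "G \<rho> n \<tau> = 0" if "\<tau> > \<rho>" for \<rho> n \<tau>
  proof -
    have "integral {a..\<rho>} (\<lambda>r. \<phi> r * k n (r - \<tau>)) = integral {a..\<rho>} (\<lambda>r. 0)"
      using that by (intro integral_cong) (auto simp: kz)
    then show ?thesis by (simp add: G_def)
  qed
  have Gps: "G \<rho> 0 \<in> pos_schwartz" for \<rho>
    by (rule pos_schwartz_right_zero[OF dG zG])
  define E where "E \<rho> = pos_apply U (G \<rho> 0)" for \<rho>
  obtain C N where C: "C \<ge> 0" "\<And>f B. f \<in> pos_schwartz \<Longrightarrow> pos_bounded N f B \<Longrightarrow> norm (pos_apply U f) \<le> C * B"
    using pos_apply_bound[OF U] by blast
  define W where "W = (\<Sum>n\<le>Suc N. line_weight n F)"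
  have W0: "0 \<le> W" unfolding W_def by (intro sum_nonneg line_weight_nonneg)
  have kW: "norm (k n t) \<le> W" if "n \<le> Suc N" for n t
  proof -
    have "norm (k n t) \<le> line_weight n F" unfolding k_def by (rule norm_line_inverse_weight[OF F])
    also have "\<dots> \<le> W" unfolding W_def using that by (intro member_le_sum line_weight_nonneg) auto
    finally show ?thesis .
  qed
  have deriv: "(E has_vector_derivative \<phi> \<rho> * kernel_conv U F \<rho>) (at \<rho> within {a..b})" if \<rho>: "\<rho> \<in> {a..b}" for \<rho>
  proof (rule has_vector_derivative_quadraticI[where K = "C * ((b + 1) ^ N * (2 * (B * W)))"])
    fix \<sigma> assume \<sigma>: "\<sigma> \<in> {a..b}"
    define R where "R n \<tau> = of_real ((-1) ^ n) * line_inverse (\<lambda>z. z ^ n * F z) (\<rho> - \<tau>)" for n \<tau>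
    have dR: "derivs R" unfolding R_def by (rule derivs_reflected[OF F])
    have R0: "R 0 = (\<lambda>\<tau>. line_inverse F (\<rho> - \<tau>))" by (simp add: R_def[abs_def])
    \<comment> \<open>The first-order remainder of \<open>G\<close> in its upper end point, together
      with its derivatives in \<tau>; each is O((\<sigma> - \<rho>)^2) uniformly in \<tau>.\<close>
    define X where "X n \<tau> = (G \<sigma> n \<tau> - G \<rho> n \<tau>) - (of_real (\<sigma> - \<rho>) * \<phi> \<rho>) * R n \<tau>" for n \<tau>
    have dX: "derivs X"
      unfolding X_def by (rule derivs_diff[OF derivs_diff[OF dG dG] derivs_cmult[OF dR]])
    have zX: "X n \<tau> = 0" if "\<tau> > b" for n \<tau>
      using that \<rho> \<sigma> zG kz unfolding X_def R_def k_def by simp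
    have X: "norm (X n \<tau>) \<le> 2 * (B * W) * (\<sigma> - \<rho>)\<^sup>2" if n: "n \<le> N" for n \<tau>
    proof -
      define q where "q r = integral {a..r} (\<lambda>r. \<phi> r * k n (r - \<tau>))" for r
      have "norm (q \<sigma> - q \<rho> - (\<sigma> - \<rho>) *\<^sub>R (\<phi> \<rho> * k n (\<rho> - \<tau>))) \<le> 2 * (B * W) * (\<sigma> - \<rho>)\<^sup>2"
      proof (rule quadratic_remainder[of "{a..b}" _ _ _ _ "\<lambda>r. \<phi> r * k (Suc n) (r - \<tau>) + (vderiv ^^ 1) \<phi> r * k n (r - \<tau>)"])
        show "(q has_vector_derivative \<phi> r * k n (r - \<tau>)) (at r within {a..b})" if "r \<in> {a..b}" for r
          unfolding q_def by (rule integral_has_vector_derivative[OF _ that]) (intro continuous_intros cont\<phi> contk)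
        show "((\<lambda>r. \<phi> r * k n (r - \<tau>)) has_vector_derivative \<phi> r * k (Suc n) (r - \<tau>) + (vderiv ^^ 1) \<phi> r * k n (r - \<tau>)) (at r within {a..b})" for r
        proof -
          have "((k n \<circ> (\<lambda>r. r - \<tau>)) has_vector_derivative 1 *\<^sub>R k (Suc n) (r - \<tau>)) (at r)"
            by (rule vector_diff_chain_at) (auto intro!: derivative_eq_intros derivsD[OF dk])
          then have "((\<lambda>r. k n (r - \<tau>)) has_vector_derivative k (Suc n) (r - \<tau>)) (at r)"
            by (simp add: o_def)
          moreover have "(\<phi> has_vector_derivative (vderiv ^^ 1) \<phi> r) (at r)"
            using derivsD[OF d\<phi>, of 0 r] by simp
          ultimately have "((\<lambda>r. \<phi> r * k n (r - \<tau>)) has_vector_derivative \<phi> r * k (Suc n) (r - \<tau>) + (vderiv ^^ 1) \<phi> r * k n (r - \<tau>)) (at r)"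
            by (intro has_vector_derivative_mult)
          then show ?thesis by (rule has_vector_derivative_at_within)
        qed
        show "norm (\<phi> r * k (Suc n) (r - \<tau>) + (vderiv ^^ 1) \<phi> r * k n (r - \<tau>)) \<le> 2 * (B * W)" for r
        proof -
          have "norm (\<phi> r * k (Suc n) (r - \<tau>)) \<le> B * W" "norm ((vderiv ^^ 1) \<phi> r * k n (r - \<tau>)) \<le> B * W"
            unfolding norm_mult using n Bn W0 by (intro mult_mono B0 kW; simp)+
          then show ?thesis by (metis mult_2 norm_triangle_mono)
        qed
      qed (use \<rho> \<sigma> in auto)
      moreover have "X n \<tau> = of_real ((-1) ^ n) * (q \<sigma> - q \<rho> - (\<sigma> - \<rho>) *\<^sub>R (\<phi> \<rho> * k n (\<rho> - \<tau>)))"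
        by (simp add: X_def G_def q_def R_def k_def scaleR_conv_of_real algebra_simps)
      ultimately show ?thesis by (simp add: norm_mult norm_power)
    qed
    have "pos_bounded N (X 0) ((b + 1) ^ N * (2 * (B * W) * (\<sigma> - \<rho>)\<^sup>2))"
      by (rule pos_bounded_right_zero[OF dX ab(2) _ zX X]) (use Bn W0 in auto)
    from C(2)[OF pos_schwartz_right_zero[OF dX zX] this]
    have "norm (pos_apply U (X 0)) \<le> C * ((b + 1) ^ N * (2 * (B * W))) * (\<sigma> - \<rho>)\<^sup>2"
      by (simp add: mult.assoc)
    moreover have "pos_apply U (X 0) = E \<sigma> - E \<rho> - (\<sigma> - \<rho>) *\<^sub>R (\<phi> \<rho> * kernel_conv U F \<rho>)"
    proof -
      have Rps: "R 0 \<in> pos_schwartz" unfolding R0 by (rule reflected_pos_schwartz[OF F])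
      have "pos_apply U (X 0) = pos_apply U (G \<sigma> 0) - pos_apply U (G \<rho> 0) - (of_real (\<sigma> - \<rho>) * \<phi> \<rho>) * pos_apply U (R 0)"
        unfolding X_def pos_apply_diff[OF U pos_schwartz_diff[OF Gps Gps] pos_schwartz_cmult[OF Rps]]
          pos_apply_diff[OF U Gps Gps] pos_apply_cmult[OF U Rps] ..
      then show ?thesis
        by (simp add: E_def R0 kernel_conv_def scaleR_conv_of_real mult.assoc)
    qed
    ultimately show "norm (E \<sigma> - E \<rho> - (\<sigma> - \<rho>) *\<^sub>R (\<phi> \<rho> * kernel_conv U F \<rho>)) \<le> C * ((b + 1) ^ N * (2 * (B * W))) * (\<sigma> - \<rho>)\<^sup>2"
      by simp
  qed
  have "((\<lambda>r. \<phi> r * kernel_conv U F r) has_integral (E b - E a)) {a..b}"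
    by (rule fundamental_theorem_of_calculus[OF ab(1) deriv])
  then have "integral {a..b} (\<lambda>r. \<phi> r * kernel_conv U F r) = E b - E a"
    by (rule integral_unique)
  moreover have "G a 0 = (\<lambda>\<tau>. 0)" by (auto simp: G_def)
  then have "E a = 0" by (simp add: E_def pos_apply_0[OF U])
  moreover have "E b = pos_apply U (\<lambda>\<tau>. integral {a..b} (\<lambda>r. \<phi> r * line_inverse F (r - \<tau>)))"
    by (simp add: E_def G_def[abs_def] k0)
  ultimately show ?thesis by simp
qed

subsection \<open>The symbol \<open>s M(s)\<close>\<close>

text \<open>Convexity on the half-line together with sinh 0 = 0.\<close>

lemma sinh_scale_le:
  fixes x :: real
  assumes "0 \<le> x" "0 \<le> c" "c \<le> 1" shows "sinh (c * x) \<le> c * sinh x"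
proof -
  have "convex_on {0..} (sinh :: real \<Rightarrow> real)"
    by (rule f''_ge0_imp_convex[where f' = cosh and f'' = sinh]) (auto intro!: derivative_eq_intros)
  from convex_onD[OF this assms(2,3), of 0 x] assms(1) show ?thesis by simp
qed

text \<open>Concavity on [0, \<pi>] together with sin 0 = 0.\<close>

lemma sin_scale_ge:
  fixes x :: real
  assumes "0 \<le> x" "x \<le> pi" "0 \<le> c" "c \<le> 1" shows "c * sin x \<le> sin (c * x)"
proof -
  have "convex_on {0..pi} (\<lambda>x::real. - sin x)"
    by (rule f''_ge0_imp_convex[where f' = "\<lambda>x. - cos x" and f'' = sin])
      (auto intro!: derivative_eq_intros sin_ge_zero)
  from convex_onD[OF this assms(3,4), of 0 x] assms(1,2) show ?thesis by simp
qed

text \<open>Cauchy-Schwarz for (p, q) and the unit vector (cos \<omega>, sin \<omega>); it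
  eliminates the phase \<omega> = \<beta> ln |s|.\<close>

lemma abs_cos_sin_combination_le:
  fixes p q \<omega> :: real
  shows "\<bar>p * cos \<omega> + q * sin \<omega>\<bar> \<le> sqrt (p\<^sup>2 + q\<^sup>2)"
proof (rule real_le_rsqrt)
  have "(p * cos \<omega> + q * sin \<omega>)\<^sup>2 + (p * sin \<omega> - q * cos \<omega>)\<^sup>2 = (p\<^sup>2 + q\<^sup>2) * ((sin \<omega>)\<^sup>2 + (cos \<omega>)\<^sup>2)"
    unfolding power2_eq_square by algebra
  then have "(p * cos \<omega> + q * sin \<omega>)\<^sup>2 + (p * sin \<omega> - q * cos \<omega>)\<^sup>2 = p\<^sup>2 + q\<^sup>2" by simp
  then show "\<bar>p * cos \<omega> + q * sin \<omega>\<bar>\<^sup>2 \<le> p\<^sup>2 + q\<^sup>2"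
    using zero_le_power2[of "p * sin \<omega> - q * cos \<omega>"] by (simp only: power2_abs)
qed

text \<open>From cosh^2 x + cot^2 y sinh^2 x = 1 + sinh^2 x / sin^2 y. In this form the hypothesis
  compares amplitudes directly.\<close>

lemma cosh_sqrt_cot:
  fixes x y :: real
  assumes "sin y \<noteq> 0"
  shows "cosh x * sqrt (1 + (cot y * tanh x)\<^sup>2) = sqrt (1 + (sinh x / sin y)\<^sup>2)"
proof -
  have c: "cosh x > 0" by (rule cosh_real_pos)
  have "cosh x * sqrt (1 + (cot y * tanh x)\<^sup>2) = sqrt ((cosh x)\<^sup>2 * (1 + (cot y * tanh x)\<^sup>2))"
    using c by (simp add: real_sqrt_mult)
  also have "(cosh x)\<^sup>2 * (1 + (cot y * tanh x)\<^sup>2) = (cosh x)\<^sup>2 + (cos y / sin y * sinh x)\<^sup>2"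
    using c by (simp add: cot_def tanh_def power_mult_distrib power_divide field_simps)
  also have "\<dots> = 1 + (sinh x / sin y)\<^sup>2"
    using assms by (simp add: cosh_square_eq cos_squared_eq power_mult_distrib power_divide field_simps)
  finally show ?thesis .
qed

lemma cosh_sqrt_tan:
  fixes x y :: real
  assumes "cos y \<noteq> 0"
  shows "cosh x * sqrt (1 + (tan y * tanh x)\<^sup>2) = sqrt (1 + (sinh x / cos y)\<^sup>2)"
proof -
  have c: "cosh x > 0" by (rule cosh_real_pos)
  have "cosh x * sqrt (1 + (tan y * tanh x)\<^sup>2) = sqrt ((cosh x)\<^sup>2 * (1 + (tan y * tanh x)\<^sup>2))"
    using c by (simp add: real_sqrt_mult)
  also have "(cosh x)\<^sup>2 * (1 + (tan y * tanh x)\<^sup>2) = (cosh x)\<^sup>2 + (sin y / cos y * sinh x)\<^sup>2"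
    using c by (simp add: tan_def tanh_def power_mult_distrib power_divide field_simps)
  also have "\<dots> = 1 + (sinh x / cos y)\<^sup>2"
    using assms by (simp add: cosh_square_eq sin_squared_eq power_mult_distrib power_divide field_simps)
  finally show ?thesis .
qed

lemma powr_polar:
  fixes s :: complex
  assumes "s \<noteq> 0"
  shows "s powr Complex \<alpha> \<beta> = of_real (norm s powr \<alpha> * exp (- (\<beta> * Arg s))) * cis (\<alpha> * Arg s + \<beta> * ln (norm s))"
proof -
  have L: "Ln s = Complex (ln (norm s)) (Arg s)"
    by (rule complex_eqI) (use assms in \<open>simp_all add: Arg_eq_Im_Ln\<close>)
  have "s powr Complex \<alpha> \<beta> = exp (Complex \<alpha> \<beta> * Ln s)"
    using assms by (simp add: powr_def)
  also have "Complex \<alpha> \<beta> * Ln s = Complex (\<alpha> * ln (norm s) + - (\<beta> * Arg s)) (\<alpha> * Arg s + \<beta> * ln (norm s))"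
    unfolding L by (simp add: complex_eq_iff)
  also have "exp \<dots> = of_real (exp (\<alpha> * ln (norm s)) * exp (- (\<beta> * Arg s))) * cis (\<alpha> * Arg s + \<beta> * ln (norm s))"
    unfolding exp_add[symmetric] by (rule complex_eqI) (simp_all add: Re_exp Im_exp del: of_real_mult)
  finally show ?thesis using assms by (simp add: powr_def)
qed

lemma norm_powr_polar:
  assumes "s \<noteq> 0" shows "norm (s powr Complex \<alpha> \<beta>) = norm s powr \<alpha> * exp (- (\<beta> * Arg s))"
  by (simp add: powr_polar[OF assms] norm_mult)

lemma abs_Arg_half_plane: "0 \<le> Re s \<Longrightarrow> \<bar>Arg s\<bar> \<le> pi / 2"
  using Arg_Re_nonneg[of s] by (cases "s = 0") (auto simp: Arg_zero)

lemma half_plane_not_nonpos: "0 \<le> Re s \<Longrightarrow> s \<noteq> 0 \<Longrightarrow> s \<notin> \<real>\<^sub>\<le>\<^sub>0"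
  by (auto simp: complex_nonpos_Reals_iff complex_eq_iff)

text \<open>Away from 0 the closed half-plane avoids the branch cut. At 0 the bound |s|^\<alpha>
  exp(|\<beta>| \<pi> / 2) yields continuity with the default value
  \<open>0 powr w = 0\<close>.\<close>

lemma hp_holo_powr:
  assumes \<alpha>: "\<alpha> > 0"
  shows "hp_holo (\<lambda>s. s powr Complex \<alpha> \<beta>)"
  unfolding hp_holo_def
proof
  let ?w = "Complex \<alpha> \<beta>"
  have d: "((\<lambda>s. s powr ?w) has_field_derivative (?w * s powr (?w - 1))) (at s)" if "0 \<le> Re s" "s \<noteq> 0" for s
    by (rule has_field_derivative_powr[OF half_plane_not_nonpos[OF that]])
  show "(\<lambda>s. s powr ?w) holomorphic_on {z. 0 < Re z}"
    unfolding holomorphic_on_open[OF open_halfspace_Re_gt] using d by (metis less_imp_le mem_Collect_eq order_less_irrefl zero_complex.sel(1))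
  show "continuous_on {z. 0 \<le> Re z} (\<lambda>s. s powr ?w)"
    unfolding continuous_on_eq_continuous_within
  proof
    fix s assume s: "s \<in> {z. 0 \<le> Re z}"
    show "continuous (at s within {z. 0 \<le> Re z}) (\<lambda>s. s powr ?w)"
    proof (cases "s = 0")
      case False
      then have "isCont (\<lambda>s. s powr ?w) s" using d s by (auto intro: DERIV_isCont)
      then show ?thesis by (rule continuous_at_imp_continuous_at_within)
    next
      case True
      have "((\<lambda>s. s powr ?w) \<longlongrightarrow> 0) (at 0 within {z. 0 \<le> Re z})"
      proof (rule Lim_null_comparison)
        show "\<forall>\<^sub>F s in at 0 within {z. 0 \<le> Re z}. norm (s powr ?w) \<le> norm s powr \<alpha> * exp (\<bar>\<beta>\<bar> * (pi / 2))"
          unfolding eventually_at_filter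
        proof (intro always_eventually allI impI)
          fix s :: complex assume s: "s \<noteq> 0" "s \<in> {z. 0 \<le> Re z}"
          have "- (\<beta> * Arg s) \<le> \<bar>\<beta>\<bar> * \<bar>Arg s\<bar>"
            by (metis abs_ge_minus_self abs_mult)
          also have "\<dots> \<le> \<bar>\<beta>\<bar> * (pi / 2)"
            using abs_Arg_half_plane[of s] s by (intro mult_left_mono) auto
          finally show "norm (s powr ?w) \<le> norm s powr \<alpha> * exp (\<bar>\<beta>\<bar> * (pi / 2))"
            unfolding norm_powr_polar[OF s(1)] by (intro mult_left_mono) auto
        qed
        have "((\<lambda>s. norm s powr \<alpha>) \<longlongrightarrow> norm (0::complex) powr \<alpha>) (at 0 within {z. 0 \<le> Re z})"
          using \<alpha> by (intro tendsto_powr' tendsto_norm tendsto_ident_at tendsto_const) auto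
        then show "((\<lambda>s. norm s powr \<alpha> * exp (\<bar>\<beta>\<bar> * (pi / 2))) \<longlongrightarrow> 0) (at (0::complex) within {z. 0 \<le> Re z})"
          by (intro tendsto_mult_left_zero) simp
      qed
      then show ?thesis using True by (simp add: continuous_within)
    qed
  qed
qed

lemma hp_holo_add: "hp_holo f \<Longrightarrow> hp_holo g \<Longrightarrow> hp_holo (\<lambda>z. f z + g z)"
  by (auto simp: hp_holo_def intro!: continuous_on_add holomorphic_on_add)

lemma hp_holo_csqrt:
  assumes h: "hp_holo f" and n: "\<And>z. 0 \<le> Re z \<Longrightarrow> f z \<notin> \<real>\<^sub>\<le>\<^sub>0"
  shows "hp_holo (\<lambda>z. csqrt (f z))"
  unfolding hp_holo_def
proof
  have "continuous_on (- \<real>\<^sub>\<le>\<^sub>0) csqrt"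
    by (intro continuous_at_imp_continuous_on ballI continuous_at_csqrt) simp
  then show "continuous_on {z. 0 \<le> Re z} (\<lambda>z. csqrt (f z))"
    by (rule continuous_on_compose2) (use h n in \<open>auto simp: hp_holo_def\<close>)
  have "(csqrt \<circ> f) holomorphic_on {z. 0 < Re z}"
  proof (rule holomorphic_on_compose_gen[of f _ csqrt "- \<real>\<^sub>\<le>\<^sub>0"])
    show "csqrt holomorphic_on - \<real>\<^sub>\<le>\<^sub>0" by (rule holomorphic_on_csqrt)
  qed (use h n in \<open>auto simp: hp_holo_def\<close>)
  then show "(\<lambda>z. csqrt (f z)) holomorphic_on {z. 0 < Re z}" by (simp add: o_def)
qed

section \<open>Estimates of the symbol on the closed right half-plane\<close>

locale fractional_wave =
  fixes \<alpha> \<beta> a1 a2 b1 b2 :: real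
  assumes \<alpha>: "0 < \<alpha>" "\<alpha> < 1" and \<beta>: "0 < \<beta>" and a1: "0 < a1" "a1 < a2" and b1: "0 < b1" "b1 < b2"
    and proportional: "a2 * b1 = a1 * b2"
    and cot_cond: "a1 > 2 * b1 * cosh (\<beta> * pi / 2) * sqrt (1 + (cot (\<alpha> * pi / 2) * tanh (\<beta> * pi / 2))\<^sup>2)"
    and tan_cond: "a1 > 2 * b1 * cosh (\<beta> * pi / 2) * sqrt (1 + (tan (\<alpha> * pi / 2) * tanh (\<beta> * pi / 2))\<^sup>2)"
begin

definition "\<rho> = a2 / a1"
definition "P = frac_poly \<alpha> \<beta> a2 b2"
definition "Q = frac_poly \<alpha> \<beta> a1 b1"
definition "Z s = Q s - 1"
definition "M s = csqrt (Q s / P s)"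

lemma \<rho>: "\<rho> > 1"
  using a1 by (simp add: \<rho>_def)

lemma Q_eq: "Q s = 1 + Z s"
  by (simp add: Z_def)

lemma P_eq: "P s = 1 + of_real \<rho> * Z s"
proof -
  have "a2 = \<rho> * a1" "b2 = \<rho> * b1"
    using a1 proportional by (auto simp: \<rho>_def field_simps)
  then have e: "complex_of_real a2 = of_real \<rho> * of_real a1" "complex_of_real b2 = of_real \<rho> * of_real b1"
    unfolding of_real_mult[symmetric] by (simp_all only:)
  show ?thesis
    unfolding P_def Q_def Z_def frac_poly_def e by (simp add: algebra_simps)
qed

lemma \<alpha>_half: "0 < sin (\<alpha> * pi / 2)" "0 < cos (\<alpha> * pi / 2)"
proof -
  have "0 < \<alpha> * pi / 2" "\<alpha> * pi / 2 < pi / 2" using \<alpha> by auto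
  then show "0 < sin (\<alpha> * pi / 2)" "0 < cos (\<alpha> * pi / 2)"
    by (auto intro!: sin_gt_zero2 cos_gt_zero)
qed

text \<open>The margin in the cot condition after \<open>cosh_sqrt_cot\<close>; it becomes the
  constant in the lower bound for Im Z.\<close>

definition "c\<^sub>0 = a1 - 2 * b1 * sqrt (1 + (sinh (\<beta> * pi / 2) / sin (\<alpha> * pi / 2))\<^sup>2)"

lemma c\<^sub>0: "c\<^sub>0 > 0"
  using cot_cond cosh_sqrt_cot[of "\<alpha> * pi / 2" "\<beta> * pi / 2"] \<alpha>_half by (simp add: c\<^sub>0_def mult.assoc)

lemma tan_cond': "a1 > 2 * b1 * sqrt (1 + (sinh (\<beta> * pi / 2) / cos (\<alpha> * pi / 2))\<^sup>2)"
  using tan_cond cosh_sqrt_tan[of "\<alpha> * pi / 2" "\<beta> * pi / 2"] \<alpha>_half by (simp add: mult.assoc)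

text \<open>With |\<theta>| = c \<pi> / 2, convexity gives |sinh(\<beta> \<theta>)| \<le> c
  sinh(\<beta> \<pi> / 2), and concavity gives c \<le> sin(\<alpha> |\<theta>|) / sin(\<alpha> \<pi>
  / 2). So the ratio to sin is controlled by its value at the extreme angles; for cos, monotonicity
  is enough.\<close>

lemma abs_sinh_le:
  assumes "\<bar>\<theta>\<bar> \<le> pi / 2"
  shows "\<bar>sinh (\<beta> * \<theta>)\<bar> \<le> sinh (\<beta> * pi / 2) / sin (\<alpha> * pi / 2) * \<bar>sin (\<alpha> * \<theta>)\<bar>"
    and "\<bar>sinh (\<beta> * \<theta>)\<bar> \<le> sinh (\<beta> * pi / 2) / cos (\<alpha> * pi / 2) * cos (\<alpha> * \<theta>)"
    and "\<bar>sin (\<alpha> * \<theta>)\<bar> = sin (\<alpha> * \<bar>\<theta>\<bar>)" "0 \<le> sin (\<alpha> * \<bar>\<theta>\<bar>)" "0 < cos (\<alpha> * \<theta>)"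
proof -
  define c where "c = \<bar>\<theta>\<bar> / (pi / 2)"
  have c: "0 \<le> c" "c \<le> 1" "\<bar>\<theta>\<bar> = c * (pi / 2)" using assms by (auto simp: c_def)
  have h: "\<bar>sinh (\<beta> * \<theta>)\<bar> = sinh (c * (\<beta> * pi / 2))"
    using sinh_real_abs[of "\<beta> * \<theta>"] \<beta> c(3) by (simp add: abs_mult mult.left_commute)
  have sp: "0 \<le> sinh (\<beta> * pi / 2)" using \<beta> by simp
  have ar: "0 \<le> \<alpha> * \<bar>\<theta>\<bar>" "\<alpha> * \<bar>\<theta>\<bar> \<le> \<alpha> * pi / 2" "\<alpha> * pi / 2 < pi / 2"
    using assms \<alpha> by (auto simp: mult_left_mono)
  have ar0: "0 \<le> \<alpha> * pi / 2" using \<alpha> by simp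
  show s0: "0 \<le> sin (\<alpha> * \<bar>\<theta>\<bar>)"
    using ar pi_gt_zero by (intro sin_ge_zero) linarith+
  show sa: "\<bar>sin (\<alpha> * \<theta>)\<bar> = sin (\<alpha> * \<bar>\<theta>\<bar>)"
    using s0 by (cases "\<theta> \<ge> 0") auto
  have "sinh (c * (\<beta> * pi / 2)) \<le> c * sinh (\<beta> * pi / 2)"
    using c \<beta> by (intro sinh_scale_le) auto
  then have le: "\<bar>sinh (\<beta> * \<theta>)\<bar> \<le> c * sinh (\<beta> * pi / 2)" by (simp add: h)
  have "c * sin (\<alpha> * pi / 2) \<le> sin (c * (\<alpha> * pi / 2))"
    using c ar ar0 pi_gt_zero by (intro sin_scale_ge; linarith)
  also have "c * (\<alpha> * pi / 2) = \<alpha> * \<bar>\<theta>\<bar>" by (simp add: c(3))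
  finally have "c \<le> \<bar>sin (\<alpha> * \<theta>)\<bar> / sin (\<alpha> * pi / 2)"
    using \<alpha>_half by (simp add: sa field_simps)
  from mult_right_mono[OF this sp] le
  show "\<bar>sinh (\<beta> * \<theta>)\<bar> \<le> sinh (\<beta> * pi / 2) / sin (\<alpha> * pi / 2) * \<bar>sin (\<alpha> * \<theta>)\<bar>"
    by (simp add: mult.commute)
  have "cos (\<alpha> * pi / 2) \<le> cos (\<alpha> * \<bar>\<theta>\<bar>)"
    using ar pi_gt_zero by (intro cos_monotone_0_pi_le) linarith+
  also have ca: "cos (\<alpha> * \<bar>\<theta>\<bar>) = cos (\<alpha> * \<theta>)"
    by (cases "\<theta> \<ge> 0") auto
  finally have cc: "cos (\<alpha> * pi / 2) \<le> cos (\<alpha> * \<theta>)" .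
  then show "0 < cos (\<alpha> * \<theta>)" using \<alpha>_half by linarith
  have "1 \<le> cos (\<alpha> * \<theta>) / cos (\<alpha> * pi / 2)" using cc \<alpha>_half by simp
  from mult_left_mono[OF this sp]
  have "sinh (\<beta> * pi / 2) \<le> sinh (\<beta> * pi / 2) / cos (\<alpha> * pi / 2) * cos (\<alpha> * \<theta>)"
    by simp
  moreover have "c * sinh (\<beta> * pi / 2) \<le> sinh (\<beta> * pi / 2)"
    using mult_right_mono[OF c(2) sp] by simp
  ultimately show "\<bar>sinh (\<beta> * \<theta>)\<bar> \<le> sinh (\<beta> * pi / 2) / cos (\<alpha> * pi / 2) * cos (\<alpha> * \<theta>)"
    using le by linarith
qed

lemma sqrt_sq_bound:
  fixes p q S :: real
  assumes "\<bar>q\<bar> \<le> S * p" "0 \<le> p"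
  shows "sqrt (p\<^sup>2 + q\<^sup>2) \<le> p * sqrt (1 + S\<^sup>2)"
proof -
  have "q\<^sup>2 \<le> (S * p)\<^sup>2" using power_mono[OF assms(1), of 2] by simp
  then have "sqrt (p\<^sup>2 + q\<^sup>2) \<le> sqrt (p\<^sup>2 * (1 + S\<^sup>2))"
    by (intro real_sqrt_le_mono) (simp add: power_mult_distrib algebra_simps)
  then show ?thesis using assms(2) by (simp add: real_sqrt_mult)
qed

text \<open>The factors exp(-\<beta> \<theta>) and exp(\<beta> \<theta>) of the two complex powers,
  with phases \<alpha> \<theta> + \<omega> and \<alpha> \<theta> - \<omega>, combine into cosh and
  sinh; the oscillating part becomes linear in cos \<omega> and sin \<omega>.\<close>

lemma Z_polar:
  assumes s: "s \<noteq> 0"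
  defines "r \<equiv> norm s" and "\<theta> \<equiv> Arg s" and "\<omega> \<equiv> \<beta> * ln (norm s)"
  shows "Re (Z s) = r powr \<alpha> * (a1 * cos (\<alpha> * \<theta>) + 2 * b1 * (cosh (\<beta> * \<theta>) * cos (\<alpha> * \<theta>) * cos \<omega> + sinh (\<beta> * \<theta>) * sin (\<alpha> * \<theta>) * sin \<omega>))"
    and "Im (Z s) = r powr \<alpha> * (a1 * sin (\<alpha> * \<theta>) + 2 * b1 * (cosh (\<beta> * \<theta>) * sin (\<alpha> * \<theta>) * cos \<omega> + - (sinh (\<beta> * \<theta>) * cos (\<alpha> * \<theta>)) * sin \<omega>))"
proof -
  have p0: "s powr of_real \<alpha> = of_real (r powr \<alpha>) * cis (\<alpha> * \<theta>)"
    using powr_polar[OF s, of \<alpha> 0] by (simp add: r_def \<theta>_def complex_of_real_def)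
  have p1: "s powr Complex \<alpha> \<beta> = of_real (r powr \<alpha> * exp (- (\<beta> * \<theta>))) * cis (\<alpha> * \<theta> + \<omega>)"
    using powr_polar[OF s, of \<alpha> \<beta>] by (simp add: r_def \<theta>_def \<omega>_def)
  have p2: "s powr Complex \<alpha> (- \<beta>) = of_real (r powr \<alpha> * exp (\<beta> * \<theta>)) * cis (\<alpha> * \<theta> - \<omega>)"
    using powr_polar[OF s, of \<alpha> "- \<beta>"] by (simp add: r_def \<theta>_def \<omega>_def)
  have Z: "Z s = of_real a1 * s powr of_real \<alpha> + of_real b1 * (s powr Complex \<alpha> \<beta> + s powr Complex \<alpha> (- \<beta>))"
    by (simp add: Z_def Q_def frac_poly_def)
  show "Re (Z s) = r powr \<alpha> * (a1 * cos (\<alpha> * \<theta>) + 2 * b1 * (cosh (\<beta> * \<theta>) * cos (\<alpha> * \<theta>) * cos \<omega> + sinh (\<beta> * \<theta>) * sin (\<alpha> * \<theta>) * sin \<omega>))"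
    unfolding Z p0 p1 p2
    by (simp add: cos_add cos_diff cosh_field_def sinh_field_def add_divide_distrib diff_divide_distrib algebra_simps)
  show "Im (Z s) = r powr \<alpha> * (a1 * sin (\<alpha> * \<theta>) + 2 * b1 * (cosh (\<beta> * \<theta>) * sin (\<alpha> * \<theta>) * cos \<omega> + - (sinh (\<beta> * \<theta>) * cos (\<alpha> * \<theta>)) * sin \<omega>))"
    unfolding Z p0 p1 p2
    by (simp add: sin_add sin_diff cosh_field_def sinh_field_def add_divide_distrib diff_divide_distrib algebra_simps)
qed

lemma Z_0: "Z 0 = 0"
  by (simp add: Z_def Q_def frac_poly_def)

text \<open>The oscillating part has amplitude sqrt(cos^2 (\<alpha> \<theta>) + sinh^2 (\<beta>
  \<theta>)), which the tan condition keeps below a1 cos(\<alpha> \<theta>) / (2 b1).\<close>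

lemma Re_Z_nonneg:
  assumes "0 \<le> Re s" shows "0 \<le> Re (Z s)"
proof (cases "s = 0")
  case False
  define \<theta> \<omega> where "\<theta> = Arg s" and "\<omega> = \<beta> * ln (norm s)"
  have \<theta>: "\<bar>\<theta>\<bar> \<le> pi / 2" unfolding \<theta>_def by (rule abs_Arg_half_plane[OF assms])
  let ?S = "sinh (\<beta> * pi / 2) / cos (\<alpha> * pi / 2)" and ?c = "cos (\<alpha> * \<theta>)"
  let ?E = "cosh (\<beta> * \<theta>) * ?c * cos \<omega> + sinh (\<beta> * \<theta>) * sin (\<alpha> * \<theta>) * sin \<omega>"
  have "\<bar>?E\<bar> \<le> sqrt ((cosh (\<beta> * \<theta>) * ?c)\<^sup>2 + (sinh (\<beta> * \<theta>) * sin (\<alpha> * \<theta>))\<^sup>2)"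
    by (rule abs_cos_sin_combination_le)
  also have "(cosh (\<beta> * \<theta>) * ?c)\<^sup>2 + (sinh (\<beta> * \<theta>) * sin (\<alpha> * \<theta>))\<^sup>2 = ?c\<^sup>2 + (sinh (\<beta> * \<theta>))\<^sup>2"
    by (simp add: power_mult_distrib cosh_square_eq sin_squared_eq algebra_simps)
  also have "sqrt \<dots> \<le> ?c * sqrt (1 + ?S\<^sup>2)"
    using abs_sinh_le[OF \<theta>] by (intro sqrt_sq_bound) auto
  finally have "2 * b1 * \<bar>?E\<bar> \<le> 2 * b1 * (?c * sqrt (1 + ?S\<^sup>2))"
    using b1 by (intro mult_left_mono) auto
  also have "\<dots> = (2 * b1 * sqrt (1 + ?S\<^sup>2)) * ?c" by simp
  also have "\<dots> \<le> a1 * ?c"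
    using tan_cond' abs_sinh_le(5)[OF \<theta>] by (intro mult_right_mono) auto
  finally have "0 \<le> a1 * ?c + 2 * b1 * ?E"
    using b1 abs_ge_minus_self[of "2 * b1 * ?E"] by (simp add: abs_mult)
  then show ?thesis
    unfolding Z_polar(1)[OF False] \<theta>_def \<omega>_def by (intro mult_nonneg_nonneg) auto
qed (simp add: Z_0)

text \<open>Multiplication by Im s treats both signs at once. The amplitude is now sqrt(sin^2
  (\<alpha> \<theta>) + sinh^2 (\<beta> \<theta>)), and the cot condition leaves the multiple
  \<open>c\<^sub>0\<close> of |sin(\<alpha> \<theta>)|; finally sin(\<alpha> |\<theta>|) \<ge>
  \<alpha> sin |\<theta>| leads back to Im s = r sin \<theta>.\<close>

lemma Im_Z_bound:
  assumes "0 \<le> Re s" "s \<noteq> 0"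
  shows "\<alpha> * c\<^sub>0 * norm s powr (\<alpha> - 1) * (Im s)\<^sup>2 \<le> Im s * Im (Z s)"
proof -
  define r \<theta> \<omega> where "r = norm s" and "\<theta> = Arg s" and "\<omega> = \<beta> * ln (norm s)"
  have \<theta>: "\<bar>\<theta>\<bar> \<le> pi / 2" unfolding \<theta>_def by (rule abs_Arg_half_plane[OF assms(1)])
  have r: "r > 0" using assms by (simp add: r_def)
  have "s = rcis r \<theta>" by (simp add: r_def \<theta>_def rcis_cmod_Arg)
  then have Ims: "Im s = r * sin \<theta>" by simp
  let ?S = "sinh (\<beta> * pi / 2) / sin (\<alpha> * pi / 2)" and ?s = "sin (\<alpha> * \<theta>)"
  let ?E = "cosh (\<beta> * \<theta>) * ?s * cos \<omega> + - (sinh (\<beta> * \<theta>) * cos (\<alpha> * \<theta>)) * sin \<omega>"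
  have "\<bar>?E\<bar> \<le> sqrt ((cosh (\<beta> * \<theta>) * ?s)\<^sup>2 + (- (sinh (\<beta> * \<theta>) * cos (\<alpha> * \<theta>)))\<^sup>2)"
    by (rule abs_cos_sin_combination_le)
  also have "(cosh (\<beta> * \<theta>) * ?s)\<^sup>2 + (- (sinh (\<beta> * \<theta>) * cos (\<alpha> * \<theta>)))\<^sup>2 = \<bar>?s\<bar>\<^sup>2 + (sinh (\<beta> * \<theta>))\<^sup>2"
    by (simp add: power_mult_distrib cosh_square_eq cos_squared_eq algebra_simps)
  also have "sqrt \<dots> \<le> \<bar>?s\<bar> * sqrt (1 + ?S\<^sup>2)"
    using abs_sinh_le(1)[OF \<theta>] by (intro sqrt_sq_bound) auto
  finally have E: "\<bar>?E\<bar> \<le> \<bar>?s\<bar> * sqrt (1 + ?S\<^sup>2)" .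
  \<comment> \<open>sin \<theta> and sin(\<alpha> \<theta>) have equal signs, since 0 < \<alpha> < 1
    and |\<theta>| \<le> \<pi> / 2.\<close>
  have same: "sin \<theta> * ?s = \<bar>sin \<theta>\<bar> * \<bar>?s\<bar>"
  proof -
    have "0 \<le> sin \<bar>\<theta>\<bar> * sin (\<alpha> * \<bar>\<theta>\<bar>)"
      by (rule mult_nonneg_nonneg[OF sin_ge_zero abs_sinh_le(4)[OF \<theta>]]) (use \<theta> in auto)
    then have "0 \<le> sin \<theta> * ?s" by (cases "\<theta> \<ge> 0") auto
    then show ?thesis by (simp add: abs_mult[symmetric])
  qed
  have "\<alpha> * sin \<bar>\<theta>\<bar> \<le> sin (\<alpha> * \<bar>\<theta>\<bar>)"
    using \<alpha> \<theta> by (intro sin_scale_ge) auto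
  moreover have "sin \<bar>\<theta>\<bar> = \<bar>sin \<theta>\<bar>"
    using \<theta> sin_ge_zero[of "\<bar>\<theta>\<bar>"] by (cases "\<theta> \<ge> 0") auto
  ultimately have as: "\<alpha> * \<bar>sin \<theta>\<bar> \<le> \<bar>?s\<bar>" by (simp add: abs_sinh_le(3)[OF \<theta>])
  have "sin \<theta> * (2 * b1 * ?E) \<ge> - (\<bar>sin \<theta>\<bar> * (2 * b1 * (\<bar>?s\<bar> * sqrt (1 + ?S\<^sup>2))))"
  proof -
    have "\<bar>sin \<theta> * (2 * b1 * ?E)\<bar> \<le> \<bar>sin \<theta>\<bar> * (2 * b1 * (\<bar>?s\<bar> * sqrt (1 + ?S\<^sup>2)))"
      unfolding abs_mult using b1 E by (intro mult_left_mono mult_mono) auto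
    then show ?thesis by linarith
  qed
  then have "\<bar>sin \<theta>\<bar> * \<bar>?s\<bar> * c\<^sub>0 \<le> sin \<theta> * (a1 * ?s + 2 * b1 * ?E)"
    using same by (simp add: c\<^sub>0_def algebra_simps)
  moreover have "\<bar>sin \<theta>\<bar> * (\<alpha> * \<bar>sin \<theta>\<bar>) * c\<^sub>0 \<le> \<bar>sin \<theta>\<bar> * \<bar>?s\<bar> * c\<^sub>0"
    using as c\<^sub>0 by (intro mult_right_mono mult_left_mono) auto
  moreover have "\<bar>sin \<theta>\<bar> * (\<alpha> * \<bar>sin \<theta>\<bar>) * c\<^sub>0 = \<alpha> * c\<^sub>0 * (sin \<theta>)\<^sup>2"
    using abs_mult_self_eq[of "sin \<theta>"] unfolding power2_eq_square by algebra
  ultimately have "\<alpha> * c\<^sub>0 * (sin \<theta>)\<^sup>2 \<le> sin \<theta> * (a1 * ?s + 2 * b1 * ?E)" by linarith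
  then have "(r * r powr \<alpha>) * (\<alpha> * c\<^sub>0 * (sin \<theta>)\<^sup>2) \<le> (r * r powr \<alpha>) * (sin \<theta> * (a1 * ?s + 2 * b1 * ?E))"
    using r by (intro mult_left_mono) auto
  also have "\<dots> = Im s * Im (Z s)"
    unfolding Z_polar(2)[OF assms(2)] Ims r_def \<theta>_def \<omega>_def by (simp add: algebra_simps)
  also have "(r * r powr \<alpha>) * (\<alpha> * c\<^sub>0 * (sin \<theta>)\<^sup>2) = \<alpha> * c\<^sub>0 * r powr (\<alpha> - 1) * (Im s)\<^sup>2"
    using r by (simp add: Ims power2_eq_square powr_diff field_simps)
  finally show ?thesis by (simp add: r_def)
qed

text \<open>On the half-plane both complex powers are at most |s|^\<alpha> exp(\<beta> \<pi> / 2) in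
  modulus.\<close>

definition "A\<^sub>0 = a1 + b1 * (exp (\<beta> * (pi / 2)) + exp (\<beta> * (pi / 2)))"

lemma A\<^sub>0: "A\<^sub>0 > 0"
  using a1 b1 by (simp add: A\<^sub>0_def add_pos_pos)

lemma norm_Z_le:
  assumes "0 \<le> Re s" shows "norm (Z s) \<le> A\<^sub>0 * norm s powr \<alpha>"
proof (cases "s = 0")
  case False
  have Z: "Z s = of_real a1 * s powr Complex \<alpha> 0 + of_real b1 * (s powr Complex \<alpha> \<beta> + s powr Complex \<alpha> (- \<beta>))"
    by (simp add: Z_def Q_def frac_poly_def complex_of_real_def)
  have t: "\<bar>Arg s\<bar> \<le> pi / 2" by (rule abs_Arg_half_plane[OF assms])
  have t1: "- (\<beta> * Arg s) \<le> \<beta> * (pi / 2)" "\<beta> * Arg s \<le> \<beta> * (pi / 2)"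
    using mult_left_mono[of "- Arg s" "pi / 2" \<beta>] mult_left_mono[of "Arg s" "pi / 2" \<beta>] t \<beta> by auto
  have n: "norm (s powr Complex \<alpha> 0) \<le> norm s powr \<alpha>"
    "norm (s powr Complex \<alpha> \<beta>) \<le> norm s powr \<alpha> * exp (\<beta> * (pi / 2))"
    "norm (s powr Complex \<alpha> (- \<beta>)) \<le> norm s powr \<alpha> * exp (\<beta> * (pi / 2))"
    unfolding norm_powr_polar[OF False] using t1 by (auto intro!: mult_left_mono)
  have "norm (Z s) \<le> a1 * norm s powr \<alpha> + b1 * (norm s powr \<alpha> * exp (\<beta> * (pi / 2)) + norm s powr \<alpha> * exp (\<beta> * (pi / 2)))"
    unfolding Z
  proof (rule norm_triangle_mono)
    show "norm (of_real a1 * s powr Complex \<alpha> 0) \<le> a1 * norm s powr \<alpha>"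
      using n(1) a1 by (simp add: norm_mult mult_left_mono)
    show "norm (of_real b1 * (s powr Complex \<alpha> \<beta> + s powr Complex \<alpha> (- \<beta>)))
        \<le> b1 * (norm s powr \<alpha> * exp (\<beta> * (pi / 2)) + norm s powr \<alpha> * exp (\<beta> * (pi / 2)))"
      using mult_left_mono[OF norm_triangle_mono[OF n(2,3)], of b1] b1 by (simp add: norm_mult)
  qed
  then show ?thesis by (simp add: A\<^sub>0_def algebra_simps)
qed (simp add: Z_0)

lemma PQ_nonzero:
  assumes "0 \<le> Re s" shows "P s \<noteq> 0" "Q s \<noteq> 0"
proof -
  have "Re (P s) \<ge> 1" "Re (Q s) \<ge> 1"
    using Re_Z_nonneg[OF assms] \<rho> by (auto simp: P_eq Q_eq)
  then show "P s \<noteq> 0" "Q s \<noteq> 0" by auto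
qed

text \<open>Componentwise comparison of 1 + Z, 1 + \<rho> Z and \<rho> + \<rho> Z, using Re Z \<ge>
  0 and \<rho> > 1.\<close>

lemma norm_Q_P:
  assumes "0 \<le> Re s" shows "norm (Q s) \<le> norm (P s)" "norm (P s) \<le> \<rho> * norm (Q s)"
proof -
  define x y where "x = Re (Z s)" and "y = Im (Z s)"
  have x: "x \<ge> 0" using Re_Z_nonneg[OF assms] by (simp add: x_def)
  have nQ: "(norm (Q s))\<^sup>2 = (1 + x)\<^sup>2 + y\<^sup>2" by (simp add: Q_eq cmod_power2 x_def y_def)
  have nP: "(norm (P s))\<^sup>2 = (1 + \<rho> * x)\<^sup>2 + (\<rho> * y)\<^sup>2" by (simp add: P_eq cmod_power2 x_def y_def)
  have "x \<le> \<rho> * x" using x \<rho> mult_right_mono[of 1 \<rho> x] by simp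
  then have "(1 + x)\<^sup>2 \<le> (1 + \<rho> * x)\<^sup>2" using x by (intro power_mono) auto
  moreover have "\<bar>y\<bar> \<le> \<bar>\<rho> * y\<bar>" using \<rho> mult_right_mono[of 1 \<rho> "\<bar>y\<bar>"] by (simp add: abs_mult)
  then have "y\<^sup>2 \<le> (\<rho> * y)\<^sup>2" by (simp add: abs_le_square_iff)
  ultimately have "(norm (Q s))\<^sup>2 \<le> (norm (P s))\<^sup>2" unfolding nQ nP by linarith
  then show "norm (Q s) \<le> norm (P s)" by (rule power2_le_imp_le) simp
  have "1 + \<rho> * x \<le> \<rho> * (1 + x)" using \<rho> by (simp add: distrib_left)
  then have "(1 + \<rho> * x)\<^sup>2 \<le> (\<rho> * (1 + x))\<^sup>2" using x \<rho> by (intro power_mono) auto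
  then have "(norm (P s))\<^sup>2 \<le> (\<rho> * (1 + x))\<^sup>2 + (\<rho> * y)\<^sup>2"
    unfolding nP by (rule add_right_mono)
  also have "\<dots> = \<rho>\<^sup>2 * (norm (Q s))\<^sup>2"
    unfolding nQ power_mult_distrib by (rule distrib_left[symmetric])
  finally have "(norm (P s))\<^sup>2 \<le> (\<rho> * norm (Q s))\<^sup>2"
    by (simp only: power_mult_distrib)
  then show "norm (P s) \<le> \<rho> * norm (Q s)" by (rule power2_le_imp_le) (use \<rho> in simp)
qed

text \<open>Q times the conjugate of P is 1 + \<rho> |Z|^2 + (1 + \<rho>) Re Z - i (\<rho> - 1) Im
  Z. So Q / P stays in the right half-plane, off the branch cut of the square root, and its
  imaginary part is opposite in sign to Im Z.\<close>

lemma QP_ratio: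
  assumes "0 \<le> Re s"
  shows "Re (Q s / P s) > 0" "Im (Q s / P s) = - ((\<rho> - 1) * Im (Z s)) / (norm (P s))\<^sup>2"
    "norm (Q s / P s) \<le> 1" "1 / \<rho> \<le> norm (Q s / P s)"
proof -
  define x y where "x = Re (Z s)" and "y = Im (Z s)"
  have x: "x \<ge> 0" using Re_Z_nonneg[OF assms] by (simp add: x_def)
  have p: "norm (P s) > 0" using PQ_nonzero[OF assms] by simp
  have "Re (Q s / P s) = (1 + \<rho> * (x\<^sup>2 + y\<^sup>2) + (1 + \<rho>) * x) / (norm (P s))\<^sup>2"
    unfolding Re_divide' by (simp add: P_eq Q_eq x_def y_def power2_eq_square algebra_simps)
  moreover have "1 + \<rho> * (x\<^sup>2 + y\<^sup>2) + (1 + \<rho>) * x > 0"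
    using x \<rho> by (intro add_pos_nonneg mult_nonneg_nonneg) auto
  ultimately show "Re (Q s / P s) > 0" using p by simp
  show "Im (Q s / P s) = - ((\<rho> - 1) * Im (Z s)) / (norm (P s))\<^sup>2"
    unfolding Im_divide' by (simp add: P_eq Q_eq algebra_simps)
  show "norm (Q s / P s) \<le> 1" "1 / \<rho> \<le> norm (Q s / P s)"
    using norm_Q_P[OF assms] p \<rho> by (auto simp: norm_divide field_simps)
qed

lemma M_square: "(M s)\<^sup>2 = Q s / P s"
  by (simp add: M_def)

text \<open>Re (M^2) > 0 makes |M|^2 at most 2 (Re M)^2, while |M|^2 = |Q / P| \<ge> 1 /
  \<rho>.\<close>

lemma M_bounds:
  assumes s: "0 \<le> Re s"
  shows "norm (M s) \<le> 1" "1 / sqrt (2 * \<rho>) \<le> Re (M s)" "Re (M s) \<le> 1"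
proof -
  have n2: "(norm (M s))\<^sup>2 = norm (Q s / P s)" by (simp only: norm_power[symmetric] M_square)
  then have "(norm (M s))\<^sup>2 \<le> 1\<^sup>2" using QP_ratio(3)[OF s] by simp
  then show 1: "norm (M s) \<le> 1" by (rule power2_le_imp_le) simp
  then show "Re (M s) \<le> 1" using complex_Re_le_cmod[of "M s"] by linarith
  have R0: "0 \<le> Re (M s)" unfolding M_def by (rule Re_csqrt)
  have "(Re (M s))\<^sup>2 - (Im (M s))\<^sup>2 = Re (Q s / P s)"
    using arg_cong[OF M_square, of Re s] by (simp add: power2_eq_square)
  then have "(norm (M s))\<^sup>2 \<le> 2 * (Re (M s))\<^sup>2"
    using QP_ratio(1)[OF s] unfolding cmod_power2 by linarith
  then have "1 / \<rho> \<le> 2 * (Re (M s))\<^sup>2" using n2 QP_ratio(4)[OF s] by linarith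
  then have "1 / (2 * \<rho>) \<le> (Re (M s))\<^sup>2" using \<rho> by (simp add: field_simps)
  from real_sqrt_le_mono[OF this] R0 show "1 / sqrt (2 * \<rho>) \<le> Re (M s)"
    by (simp add: real_sqrt_divide)
qed

text \<open>In Re(s M) = Re s Re M - Im s Im M both terms are nonnegative, because Im M = Im(Q / P)
  / (2 Re M) is opposite in sign to Im s. As Re M \<le> 1, removing it from the denominator only
  decreases the second term.\<close>

lemma Re_sM_lower:
  assumes s: "0 \<le> Re s" "s \<noteq> 0"
  shows "Re (s * M s) \<ge> 1 / sqrt (2 * \<rho>) * Re s + ((\<rho> - 1) * (\<alpha> * c\<^sub>0) / 2) * (norm s powr (\<alpha> - 1) * (Im s)\<^sup>2) / (norm (P s))\<^sup>2"
proof -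
  have p: "norm (P s) > 0" using PQ_nonzero[OF s(1)] by simp
  have R: "Re (M s) > 0" "Re (M s) \<le> 1"
    using M_bounds[OF s(1)] \<rho> by (auto intro: less_le_trans[of 0 "1 / sqrt (2 * \<rho>)"])
  define I where "I = Im s * Im (Z s)"
  have I: "\<alpha> * c\<^sub>0 * norm s powr (\<alpha> - 1) * (Im s)\<^sup>2 \<le> I" unfolding I_def by (rule Im_Z_bound[OF s])
  have "0 \<le> \<alpha> * c\<^sub>0 * norm s powr (\<alpha> - 1) * (Im s)\<^sup>2" using \<alpha> c\<^sub>0 by simp
  then have I0: "0 \<le> I" using I by linarith
  have "2 * (Re (M s) * Im (M s)) = Im (Q s / P s)"
    using arg_cong[OF M_square, of Im s] by (simp add: power2_eq_square mult.commute)
  also have "\<dots> = - ((\<rho> - 1) * Im (Z s)) / (norm (P s))\<^sup>2" by (rule QP_ratio(2)[OF s(1)])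
  finally have e: "2 * (Re (M s) * Im (M s)) = - ((\<rho> - 1) * Im (Z s)) / (norm (P s))\<^sup>2" .
  have "Im (M s) = 2 * (Re (M s) * Im (M s)) / (2 * Re (M s))"
    using R by simp
  then have "Im (M s) = - ((\<rho> - 1) * Im (Z s)) / (norm (P s))\<^sup>2 / (2 * Re (M s))"
    by (simp only: e)
  then have "- (Im s * Im (M s)) = ((\<rho> - 1) * I / (2 * (norm (P s))\<^sup>2)) * (1 / Re (M s))"
    by (simp add: I_def mult.commute mult.left_commute)
  also have "\<dots> \<ge> ((\<rho> - 1) * I / (2 * (norm (P s))\<^sup>2)) * 1"
    using R I0 \<rho> by (intro mult_left_mono) auto
  finally have 1: "- (Im s * Im (M s)) \<ge> (\<rho> - 1) * I / (2 * (norm (P s))\<^sup>2)" by simp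
  have "(\<rho> - 1) * I / (2 * (norm (P s))\<^sup>2) \<ge> (\<rho> - 1) * (\<alpha> * c\<^sub>0 * norm s powr (\<alpha> - 1) * (Im s)\<^sup>2) / (2 * (norm (P s))\<^sup>2)"
    using I \<rho> by (intro divide_right_mono mult_left_mono) auto
  moreover have "Re s * Re (M s) \<ge> Re s * (1 / sqrt (2 * \<rho>))"
    using M_bounds(2)[OF s(1)] s(1) by (intro mult_left_mono) auto
  ultimately show ?thesis using 1 by (simp add: algebra_simps)
qed

text \<open>Up to a constant, a lower bound of \<open>Re (s M(s))\<close> on the imaginary axis: \<open>M(s) = sqrt (Q / P)\<close> tends to the
  real numbers \<open>1\<close> at \<open>0\<close> and \<open>1 / sqrt \<rho>\<close> at infinity with errors of order \<open>\<bar>s\<bar>^\<alpha>\<close> and \<open>\<bar>s\<bar>^(- \<alpha>)\<close>.\<close>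

definition "mdecay r = (if 1 \<le> r then r powr (1 - \<alpha>) else r powr (1 + \<alpha>))"

lemma mdecay_nonneg: "0 \<le> mdecay r"
  by (simp add: mdecay_def)

text \<open>mdecay(r) / r^2 equals r^(\<alpha> - 1) / max(1, r^\<alpha>)^2, up to constants the
  coefficient of (Im s)^2 in the preceding bound. For the part (Re s)^2 of |s|^2, the inequality
  mdecay(r) \<le> r and the term in Re s suffice.\<close>

lemma Re_sM_ge: "\<exists>c>0. \<forall>s. 0 \<le> Re s \<longrightarrow> c * mdecay (norm s) \<le> Re (s * M s)"
proof -
  define B where "B = 1 + \<rho> * A\<^sub>0"
  have B: "B \<ge> 1" using A\<^sub>0 \<rho> by (simp add: B_def)
  define c2 where "c2 = (\<rho> - 1) * (\<alpha> * c\<^sub>0) / 2 / B\<^sup>2"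
  define c where "c = min (1 / sqrt (2 * \<rho>)) c2"
  have c2: "c2 > 0" using \<rho> \<alpha> c\<^sub>0 B by (simp add: c2_def)
  have c: "c > 0" "c \<le> 1 / sqrt (2 * \<rho>)" "c \<le> c2" using c2 \<rho> by (auto simp: c_def)
  have "c * mdecay (norm s) \<le> Re (s * M s)" if s: "0 \<le> Re s" for s
  proof (cases "s = 0")
    case False
    define r where "r = norm s"
    have r: "r > 0" using False by (simp add: r_def)
    have r2: "r\<^sup>2 = (Re s)\<^sup>2 + (Im s)\<^sup>2" by (simp add: r_def cmod_power2)
    \<comment> \<open>By the bound on Z, |P(s)| is at most a constant multiple of this
      quantity.\<close>
    define e where "e = max 1 (r powr \<alpha>)"
    have e: "e \<ge> 1" by (simp add: e_def)
    have p: "norm (P s) > 0" using PQ_nonzero[OF s] by simp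
    have "norm (P s) \<le> 1 + \<rho> * (A\<^sub>0 * r powr \<alpha>)"
      unfolding P_eq using norm_Z_le[OF s] \<rho>
      by (intro norm_triangle_le) (auto simp: norm_mult r_def intro!: mult_left_mono)
    also have "\<dots> \<le> e + \<rho> * (A\<^sub>0 * e)"
      using \<rho> A\<^sub>0 by (intro add_mono mult_left_mono) (auto simp: e_def)
    finally have "norm (P s) \<le> B * e" by (simp add: B_def algebra_simps)
    then have "(norm (P s))\<^sup>2 \<le> (B * e)\<^sup>2" using p by (intro power_mono) auto
    then have P2: "(norm (P s))\<^sup>2 \<le> B\<^sup>2 * e\<^sup>2" by (simp add: power_mult_distrib)
    have "c2 * (r powr (\<alpha> - 1) * (Im s)\<^sup>2) / e\<^sup>2 = ((\<rho> - 1) * (\<alpha> * c\<^sub>0) / 2) * (r powr (\<alpha> - 1) * (Im s)\<^sup>2) / (B\<^sup>2 * e\<^sup>2)"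
      by (simp add: c2_def)
    also have "\<dots> \<le> ((\<rho> - 1) * (\<alpha> * c\<^sub>0) / 2) * (r powr (\<alpha> - 1) * (Im s)\<^sup>2) / (norm (P s))\<^sup>2"
      using P2 p \<rho> \<alpha> c\<^sub>0 B e by (intro divide_left_mono mult_nonneg_nonneg mult_pos_pos) auto
    finally have low: "1 / sqrt (2 * \<rho>) * Re s + c2 * (r powr (\<alpha> - 1) * (Im s)\<^sup>2) / e\<^sup>2 \<le> Re (s * M s)"
      using Re_sM_lower[OF s False] by (simp add: r_def)
    have Im': "c * (mdecay r / r\<^sup>2 * (Im s)\<^sup>2) \<le> c2 * (r powr (\<alpha> - 1) * (Im s)\<^sup>2) / e\<^sup>2"
    proof -
      have "mdecay r / r\<^sup>2 = r powr (\<alpha> - 1) / e\<^sup>2"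
      proof (cases "r \<ge> 1")
        case True
        then have ee: "e = r powr \<alpha>" using \<alpha> by (simp add: e_def ge_one_powr_ge_zero max_def)
        have "mdecay r / r\<^sup>2 = r powr (1 - \<alpha>) / r powr 2" using True r by (simp add: mdecay_def)
        also have "\<dots> = r powr ((1 - \<alpha>) - 2)" by (simp only: powr_diff)
        also have "(1 - \<alpha>) - 2 = (\<alpha> - 1) - (\<alpha> + \<alpha>)" by simp
        also have "r powr \<dots> = r powr (\<alpha> - 1) / r powr (\<alpha> + \<alpha>)" by (simp only: powr_diff)
        also have "r powr (\<alpha> + \<alpha>) = e\<^sup>2" by (simp only: ee power2_eq_square powr_add)
        finally show ?thesis .
      next
        case False
        have "r powr \<alpha> \<le> 1 powr \<alpha>" using False r \<alpha> by (intro powr_mono2) auto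
        then have ee: "e = 1" by (simp add: e_def)
        have "mdecay r / r\<^sup>2 = r powr (1 + \<alpha>) / r powr 2" using False r by (simp add: mdecay_def)
        also have "\<dots> = r powr (\<alpha> - 1)" by (simp add: powr_diff[symmetric])
        finally show ?thesis by (simp add: ee)
      qed
      then have "c * (mdecay r / r\<^sup>2 * (Im s)\<^sup>2) = c * (r powr (\<alpha> - 1) * (Im s)\<^sup>2 / e\<^sup>2)" by simp
      also have "\<dots> \<le> c2 * (r powr (\<alpha> - 1) * (Im s)\<^sup>2 / e\<^sup>2)"
        using c by (intro mult_right_mono) auto
      finally show ?thesis by simp
    qed
    have Re': "c * (mdecay r / r\<^sup>2 * (Re s)\<^sup>2) \<le> 1 / sqrt (2 * \<rho>) * Re s"
    proof -
      have m: "mdecay r \<le> r"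
      proof (cases "r \<ge> 1")
        case True
        then have "r powr (1 - \<alpha>) \<le> r powr 1" using \<alpha> by (intro powr_mono) auto
        then show ?thesis using True by (simp add: mdecay_def)
      next
        case False
        then have "r powr (1 + \<alpha>) \<le> r powr 1" using \<alpha> r by (intro powr_mono') auto
        then show ?thesis using False r by (simp add: mdecay_def)
      qed
      have "mdecay r / r\<^sup>2 * (Re s)\<^sup>2 \<le> r / r\<^sup>2 * (Re s)\<^sup>2"
        using m by (intro mult_right_mono divide_right_mono) auto
      also have "\<dots> = Re s * (Re s / r)" using r by (simp add: power2_eq_square)
      also have "\<dots> \<le> Re s * 1"
        using s r complex_Re_le_cmod[of s] by (intro mult_left_mono) (auto simp: r_def)
      finally have "mdecay r / r\<^sup>2 * (Re s)\<^sup>2 \<le> Re s" by simp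
      then have "c * (mdecay r / r\<^sup>2 * (Re s)\<^sup>2) \<le> c * Re s" using c by (intro mult_left_mono) auto
      also have "\<dots> \<le> 1 / sqrt (2 * \<rho>) * Re s" using c s by (intro mult_right_mono) auto
      finally show ?thesis .
    qed
    have "c * mdecay r = c * (mdecay r / r\<^sup>2 * (Re s)\<^sup>2) + c * (mdecay r / r\<^sup>2 * (Im s)\<^sup>2)"
    proof -
      have "c * (mdecay r / r\<^sup>2 * (Re s)\<^sup>2) + c * (mdecay r / r\<^sup>2 * (Im s)\<^sup>2) = c * (mdecay r / r\<^sup>2 * r\<^sup>2)"
        unfolding r2 by (simp only: distrib_left)
      then show ?thesis using r by simp
    qed
    then show ?thesis using low Im' Re' by (simp add: r_def)
  qed (simp add: mdecay_def)
  then show ?thesis using c(1) by blast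
qed

lemma hp_holo_frac_poly: "hp_holo (frac_poly \<alpha> \<beta> a b)"
proof -
  note h = hp_holo_powr[OF \<alpha>(1)] and c = hp_holoI_entire[OF holomorphic_on_const]
  have "hp_holo (\<lambda>s. 1 + of_real a * s powr Complex \<alpha> 0 + of_real b * (s powr Complex \<alpha> \<beta> + s powr Complex \<alpha> (- \<beta>)))"
    by (rule hp_holo_add[OF hp_holo_add[OF c hp_holo_mult[OF c h]] hp_holo_mult[OF c hp_holo_add[OF h h]]])
  then show ?thesis
    by (simp add: frac_poly_def[abs_def] complex_of_real_def)
qed

lemma hp_holo_P: "hp_holo P" and hp_holo_Q: "hp_holo Q"
  unfolding P_def Q_def by (rule hp_holo_frac_poly)+

lemma hp_holo_M: "hp_holo M"
  unfolding M_def[abs_def]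
proof (rule hp_holo_csqrt)
  show "hp_holo (\<lambda>s. Q s / P s)"
    by (rule hp_holo_divide[OF hp_holo_Q hp_holo_P]) (rule PQ_nonzero)
  show "Q s / P s \<notin> \<real>\<^sub>\<le>\<^sub>0" if "0 \<le> Re s" for s
    using QP_ratio(1)[OF that] by (auto simp: complex_nonpos_Reals_iff)
qed

end

subsection \<open>The transformed kernel\<close>

text \<open>(1 - exp(-z)) / z as an entire function.\<close>

definition expm1_quot :: "complex \<Rightarrow> complex" where
  "expm1_quot z = (if z = 0 then 1 else (1 - exp (- z)) / z)"

lemma expm1_quot_holomorphic: "expm1_quot holomorphic_on UNIV"
proof -
  have d: "deriv (\<lambda>z::complex. - exp (- z)) 0 = 1"
    by (rule DERIV_imp_deriv) (auto intro!: derivative_eq_intros)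
  \<comment> \<open>The quotient is the difference quotient at 0 of -exp(-z), whose singularity
    \<open>pole_lemma_open\<close> removes.\<close>
  have "(\<lambda>z. if z = 0 then deriv (\<lambda>z::complex. - exp (- z)) 0 else (- exp (- z) - - exp (- 0)) / (z - 0)) holomorphic_on UNIV"
    by (rule pole_lemma_open) (auto intro!: holomorphic_intros)
  then show ?thesis
    unfolding d by (simp add: expm1_quot_def[abs_def] cong: if_cong)
qed

text \<open>The first and third bounds come from expanding exp(-t z) over t in [0, 1], where its
  norm is at most 1 because Re z \<ge> 0.\<close>

lemma norm_exp_minus_bounds:
  fixes z :: complex
  assumes z: "0 \<le> Re z"
  shows "norm (1 - exp (- z)) \<le> norm z" "norm (1 - exp (- z)) \<le> 2" "norm z - (norm z)\<^sup>2 \<le> norm (1 - exp (- z))"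
proof -
  let ?f = "\<lambda>t::real. exp (- (of_real t * z))"
  have d: "(?f has_vector_derivative - (z * ?f t)) (at t within {0..1})" for t
    by (rule has_vector_derivative_real_field) (auto intro!: derivative_eq_intros)
  have d2: "((\<lambda>t. - (z * ?f t)) has_vector_derivative z * (z * ?f t)) (at t within {0..1})" for t
    using has_vector_derivative_mult_right[OF d, of "- z"] by (simp add: mult.left_commute)
  have e: "norm (?f t) \<le> 1" if "t \<in> {0..1}" for t
    using that z by (simp add: norm_exp_eq_Re mult_nonneg_nonneg)
  have "norm (?f 1 - ?f 0 - (1 - 0) *\<^sub>R (- (z * ?f 0))) \<le> (norm z)\<^sup>2 * (1 - 0)\<^sup>2"
  proof (rule quadratic_remainder[OF _ _ _ d d2])
    fix t :: real assume "t \<in> closed_segment 0 1"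
    then have "norm (?f t) \<le> 1" by (intro e) (simp add: closed_segment_eq_real_ivl)
    then have "norm z * (norm z * norm (?f t)) \<le> norm z * (norm z * 1)" by (intro mult_left_mono) auto
    then show "norm (z * (z * ?f t)) \<le> (norm z)\<^sup>2" by (simp add: norm_mult power2_eq_square)
  qed auto
  then have "norm (z - (1 - exp (- z))) \<le> (norm z)\<^sup>2" by (simp add: algebra_simps)
  then show "norm z - (norm z)\<^sup>2 \<le> norm (1 - exp (- z))"
    using norm_triangle_ineq2[of z "1 - exp (- z)"] by linarith
  have "norm (?f 1 - ?f 0) \<le> norm z * norm (1 - 0 :: real)"
  proof (rule differentiable_bound[of "{0..1}" ?f "\<lambda>t h. h *\<^sub>R (- (z * ?f t))"])
    show "onorm (\<lambda>h. h *\<^sub>R (- (z * ?f t))) \<le> norm z" if "t \<in> {0..1}" for t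
    proof (rule onorm_le)
      fix h :: real
      have "\<bar>h\<bar> * (norm z * norm (?f t)) \<le> \<bar>h\<bar> * (norm z * 1)"
        using e[OF that] by (intro mult_left_mono) auto
      then show "norm (h *\<^sub>R (- (z * ?f t))) \<le> norm z * norm h" by (simp add: norm_mult mult.commute)
    qed
  qed (use d in \<open>auto simp: has_vector_derivative_def\<close>)
  then show "norm (1 - exp (- z)) \<le> norm z" by (simp add: norm_minus_commute)
  show "norm (1 - exp (- z)) \<le> 2"
    using norm_triangle_ineq4[of 1 "exp (- z)"] z by (simp add: norm_exp_eq_Re) (smt (verit) exp_le_one_iff)
qed

lemma hp_holo_entire_compose:
  assumes g: "g holomorphic_on UNIV" and f: "hp_holo f" shows "hp_holo (\<lambda>z. g (f z))"
  unfolding hp_holo_def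
proof
  show "continuous_on {z. 0 \<le> Re z} (\<lambda>z. g (f z))"
    by (rule continuous_on_compose2[OF holomorphic_on_imp_continuous_on[OF g]]) (use f in \<open>auto simp: hp_holo_def\<close>)
  show "(\<lambda>z. g (f z)) holomorphic_on {z. 0 < Re z}"
    using holomorphic_on_compose_gen[of f "{z. 0 < Re z}" g UNIV] f g by (auto simp: hp_holo_def o_def)
qed

lemma hp_holo_const: "hp_holo (\<lambda>z. c)"
  by (rule hp_holoI_entire) (rule holomorphic_on_const)

lemma hp_holo_exp: "hp_holo f \<Longrightarrow> hp_holo (\<lambda>z. exp (f z))"
  by (rule hp_holo_entire_compose) (auto intro: holomorphic_intros)

text \<open>Uses exp x \<ge> (x / k)^k with k so large that a k \<ge> n.\<close>

lemma exp_powr_decay: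
  assumes c: "c > 0" and a: "0 < a"
  shows "\<exists>C. \<forall>r\<ge>1. exp (- (c * r powr a)) * (1 + r) ^ n \<le> (C::real)"
proof -
  obtain j :: nat where j: "real n / a \<le> real j" using real_arch_simple by blast
  \<comment> \<open>\<open>Suc\<close> keeps k positive, so that division by k is
    meaningful.\<close>
  define k where "k = Suc j"
  have k: "real n \<le> a * real k" "k > 0" using j a by (auto simp: k_def field_simps)
  have "exp (- (c * r powr a)) * (1 + r) ^ n \<le> 2 ^ n * (real k / c) ^ k" if r: "r \<ge> 1" for r
  proof -
    have u: "0 < c * r powr a" using c r by simp
    have "(c * r powr a / real k) ^ k \<le> (1 + c * r powr a / real k) ^ k"
      using u by (intro power_mono) auto
    also have "\<dots> \<le> exp (c * r powr a)"
      using u k by (intro exp_ge_one_plus_x_over_n_power_n) auto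
    finally have e: "(c * r powr a / real k) ^ k \<le> exp (c * r powr a)" .
    have "r ^ n = r powr real n" using r by (simp add: powr_realpow)
    also have "\<dots> \<le> r powr (a * real k)" using r k by (intro powr_mono) auto
    also have "\<dots> = (r powr a) ^ k" using r by (simp add: powr_powr[symmetric] powr_realpow)
    finally have rn: "r ^ n \<le> (r powr a) ^ k" .
    have "(1 + r) ^ n \<le> (2 * r) ^ n" using r by (intro power_mono) auto
    also have "\<dots> = 2 ^ n * r ^ n" by (simp add: power_mult_distrib)
    also have "\<dots> \<le> 2 ^ n * (r powr a) ^ k" using rn by simp
    also have "\<dots> = 2 ^ n * (real k / c) ^ k * (c * r powr a / real k) ^ k"
      using c k by (simp add: power_mult_distrib power_divide)
    also have "\<dots> \<le> 2 ^ n * (real k / c) ^ k * exp (c * r powr a)"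
      using e c by (intro mult_left_mono) auto
    finally show ?thesis by (simp add: exp_minus field_simps)
  qed
  then show ?thesis by blast
qed

locale fractional_wave_on = fractional_wave +
  fixes l :: ereal
  assumes l_pos: "0 < l"
begin

text \<open>For \<open>l = \<infinity>\<close> this takes the default value 0; the formulas with
  \<open>len\<close> are therefore guarded by \<open>l \<noteq> \<infinity>\<close>.\<close>

definition "len = real_of_ereal l"
definition "w s = s * M s"

text \<open>The formula for \<open>kernel_hat\<close> with its removable singularity at \<open>s = 0\<close> removed, and its
  derivative in \<open>x\<close>.\<close>

definition "kern0 x s = (if l = \<infinity> then exp (- (of_real x * w s))
  else exp (- (of_real x * w s)) * of_real ((len - x) / len) * expm1_quot (of_real (2 * (len - x)) * w s) / expm1_quot (of_real (2 * len) * w s))"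

definition "kern1 x s = (if l = \<infinity> then - w s * exp (- (of_real x * w s))
  else - (exp (- (of_real x * w s)) + exp (- (of_real (2 * len - x) * w s))) / (of_real (2 * len) * expm1_quot (of_real (2 * len) * w s)))"

lemma len_pos: "l \<noteq> \<infinity> \<Longrightarrow> 0 < len"
  unfolding len_def using l_pos by (cases l) auto

lemma space_dom_iff: "x \<in> space_dom l \<longleftrightarrow> 0 \<le> x \<and> (l \<noteq> \<infinity> \<longrightarrow> x \<le> len)"
  unfolding space_dom_def len_def using l_pos by (cases l) auto

lemma kern_inf:
  assumes "l = \<infinity>"
  shows "kern0 x s = exp (- (of_real x * w s))" "kern1 x s = - w s * exp (- (of_real x * w s))"
  unfolding kern0_def kern1_def by (rule if_P[OF assms])+

lemma kern_fin:
  assumes "l \<noteq> \<infinity>"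
  shows "kern0 x s = exp (- (of_real x * w s)) * of_real ((len - x) / len) * expm1_quot (of_real (2 * (len - x)) * w s) / expm1_quot (of_real (2 * len) * w s)"
    "kern1 x s = - (exp (- (of_real x * w s)) + exp (- (of_real (2 * len - x) * w s))) / (of_real (2 * len) * expm1_quot (of_real (2 * len) * w s))"
  unfolding kern0_def kern1_def by (simp_all only: assms if_False)

lemma space_dom_convex: "convex (space_dom l)"
proof (cases "l = \<infinity>")
  case True
  have "space_dom l = {0..}" unfolding set_eq_iff space_dom_iff using True by auto
  then show ?thesis by simp
next
  case False
  have "space_dom l = {0..len}" unfolding set_eq_iff space_dom_iff using False by auto
  then show ?thesis by simp
qed

lemma w_0 [simp]: "w 0 = 0"
  by (simp add: w_def)

lemma hp_holo_w: "hp_holo w"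
  unfolding w_def[abs_def] by (rule hp_holo_mult[OF hp_holoI_entire hp_holo_M]) (rule holomorphic_on_ident)

lemma norm_w_le: "0 \<le> Re s \<Longrightarrow> norm (w s) \<le> norm s"
  using mult_left_mono[OF M_bounds(1), of s "norm s"] by (simp add: w_def norm_mult)

lemma Re_w_pos: assumes "0 \<le> Re s" "s \<noteq> 0" shows "0 < Re (w s)"
proof -
  obtain c where "c > 0" "c * mdecay (norm s) \<le> Re (w s)"
    using Re_sM_ge assms(1) unfolding w_def by blast
  moreover have "mdecay (norm s) > 0" using assms by (simp add: mdecay_def)
  ultimately show ?thesis by (metis less_le_trans mult_pos_pos)
qed

lemma w_nonzero: "0 \<le> Re s \<Longrightarrow> s \<noteq> 0 \<Longrightarrow> w s \<noteq> 0"
  using Re_w_pos by force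

lemma Re_w_nonneg: "0 \<le> Re s \<Longrightarrow> 0 \<le> Re (w s)"
  using Re_w_pos[of s] by (cases "s = 0") auto

text \<open>For small \<zeta> = 2 l w the second-order bound gives |1 - exp(-\<zeta>)| \<ge>
  |\<zeta>| / 2. Otherwise |w(s)| \<le> |s| keeps |s|, hence also Re w, away from 0, and
  |exp(-\<zeta>)| is bounded by some q < 1.\<close>

lemma denom_lower:
  assumes l: "l \<noteq> \<infinity>"
  shows "\<exists>d>0. d \<le> 1 \<and> (\<forall>s. 0 \<le> Re s \<longrightarrow> d * min 1 (norm (of_real (2 * len) * w s)) \<le> norm (1 - exp (- (of_real (2 * len) * w s))))"
proof -
  note len = len_pos[OF l]
  obtain c where c: "c > 0" "\<And>s. 0 \<le> Re s \<Longrightarrow> c * mdecay (norm s) \<le> Re (w s)"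
    using Re_sM_ge unfolding w_def by blast
  \<comment> \<open>|\<zeta>| > 1/2 forces |s| \<ge> 1 / (4 len). The minimum with 1 gives m \<le>
    1, so that m bounds \<open>mdecay\<close> from below for |s| \<ge> 1 too.\<close>
  define \<epsilon> where "\<epsilon> = min 1 (1 / (4 * len))"
  have \<epsilon>: "0 < \<epsilon>" "\<epsilon> \<le> 1" "\<epsilon> \<le> 1 / (4 * len)" using len by (auto simp: \<epsilon>_def)
  define m where "m = \<epsilon> powr (1 + \<alpha>)"
  have m: "0 < m" "m \<le> 1" using \<epsilon> \<alpha> powr_mono2[of "1 + \<alpha>" \<epsilon> 1] by (auto simp: m_def)
  define q where "q = exp (- (2 * len * (c * m)))"
  have q: "q < 1" using len c m by (simp add: q_def)
  define d where "d = min (1/2) (1 - q)"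
  have d: "d > 0" using q by (simp add: d_def)
  have d': "d \<le> 1/2" "d \<le> 1 - q" unfolding d_def by (rule min.cobounded1, rule min.cobounded2)
  note d = d d'
  have "d * min 1 (norm \<zeta>) \<le> norm (1 - exp (- \<zeta>))" if s: "0 \<le> Re s" and \<zeta>: "\<zeta> = of_real (2 * len) * w s" for s \<zeta>
  proof (cases "norm \<zeta> \<le> 1/2")
    case True
    have "0 \<le> Re \<zeta>" using Re_w_nonneg[OF s] len by (simp add: \<zeta>)
    from norm_exp_minus_bounds(3)[OF this] have "norm \<zeta> - norm \<zeta> * norm \<zeta> \<le> norm (1 - exp (- \<zeta>))"
      by (simp add: power2_eq_square)
    moreover have "norm \<zeta> * norm \<zeta> \<le> norm \<zeta> * (1/2)" using True by (intro mult_left_mono) auto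
    moreover have "d * min 1 (norm \<zeta>) \<le> 1/2 * norm \<zeta>" using d by (intro mult_mono) auto
    ultimately show ?thesis by linarith
  next
    case False
    have "1/2 < norm \<zeta>" using False by simp
    also have "norm \<zeta> \<le> 2 * len * norm s"
      using norm_w_le[OF s] len by (simp add: \<zeta> norm_mult)
    finally have "1 / (4 * len) \<le> norm s" using len by (simp add: field_simps)
    then have r: "\<epsilon> \<le> norm s" using \<epsilon> by linarith
    have "m \<le> mdecay (norm s)"
    proof (cases "norm s \<ge> 1")
      case True
      then have "1 \<le> mdecay (norm s)" using \<alpha> by (simp add: mdecay_def ge_one_powr_ge_zero)
      then show ?thesis using m by linarith
    next
      case False
      then show ?thesis using r \<epsilon> \<alpha> by (auto simp: mdecay_def m_def intro!: powr_mono2)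
    qed
    then have "c * m \<le> c * mdecay (norm s)" using c by (intro mult_left_mono) auto
    then have "c * m \<le> Re (w s)" using c(2)[OF s] by linarith
    then have "2 * len * (c * m) \<le> Re \<zeta>" using len by (simp add: \<zeta> mult_left_mono)
    then have "norm (exp (- \<zeta>)) \<le> q" by (simp add: q_def norm_exp_eq_Re)
    then have "1 - q \<le> norm (1 - exp (- \<zeta>))" using norm_triangle_ineq2[of 1 "exp (- \<zeta>)"] by simp
    moreover have "d * min 1 (norm \<zeta>) \<le> d * 1" using d by (intro mult_left_mono) auto
    ultimately show ?thesis using d by linarith
  qed
  then show ?thesis using d by (intro exI[of _ d]) auto
qed

lemma expm1_quot_nonzero:
  assumes "0 \<le> Re s" "l \<noteq> \<infinity>" shows "expm1_quot (of_real (2 * len) * w s) \<noteq> 0"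
proof (cases "s = 0")
  case False
  have p: "0 < Re (of_real (2 * len) * w s)" using Re_w_pos[OF assms(1) False] len_pos[OF assms(2)] by simp
  define \<zeta> where "\<zeta> = of_real (2 * len) * w s"
  have "norm (exp (- \<zeta>)) < 1" using p unfolding \<zeta>_def[symmetric] by (simp add: norm_exp_eq_Re)
  then have "exp (- \<zeta>) \<noteq> 1" by (metis norm_one less_irrefl)
  then show ?thesis using p unfolding \<zeta>_def[symmetric] by (auto simp: expm1_quot_def)
qed (simp add: expm1_quot_def)

lemma hp_holo_scaled: "hp_holo (\<lambda>s. of_real a * w s)" "hp_holo (\<lambda>s. exp (- (of_real a * w s)))"
proof -
  show *: "hp_holo (\<lambda>s. of_real a * w s)" for a by (rule hp_holo_mult[OF hp_holo_const hp_holo_w])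
  show "hp_holo (\<lambda>s. exp (- (of_real a * w s)))"
    using hp_holo_exp[OF *[of "- a"]] by simp
qed

lemma hp_holo_kern0: "hp_holo (kern0 x)"
proof (cases "l = \<infinity>")
  case True
  show ?thesis unfolding kern_inf(1)[OF True, abs_def] by (rule hp_holo_scaled(2))
next
  case False
  have "hp_holo (\<lambda>s. exp (- (of_real x * w s)) * of_real ((len - x) / len) * expm1_quot (of_real (2 * (len - x)) * w s) / expm1_quot (of_real (2 * len) * w s))"
    by (rule hp_holo_divide[OF hp_holo_mult[OF hp_holo_mult[OF hp_holo_scaled(2) hp_holo_const]
        hp_holo_entire_compose[OF expm1_quot_holomorphic hp_holo_scaled(1)]] hp_holo_entire_compose[OF expm1_quot_holomorphic hp_holo_scaled(1)]])
      (rule expm1_quot_nonzero[OF _ False])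
  then show ?thesis unfolding kern_fin(1)[OF False, abs_def] .
qed

lemma hp_holo_kern1: "hp_holo (kern1 x)"
proof (cases "l = \<infinity>")
  case True
  have "hp_holo (\<lambda>s. - 1 * w s * exp (- (of_real x * w s)))"
    by (rule hp_holo_mult[OF hp_holo_mult[OF hp_holo_const hp_holo_w] hp_holo_scaled(2)])
  then show ?thesis unfolding kern_inf(2)[OF True, abs_def] by simp
next
  case False
  have "hp_holo (\<lambda>s. (- 1 * (exp (- (of_real x * w s)) + exp (- (of_real (2 * len - x) * w s)))) / (of_real (2 * len) * expm1_quot (of_real (2 * len) * w s)))"
    by (rule hp_holo_divide[OF hp_holo_mult[OF hp_holo_const hp_holo_add[OF hp_holo_scaled(2) hp_holo_scaled(2)]]
        hp_holo_mult[OF hp_holo_const hp_holo_entire_compose[OF expm1_quot_holomorphic hp_holo_scaled(1)]]])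
      (use expm1_quot_nonzero[OF _ False] len_pos[OF False] in simp)
  then show ?thesis unfolding kern_fin(2)[OF False, abs_def] by simp
qed

text \<open>Away from s = 0 the entire quotients cancel. The product form suits estimates near s =
  0, the difference form differentiation in x.\<close>

lemma kern_finite_eq:
  assumes s: "0 \<le> Re s" "s \<noteq> 0" and l: "l \<noteq> \<infinity>"
  shows "kern0 x s = exp (- (of_real x * w s)) * (1 - exp (- (of_real (2 * (len - x)) * w s))) / (1 - exp (- (of_real (2 * len) * w s)))"
    and "kern0 x s = (exp (- (of_real x * w s)) - exp (- (of_real (2 * len - x) * w s))) / (1 - exp (- (of_real (2 * len) * w s)))"
    and "kern1 x s = - (w s * (exp (- (of_real x * w s)) + exp (- (of_real (2 * len - x) * w s)))) / (1 - exp (- (of_real (2 * len) * w s)))"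
    and "1 - exp (- (of_real (2 * len) * w s)) \<noteq> 0"
proof -
  note w0 = w_nonzero[OF s] and len = len_pos[OF l]
  define D where "D = 1 - exp (- (of_real (2 * len) * w s))"
  have q: "expm1_quot (of_real (2 * len) * w s) = D / (of_real (2 * len) * w s)"
    using w0 len by (simp add: expm1_quot_def D_def)
  show D: "1 - exp (- (of_real (2 * len) * w s)) \<noteq> 0"
    using expm1_quot_nonzero[OF s(1) l] unfolding q by (auto simp: D_def)
  have D': "D \<noteq> 0" using D by (simp add: D_def)
  show 1: "kern0 x s = exp (- (of_real x * w s)) * (1 - exp (- (of_real (2 * (len - x)) * w s))) / (1 - exp (- (of_real (2 * len) * w s)))"
    unfolding D_def[symmetric]
  proof (cases "x = len")
    case True
    then show "kern0 x s = exp (- (of_real x * w s)) * (1 - exp (- (of_real (2 * (len - x)) * w s))) / D"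
      by (simp add: kern_fin(1)[OF l])
  next
    case False
    then have x: "complex_of_real (len - x) \<noteq> 0" by (simp only: of_real_eq_0_iff)
    have q': "expm1_quot (of_real (2 * (len - x)) * w s) = (1 - exp (- (of_real (2 * (len - x)) * w s))) / (2 * of_real (len - x) * w s)"
      using w0 x by (simp add: expm1_quot_def)
    have "kern0 x s = exp (- (of_real x * w s)) * (of_real (len - x) / of_real len) * ((1 - exp (- (of_real (2 * (len - x)) * w s))) / (2 * of_real (len - x) * w s)) / (D / (2 * of_real len * w s))"
      unfolding kern_fin(1)[OF l] q q' by simp
    also have "\<dots> = exp (- (of_real x * w s)) * (1 - exp (- (of_real (2 * (len - x)) * w s))) / D"
    proof -
      have alg: "e * (a / b) * (n / (2 * a * v)) / (D / (2 * b * v)) = e * n / D" if "a \<noteq> 0" "b \<noteq> 0" "v \<noteq> 0" for e a b n v :: complex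
        using that D' by (simp add: field_simps)
      show ?thesis by (rule alg[OF x _ w0]) (use len in simp)
    qed
    finally show "kern0 x s = exp (- (of_real x * w s)) * (1 - exp (- (of_real (2 * (len - x)) * w s))) / D" .
  qed
  have "exp (- (of_real x * w s)) * exp (- (of_real (2 * (len - x)) * w s)) = exp (- (of_real (2 * len - x) * w s))"
    unfolding exp_add[symmetric] by (simp add: algebra_simps)
  then show "kern0 x s = (exp (- (of_real x * w s)) - exp (- (of_real (2 * len - x) * w s))) / (1 - exp (- (of_real (2 * len) * w s)))"
    unfolding 1 by (simp only: right_diff_distrib mult_1_right)
  show "kern1 x s = - (w s * (exp (- (of_real x * w s)) + exp (- (of_real (2 * len - x) * w s)))) / (1 - exp (- (of_real (2 * len) * w s)))"
    using w0 len D' unfolding kern_fin(2)[OF l] q D_def[symmetric] by (simp add: field_simps)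
qed

lemma kern_at_0:
  assumes "l \<noteq> \<infinity>" shows "kern0 x 0 = of_real ((len - x) / len)" "kern1 x 0 = of_real (- 1 / len)"
  unfolding kern_fin[OF assms] by (simp_all add: expm1_quot_def)

lemma has_vector_derivative_exp_line:
  fixes a b x :: real and v :: complex
  shows "((\<lambda>x. exp (- (of_real (a + b * x) * v))) has_vector_derivative - (of_real b * v * exp (- (of_real (a + b * x) * v)))) (at x within A)"
  unfolding of_real_add of_real_mult
  by (rule has_vector_derivative_real_field) (auto intro!: derivative_eq_intros)

text \<open>Pointwise in s, including s = 0, where for finite l the kernel is the linear function 1
  - x / l.\<close>

lemma kern0_derivative:
  assumes s: "0 \<le> Re s"
  shows "((\<lambda>x. kern0 x s) has_vector_derivative kern1 x s) (at x within A)"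
proof -
  have e1: "((\<lambda>x. exp (- (of_real x * w s))) has_vector_derivative - (w s * exp (- (of_real x * w s)))) (at x within A)"
    using has_vector_derivative_exp_line[of 0 1 "w s" x A] by simp
  have e2: "((\<lambda>x. exp (- (of_real (2 * len - x) * w s))) has_vector_derivative w s * exp (- (of_real (2 * len - x) * w s))) (at x within A)"
    using has_vector_derivative_exp_line[of "2 * len" "-1" "w s" x A] by simp
  consider "l = \<infinity>" | "l \<noteq> \<infinity>" "s = 0" | "l \<noteq> \<infinity>" "s \<noteq> 0" by blast
  then show ?thesis
  proof cases
    case 1
    show ?thesis using e1 unfolding kern_inf[OF 1] by simp
  next
    case 2
    have "((\<lambda>x. (len - x) / len) has_real_derivative - 1 / len) (at x within A)"
      using len_pos[OF 2(1)] by (auto intro!: derivative_eq_intros)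
    then have "((\<lambda>x. complex_of_real ((len - x) / len)) has_vector_derivative of_real (- 1 / len)) (at x within A)"
      by (intro has_vector_derivative_of_real) (simp add: has_real_derivative_iff_has_vector_derivative)
    then show ?thesis using 2 kern_at_0 by simp
  next
    case 3
    have "((\<lambda>x. (exp (- (of_real x * w s)) - exp (- (of_real (2 * len - x) * w s))) / (1 - exp (- (of_real (2 * len) * w s))))
       has_vector_derivative (- (w s * exp (- (of_real x * w s))) - w s * exp (- (of_real (2 * len - x) * w s))) / (1 - exp (- (of_real (2 * len) * w s)))) (at x within A)"
      by (intro has_vector_derivative_divide has_vector_derivative_diff e1 e2)
    moreover have "- (w s * exp (- (of_real x * w s))) - w s * exp (- (of_real (2 * len - x) * w s)) = - (w s * (exp (- (of_real x * w s)) + exp (- (of_real (2 * len - x) * w s))))"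
      by (simp add: algebra_simps)
    ultimately show ?thesis
      unfolding kern_finite_eq(2)[OF s 3(2) 3(1)] kern_finite_eq(3)[OF s 3(2) 3(1)] by simp
  qed
qed

text \<open>This is the transformed equation k'' = w^2 k. For finite l the point s = 0 is consistent
  with it: the kernel is linear in x there and w vanishes.\<close>

lemma kern1_derivative:
  assumes s: "0 \<le> Re s"
  shows "((\<lambda>x. kern1 x s) has_vector_derivative (w s)\<^sup>2 * kern0 x s) (at x within A)"
proof -
  have e1: "((\<lambda>x. exp (- (of_real x * w s))) has_vector_derivative - (w s * exp (- (of_real x * w s)))) (at x within A)"
    using has_vector_derivative_exp_line[of 0 1 "w s" x A] by simp
  have e2: "((\<lambda>x. exp (- (of_real (2 * len - x) * w s))) has_vector_derivative w s * exp (- (of_real (2 * len - x) * w s))) (at x within A)"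
    using has_vector_derivative_exp_line[of "2 * len" "-1" "w s" x A] by simp
  consider "l = \<infinity>" | "l \<noteq> \<infinity>" "s = 0" | "l \<noteq> \<infinity>" "s \<noteq> 0" by blast
  then show ?thesis
  proof cases
    case 1
    show ?thesis using has_vector_derivative_mult_right[OF e1, of "- w s"]
      unfolding kern_inf[OF 1] by (simp add: power2_eq_square mult.assoc)
  next
    case 2
    then show ?thesis using kern_at_0 by simp
  next
    case 3
    have "((\<lambda>x. - (w s * (exp (- (of_real x * w s)) + exp (- (of_real (2 * len - x) * w s)))) / (1 - exp (- (of_real (2 * len) * w s))))
       has_vector_derivative - (w s * (- (w s * exp (- (of_real x * w s))) + w s * exp (- (of_real (2 * len - x) * w s)))) / (1 - exp (- (of_real (2 * len) * w s)))) (at x within A)"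
      by (intro has_vector_derivative_divide has_vector_derivative_minus has_vector_derivative_mult_right has_vector_derivative_add e1 e2)
    moreover have "- (w s * (- (w s * exp (- (of_real x * w s))) + w s * exp (- (of_real (2 * len - x) * w s)))) / (1 - exp (- (of_real (2 * len) * w s)))
        = (w s)\<^sup>2 * kern0 x s"
      unfolding kern_finite_eq(2)[OF s 3(2) 3(1)] by (simp add: power2_eq_square algebra_simps)
    ultimately show ?thesis
      unfolding kern_finite_eq(3)[OF s 3(2) 3(1)] by simp
  qed
qed

text \<open>For finite l, with \<zeta> = 2 l w, numerator and denominator are both compared with
  min(1, |\<zeta>|), so the quotient is bounded down to s = 0. For the x-derivative one uses that
  |w| / min(1, |\<zeta>|) is at most |s| + 1 / (2 l).\<close>

lemma kern_bounds:
  "\<exists>C>0. \<forall>x\<in>space_dom l. \<forall>s. 0 \<le> Re s \<longrightarrow>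
     norm (kern0 x s) \<le> C * exp (- (x * Re (w s))) \<and> norm (kern1 x s) \<le> C * (1 + norm s)"
proof (cases "l = \<infinity>")
  case True
  have "norm (kern0 x s) \<le> 1 * exp (- (x * Re (w s))) \<and> norm (kern1 x s) \<le> 1 * (1 + norm s)"
    if x: "x \<in> space_dom l" and s: "0 \<le> Re s" for x s
  proof -
    have "exp (- (x * Re (w s))) \<le> 1" using x Re_w_nonneg[OF s] by (simp add: space_dom_iff)
    then have "norm (w s) * exp (- (x * Re (w s))) \<le> (1 + norm s) * 1"
      using norm_w_le[OF s] by (intro mult_mono) auto
    then show ?thesis unfolding kern_inf[OF True] by (simp add: norm_mult norm_exp_eq_Re)
  qed
  then show ?thesis by (intro exI[of _ 1]) auto
next
  case False
  note len = len_pos[OF False]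
  obtain d where d: "d > 0" "d \<le> 1" "\<And>s. 0 \<le> Re s \<Longrightarrow> d * min 1 (norm (of_real (2 * len) * w s)) \<le> norm (1 - exp (- (of_real (2 * len) * w s)))"
    using denom_lower[OF False] by blast
  \<comment> \<open>The factor 2 / d bounds the quotient, and 2 / d times 1 / (2 len) the derivative
    near s = 0; C dominates both.\<close>
  define C where "C = 2 / d * (1 + 1 / (2 * len))"
  have C: "2 / d \<le> C" "2 / d * (1 / (2 * len)) \<le> C" "C > 0" using d len by (auto simp: C_def field_simps add_pos_pos)
  have "norm (kern0 x s) \<le> C * exp (- (x * Re (w s))) \<and> norm (kern1 x s) \<le> C * (1 + norm s)"
    if x: "x \<in> space_dom l" and s: "0 \<le> Re s" for x s
  proof (cases "s = 0")
    case True
    have xl: "0 \<le> x" "x \<le> len" using x False by (auto simp: space_dom_iff)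
    have "\<bar>(len - x) / len\<bar> \<le> 1" using xl len by (simp add: field_simps)
    moreover have "1 \<le> 2 / d" using d by (simp add: field_simps)
    ultimately have "\<bar>(len - x) / len\<bar> \<le> C" using C by linarith
    moreover have "1 / len \<le> 2 / d * (1 / (2 * len))" using d len by (simp add: field_simps)
    then have "1 / len \<le> C" using C by linarith
    ultimately show ?thesis using True len unfolding True kern_at_0[OF False] norm_of_real by simp
  next
    case s0: False
    have xl: "0 \<le> x" "x \<le> len" using x False by (auto simp: space_dom_iff)
    define \<zeta> v where "\<zeta> = of_real (2 * len) * w s" and "v = of_real (2 * (len - x)) * w s"
    let ?D = "1 - exp (- \<zeta>)"
    have wp: "norm (w s) > 0" using w_nonzero[OF s s0] by simp
    have n\<zeta>: "norm \<zeta> = 2 * len * norm (w s)" unfolding \<zeta>_def norm_mult norm_of_real using len by simp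
    have nv: "norm v = 2 * (len - x) * norm (w s)" unfolding v_def norm_mult norm_of_real using xl by simp
    have mp: "min 1 (norm \<zeta>) > 0" using wp len by (simp add: n\<zeta>)
    have Dl: "d * min 1 (norm \<zeta>) \<le> norm ?D" unfolding \<zeta>_def by (rule d(3)[OF s])
    have Dp: "norm ?D > 0" using less_le_trans[OF mult_pos_pos[OF d(1) mp] Dl] .
    have vr: "0 \<le> Re v" using Re_w_nonneg[OF s] xl by (simp add: v_def)
    have "norm v \<le> norm \<zeta>" unfolding n\<zeta> nv using xl wp by (intro mult_right_mono) auto
    then have "norm (1 - exp (- v)) \<le> 2 * min 1 (norm \<zeta>)"
    proof (cases "1 \<le> norm \<zeta>")
      case False
      have "norm (1 - exp (- v)) \<le> norm \<zeta>"
        using norm_exp_minus_bounds(1)[OF vr] \<open>norm v \<le> norm \<zeta>\<close> by linarith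
      also have "\<dots> \<le> 2 * norm \<zeta>" by simp
      finally show ?thesis using False by simp
    qed (use norm_exp_minus_bounds(2)[OF vr] in simp)
    then have "norm (1 - exp (- v)) / norm ?D \<le> 2 * min 1 (norm \<zeta>) / (d * min 1 (norm \<zeta>))"
      using Dl mp d(1) by (intro frac_le mult_pos_pos) auto
    also have "\<dots> = 2 / d" using less_imp_neq[OF mp] by simp
    finally have r: "norm (1 - exp (- v)) / norm ?D \<le> C" using C by linarith
    have "norm (kern0 x s) = exp (- (x * Re (w s))) * (norm (1 - exp (- v)) / norm ?D)"
      unfolding kern_finite_eq(1)[OF s s0 False] \<zeta>_def[symmetric] v_def[symmetric] by (simp add: norm_divide norm_mult norm_exp_eq_Re)
    also have "\<dots> \<le> exp (- (x * Re (w s))) * C" using r by (intro mult_left_mono) auto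
    finally have k0: "norm (kern0 x s) \<le> C * exp (- (x * Re (w s)))" by (simp add: mult.commute)
    have e2: "norm (exp (- (of_real x * w s)) + exp (- (of_real (2 * len - x) * w s))) \<le> 1 + 1"
      using xl Re_w_nonneg[OF s] by (intro norm_triangle_mono) (auto simp: norm_exp_eq_Re)
    have "norm (kern1 x s) \<le> norm (w s) * 2 / norm ?D"
      unfolding kern_finite_eq(3)[OF s s0 False] \<zeta>_def[symmetric] norm_divide norm_minus_cancel norm_mult
      using e2 wp Dp by (intro divide_right_mono mult_left_mono) auto
    also have "\<dots> \<le> norm (w s) * 2 / (d * min 1 (norm \<zeta>))"
      using Dl mp Dp d(1) wp by (intro divide_left_mono mult_pos_pos) auto
    also have "\<dots> = 2 / d * (norm (w s) / min 1 (norm \<zeta>))" by simp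
    also have "\<dots> \<le> 2 / d * (norm s + 1 / (2 * len))"
    proof -
      have "norm (w s) / min 1 (norm \<zeta>) \<le> norm s + 1 / (2 * len)"
      proof (cases "1 \<le> norm \<zeta>")
        case True
        then have "norm (w s) / min 1 (norm \<zeta>) = norm (w s)" by simp
        then show ?thesis using norm_w_le[OF s] len by (simp add: add_increasing2)
      next
        case False
        then have "norm (w s) / min 1 (norm \<zeta>) = 1 / (2 * len)" using len wp by (simp add: n\<zeta>)
        then show ?thesis by simp
      qed
      then show ?thesis using d by (intro mult_left_mono) auto
    qed
    also have "\<dots> \<le> C * (1 + norm s)"
    proof -
      have "norm s + 1 / (2 * len) \<le> (1 + 1 / (2 * len)) * (1 + norm s)" using len by (simp add: field_simps)
      then have "2 / d * (norm s + 1 / (2 * len)) \<le> 2 / d * ((1 + 1 / (2 * len)) * (1 + norm s))"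
        using d by (intro mult_left_mono) auto
      then show ?thesis by (simp only: C_def mult.assoc)
    qed
    finally show ?thesis using k0 by blast
  qed
  then show ?thesis using C(3) by blast
qed

section \<open>Decay of the kernel in s and convergence in x\<close>

text \<open>Uniformity in x \<ge> x0 > 0 supplies the dominating functions for limits in x. For |s|
  \<ge> 1 the decay is that of exp(-x0 c |s|^(1 - \<alpha>)); for |s| < 1 boundedness is
  enough.\<close>

lemma kern0_decay:
  assumes "x0 > 0"
  shows "\<exists>C. \<forall>x\<in>space_dom l. x0 \<le> x \<longrightarrow> (\<forall>s. 0 \<le> Re s \<longrightarrow> norm (kern0 x s) * (1 + norm s) ^ n \<le> C)"
proof -
  obtain C where C: "C > 0" "\<And>x s. x \<in> space_dom l \<Longrightarrow> 0 \<le> Re s \<Longrightarrow> norm (kern0 x s) \<le> C * exp (- (x * Re (w s)))"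
    using kern_bounds by blast
  obtain c where c: "c > 0" "\<And>s. 0 \<le> Re s \<Longrightarrow> c * mdecay (norm s) \<le> Re (w s)"
    using Re_sM_ge unfolding w_def by blast
  obtain B where B: "\<And>r. r \<ge> 1 \<Longrightarrow> exp (- ((x0 * c) * r powr (1 - \<alpha>))) * (1 + r) ^ n \<le> B"
    using exp_powr_decay[of "x0 * c" "1 - \<alpha>" n] assms c(1) \<alpha> by auto
  have "norm (kern0 x s) * (1 + norm s) ^ n \<le> C * max B (2 ^ n)" if x: "x \<in> space_dom l" "x0 \<le> x" and s: "0 \<le> Re s" for x s
  proof -
    have "exp (- (x * Re (w s))) * (1 + norm s) ^ n \<le> max B (2 ^ n)"
    proof (cases "norm s \<ge> 1")
      case True
      have "(x0 * c) * norm s powr (1 - \<alpha>) = x0 * (c * mdecay (norm s))" using True by (simp add: mdecay_def)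
      also have "\<dots> \<le> x * Re (w s)"
        using x assms c(2)[OF s] c(1) mdecay_nonneg by (intro mult_mono) auto
      finally have "exp (- (x * Re (w s))) * (1 + norm s) ^ n \<le> exp (- ((x0 * c) * norm s powr (1 - \<alpha>))) * (1 + norm s) ^ n"
        by (intro mult_right_mono) auto
      then show ?thesis using B[OF True] by linarith
    next
      case False
      have "exp (- (x * Re (w s))) * (1 + norm s) ^ n \<le> 1 * 2 ^ n"
        using x assms Re_w_nonneg[OF s] False by (intro mult_mono power_mono) auto
      then show ?thesis by linarith
    qed
    then have "C * (exp (- (x * Re (w s))) * (1 + norm s) ^ n) \<le> C * max B (2 ^ n)"
      using C(1) by (intro mult_left_mono) auto
    moreover have "norm (kern0 x s) * (1 + norm s) ^ n \<le> C * exp (- (x * Re (w s))) * (1 + norm s) ^ n"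
      using C(2)[OF x(1) s] by (intro mult_right_mono) auto
    ultimately show ?thesis by (simp add: mult.assoc)
  qed
  then show ?thesis by blast
qed

lemma hp_rapid_kern0:
  assumes "x \<in> space_dom l - {0}" shows "hp_rapid (kern0 x)"
  unfolding hp_rapid_def
proof (intro conjI allI)
  have "x > 0" "x \<in> space_dom l" using assms by (auto simp: space_dom_iff)
  then show "\<exists>C. \<forall>z. 0 \<le> Re z \<longrightarrow> norm (kern0 x z) * (1 + norm z) ^ n \<le> C" for n
    using kern0_decay[of x n] by blast
qed (rule hp_holo_kern0)

text \<open>Multiplying numerator and denominator of the first fraction by exp(-2 l w) turns growing
  exponentials into decaying ones and gives both fractions the same denominator.\<close>

lemma kernel_hat_eq:
  assumes s: "0 < Re s"
  shows "kernel_hat M l x s = kern0 x s"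
proof (cases "l = \<infinity>")
  case True
  have "kernel_hat M l x s = exp (- (s * M s * of_real x))" unfolding kernel_hat_def by (rule if_P[OF True])
  then show ?thesis unfolding kern_inf[OF True] by (simp add: w_def mult.commute)
next
  case False
  have s': "0 \<le> Re s" "s \<noteq> 0" using s by auto
  define v where "v = w s"
  define e where "e a = exp (- (of_real a * v))" for a :: real
  have ne: "1 - e (2 * len) \<noteq> 0" using kern_finite_eq(4)[OF s' False] by (simp add: e_def v_def)
  have add: "e a * e b = e (a + b)" for a b by (simp add: e_def exp_add[symmetric] algebra_simps)
  have e0: "e 0 = 1" by (simp add: e_def)
  have inv: "exp (of_real a * v) = e (- a)" for a by (simp add: e_def)
  have n2: "1 - e (- (2 * len)) = - (e (- (2 * len)) * (1 - e (2 * len)))"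
    by (simp add: right_diff_distrib add e0)
  have np: "e a \<noteq> 0" for a by (simp add: e_def)
  have "kernel_hat M l x s = e (- x) / (1 - e (- (2 * len))) + e x / (1 - e (2 * len))"
    using False inv[of x] inv[of "2 * len"] by (simp add: kernel_hat_def e_def v_def w_def len_def mult_ac)
  also have "e (- x) / (1 - e (- (2 * len))) = - (e (2 * len - x) / (1 - e (2 * len)))"
  proof -
    have "e (- x) = e (- (2 * len)) * e (2 * len - x)" by (simp add: add)
    then show ?thesis unfolding n2 using np[of "- (2 * len)"] by simp
  qed
  finally have "kernel_hat M l x s = (e x - e (2 * len - x)) / (1 - e (2 * len))"
    by (simp add: diff_divide_distrib)
  then show ?thesis
    unfolding kern_finite_eq(2)[OF s' False] by (simp add: e_def v_def)
qed

lemma kern0_boundary: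
  assumes s: "0 < Re s"
  shows "kern0 0 s = 1" "l \<noteq> \<infinity> \<Longrightarrow> kern0 len s = 0"
proof -
  show "kern0 0 s = 1"
  proof (cases "l = \<infinity>")
    case True show ?thesis unfolding kern_inf[OF True] by simp
  next
    case False
    moreover have "0 \<le> Re s" "s \<noteq> 0" using s by auto
    ultimately show ?thesis
      using kern_finite_eq(2)[of s 0] kern_finite_eq(4)[of s] by simp
  qed
  show "l \<noteq> \<infinity> \<Longrightarrow> kern0 len s = 0" by (simp add: kern_fin(1))
qed

text \<open>Dominated convergence: eventually X n > x / 2, where the decay in s is uniform.\<close>

lemma kern_difference_weight_tendsto:
  assumes x: "\<And>n. X n \<in> space_dom l - {0}" "x \<in> space_dom l - {0}" "X \<longlonglongrightarrow> x"
  shows "(\<lambda>n. line_weight j (\<lambda>z. kern0 (X n) z - kern0 x z)) \<longlonglongrightarrow> 0"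
proof -
  have xp: "x > 0" using x(2) by (auto simp: space_dom_iff)
  have "\<forall>\<^sub>F n in sequentially. x / 2 < X n" using x(3) xp by (intro order_tendstoD) auto
  then obtain N where N: "\<And>n. n \<ge> N \<Longrightarrow> x / 2 < X n" unfolding eventually_sequentially by blast
  obtain C where C: "\<And>x' s. x' \<in> space_dom l \<Longrightarrow> x / 2 \<le> x' \<Longrightarrow> 0 \<le> Re s \<Longrightarrow> norm (kern0 x' s) * (1 + norm s) ^ (j + 2) \<le> C"
    using kern0_decay[of "x / 2" "j + 2"] xp by auto
  define f where "f n y = norm (Complex 0 y ^ j * (kern0 (X (n + N)) (Complex 0 y) - kern0 x (Complex 0 y)))" for n y
  have "(\<lambda>n. \<integral>y. f n y \<partial>lborel) \<longlonglongrightarrow> integral\<^sup>L lborel (\<lambda>y::real. 0)"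
  proof (rule integral_dominated_convergence[where w = "\<lambda>y::real. (2 * C) * inverse (1 + y\<^sup>2)"])
    show "integrable lborel (\<lambda>y. (2 * C) * inverse (1 + y\<^sup>2))"
      by (intro integrable_mult_right integrable_inverse_1_plus_square')
    show "f n \<in> borel_measurable lborel" for n
      using borel_measurable_integrable[OF integrable_norm[OF hp_rapid_integrable[OF hp_rapid_diff[OF hp_rapid_kern0[OF x(1)] hp_rapid_kern0[OF x(2)]]]]]
      unfolding f_def by simp
    show "AE y in lborel. (\<lambda>n. f n y) \<longlonglongrightarrow> 0"
    proof (rule AE_I2)
      fix y
      have c: "isCont (\<lambda>x. kern0 x (Complex 0 y)) x"
        using kern0_derivative[of "Complex 0 y" x UNIV] by (auto intro: has_vector_derivative_continuous)
      have "(\<lambda>n. X (n + N)) \<longlonglongrightarrow> x" using x(3) by (rule LIMSEQ_ignore_initial_segment)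
      from isCont_tendsto_compose[OF c this]
      have "(\<lambda>n. f n y) \<longlonglongrightarrow> norm (Complex 0 y ^ j * (kern0 x (Complex 0 y) - kern0 x (Complex 0 y)))"
        unfolding f_def by (intro tendsto_intros)
      then show "(\<lambda>n. f n y) \<longlonglongrightarrow> 0" by simp
    qed
    show "AE y in lborel. norm (f n y) \<le> (2 * C) * inverse (1 + y\<^sup>2)" for n
    proof (rule AE_I2)
      fix y :: real
      let ?s = "Complex 0 y" and ?a = "kern0 (X (n + N))" and ?b = "kern0 x"
      have p: "1 + y\<^sup>2 > 0" by (simp add: add_pos_nonneg)
      have ns: "norm ?s = \<bar>y\<bar>" by (simp add: cmod_def)
      have "1 + y\<^sup>2 \<le> (1 + \<bar>y\<bar>)\<^sup>2" by (simp add: power2_eq_square algebra_simps abs_mult_self_eq)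
      then have "\<bar>y\<bar> ^ j * (1 + y\<^sup>2) \<le> (1 + \<bar>y\<bar>) ^ j * (1 + \<bar>y\<bar>)\<^sup>2"
        using p by (intro mult_mono power_mono) auto
      then have pw: "norm ?s ^ j * (1 + y\<^sup>2) \<le> (1 + norm ?s) ^ (j + 2)" by (simp only: ns power_add)
      have "f n y * (1 + y\<^sup>2) = (norm ?s ^ j * (1 + y\<^sup>2)) * norm (?a ?s - ?b ?s)"
        by (simp add: f_def norm_mult norm_power)
      also have "\<dots> \<le> (1 + norm ?s) ^ (j + 2) * (norm (?a ?s) + norm (?b ?s))"
        using pw p by (intro mult_mono norm_triangle_ineq4) auto
      also have "\<dots> \<le> C + C"
        unfolding distrib_left using x xp N[of "n + N"]
        by (intro add_mono; subst mult.commute; intro C) (auto intro: less_imp_le)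
      finally show "norm (f n y) \<le> (2 * C) * inverse (1 + y\<^sup>2)"
        using p by (simp add: f_def field_simps)
    qed
  qed auto
  then have "(\<lambda>n. line_weight j (\<lambda>z. kern0 (X (n + N)) z - kern0 x z)) \<longlonglongrightarrow> 0"
    by (simp add: line_weight_def f_def)
  then show ?thesis by (rule LIMSEQ_offset)
qed

text \<open>Dominated convergence, with exp(-x Re w) tending to 0 except at y = 0, where w
  vanishes.\<close>

lemma kern_weight_tendsto_at_top:
  assumes l: "l = \<infinity>"
  shows "((\<lambda>x. line_weight j (kern0 x)) \<longlongrightarrow> 0) at_top"
proof -
  have X: "x \<in> space_dom l - {0}" if "x \<ge> 1" for x
    unfolding Diff_iff space_dom_iff using that l by auto
  obtain C where C: "\<And>x' s. x' \<in> space_dom l \<Longrightarrow> 1 \<le> x' \<Longrightarrow> 0 \<le> Re s \<Longrightarrow> norm (kern0 x' s) * (1 + norm s) ^ (j + 2) \<le> C"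
    using kern0_decay[of 1 "j + 2"] by auto
  define f where "f x y = norm (Complex 0 y ^ j * kern0 x (Complex 0 y))" for x y
  have "((\<lambda>x. \<integral>y. f x y \<partial>lborel) \<longlongrightarrow> integral\<^sup>L lborel (\<lambda>y::real. 0)) at_top"
  proof (rule integral_dominated_convergence_at_top[where w = "\<lambda>y::real. C * inverse (1 + y\<^sup>2)"])
    show "integrable lborel (\<lambda>y. C * inverse (1 + y\<^sup>2))"
      by (intro integrable_mult_right integrable_inverse_1_plus_square')
    show "f x \<in> borel_measurable lborel" for x
    proof -
      have "(\<lambda>y. Complex 0 y ^ j * kern0 x (Complex 0 y)) \<in> borel_measurable borel"
        by (intro borel_measurable_continuous_onI continuous_intros hp_holo_line_continuous[OF hp_holo_kern0])
          (auto simp: Complex_eq intro!: continuous_intros)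
      then show ?thesis unfolding f_def by measurable
    qed
    show "AE y in lborel. ((\<lambda>x. f x y) \<longlongrightarrow> 0) at_top"
      using AE_lborel_singleton[of 0]
    proof eventually_elim
      case (elim y)
      let ?s = "Complex 0 y"
      have "?s \<noteq> 0" using elim by (simp add: complex_eq_iff)
      then have w: "Re (w ?s) > 0" by (intro Re_w_pos) auto
      have "((\<lambda>x. exp (- Re (w ?s) * x)) \<longlongrightarrow> 0) at_top"
        using w by (intro filterlim_compose[OF exp_at_bot] filterlim_tendsto_neg_mult_at_bot[OF tendsto_const _ filterlim_ident]) auto
      then have "((\<lambda>x. norm (?s ^ j) * exp (- Re (w ?s) * x)) \<longlongrightarrow> 0) at_top"
        by (rule tendsto_mult_right_zero)
      then show ?case by (simp add: f_def kern_inf[OF l] norm_mult norm_exp_eq_Re mult.commute)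
    qed
    show "\<forall>\<^sub>F x in at_top. AE y in lborel. norm (f x y) \<le> C * inverse (1 + y\<^sup>2)"
      using eventually_ge_at_top[of 1]
    proof eventually_elim
      case (elim x)
      have "norm (f x y) \<le> C * inverse (1 + y\<^sup>2)" for y
      proof -
        let ?s = "Complex 0 y"
        have p: "1 + y\<^sup>2 > 0" by (simp add: add_pos_nonneg)
        have ns: "norm ?s = \<bar>y\<bar>" by (simp add: cmod_def)
        have "1 + y\<^sup>2 \<le> (1 + \<bar>y\<bar>)\<^sup>2" by (simp add: power2_eq_square algebra_simps abs_mult_self_eq)
        then have "\<bar>y\<bar> ^ j * (1 + y\<^sup>2) \<le> (1 + \<bar>y\<bar>) ^ j * (1 + \<bar>y\<bar>)\<^sup>2"
          using p by (intro mult_mono power_mono) auto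
        then have pw: "norm ?s ^ j * (1 + y\<^sup>2) \<le> (1 + norm ?s) ^ (j + 2)" by (simp only: ns power_add)
        have "f x y * (1 + y\<^sup>2) = (norm ?s ^ j * (1 + y\<^sup>2)) * norm (kern0 x ?s)"
          by (simp add: f_def norm_mult norm_power)
        also have "\<dots> \<le> (1 + norm ?s) ^ (j + 2) * norm (kern0 x ?s)"
          using pw by (intro mult_right_mono) auto
        also have "\<dots> \<le> C" by (subst mult.commute, rule C) (use X[OF elim] elim in auto)
        finally show ?thesis using p by (simp add: f_def field_simps)
      qed
      then show ?case by simp
    qed
  qed auto
  then show ?thesis by (simp add: line_weight_def f_def)
qed

end

subsection \<open>Dependence on a parameter and convolution with a kernel\<close>

lemma hp_holo_diff: "hp_holo f \<Longrightarrow> hp_holo g \<Longrightarrow> hp_holo (\<lambda>z. f z - g z)"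
  by (auto simp: hp_holo_def intro!: continuous_intros holomorphic_intros)

lemma hp_polyI: "hp_holo F \<Longrightarrow> (\<And>z. 0 \<le> Re z \<Longrightarrow> norm (F z) \<le> C * (1 + norm z) ^ m) \<Longrightarrow> hp_poly m F"
  unfolding hp_poly_def by blast

lemma hp_poly_diff: assumes "hp_poly m F" "hp_poly m G" shows "hp_poly m (\<lambda>z. F z - G z)"
proof -
  obtain C D where C: "\<And>z. 0 \<le> Re z \<Longrightarrow> norm (F z) \<le> C * (1 + norm z) ^ m"
    and D: "\<And>z. 0 \<le> Re z \<Longrightarrow> norm (G z) \<le> D * (1 + norm z) ^ m"
    using assms unfolding hp_poly_def by blast
  show ?thesis
  proof (rule hp_polyI)
    show "hp_holo (\<lambda>z. F z - G z)" using assms by (auto simp: hp_poly_def intro: hp_holo_diff)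
    show "norm (F z - G z) \<le> (C + D) * (1 + norm z) ^ m" if "0 \<le> Re z" for z
      using norm_triangle_ineq4[of "F z" "G z"] C[OF that] D[OF that] by (simp add: distrib_right)
  qed
qed

lemma hp_poly_cmult: assumes "hp_poly m F" shows "hp_poly m (\<lambda>z. c * F z)"
proof -
  obtain C where C: "\<And>z. 0 \<le> Re z \<Longrightarrow> norm (F z) \<le> C * (1 + norm z) ^ m"
    using assms unfolding hp_poly_def by blast
  show ?thesis
  proof (rule hp_polyI)
    show "hp_holo (\<lambda>z. c * F z)" using assms by (auto simp: hp_poly_def intro: hp_holo_mult hp_holo_const)
    show "norm (c * F z) \<le> (norm c * C) * (1 + norm z) ^ m" if "0 \<le> Re z" for z
      using mult_left_mono[OF C[OF that] norm_ge_zero[of c]] by (simp add: norm_mult mult.assoc)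
  qed
qed

lemma damped_integrable: "hp_poly m F \<Longrightarrow> integrable lborel (\<lambda>y. damped m F (Complex 0 y))"
  by (rule hp_decay_line_integrable[OF hp_decay_damped order_refl])

lemma inv_dist_integrable:
  assumes "hp_poly m F" "\<phi> \<in> schwartz"
  shows "integrable lborel (\<lambda>t. indicator {0<..} t *\<^sub>R (line_inverse (damped m F) t * (sub_vderiv ^^ (m + 2)) \<phi> t))"
  by (rule reg_integrable[OF borel_measurable_line_inverse norm_line_inverse_le sub_vderiv_schwartz])
    (rule damped_integrable[OF assms(1)] assms(2))+

lemma inv_dist_diff:
  assumes F: "hp_poly m F" and G: "hp_poly m G" and \<phi>: "\<phi> \<in> schwartz"
  shows "inv_dist m (\<lambda>z. F z - G z) \<phi> = inv_dist m F \<phi> - inv_dist m G \<phi>"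
proof -
  have d: "damped m (\<lambda>z. F z - G z) = (\<lambda>z. damped m F z - damped m G z)"
    by (auto simp: damped_def diff_divide_distrib)
  show ?thesis
    unfolding inv_dist_apply[OF \<phi>] d line_inverse_diff[OF damped_integrable[OF F] damped_integrable[OF G]]
      left_diff_distrib scaleR_diff_right
    by (rule Bochner_Integration.integral_diff[OF inv_dist_integrable[OF F \<phi>] inv_dist_integrable[OF G \<phi>]])
qed

lemma inv_dist_cmult:
  assumes \<phi>: "\<phi> \<in> schwartz"
  shows "inv_dist m (\<lambda>z. c * F z) \<phi> = c * inv_dist m F \<phi>"
proof -
  have d: "damped m (\<lambda>z. c * F z) = (\<lambda>z. c * damped m F z)"
    by (auto simp: damped_def)
  have l: "line_inverse (\<lambda>z. c * damped m F z) t = c * line_inverse (damped m F) t" for t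
    by (simp add: line_inverse_def mult.left_commute[of _ c])
  have "inv_dist m (\<lambda>z. c * F z) \<phi> = (\<integral>t. c * (indicator {0<..} t *\<^sub>R (line_inverse (damped m F) t * (sub_vderiv ^^ (m + 2)) \<phi> t)) \<partial>lborel)"
    unfolding inv_dist_apply[OF \<phi>] d l by (simp add: mult.assoc)
  also have "\<dots> = c * inv_dist m F \<phi>"
    unfolding inv_dist_apply[OF \<phi>] by (rule integral_mult_right_zero)
  finally show ?thesis .
qed

lemma inv_dist_bound:
  assumes \<phi>: "\<phi> \<in> schwartz"
  shows "\<exists>A\<ge>0. \<forall>F. hp_poly m F \<longrightarrow> norm (inv_dist m F \<phi>) \<le> A * (\<integral>y. norm (damped m F (Complex 0 y)) \<partial>lborel)"
proof -
  note \<psi> = sub_vderiv_schwartz[OF \<phi>, of "m + 2"]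
  obtain B where B: "full_bounded 2 ((sub_vderiv ^^ (m + 2)) \<phi>) B" using schwartz_bounds[OF \<psi>] by blast
  let ?I = "\<integral>t. inverse (1 + t\<^sup>2) \<partial>(lborel :: real measure)"
  have "?I \<ge> 0" by (rule integral_nonneg_AE) (simp add: add_nonneg_nonneg)
  then have A: "2 * ?I * B \<ge> 0" using full_bounded_nonneg[OF B] by simp
  have "norm (inv_dist m F \<phi>) \<le> 2 * ?I * B * (\<integral>y. norm (damped m F (Complex 0 y)) \<partial>lborel)" if F: "hp_poly m F" for F
  proof -
    note i = damped_integrable[OF F]
    show ?thesis
      using reg_bound(2)[OF borel_measurable_line_inverse[OF i] norm_line_inverse_le[OF i] \<psi> B]
      unfolding inv_dist_def add_ddt_funpow[OF \<phi>] by (simp only: mult_ac)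
  qed
  with A show ?thesis by blast
qed

text \<open>A polynomial bound of the symbol controls the pairing, with a factor depending only on m
  and \<phi>; in this way estimates of symbols pass to distributions.\<close>

lemma inv_dist_bound_poly:
  assumes \<phi>: "\<phi> \<in> schwartz"
  shows "\<exists>A\<ge>0. \<forall>F C. hp_holo F \<and> (\<forall>z. 0 \<le> Re z \<longrightarrow> norm (F z) \<le> C * (1 + norm z) ^ m) \<longrightarrow> norm (inv_dist m F \<phi>) \<le> A * \<bar>C\<bar>"
proof -
  obtain A where A: "A \<ge> 0" "\<And>F. hp_poly m F \<Longrightarrow> norm (inv_dist m F \<phi>) \<le> A * (\<integral>y. norm (damped m F (Complex 0 y)) \<partial>lborel)"
    using inv_dist_bound[OF \<phi>] by blast
  let ?I = "\<integral>t. inverse (1 + t\<^sup>2) \<partial>(lborel :: real measure)"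
  have I: "?I \<ge> 0" by (rule integral_nonneg_AE) (simp add: add_nonneg_nonneg)
  have "norm (inv_dist m F \<phi>) \<le> (A * (2 ^ m * ?I)) * \<bar>C\<bar>"
    if h: "hp_holo F" and C: "\<And>z. 0 \<le> Re z \<Longrightarrow> norm (F z) \<le> C * (1 + norm z) ^ m" for F C
  proof -
    have F: "hp_poly m F" by (rule hp_polyI[OF h C])
    have "(\<integral>y. norm (damped m F (Complex 0 y)) \<partial>lborel) \<le> (\<integral>y. (2 ^ m * \<bar>C\<bar>) * inverse (1 + y\<^sup>2) \<partial>lborel)"
    proof (rule integral_mono)
      show "norm (damped m F (Complex 0 y)) \<le> 2 ^ m * \<bar>C\<bar> * inverse (1 + y\<^sup>2)" for y
      proof -
        have "norm (Complex 0 y) = \<bar>y\<bar>" "1 + y\<^sup>2 > 0" by (simp_all add: cmod_def add_pos_nonneg)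
        then show ?thesis
          using damped_bound[of "Complex 0 y" F C m] C[of "Complex 0 y"]
          by (simp add: field_simps)
      qed
    qed (intro integrable_norm damped_integrable[OF F] integrable_mult_right integrable_inverse_1_plus_square')+
    also have "\<dots> = (2 ^ m * \<bar>C\<bar>) * ?I" by (rule integral_mult_right_zero)
    finally have "A * (\<integral>y. norm (damped m F (Complex 0 y)) \<partial>lborel) \<le> A * ((2 ^ m * \<bar>C\<bar>) * ?I)"
      using A(1) by (rule mult_left_mono)
    with A(2)[OF F] show ?thesis by (simp add: mult_ac)
  qed
  moreover have "A * (2 ^ m * ?I) \<ge> 0" using A(1) I by simp
  ultimately show ?thesis by blast
qed

text \<open>The first-order remainder of the symbol in x is at most C (y - x)^2 (1 + |s|)^m;
  inversion is linear and bounded, so the remainder of the pairing is quadratic as well.\<close>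

lemma inv_dist_parameter_derivative:
  assumes S: "convex S" "x \<in> S" and \<phi>: "\<phi> \<in> schwartz"
    and F: "\<And>x. x \<in> S \<Longrightarrow> hp_poly m (F x)" and F': "\<And>x. x \<in> S \<Longrightarrow> hp_poly m (F' x)"
    and d: "\<And>x s. x \<in> S \<Longrightarrow> 0 \<le> Re s \<Longrightarrow> ((\<lambda>x. F x s) has_vector_derivative F' x s) (at x within S)"
    and d': "\<And>x s. x \<in> S \<Longrightarrow> 0 \<le> Re s \<Longrightarrow> ((\<lambda>x. F' x s) has_vector_derivative F'' x s) (at x within S)"
    and C: "\<And>x s. x \<in> S \<Longrightarrow> 0 \<le> Re s \<Longrightarrow> norm (F'' x s) \<le> C * (1 + norm s) ^ m"
  shows "((\<lambda>x. inv_dist m (F x) \<phi>) has_vector_derivative inv_dist m (F' x) \<phi>) (at x within S)"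
proof -
  obtain A where A: "A \<ge> 0" "\<And>F C. hp_holo F \<Longrightarrow> (\<And>z. 0 \<le> Re z \<Longrightarrow> norm (F z) \<le> C * (1 + norm z) ^ m) \<Longrightarrow> norm (inv_dist m F \<phi>) \<le> A * \<bar>C\<bar>"
    using inv_dist_bound_poly[OF \<phi>] by blast
  show ?thesis
  proof (rule has_vector_derivative_quadraticI)
    fix y assume y: "y \<in> S"
    define G where "G z = (F y z - F x z) - of_real (y - x) * F' x z" for z
    have p: "hp_poly m (\<lambda>z. F y z - F x z)" "hp_poly m (\<lambda>z. of_real (y - x) * F' x z)"
      by (rule hp_poly_diff[OF F[OF y] F[OF S(2)]] hp_poly_cmult[OF F'[OF S(2)]])+
    have G: "hp_poly m G" unfolding G_def[abs_def] by (rule hp_poly_diff[OF p])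
    have "inv_dist m G \<phi> = inv_dist m (F y) \<phi> - inv_dist m (F x) \<phi> - (y - x) *\<^sub>R inv_dist m (F' x) \<phi>"
      unfolding G_def[abs_def] inv_dist_diff[OF p \<phi>] inv_dist_diff[OF F[OF y] F[OF S(2)] \<phi>] inv_dist_cmult[OF \<phi>] scaleR_conv_of_real ..
    moreover have "norm (inv_dist m G \<phi>) \<le> A * \<bar>C * (y - x)\<^sup>2\<bar>"
    proof (rule A(2))
      show "hp_holo G" using G by (simp add: hp_poly_def)
      fix z :: complex assume z: "0 \<le> Re z"
      have "norm (F y z - F x z - (y - x) *\<^sub>R F' x z) \<le> (C * (1 + norm z) ^ m) * (y - x)\<^sup>2"
      proof (rule quadratic_remainder[OF S y d d'])
        fix t assume "t \<in> closed_segment x y"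
        then have "t \<in> S" using closed_segment_subset[OF S(2) y S(1)] by blast
        then show "norm (F'' t z) \<le> C * (1 + norm z) ^ m" using C z by blast
      qed (use z in auto)
      then show "norm (G z) \<le> C * (y - x)\<^sup>2 * (1 + norm z) ^ m"
        by (simp add: G_def scaleR_conv_of_real mult_ac)
    qed
    ultimately show "norm (inv_dist m (F y) \<phi> - inv_dist m (F x) \<phi> - (y - x) *\<^sub>R inv_dist m (F' x) \<phi>) \<le> (A * \<bar>C\<bar>) * (y - x)\<^sup>2"
      by (simp add: abs_mult mult_ac)
  qed
qed

text \<open>Commuting the factors moves U onto the test function, so that dependence on the symbol F
  is that of \<open>inv_dist\<close> at one fixed test function.\<close>

lemma conv_inv_dist:
  assumes U: "U \<in> tempered_pos" and F: "hp_poly m F" and \<phi>: "\<phi> \<in> schwartz"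
  shows "(U *\<^sub>t inv_dist m F) \<phi> = inv_dist m F (\<lambda>t. cutoff 0 t * U (\<lambda>\<tau>. \<phi> (t + \<tau>)))"
proof -
  have T: "inv_dist m F \<in> tempered_pos" by (rule has_laplaceD(1)[OF inv_dist_has_laplace[OF F]])
  show ?thesis
    unfolding conv_commute[OF U T] conv_apply[OF \<phi>]
    by (rule pos_apply_extend[OF T pos_schwartz_translate[OF U \<phi>]])
qed

section \<open>Representation by functions\<close>

lemma represented_by_reg:
  assumes g: "g \<in> borel_measurable borel" "\<And>t. norm (g t) \<le> K"
  shows "represented_by (reg g) g"
  unfolding represented_by_def set_integrable_def set_lebesgue_integral_def
  using reg_integrable[OF g] by (auto simp: reg_def)

lemma zero_at_left_limit:
  fixes f :: "real \<Rightarrow> complex"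
  assumes "continuous_on UNIV f" "\<And>t. t < 0 \<Longrightarrow> f t = 0" and t: "t \<le> 0"
  shows "f t = 0"
proof (cases "t = 0")
  case True
  have "isCont f 0" using assms(1) by (simp add: continuous_on_eq_continuous_at)
  moreover have "(\<lambda>n. - inverse (real (Suc n))) \<longlonglongrightarrow> 0"
    using tendsto_minus[OF LIMSEQ_inverse_real_of_nat] by simp
  ultimately have "(\<lambda>n. f (- inverse (real (Suc n)))) \<longlonglongrightarrow> f 0"
    by (rule isCont_tendsto_compose)
  then have "(\<lambda>n. 0) \<longlonglongrightarrow> f 0" using assms(2) by simp
  then show ?thesis using True by (simp add: LIMSEQ_const_iff)
qed (use assms in auto)

lemma compact_support_integral:
  fixes h :: "real \<Rightarrow> complex"
  assumes c: "continuous_on UNIV h" and z: "\<And>t. \<bar>t\<bar> > b \<Longrightarrow> h t = 0"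
  shows "integrable lborel h" "(\<integral>t. h t \<partial>lborel) = integral {- b..b} h"
proof -
  have ind: "h = (\<lambda>t. indicator {- b..b} t *\<^sub>R h t)"
    using z by (auto simp: indicator_def fun_eq_iff abs_le_iff not_le)
  have i: "set_integrable lborel {- b..b} h"
    by (rule borel_integrable_atLeastAtMost') (rule continuous_on_subset[OF c], simp)
  then show "integrable lborel h" using ind by (simp add: set_integrable_def)
  show "(\<integral>t. h t \<partial>lborel) = integral {- b..b} h"
    using set_borel_integral_eq_integral(2)[OF i] ind by (simp add: set_lebesgue_integral_def)
qed

lemma schwartz_continuous: "\<phi> \<in> schwartz \<Longrightarrow> continuous_on A \<phi>"
  using derivs_continuous_on[OF schwartz_derivs, of \<phi> A 0] by simp

lemma line_inverse_rapid_nonpos: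
  assumes F: "hp_rapid F" and t: "t \<le> 0" shows "line_inverse F t = 0"
  by (rule zero_at_left_limit[OF continuous_line_inverse[OF hp_rapid_integrable0[OF F]] _ t])
    (rule line_inverse_negative[OF hp_rapid_decay[OF F]])

lemma kernel_conv_nonpos:
  assumes U: "U \<in> tempered_pos" and F: "hp_rapid F" and t: "t \<le> 0" shows "kernel_conv U F t = 0"
  by (rule zero_at_left_limit[OF kernel_conv_continuous[OF U F] _ t]) (rule kernel_conv_negative[OF U F])

text \<open>After the substitution r = t + \<tau> the integral runs over a fixed compact interval
  and can be exchanged with the pairing with U. Kernel and convolution vanish for t \<le> 0, so
  integrals over t > 0 and over the line coincide.\<close>

lemma represented_by_kernel_conv:
  assumes U: "U \<in> tempered_pos" and F: "hp_rapid F"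
  shows "represented_by (U *\<^sub>t reg (line_inverse F)) (kernel_conv U F)"
  unfolding represented_by_def set_integrable_def set_lebesgue_integral_def
proof (intro ballI impI)
  fix \<phi> assume \<phi>: "\<phi> \<in> schwartz" and "bounded {t. \<phi> t \<noteq> 0}"
  then obtain b where "\<And>t. \<phi> t \<noteq> 0 \<Longrightarrow> \<bar>t\<bar> \<le> b" by (auto simp: bounded_iff)
  then have b: "\<And>t. \<bar>t\<bar> > max b 0 \<Longrightarrow> \<phi> t = 0" by force
  define c where "c = max b 0"
  have c: "c \<ge> 0" "\<And>t. \<bar>t\<bar> > c \<Longrightarrow> \<phi> t = 0" using b by (auto simp: c_def)
  let ?k = "line_inverse F" and ?v = "kernel_conv U F"
  have ck: "continuous_on A ?k" for A by (rule continuous_line_inverse[OF hp_rapid_integrable0[OF F]])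
  have v: "indicator {0<..} t *\<^sub>R (?v t * \<phi> t) = ?v t * \<phi> t" for t
    using kernel_conv_nonpos[OF U F, of t] by (auto simp: indicator_def)
  have cv: "continuous_on UNIV (\<lambda>t. \<phi> t * ?v t)"
    by (intro continuous_intros schwartz_continuous[OF \<phi>] kernel_conv_continuous[OF U F])
  note vi = compact_support_integral[OF cv, of c]
  have reg: "reg ?k (\<lambda>\<tau>. \<phi> (t + \<tau>)) = integral {- c..c} (\<lambda>r. \<phi> r * ?k (r - t))" for t
  proof -
    have "indicator {0<..} \<tau> *\<^sub>R (?k \<tau> * \<phi> (t + \<tau>)) = ?k \<tau> * \<phi> (t + \<tau>)" for \<tau>
      using line_inverse_rapid_nonpos[OF F, of \<tau>] by (auto simp: indicator_def)
    then have "reg ?k (\<lambda>\<tau>. \<phi> (t + \<tau>)) = (\<integral>\<tau>. ?k \<tau> * \<phi> (t + \<tau>) \<partial>lborel)"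
      unfolding reg_def restrict_apply'[OF schwartz_translate[OF \<phi>]] by simp
    also have "\<dots> = (\<integral>r. \<phi> r * ?k (r - t) \<partial>lborel)"
      using lborel_integral_real_affine[of 1 "\<lambda>r. \<phi> r * ?k (r - t)" t] by (simp add: mult.commute)
    also have "\<dots> = integral {- c..c} (\<lambda>r. \<phi> r * ?k (r - t))"
      by (rule compact_support_integral(2))
        (auto intro!: continuous_intros schwartz_continuous[OF \<phi>] continuous_on_compose2[OF ck, of UNIV] simp: c(2))
    finally show ?thesis .
  qed
  have "(U *\<^sub>t reg ?k) \<phi> = integral {- c..c} (\<lambda>r. \<phi> r * ?v r)"
    unfolding conv_apply[OF \<phi>] reg by (rule pos_apply_integral[OF U F \<phi>]) (use c in auto)
  also have "\<dots> = (\<integral>r. \<phi> r * ?v r \<partial>lborel)" using vi(2) c(2) by simp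
  also have "\<dots> = (\<integral>r. indicator {0<..} r *\<^sub>R (?v r * \<phi> r) \<partial>lborel)" unfolding v by (simp only: mult.commute)
  finally show "integrable lborel (\<lambda>t. indicator {0<..} t *\<^sub>R (?v t * \<phi> t)) \<and>
      (U *\<^sub>t reg ?k) \<phi> = (\<integral>t. indicator {0<..} t *\<^sub>R (?v t * \<phi> t) \<partial>lborel)"
    using vi(1) c(2) unfolding v by (simp add: mult.commute)
qed

text \<open>The reflected kernel times the cutoff has support in [-1, t], so
  \<open>represented_by\<close> applies to it; the reflection \<tau> \<mapsto> t - \<tau> then gives
  the convolution integral.\<close>

lemma kernel_conv_function:
  assumes U: "U \<in> tempered_pos" "represented_by U f" and F: "hp_rapid F" and t: "0 < t"
  shows "set_integrable lborel {0<..<t} (\<lambda>\<tau>. f (t - \<tau>) * line_inverse F \<tau>)"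
    "kernel_conv U F t = (LINT \<tau>:{0<..<t}|lborel. f (t - \<tau>) * line_inverse F \<tau>)"
proof -
  let ?k = "line_inverse F"
  define \<psi> where "\<psi> \<tau> = cutoff 0 \<tau> * ?k (t - \<tau>)" for \<tau>
  have \<psi>: "\<psi> \<in> schwartz" unfolding \<psi>_def[abs_def] by (rule extend_schwartz[OF reflected_pos_schwartz[OF F]])
  have "{\<tau>. \<psi> \<tau> \<noteq> 0} \<subseteq> {- 1..t}"
  proof
    fix \<tau> assume "\<tau> \<in> {\<tau>. \<psi> \<tau> \<noteq> 0}"
    then have "\<not> \<tau> \<le> - 1" "\<not> t - \<tau> \<le> 0"
      using cutoff_eq_0 line_inverse_rapid_nonpos[OF F] by (auto simp: \<psi>_def)
    then show "\<tau> \<in> {- 1..t}" by simp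
  qed
  then have "bounded {\<tau>. \<psi> \<tau> \<noteq> 0}" using bounded_subset[OF bounded_closed_interval] by blast
  then have i: "integrable lborel (\<lambda>\<tau>. indicator {0<..} \<tau> *\<^sub>R (f \<tau> * \<psi> \<tau>))"
    and e: "U \<psi> = (\<integral>\<tau>. indicator {0<..} \<tau> *\<^sub>R (f \<tau> * \<psi> \<tau>) \<partial>lborel)"
    using U(2) \<psi> by (auto simp: represented_by_def set_integrable_def set_lebesgue_integral_def)
  have eq: "indicator {0<..} (t + (- 1) * \<tau>) *\<^sub>R (f (t + (- 1) * \<tau>) * \<psi> (t + (- 1) * \<tau>)) = indicator {0<..<t} \<tau> *\<^sub>R (f (t - \<tau>) * ?k \<tau>)" for \<tau>
    using line_inverse_rapid_nonpos[OF F, of \<tau>] cutoff_eq_1[of "t - \<tau>"]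
    by (auto simp: indicator_def \<psi>_def)
  show "set_integrable lborel {0<..<t} (\<lambda>\<tau>. f (t - \<tau>) * ?k \<tau>)"
    using lborel_integrable_real_affine[OF i, of "- 1" t] unfolding eq set_integrable_def by simp
  have "kernel_conv U F t = U \<psi>"
    unfolding kernel_conv_def pos_apply_extend[OF U(1) reflected_pos_schwartz[OF F]] \<psi>_def[abs_def] ..
  also have "\<dots> = (LINT \<tau>:{0<..<t}|lborel. f (t - \<tau>) * ?k \<tau>)"
    unfolding e set_lebesgue_integral_def
    using lborel_integral_real_affine[of "- 1" "\<lambda>\<tau>. indicator {0<..} \<tau> *\<^sub>R (f \<tau> * \<psi> \<tau>)" t] unfolding eq by simp
  finally show "kernel_conv U F t = (LINT \<tau>:{0<..<t}|lborel. f (t - \<tau>) * ?k \<tau>)" .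
qed

subsection \<open>The kernel and the solution\<close>

context fractional_wave_on
begin

text \<open>The exponent 3 suits all four symbols: two powers from w^2 and one from the
  x-derivative.\<close>

lemma hp_poly_kern:
  "\<exists>C\<ge>0. \<forall>x\<in>space_dom l. \<forall>s. 0 \<le> Re s \<longrightarrow> norm (kern0 x s) \<le> C * (1 + norm s) ^ 3 \<and>
     norm (kern1 x s) \<le> C * (1 + norm s) ^ 3 \<and> norm ((w s)\<^sup>2 * kern0 x s) \<le> C * (1 + norm s) ^ 3 \<and>
     norm ((w s)\<^sup>2 * kern1 x s) \<le> C * (1 + norm s) ^ 3"
proof -
  obtain C where C: "C > 0" "\<And>x s. x \<in> space_dom l \<Longrightarrow> 0 \<le> Re s \<Longrightarrow>
     norm (kern0 x s) \<le> C * exp (- (x * Re (w s))) \<and> norm (kern1 x s) \<le> C * (1 + norm s)"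
    using kern_bounds by blast
  have "norm (kern0 x s) \<le> C * (1 + norm s) ^ 3 \<and>
     norm (kern1 x s) \<le> C * (1 + norm s) ^ 3 \<and> norm ((w s)\<^sup>2 * kern0 x s) \<le> C * (1 + norm s) ^ 3 \<and>
     norm ((w s)\<^sup>2 * kern1 x s) \<le> C * (1 + norm s) ^ 3"
    if x: "x \<in> space_dom l" and s: "0 \<le> Re s" for x s
  proof -
    define r where "r = 1 + norm s"
    have r: "r \<ge> 1" by (simp add: r_def)
    have w: "(norm (w s))\<^sup>2 \<le> r\<^sup>2" using norm_w_le[OF s] by (intro power_mono) (auto simp: r_def)
    have "exp (- (x * Re (w s))) \<le> 1" using x Re_w_nonneg[OF s] by (simp add: space_dom_iff)
    then have "C * exp (- (x * Re (w s))) \<le> C * 1" using C(1) by (intro mult_left_mono) auto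
    then have 0: "norm (kern0 x s) \<le> C" using C(2)[OF x s] by simp
    have 1: "norm (kern1 x s) \<le> C * r" using C(2)[OF x s] by (simp add: r_def)
    have p: "1 \<le> r ^ 3" "r \<le> r ^ 3" "r ^ 2 \<le> r ^ 3"
      using r power_increasing[of 1 3 r] power_increasing[of 2 3 r] by (auto intro: one_le_power)
    have "C * 1 \<le> C * r ^ 3" "C * r \<le> C * r ^ 3" "C * r\<^sup>2 \<le> C * r ^ 3"
      using C(1) p by (auto intro: mult_left_mono simp only:)
    moreover have "(norm (w s))\<^sup>2 * norm (kern0 x s) \<le> r\<^sup>2 * C"
      using w 0 by (intro mult_mono) auto
    moreover have "(norm (w s))\<^sup>2 * norm (kern1 x s) \<le> r\<^sup>2 * (C * r)"
      using w 1 by (intro mult_mono) auto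
    moreover have "r\<^sup>2 * (C * r) = C * r ^ 3" by (simp add: power2_eq_square power3_eq_cube)
    ultimately show ?thesis
      using 0 1 unfolding norm_mult norm_power r_def[symmetric] by (simp only: mult.commute) (intro conjI TrueI; linarith)
  qed
  then show ?thesis using C(1) by (intro exI[of _ C]) auto
qed

lemma hp_holo_w2: "hp_holo (\<lambda>s. (w s)\<^sup>2 * kern0 x s)" "hp_holo (\<lambda>s. (w s)\<^sup>2 * kern1 x s)"
  unfolding power2_eq_square by (rule hp_holo_mult hp_holo_w hp_holo_kern0 hp_holo_kern1)+

lemma hp_poly_kern0: "x \<in> space_dom l \<Longrightarrow> hp_poly 3 (kern0 x)"
  and hp_poly_kern1: "x \<in> space_dom l \<Longrightarrow> hp_poly 3 (kern1 x)"
  and hp_poly_kern2: "x \<in> space_dom l \<Longrightarrow> hp_poly 3 (\<lambda>s. (w s)\<^sup>2 * kern0 x s)"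
  unfolding hp_poly_def using hp_poly_kern hp_holo_kern0 hp_holo_kern1 hp_holo_w2 by meson+

lemma kern_parameter_derivative:
  assumes x: "x \<in> space_dom l" and \<phi>: "\<phi> \<in> schwartz"
  shows "((\<lambda>x. inv_dist 3 (kern0 x) \<phi>) has_vector_derivative inv_dist 3 (kern1 x) \<phi>) (at x within space_dom l)"
    "((\<lambda>x. inv_dist 3 (kern1 x) \<phi>) has_vector_derivative inv_dist 3 (\<lambda>s. (w s)\<^sup>2 * kern0 x s) \<phi>) (at x within space_dom l)"
proof -
  obtain C where C: "\<And>x s. x \<in> space_dom l \<Longrightarrow> 0 \<le> Re s \<Longrightarrow> norm ((w s)\<^sup>2 * kern0 x s) \<le> C * (1 + norm s) ^ 3"
     "\<And>x s. x \<in> space_dom l \<Longrightarrow> 0 \<le> Re s \<Longrightarrow> norm ((w s)\<^sup>2 * kern1 x s) \<le> C * (1 + norm s) ^ 3"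
    using hp_poly_kern by blast
  show "((\<lambda>x. inv_dist 3 (kern0 x) \<phi>) has_vector_derivative inv_dist 3 (kern1 x) \<phi>) (at x within space_dom l)"
    by (rule inv_dist_parameter_derivative[OF space_dom_convex x \<phi> hp_poly_kern0 hp_poly_kern1 kern0_derivative kern1_derivative C(1)])
  show "((\<lambda>x. inv_dist 3 (kern1 x) \<phi>) has_vector_derivative inv_dist 3 (\<lambda>s. (w s)\<^sup>2 * kern0 x s) \<phi>) (at x within space_dom l)"
    by (rule inv_dist_parameter_derivative[OF space_dom_convex x \<phi> hp_poly_kern1 hp_poly_kern2 kern1_derivative _ C(2)])
      (auto intro: has_vector_derivative_mult_right[OF kern0_derivative])
qed

lemma kernel_has_laplace:
  assumes "x \<in> space_dom l" shows "has_laplace (inv_dist 3 (kern0 x)) (kernel_hat M l x)"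
  by (rule has_laplace_cong[OF inv_dist_has_laplace[OF hp_poly_kern0[OF assms]]]) (simp add: kernel_hat_eq)

lemma inverse_laplace_kernel: "x \<in> space_dom l \<Longrightarrow> inverse_laplace (kernel_hat M l x) = inv_dist 3 (kern0 x)"
  by (rule inverse_laplace_eq[OF kernel_has_laplace])

lemma zero_mem_space_dom: "0 \<in> space_dom l"
  unfolding space_dom_iff using len_pos by (auto intro: less_imp_le)

lemma kernel_at_0: "inv_dist 3 (kern0 0) = dirac"
  by (rule has_laplace_unique[OF inv_dist_has_laplace[OF hp_poly_kern0[OF zero_mem_space_dom]] has_laplace_dirac])
    (simp add: kern0_boundary(1))

lemma kernel_at_len:
  assumes l: "l \<noteq> \<infinity>" shows "inv_dist 3 (kern0 len) = zero_distr"
proof -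
  have "len \<in> space_dom l" unfolding space_dom_iff using len_pos[OF l] by auto
  from has_laplace_unique[OF inv_dist_has_laplace[OF hp_poly_kern0[OF this]] has_laplace_zero kern0_boundary(2)[OF _ l]]
  show ?thesis .
qed

lemma hp_poly_PQ: "hp_poly 0 (\<lambda>s. P s / Q s)"
proof (rule hp_polyI)
  show "hp_holo (\<lambda>s. P s / Q s)"
    by (rule hp_holo_divide[OF hp_holo_P hp_holo_Q]) (rule PQ_nonzero)
  show "norm (P s / Q s) \<le> \<rho> * (1 + norm s) ^ 0" if "0 \<le> Re s" for s
    using norm_Q_P(2)[OF that] PQ_nonzero(2)[OF that] by (simp add: norm_divide divide_le_eq)
qed

lemma inverse_laplace_PQ: "inverse_laplace (\<lambda>s. P s / Q s) = inv_dist 0 (\<lambda>s. P s / Q s)"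
  by (rule inverse_laplace_eq[OF inv_dist_has_laplace[OF hp_poly_PQ]])

text \<open>On the imaginary axis |1 + i y| \<ge> 1, so damping only decreases the symbol, and the
  L1 norm of the undamped kernel bounds the pairing.\<close>

lemma kernel_vanishing:
  assumes l: "l = \<infinity>" and \<phi>: "\<phi> \<in> schwartz"
  shows "((\<lambda>x. inv_dist 3 (kern0 x) \<phi>) \<longlongrightarrow> 0) at_top"
proof -
  obtain A where A: "A \<ge> 0" "\<And>F. hp_poly 3 F \<Longrightarrow> norm (inv_dist 3 F \<phi>) \<le> A * (\<integral>y. norm (damped 3 F (Complex 0 y)) \<partial>lborel)"
    using inv_dist_bound[OF \<phi>] by blast
  have "norm (inv_dist 3 (kern0 x) \<phi>) \<le> A * line_weight 0 (kern0 x)" if x: "x \<ge> 1" for x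
  proof -
    have X: "x \<in> space_dom l - {0}" unfolding Diff_iff space_dom_iff using x l by auto
    then have p: "hp_poly 3 (kern0 x)" using hp_poly_kern0 by blast
    have "(\<integral>y. norm (damped 3 (kern0 x) (Complex 0 y)) \<partial>lborel) \<le> (\<integral>y. norm (kern0 x (Complex 0 y)) \<partial>lborel)"
    proof (rule integral_mono[OF integrable_norm[OF damped_integrable[OF p]] integrable_norm[OF hp_rapid_integrable0[OF hp_rapid_kern0[OF X]]]])
      fix y :: real
      have "1 \<le> norm (1 + Complex 0 y)" by (simp add: cmod_def)
      then have "1 \<le> norm (1 + Complex 0 y) ^ 5" by (rule one_le_power)
      then have "norm (kern0 x (Complex 0 y)) / norm (1 + Complex 0 y) ^ 5 \<le> norm (kern0 x (Complex 0 y)) / 1"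
        by (intro divide_left_mono) auto
      then show "norm (damped 3 (kern0 x) (Complex 0 y)) \<le> norm (kern0 x (Complex 0 y))"
        by (simp add: damped_def norm_divide norm_power)
    qed
    then show ?thesis
      using A(2)[OF p] mult_left_mono[OF _ A(1)] by (fastforce simp: line_weight_def)
  qed
  moreover have "((\<lambda>x. A * line_weight 0 (kern0 x)) \<longlongrightarrow> 0) at_top"
    by (rule tendsto_mult_right_zero[OF kern_weight_tendsto_at_top[OF l]])
  ultimately show ?thesis
    by (intro Lim_null_comparison[of "\<lambda>x. inv_dist 3 (kern0 x) \<phi>"])
      (auto intro: eventually_mono[OF eventually_ge_at_top[of 1]])
qed

text \<open>The equation and the values at the end points are identities of transforms, settled by
  uniqueness; in the equation (P / Q) w^2 = s^2. Derivatives and limits in x are carried from the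
  kernel to u by a test function that does not depend on x.\<close>

lemma wave_solution_conv:
  assumes U: "U \<in> tempered_pos"
  shows "wave_solution (inv_dist 0 (\<lambda>s. P s / Q s)) l U (\<lambda>x. U *\<^sub>t inverse_laplace (kernel_hat M l x))"
proof -
  let ?K = "\<lambda>x. inv_dist 3 (kern0 x)" and ?K1 = "\<lambda>x. inv_dist 3 (kern1 x)"
    and ?K2 = "\<lambda>x. inv_dist 3 (\<lambda>s. (w s)\<^sup>2 * kern0 x s)" and ?L = "inv_dist 0 (\<lambda>s. P s / Q s)"
  let ?u = "\<lambda>x. U *\<^sub>t inverse_laplace (kernel_hat M l x)"
  note L = inv_dist_has_laplace[OF hp_poly_PQ]
  note KL = inv_dist_has_laplace[OF hp_poly_kern0] inv_dist_has_laplace[OF hp_poly_kern1] inv_dist_has_laplace[OF hp_poly_kern2]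
  note KT = KL[THEN has_laplaceD(1)]
  have uK: "?u x = U *\<^sub>t ?K x" if "x \<in> space_dom l" for x unfolding inverse_laplace_kernel[OF that] ..
  \<comment> \<open>The correlation of \<phi> with U, made Schwartz by the cutoff.\<close>
  define \<Psi> where "\<Psi> \<phi> t = cutoff 0 t * U (\<lambda>\<tau>. \<phi> (t + \<tau>))" for \<phi> t
  have \<Psi>: "\<Psi> \<phi> \<in> schwartz" if "\<phi> \<in> schwartz" for \<phi>
    unfolding \<Psi>_def[abs_def] by (rule extend_schwartz[OF pos_schwartz_translate[OF U that]])
  have u0: "?u x \<phi> = ?K x (\<Psi> \<phi>)" if "x \<in> space_dom l" "\<phi> \<in> schwartz" for x \<phi>
    unfolding uK[OF that(1)] \<Psi>_def[abs_def] by (rule conv_inv_dist[OF U hp_poly_kern0[OF that(1)] that(2)])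
  have u1: "(U *\<^sub>t ?K1 x) \<phi> = ?K1 x (\<Psi> \<phi>)" if "x \<in> space_dom l" "\<phi> \<in> schwartz" for x \<phi>
    unfolding \<Psi>_def[abs_def] by (rule conv_inv_dist[OF U hp_poly_kern1[OF that(1)] that(2)])
  have u2: "(U *\<^sub>t ?K2 x) \<phi> = ?K2 x (\<Psi> \<phi>)" if "x \<in> space_dom l" "\<phi> \<in> schwartz" for x \<phi>
    unfolding \<Psi>_def[abs_def] by (rule conv_inv_dist[OF U hp_poly_kern2[OF that(1)] that(2)])
  have d0: "has_x_deriv ?u (\<lambda>x. U *\<^sub>t ?K1 x) (space_dom l)"
    unfolding has_x_deriv_def
  proof (intro ballI)
    fix x \<phi> assume x: "x \<in> space_dom l" and \<phi>: "\<phi> \<in> schwartz"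
    show "((\<lambda>y. ?u y \<phi>) has_vector_derivative (U *\<^sub>t ?K1 x) \<phi>) (at x within space_dom l)"
      unfolding u1[OF x \<phi>]
      by (rule has_vector_derivative_transform[OF x _ kern_parameter_derivative(1)[OF x \<Psi>[OF \<phi>]]]) (rule u0[OF _ \<phi>])
  qed
  have d1: "has_x_deriv (\<lambda>x. U *\<^sub>t ?K1 x) (\<lambda>x. U *\<^sub>t ?K2 x) (space_dom l)"
    unfolding has_x_deriv_def
  proof (intro ballI)
    fix x \<phi> assume x: "x \<in> space_dom l" and \<phi>: "\<phi> \<in> schwartz"
    show "((\<lambda>y. (U *\<^sub>t ?K1 y) \<phi>) has_vector_derivative (U *\<^sub>t ?K2 x) \<phi>) (at x within space_dom l)"
      unfolding u2[OF x \<phi>]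
      by (rule has_vector_derivative_transform[OF x _ kern_parameter_derivative(2)[OF x \<Psi>[OF \<phi>]]]) (rule u1[OF _ \<phi>])
  qed
  have eq: "ddt (ddt (?u x)) = ?L *\<^sub>t (U *\<^sub>t ?K2 x)" if x: "x \<in> space_dom l" for x
    unfolding uK[OF x]
  proof (rule laplace_unique)
    note c0 = conv_tempered_pos[OF U KT(1)[OF x]] and c2 = conv_tempered_pos[OF U KT(3)[OF x]]
    show "ddt (ddt (U *\<^sub>t ?K x)) \<in> tempered_pos" by (intro ddt_tempered_pos c0)
    show "?L *\<^sub>t (U *\<^sub>t ?K2 x) \<in> tempered_pos" by (rule conv_tempered_pos[OF has_laplaceD(1)[OF L] c2])
    fix s :: complex assume s: "0 < Re s"
    have nz: "P s \<noteq> 0" "Q s \<noteq> 0" using PQ_nonzero[of s] s by auto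
    have "laplace (?L *\<^sub>t (U *\<^sub>t ?K2 x)) s = P s / Q s * (laplace U s * ((w s)\<^sup>2 * kern0 x s))"
      unfolding laplace_conv[OF has_laplaceD(1)[OF L] c2 s] laplace_conv[OF U KT(3)[OF x] s]
        has_laplaceD(2)[OF L s] has_laplaceD(2)[OF KL(3)[OF x] s] ..
    also have "(w s)\<^sup>2 = s\<^sup>2 * (Q s / P s)" by (simp add: w_def power_mult_distrib M_square)
    also have "P s / Q s * (laplace U s * (s\<^sup>2 * (Q s / P s) * kern0 x s)) = s * (s * (laplace U s * kern0 x s))"
      using nz by (simp add: power2_eq_square)
    also have "\<dots> = laplace (ddt (ddt (U *\<^sub>t ?K x))) s"
      unfolding laplace_ddt[OF ddt_tempered_pos[OF c0] s] laplace_ddt[OF c0 s] laplace_conv[OF U KT(1)[OF x] s]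
        has_laplaceD(2)[OF KL(1)[OF x] s] ..
    finally show "laplace (ddt (ddt (U *\<^sub>t ?K x))) s = laplace (?L *\<^sub>t (U *\<^sub>t ?K2 x)) s" ..
  qed
  have b0: "?u 0 = U"
    unfolding uK[OF zero_mem_space_dom] kernel_at_0
  proof (rule laplace_unique[OF conv_tempered_pos[OF U has_laplaceD(1)[OF has_laplace_dirac]] U])
    fix s :: complex assume s: "0 < Re s"
    show "laplace (U *\<^sub>t dirac) s = laplace U s"
      unfolding laplace_conv[OF U has_laplaceD(1)[OF has_laplace_dirac] s] has_laplaceD(2)[OF has_laplace_dirac s] by simp
  qed
  have bl: "if l = \<infinity> then \<forall>\<phi>\<in>schwartz. ((\<lambda>x. ?u x \<phi>) \<longlongrightarrow> 0) at_top else ?u (real_of_ereal l) = zero_distr"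
  proof (cases "l = \<infinity>")
    case True
    have "((\<lambda>x. ?u x \<phi>) \<longlongrightarrow> 0) at_top" if \<phi>: "\<phi> \<in> schwartz" for \<phi>
    proof (rule Lim_transform_eventually[OF kernel_vanishing[OF True \<Psi>[OF \<phi>]]])
      show "\<forall>\<^sub>F x in at_top. ?K x (\<Psi> \<phi>) = ?u x \<phi>"
        using eventually_ge_at_top[of 0]
      proof eventually_elim
        case (elim x)
        have "x \<in> space_dom l" unfolding space_dom_iff using elim True by auto
        then show ?case using u0[OF _ \<phi>] by simp
      qed
    qed
    then show ?thesis unfolding if_P[OF True] by blast
  next
    case False
    have x: "len \<in> space_dom l" unfolding space_dom_iff using len_pos[OF False] by auto
    have "?u len = zero_distr"
      unfolding uK[OF x] kernel_at_len[OF False]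
    proof (rule laplace_unique[OF conv_tempered_pos[OF U has_laplaceD(1)[OF has_laplace_zero]] has_laplaceD(1)[OF has_laplace_zero]])
      fix s :: complex assume s: "0 < Re s"
      show "laplace (U *\<^sub>t zero_distr) s = laplace zero_distr s"
        unfolding laplace_conv[OF U has_laplaceD(1)[OF has_laplace_zero] s] has_laplaceD(2)[OF has_laplace_zero s] by simp
    qed
    then show ?thesis unfolding if_not_P[OF False] len_def .
  qed
  have T: "?u x \<in> tempered_pos" "U *\<^sub>t ?K1 x \<in> tempered_pos" "U *\<^sub>t ?K2 x \<in> tempered_pos" if "x \<in> space_dom l" for x
    unfolding uK[OF that] by (rule conv_tempered_pos[OF U KT(1)[OF that]] conv_tempered_pos[OF U KT(2)[OF that]] conv_tempered_pos[OF U KT(3)[OF that]])+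
  show ?thesis
    unfolding wave_solution_def
    using T eq b0 bl d0 d1 by (intro conjI exI[of _ "\<lambda>x. U *\<^sub>t ?K1 x"] exI[of _ "\<lambda>x. U *\<^sub>t ?K2 x"]) blast+
qed

text \<open>For x \<noteq> 0 undamped inversion is possible as well, and it has the same
  transform.\<close>

lemma kernel_reg: "x \<in> space_dom l - {0} \<Longrightarrow> inv_dist 3 (kern0 x) = reg (line_inverse (kern0 x))"
  by (rule has_laplace_unique[OF inv_dist_has_laplace[OF hp_poly_kern0] reg_line_inverse_has_laplace[OF hp_rapid_decay[OF hp_rapid_kern0]]]) auto

lemma bromwich_kernel:
  assumes x: "x \<in> space_dom l - {0}" and s0: "0 < s0"
  shows "integrable lborel (bromwich_integrand s0 (kernel_hat M l x) t)"
    "bromwich s0 (kernel_hat M l x) t = line_inverse (kern0 x) t"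
proof -
  have "bromwich_integrand s0 (kernel_hat M l x) t = bromwich_integrand s0 (kern0 x) t"
    unfolding bromwich_integrand_def by (simp add: kernel_hat_eq s0)
  then show "integrable lborel (bromwich_integrand s0 (kernel_hat M l x) t)"
    "bromwich s0 (kernel_hat M l x) t = line_inverse (kern0 x) t"
    using bromwich_eq_line_inverse[OF hp_rapid_decay[OF hp_rapid_kern0[OF x]] s0] by (simp_all add: bromwich_def)
qed

lemma represented_by_kernel:
  assumes x: "x \<in> space_dom l - {0}" and s0: "0 < s0"
  shows "represented_by (inv_dist 3 (kern0 x)) (bromwich s0 (kernel_hat M l x))"
proof -
  note i = hp_rapid_integrable0[OF hp_rapid_kern0[OF x]]
  have "bromwich s0 (kernel_hat M l x) = line_inverse (kern0 x)" using bromwich_kernel(2)[OF x s0] by blast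
  then show ?thesis
    unfolding kernel_reg[OF x] using represented_by_reg[OF borel_measurable_line_inverse[OF i] norm_line_inverse_le[OF i]] by simp
qed

lemma continuous_on_line_inverse_kern0:
  "continuous_on (space_dom l - {0}) (\<lambda>x. line_inverse (kern0 x) t)"
  unfolding continuous_on_sequentially o_def
proof safe
  fix X x assume X: "\<forall>n. X n \<in> space_dom l - {0}" "X \<longlonglongrightarrow> x" and x: "x \<in> space_dom l" "x \<noteq> 0"
  then have x': "x \<in> space_dom l - {0}" by simp
  note h = hp_rapid_kern0[OF X(1)[rule_format]] and h' = hp_rapid_kern0[OF x']
  have "(\<lambda>n. line_inverse (kern0 (X n)) t - line_inverse (kern0 x) t) \<longlonglongrightarrow> 0"
  proof (rule Lim_null_comparison[OF _ kern_difference_weight_tendsto[OF X(1)[rule_format] x' X(2), of 0]])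
    show "\<forall>\<^sub>F n in sequentially. norm (line_inverse (kern0 (X n)) t - line_inverse (kern0 x) t) \<le> line_weight 0 (\<lambda>z. kern0 (X n) z - kern0 x z)"
      using norm_line_inverse_weight[OF hp_rapid_diff[OF h h'], of 0]
      by (simp add: line_inverse_diff[OF hp_rapid_integrable0[OF h] hp_rapid_integrable0[OF h']])
  qed
  then show "(\<lambda>n. line_inverse (kern0 (X n)) t) \<longlonglongrightarrow> line_inverse (kern0 x) t" by (simp add: LIM_zero_iff)
qed

text \<open>As for the kernel itself, with finitely many weighted L1 norms of the difference of
  symbols in place of one; their number is fixed by the order of U.\<close>

lemma continuous_on_kernel_conv_kern0:
  assumes U: "U \<in> tempered_pos"
  shows "continuous_on (space_dom l - {0}) (\<lambda>x. kernel_conv U (kern0 x) t)"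
  unfolding continuous_on_sequentially o_def
proof safe
  fix X x assume X: "\<forall>n. X n \<in> space_dom l - {0}" "X \<longlonglongrightarrow> x" and x: "x \<in> space_dom l" "x \<noteq> 0"
  then have x': "x \<in> space_dom l - {0}" by simp
  note h = hp_rapid_kern0[OF X(1)[rule_format]] and h' = hp_rapid_kern0[OF x']
  obtain C N where C: "\<And>F t::real. hp_rapid F \<Longrightarrow> norm (kernel_conv U F t) \<le> C * ((\<bar>t\<bar> + 1) ^ N * (\<Sum>n\<le>N. line_weight n F))"
    using kernel_conv_bound[OF U] by blast
  let ?W = "\<lambda>n. C * ((\<bar>t\<bar> + 1) ^ N * (\<Sum>j\<le>N. line_weight j (\<lambda>z. kern0 (X n) z - kern0 x z)))"
  have "?W \<longlonglongrightarrow> C * ((\<bar>t\<bar> + 1) ^ N * (\<Sum>j\<le>N. 0))"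
    by (intro tendsto_intros kern_difference_weight_tendsto[OF X(1)[rule_format] x' X(2)])
  then have W: "?W \<longlonglongrightarrow> 0" by simp
  have "(\<lambda>n. kernel_conv U (kern0 (X n)) t - kernel_conv U (kern0 x) t) \<longlonglongrightarrow> 0"
    using C[OF hp_rapid_diff[OF h h'], of _ t]
    by (intro Lim_null_comparison[OF _ W] always_eventually) (simp add: kernel_conv_diff[OF U h h'])
  then show "(\<lambda>n. kernel_conv U (kern0 (X n)) t) \<longlonglongrightarrow> kernel_conv U (kern0 x) t" by (simp add: LIM_zero_iff)
qed

lemma kernel_conv_kern0_vanishing:
  assumes U: "U \<in> tempered_pos" and l: "l = \<infinity>"
  shows "((\<lambda>x. kernel_conv U (kern0 x) t) \<longlongrightarrow> 0) at_top"
proof -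
  obtain C N where C: "\<And>F t::real. hp_rapid F \<Longrightarrow> norm (kernel_conv U F t) \<le> C * ((\<bar>t\<bar> + 1) ^ N * (\<Sum>n\<le>N. line_weight n F))"
    using kernel_conv_bound[OF U] by blast
  let ?W = "\<lambda>x. C * ((\<bar>t\<bar> + 1) ^ N * (\<Sum>j\<le>N. line_weight j (kern0 x)))"
  have "(?W \<longlongrightarrow> C * ((\<bar>t\<bar> + 1) ^ N * (\<Sum>j\<le>N. 0))) at_top"
    by (intro tendsto_intros kern_weight_tendsto_at_top[OF l])
  then have W: "(?W \<longlongrightarrow> 0) at_top" by simp
  show ?thesis
  proof (rule Lim_null_comparison[OF _ W])
    show "\<forall>\<^sub>F x in at_top. norm (kernel_conv U (kern0 x) t) \<le> ?W x"
      using eventually_ge_at_top[of 1]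
    proof eventually_elim
      case (elim x)
      have "x \<in> space_dom l - {0}" unfolding Diff_iff space_dom_iff using elim l by auto
      then show ?case by (intro C hp_rapid_kern0)
    qed
  qed
qed

end

theorem theorem4p4:
  fixes \<alpha> \<beta> a1 a2 b1 b2 :: real and l :: ereal and U :: distr
  assumes "0 < \<alpha>" "\<alpha> < 1" "0 < \<beta>" "0 < a1" "a1 < a2" "0 < b1" "b1 < b2"
    and "a2 * b1 - a1 * b2 = 0"
    and "\<forall>(a, b) \<in> {(a1, b1), (a2, b2)}.
        a > 2 * b * cosh (\<beta> * pi / 2) * sqrt (1 + (cot (\<alpha> * pi / 2) * tanh (\<beta> * pi / 2))\<^sup>2) \<and>
        a > 2 * b * cosh (\<beta> * pi / 2) * sqrt (1 + (tan (\<alpha> * pi / 2) * tanh (\<beta> * pi / 2))\<^sup>2)"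
    and "0 < l" and "U \<in> tempered_pos"
  defines "P \<equiv> frac_poly \<alpha> \<beta> a2 b2"
    and "Q \<equiv> frac_poly \<alpha> \<beta> a1 b1"
  defines "M \<equiv> \<lambda>s. csqrt (Q s / P s)"
    and "L \<equiv> inverse_laplace (\<lambda>s. P s / Q s)"
  defines "K \<equiv> \<lambda>x. inverse_laplace (kernel_hat M l x)"
  defines "u \<equiv> \<lambda>x. U *\<^sub>t K x"
  shows "has_laplace L (\<lambda>s. P s / Q s)
    \<and> (\<forall>x\<in>space_dom l. has_laplace (K x) (kernel_hat M l x))
    \<and> wave_solution L l U u
    \<and> K 0 = dirac
    \<and> (\<forall>s0>0. \<forall>x\<in>space_dom l - {0}.
          (\<forall>t>0. integrable lborel (bromwich_integrand s0 (kernel_hat M l x) t)) \<and>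
          represented_by (K x) (bromwich s0 (kernel_hat M l x)))
    \<and> (\<forall>s0>0. \<forall>t>0. continuous_on (space_dom l - {0}) (\<lambda>x. bromwich s0 (kernel_hat M l x) t))
    \<and> (\<forall>\<phi>\<in>schwartz. continuous_on (space_dom l) (\<lambda>x. K x \<phi>))
    \<and> (\<exists>v. (\<forall>x\<in>space_dom l - {0}. represented_by (u x) (v x) \<and> continuous_on {0<..} (v x))
         \<and> (\<forall>t>0. continuous_on (space_dom l - {0}) (\<lambda>x. v x t))
         \<and> (l = \<infinity> \<longrightarrow> (\<forall>t>0. ((\<lambda>x. v x t) \<longlongrightarrow> 0) at_top))
         \<and> (\<forall>f s0. represented_by U f \<and> s0 > 0 \<longrightarrow>
              (\<forall>x\<in>space_dom l - {0}. \<forall>t>0.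
                 set_integrable lborel {0<..<t} (\<lambda>\<tau>. f (t - \<tau>) * bromwich s0 (kernel_hat M l x) \<tau>) \<and>
                 v x t = (LINT \<tau>:{0<..<t}|lborel. f (t - \<tau>) * bromwich s0 (kernel_hat M l x) \<tau>))))"
proof -
  interpret W: fractional_wave_on \<alpha> \<beta> a1 a2 b1 b2 l
    by unfold_locales (use assms(1-10) in auto)
  have PQ: "P = W.P" "Q = W.Q" by (simp_all add: P_def Q_def W.P_def W.Q_def fun_eq_iff)
  have M: "M = W.M" by (simp add: M_def W.M_def PQ fun_eq_iff)
  note U = assms(11)
  have L: "L = inv_dist 0 (\<lambda>s. P s / Q s)" unfolding L_def PQ by (rule W.inverse_laplace_PQ)
  have K: "K x = inv_dist 3 (W.kern0 x)" if "x \<in> space_dom l" for x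
    unfolding K_def M by (rule W.inverse_laplace_kernel[OF that])
  have B: "bromwich s0 (kernel_hat M l x) t = line_inverse (W.kern0 x) t" if "x \<in> space_dom l - {0}" "0 < s0" for s0 x t
    unfolding M by (rule W.bromwich_kernel(2)[OF that])
  have K1: "has_laplace (K x) (kernel_hat M l x)" if "x \<in> space_dom l" for x
    unfolding K[OF that] M by (rule W.kernel_has_laplace[OF that])
  have cB: "continuous_on (space_dom l - {0}) (\<lambda>x. bromwich s0 (kernel_hat M l x) t)" if "0 < s0" for s0 t
    by (rule iffD1[OF continuous_on_cong[OF refl] W.continuous_on_line_inverse_kern0[of t]]) (rule B[OF _ that, symmetric])
  have cK: "continuous_on (space_dom l) (\<lambda>x. K x \<phi>)" if "\<phi> \<in> schwartz" for \<phi>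
  proof -
    have "continuous_on (space_dom l) (\<lambda>x. inv_dist 3 (W.kern0 x) \<phi>)"
      unfolding continuous_on_eq_continuous_within
      using W.kern_parameter_derivative(1)[OF _ that] by (blast intro: has_vector_derivative_continuous)
    then show ?thesis using K by (simp cong: continuous_on_cong)
  qed
  have R: "integrable lborel (bromwich_integrand s0 (kernel_hat M l x) t)"
    "represented_by (K x) (bromwich s0 (kernel_hat M l x))" if x: "x \<in> space_dom l - {0}" and s0: "0 < s0" for s0 x t
    using W.bromwich_kernel(1)[OF x s0] W.represented_by_kernel[OF x s0] K[of x] x unfolding M by auto
  \<comment> \<open>This pointwise version of u refers neither to s0 nor to a function representing
    U, so a single v serves all of them.\<close>
  define v where "v x = kernel_conv U (W.kern0 x)" for x
  have v: "represented_by (u x) (v x)" "continuous_on {0<..} (v x)" if x: "x \<in> space_dom l - {0}" for x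
  proof -
    have "u x = U *\<^sub>t reg (line_inverse (W.kern0 x))" using K[of x] W.kernel_reg[OF x] x by (simp add: u_def)
    then show "represented_by (u x) (v x)"
      using represented_by_kernel_conv[OF U W.hp_rapid_kern0[OF x]] by (simp add: v_def)
    show "continuous_on {0<..} (v x)" unfolding v_def by (rule kernel_conv_continuous[OF U W.hp_rapid_kern0[OF x]])
  qed
  have vf: "set_integrable lborel {0<..<t} (\<lambda>\<tau>. f (t - \<tau>) * bromwich s0 (kernel_hat M l x) \<tau>) \<and>
      v x t = (LINT \<tau>:{0<..<t}|lborel. f (t - \<tau>) * bromwich s0 (kernel_hat M l x) \<tau>)"
    if "represented_by U f" "0 < s0" "x \<in> space_dom l - {0}" "0 < t" for f s0 x t
    unfolding B[OF that(3,2)] v_def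
    using kernel_conv_function[OF U that(1) W.hp_rapid_kern0[OF that(3)] that(4)] by simp
  have 1: "has_laplace L (\<lambda>s. P s / Q s)" unfolding L PQ by (rule inv_dist_has_laplace[OF W.hp_poly_PQ])
  have 2: "wave_solution L l U u"
    unfolding u_def K_def M L PQ by (rule W.wave_solution_conv[OF U])
  have 3: "K 0 = dirac" unfolding K[OF W.zero_mem_space_dom] by (rule W.kernel_at_0)
  have vx: "continuous_on (space_dom l - {0}) (\<lambda>x. v x t)" for t
    unfolding v_def by (rule W.continuous_on_kernel_conv_kern0[OF U])
  have vl: "((\<lambda>x. v x t) \<longlongrightarrow> 0) at_top" if "l = \<infinity>" for t
    unfolding v_def by (rule W.kernel_conv_kern0_vanishing[OF U that])
  show ?thesis
    using 1 2 3 K1 R cB cK v vf vx vl by (intro conjI exI[of _ v]) simp_all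
qed

end
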